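(* Suppose that $$\mathbb{E}\log Z\in(-\infty,0)\quad\text{and}\quad \mathbb{E}\,W_1\log^+W_1<\infty.$$ Suppose also that either (i) $\mathcal{M}\big((\gamma^{-1}\log m(\gamma),\infty)\big)=0$ almost surely (equivalently, $Z\in[0,1]$ almost surely), and the distribution of $\log Z$ is non-arithmetic; or (ii) $W_n=\mathcal{M}_n(\mathbb{R})/(\mathbb{E}\mathcal{M}(\mathbb{R}))^n$ for all $n$ (the Galton–Watson case, $\gamma=0$). Then the series $\sum_{n=0}^\infty a(n)(W-W_n)$ converges almost surely if and only if $\mathbb{E}\,W\log^+W\,a(\log^+W)<\infty$.
   Context: Let $\mathcal{M}$ be a point process on $\mathbb{R}$ (a random locally finite counting measure) with $\mathcal{M}\{+\infty\}=0$, and let $L:=\mathcal{M}(\mathbb{R})$, which may be deterministic or random, finite or infinite with positive probability. The branching random walk (BRW) generated by $\mathcal{M}$ is the sequence of point processes $\mathcal{M}_n$, $n=0,1,\dots$, with $\mathcal{M}_0(B)=1_{\{0\in B\}}$ and $\mathcal{M}_{n+1}(B)=\sum_r\mathcal{M}_{n,r}(B-A_{n,r})$ for Borel $B\subset\mathbb{R}$, where $\{A_{n,r}\}_r$ are the points of $\mathcal{M}_n$ and $\{\mathcal{M}_{n,r}\}$ are independent copies of $\mathcal{M}$. The BRW is supercritical: if $\mathbb{P}\{L<\infty\}=1$, it is additionally assumed that $\mathbb{E}L>1$. Individuals are the nodes $u$ of the associated family tree; $|u|$ is the generation of $u$, $A_u$ its position (the initial ancestor has generation $0$ and position $0$), so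 that $\{A_u:|u|=n\}$ are the points of $\mathcal{M}_n$. It is assumed that for a fixed $\gamma$ (with $\gamma>0$ in case (i) and $\gamma=0$ in case (ii)), $m(\gamma):=\mathbb{E}\int_{\mathbb{R}}e^{\gamma x}\,\mathcal{M}_1(dx)\in(0,\infty)$. Put $Y_u:=e^{\gamma A_u}/m(\gamma)^{|u|}$ and $W_n:=\sum_{|u|=n}Y_u=m(\gamma)^{-n}\int_{\mathbb{R}}e^{\gamma x}\mathcal{M}_n(dx)$, a non-negative martingale with respect to $\mathcal{F}_n=\sigma(\mathcal{M}_1,\dots,\mathcal{M}_n)$. $Z$ is a random variable whose distribution is defined by $\mathbb{E}\,r(Z)=\mathbb{E}\sum_{|u|=1}Y_u\,r(Y_u)$ for all non-negative bounded Borel functions $r$ (so in case (ii) $Z=(\mathbb{E}\mathcal{M}(\mathbb{R}))^{-1}$ almost surely). Under the conditions $\mathbb{E}\log Z\in(-\infty,0)$ and $\mathbb{E}W_1\log^+W_1<\infty$ the martingale $W_n$ is uniformly integrable, and $W$ denotes its almost sure and $L_1$ limit ($\mathbb{E}W=1$). $a:\mathbb{R}^+\to\mathbb{R}^+$ is a function regularly varying at $\infty$ with exponent $\alpha>-1$; if $\alpha=0$ it is additionally assumed that $a$ does not decrease near $\infty$. Here $\log^+x=\max(\log x,0)$ (and $\log^+0=0$). A distribution is non-arithmetic if it is not concentrated on $d\mathbb{Z}$ for any $d>0$.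
   Formalization: The function a is also assumed Borel measurable and bounded on every [0,x]; without local boundedness the claim fails, e.g. if a has a pole at 1/2. For a(x)=x^α with α<0, first replace a by a constant on [0,1), which affects neither side. *)

theory Defs
  imports "HOL-Probability.Probability"
begin

text \<open>
  A point process on the real line is a random element of the set of locally finite, integer-valued
  Borel measures (the total mass may be infinite), which carries the \<open>\<sigma>\<close>-algebra generated by the evaluations \<open>\<mu> \<mapsto> \<mu>(B)\<close>.
\<close>

definition point_measures :: "real measure set" where
  "point_measures =
     {\<mu>. sets \<mu> = sets borel \<and> (\<forall>B\<in>sets borel. bounded B \<longrightarrow> emeasure \<mu> B \<in> range of_nat)}"

definition point_space :: "real measure measure" where
  "point_space = (SUP B\<in>sets borel. vimage_algebra point_measures (\<lambda>\<mu>. emeasure \<mu> B) borel)"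

text \<open>
  A measurable enumeration, with multiplicities, of the points of \<open>\<mu>\<close>: by increasing absolute value,
  and of two points \<open>-r\<close> and \<open>r\<close> the negative one first. The indices in use are the
  \<open>i < \<mu>(\<real>)\<close>, see \<open>point_at_enumerates\<close> below.
\<close>

definition point_at :: "real measure \<Rightarrow> nat \<Rightarrow> real" where
  "point_at \<mu> i =
     (let r = Inf {t. 0 \<le> t \<and> of_nat i < emeasure \<mu> {-t..t}}
      in if of_nat i < emeasure \<mu> {-r..<r} then - r else r)"

lemma emeasure_count_space_subset:
  "C \<subseteq> A \<Longrightarrow> C \<subseteq> B \<Longrightarrow> emeasure (count_space A) C = emeasure (count_space B) C"
  by (cases "finite C") (simp_all add: emeasure_count_space)

lemma bounded_emeasure:
  assumes "\<mu> \<in> point_measures" "B \<in> sets borel" "bounded B"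
  shows "\<exists>k::nat. emeasure \<mu> B = of_nat k" "emeasure \<mu> B \<noteq> \<infinity>"
  using assms by (auto simp: point_measures_def)

lemma point_at_spec:
  assumes mu: "\<mu> \<in> point_measures" and i: "of_nat i < emeasure \<mu> UNIV"
  defines "r \<equiv> Inf {t. 0 \<le> t \<and> of_nat i < emeasure \<mu> {-t..t}}"
  shows "0 \<le> r" and "of_nat i < emeasure \<mu> {-r..r}"
    and "\<And>t. 0 \<le> t \<Longrightarrow> of_nat i < emeasure \<mu> {-t..t} \<Longrightarrow> r \<le> t"
    and "\<not> of_nat i < emeasure \<mu> {-r<..<r}"
proof -
  let ?T = "{t. 0 \<le> t \<and> of_nat i < emeasure \<mu> {-t..t}}"
  have sets [simp]: "sets \<mu> = sets borel"
    using mu by (auto simp: point_measures_def)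
  have bdd: "bdd_below ?T" by (auto simp: bdd_below_def)
  have mono: "emeasure \<mu> A \<le> emeasure \<mu> B" if "A \<subseteq> B" "B \<in> sets borel" for A B
    using that by (auto intro!: emeasure_mono)
  have "(\<lambda>n. emeasure \<mu> {-real n..real n}) \<longlonglongrightarrow> emeasure \<mu> (\<Union>n. {-real n..real n})"
    by (intro Lim_emeasure_incseq) (auto simp: incseq_def)
  moreover have "(\<Union>n. {-real n..real n}) = UNIV"
  proof -
    have "x \<in> (\<Union>n. {-real n..real n})" for x
    proof -
      obtain n where "\<bar>x\<bar> \<le> real n" using real_arch_simple by blast
      then show ?thesis by (intro UN_I[of n]) auto
    qed
    then show ?thesis by blast
  qed
  ultimately have "\<forall>\<^sub>F n in sequentially. of_nat i < emeasure \<mu> {-real n..real n}"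
    using i by (auto intro: order_tendstoD)
  then obtain n where n: "of_nat i < emeasure \<mu> {-real n..real n}"
    by (auto simp: eventually_sequentially)
  then have ne: "?T \<noteq> {}" by (auto intro!: exI[of _ "real n"])
  show r0: "0 \<le> r" unfolding r_def by (rule cInf_greatest[OF ne]) auto
  show r_le: "r \<le> t" if "0 \<le> t" "of_nat i < emeasure \<mu> {-t..t}" for t
    unfolding r_def by (rule cInf_lower[OF _ bdd]) (use that in auto)
  have gt: "of_nat i < emeasure \<mu> {-t..t}" if "r < t" for t
  proof -
    obtain s where s: "s \<in> ?T" "s < t"
      using cInf_lessD[OF ne, folded r_def, OF \<open>r < t\<close>] by blast
    then have "of_nat i < emeasure \<mu> {-s..s}" by auto
    also have "\<dots> \<le> emeasure \<mu> {-t..t}" using s by (intro mono) auto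
    finally show ?thesis .
  qed
  define A where "A = (\<lambda>n. {-(r + 1 / real (Suc n)) .. r + 1 / real (Suc n)})"
  have inv: "1 / real (Suc n) \<le> 1 / real (Suc m)" if "m \<le> n" for m n
    using that by (simp add: field_simps)
  have A_dec: "decseq A"
    unfolding decseq_def A_def
  proof (intro allI impI)
    fix m n :: nat assume "m \<le> n"
    from inv[OF this] show "{-(r + 1 / real (Suc n)) .. r + 1 / real (Suc n)}
       \<subseteq> {-(r + 1 / real (Suc m)) .. r + 1 / real (Suc m)}"
      by (auto simp del: of_nat_Suc)
  qed
  have A_lim: "(\<lambda>n. emeasure \<mu> (A n)) \<longlonglongrightarrow> emeasure \<mu> (\<Inter>n. A n)"
    by (intro Lim_emeasure_decseq A_dec bounded_emeasure(2)[OF mu]) (auto simp: A_def)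
  have A_Int: "(\<Inter>n. A n) = {-r..r}"
  proof -
    have "\<bar>x\<bar> \<le> r" if "\<And>n. x \<in> A n" for x
    proof (rule field_le_epsilon)
      fix e :: real assume "0 < e"
      then obtain n where "1 / real (Suc n) < e"
        using nat_approx_posE by blast
      then show "\<bar>x\<bar> \<le> r + e" using that[of n] by (auto simp: A_def abs_le_iff)
    qed
    moreover have "x \<in> A n" if "\<bar>x\<bar> \<le> r" for x n
    proof -
      have "0 \<le> 1 / real (Suc n)" by simp
      then show ?thesis using that unfolding A_def atLeastAtMost_iff by linarith
    qed
    ultimately show ?thesis unfolding set_eq_iff INT_iff atLeastAtMost_iff abs_le_iff
      by (metis UNIV_I minus_le_iff)
  qed
  obtain k where k: "emeasure \<mu> {-r..r} = of_nat k"
    using bounded_emeasure(1)[OF mu, of "{-r..r}"] by auto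
  show "of_nat i < emeasure \<mu> {-r..r}"
  proof -
    have Suc_le: "of_nat (Suc i) \<le> emeasure \<mu> (A n)" for n
    proof -
      obtain l where l: "emeasure \<mu> (A n) = of_nat l"
        using bounded_emeasure(1)[OF mu, of "A n"] by (auto simp: A_def)
      have "of_nat i < emeasure \<mu> (A n)" unfolding A_def by (rule gt) simp
      then show ?thesis by (simp add: l Suc_le_eq del: of_nat_Suc)
    qed
    have "of_nat (Suc i) \<le> emeasure \<mu> {-r..r}"
      using LIMSEQ_le_const[OF A_lim[unfolded A_Int]] Suc_le by blast
    then show ?thesis by (simp add: k Suc_le_eq del: of_nat_Suc)
  qed
  show "\<not> of_nat i < emeasure \<mu> {-r<..<r}"
  proof
    assume less: "of_nat i < emeasure \<mu> {-r<..<r}"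
    define B where "B = (\<lambda>n. {-(r - 1 / real (Suc n)) .. r - 1 / real (Suc n)})"
    have B_inc: "incseq B"
      unfolding incseq_def B_def
    proof (intro allI impI)
      fix m n :: nat assume "m \<le> n"
      from inv[OF this] show "{-(r - 1 / real (Suc m)) .. r - 1 / real (Suc m)}
         \<subseteq> {-(r - 1 / real (Suc n)) .. r - 1 / real (Suc n)}"
        by (auto simp del: of_nat_Suc)
    qed
    have "(\<lambda>n. emeasure \<mu> (B n)) \<longlonglongrightarrow> emeasure \<mu> (\<Union>n. B n)"
      by (intro Lim_emeasure_incseq B_inc) (auto simp: B_def)
    moreover have "(\<Union>n. B n) = {-r<..<r}"
    proof -
      have "\<exists>n. x \<in> B n" if "\<bar>x\<bar> < r" for x
      proof -
        obtain n where "1 / real (Suc n) < r - \<bar>x\<bar>"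
          using nat_approx_posE[of "r - \<bar>x\<bar>"] \<open>\<bar>x\<bar> < r\<close> by auto
        then show ?thesis by (intro exI[of _ n]) (auto simp: B_def)
      qed
      moreover have "\<bar>x\<bar> < r" if "x \<in> B n" for x n
      proof -
        have "0 < 1 / real (Suc n)" by simp
        then show ?thesis using that unfolding B_def atLeastAtMost_iff by linarith
      qed
      ultimately show ?thesis
        unfolding set_eq_iff UN_iff greaterThanLessThan_iff abs_less_iff
        by (metis UNIV_I minus_less_iff)
    qed
    ultimately have "\<forall>\<^sub>F n in sequentially. of_nat i < emeasure \<mu> (B n)"
      using less by (auto intro: order_tendstoD)
    then obtain n where n: "of_nat i < emeasure \<mu> (B n)"
      by (auto simp: eventually_sequentially)
    then have "B n \<noteq> {}" by auto
    then have "0 \<le> r - 1 / real (Suc n)" by (auto simp: B_def)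
    from r_le[OF this] n have "r \<le> r - 1 / real (Suc n)" by (simp add: B_def)
    then show False by (simp add: field_simps)
  qed
qed

lemma point_at_eq_iff:
  assumes mu: "\<mu> \<in> point_measures"
  shows "of_nat i < emeasure \<mu> UNIV \<and> point_at \<mu> i = x \<longleftrightarrow>
    (if 0 \<le> x then \<not> of_nat i < emeasure \<mu> {-x..<x} \<and> of_nat i < emeasure \<mu> {-x..x}
     else \<not> of_nat i < emeasure \<mu> {x<..<-x} \<and> of_nat i < emeasure \<mu> {x..<-x})"
    (is "?L = ?R")
proof -
  have sets [simp]: "sets \<mu> = sets borel"
    using mu by (auto simp: point_measures_def)
  have mono: "emeasure \<mu> A \<le> emeasure \<mu> B" if "A \<subseteq> B" "B \<in> sets borel" for A B
    using that by (auto intro!: emeasure_mono)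
  define r where "r = Inf {t. 0 \<le> t \<and> of_nat i < emeasure \<mu> {-t..t}}"
  have pt: "point_at \<mu> i = (if of_nat i < emeasure \<mu> {-r..<r} then - r else r)"
    by (simp add: point_at_def r_def Let_def)
  show ?thesis
  proof
    assume L: ?L
    note spec = point_at_spec[OF mu conjunct1[OF L], folded r_def]
    show ?R
    proof (cases "of_nat i < emeasure \<mu> {-r..<r}")
      case True
      then have "0 < r" using spec(1) by (cases "r = 0") auto
      then show ?thesis using L spec True by (auto simp: pt)
    next
      case False
      then show ?thesis using L spec by (auto simp: pt)
    qed
  next
    assume R: ?R
    have i: "of_nat i < emeasure \<mu> UNIV"
      using R mono[of "{-x..x}" UNIV] mono[of "{x..<-x}" UNIV]
      by (auto split: if_splits intro: less_le_trans)
    note spec = point_at_spec[OF mu i, folded r_def]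
    show ?L
    proof (cases "0 \<le> x")
      case True
      have "r = x"
      proof (rule antisym)
        show "r \<le> x" using R True spec(3) by auto
        show "x \<le> r"
        proof (rule ccontr)
          assume "\<not> x \<le> r"
          then have "emeasure \<mu> {-r..r} \<le> emeasure \<mu> {-x..<x}" by (intro mono) auto
          then show False using R True spec(2) by (auto dest: less_le_trans)
        qed
      qed
      then show ?thesis using R True i by (auto simp: pt)
    next
      case False
      have "r = -x"
      proof (rule antisym)
        have "emeasure \<mu> {x..<-x} \<le> emeasure \<mu> {x..-x}" by (intro mono) auto
        then show "r \<le> -x" using R False spec(3)[of "-x"] by (auto dest: less_le_trans)
        show "-x \<le> r"
        proof (rule ccontr)
          assume "\<not> -x \<le> r"
          then have "emeasure \<mu> {-r..r} \<le> emeasure \<mu> {x<..<-x}" by (intro mono) auto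
          then show False using R False spec(2) by (auto dest: less_le_trans)
        qed
      qed
      then show ?thesis using R False i by (auto simp: pt)
    qed
  qed
qed

lemma point_at_multiplicity:
  assumes mu: "\<mu> \<in> point_measures"
  shows "emeasure (count_space UNIV) {i. of_nat i < emeasure \<mu> UNIV \<and> point_at \<mu> i = x} =
    emeasure \<mu> {x}"
proof -
  have sets [simp]: "sets \<mu> = sets borel"
    using mu by (auto simp: point_measures_def)
  have *: "emeasure (count_space UNIV) {i. \<not> of_nat i < emeasure \<mu> A \<and> of_nat i < emeasure \<mu> B} =
      emeasure \<mu> {x}"
    if "A \<in> sets borel" "bounded A" "x \<notin> A" "B = insert x A" for A B
  proof -
    obtain k where k: "emeasure \<mu> A = of_nat k"
      using bounded_emeasure(1)[OF mu] \<open>A \<in> sets borel\<close> \<open>bounded A\<close> by auto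
    obtain l where l: "emeasure \<mu> {x} = of_nat l"
      using bounded_emeasure(1)[OF mu, of "{x}"] by auto
    have "emeasure \<mu> ({x} \<union> A) = emeasure \<mu> {x} + emeasure \<mu> A"
      using \<open>A \<in> sets borel\<close> \<open>x \<notin> A\<close> by (intro plus_emeasure[symmetric]) auto
    then have B: "emeasure \<mu> B = of_nat (l + k)"
      using \<open>B = insert x A\<close> by (simp add: k l)
    have "{i. \<not> of_nat i < emeasure \<mu> A \<and> of_nat i < emeasure \<mu> B} = {k..<l + k}"
      unfolding B k of_nat_less_iff by auto
    then show ?thesis by (simp add: l emeasure_count_space_finite)
  qed
  show ?thesis
  proof (cases "0 \<le> x")
    case True
    then have "{-x..x} = insert x {-x..<x}" by auto
    then show ?thesis
      using *[of "{-x..<x}" "{-x..x}"] True by (simp add: point_at_eq_iff[OF mu])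
  next
    case False
    then have "{x..<-x} = insert x {x<..<-x}" by auto
    then show ?thesis
      using *[of "{x<..<-x}" "{x..<-x}"] False by (simp add: point_at_eq_iff[OF mu])
  qed
qed

lemma point_at_enumerates:
  assumes mu: "\<mu> \<in> point_measures"
  shows "distr (count_space {i. of_nat i < emeasure \<mu> UNIV}) borel (point_at \<mu>) = \<mu>"
proof (rule measure_eqI)
  let ?I = "{i. of_nat i < emeasure \<mu> UNIV}"
  let ?\<nu> = "distr (count_space ?I) borel (point_at \<mu>)"
  have sets [simp]: "sets \<mu> = sets borel"
    using mu by (auto simp: point_measures_def)
  show "sets ?\<nu> = sets \<mu>" by simp
  have nu: "emeasure ?\<nu> B = emeasure (count_space UNIV) {i. of_nat i < emeasure \<mu> UNIV \<and> point_at \<mu> i \<in> B}"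
    if "B \<in> sets borel" for B
  proof -
    have "emeasure ?\<nu> B = emeasure (count_space ?I) (point_at \<mu> -` B \<inter> ?I)"
      using that by (subst emeasure_distr) auto
    also have "\<dots> = emeasure (count_space UNIV) (point_at \<mu> -` B \<inter> ?I)"
      by (rule emeasure_count_space_subset) auto
    also have "point_at \<mu> -` B \<inter> ?I = {i. of_nat i < emeasure \<mu> UNIV \<and> point_at \<mu> i \<in> B}"
      by auto
    finally show ?thesis .
  qed
  have atom: "emeasure ?\<nu> {x} = emeasure \<mu> {x}" for x
    using point_at_multiplicity[OF mu, of x] by (subst nu) auto
  define S where "S = {x. emeasure \<mu> {x} \<noteq> 0}"
  have S_iff: "x \<in> S \<longleftrightarrow> (\<exists>i. of_nat i < emeasure \<mu> UNIV \<and> point_at \<mu> i = x)" for x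
  proof -
    have "x \<in> S \<longleftrightarrow> emeasure (count_space UNIV) {i. of_nat i < emeasure \<mu> UNIV \<and> point_at \<mu> i = x} \<noteq> 0"
      by (simp only: S_def mem_Collect_eq point_at_multiplicity[OF mu])
    also have "\<dots> \<longleftrightarrow> (\<exists>i. of_nat i < emeasure \<mu> UNIV \<and> point_at \<mu> i = x)"
      by (subst emeasure_count_space_eq_0) auto
    finally show ?thesis .
  qed
  have "S \<subseteq> range (point_at \<mu>)" using S_iff by auto
  then have "countable S" by (rule countable_subset) auto
  then have S [measurable]: "S \<in> sets borel"
    by (rule sets.countable[rotated]) simp
  have null_nbhd: "\<exists>U. open U \<and> x \<in> U \<and> emeasure \<mu> U = 0" if "x \<notin> S" for x
  proof -
    define A where "A = (\<lambda>n. ball x (1 / real (Suc n)))"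
    have "(\<lambda>n. emeasure \<mu> (A n)) \<longlonglongrightarrow> emeasure \<mu> (\<Inter>n. A n)"
    proof (intro Lim_emeasure_decseq bounded_emeasure(2)[OF mu])
      have "1 / real (Suc n) \<le> 1 / real (Suc m)" if "m \<le> n" for m n
        using that by (simp add: field_simps)
      then show "decseq A" unfolding decseq_def A_def by (intro allI impI subset_ball)
    qed (auto simp: A_def)
    moreover have "(\<Inter>n. A n) = {x}"
    proof -
      have "y = x" if "\<And>n. y \<in> A n" for y
      proof (rule ccontr)
        assume "y \<noteq> x"
        then obtain n where "1 / real (Suc n) < dist x y"
          using nat_approx_posE[of "dist x y"] by auto
        then show False using that[of n] by (auto simp: A_def)
      qed
      then show ?thesis by (auto simp: A_def)
    qed
    ultimately have "(\<lambda>n. emeasure \<mu> (A n)) \<longlonglongrightarrow> 0"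
      using \<open>x \<notin> S\<close> by (simp add: S_def)
    then have "\<forall>\<^sub>F n in sequentially. emeasure \<mu> (A n) < 1"
      by (rule order_tendstoD) simp
    then obtain n where n: "emeasure \<mu> (A n) < 1"
      by (auto simp: eventually_sequentially)
    moreover obtain k where "emeasure \<mu> (A n) = of_nat k"
      using bounded_emeasure(1)[OF mu, of "A n"] by (auto simp: A_def)
    ultimately have "emeasure \<mu> (A n) = 0" by auto
    then show ?thesis by (intro exI[of _ "A n"]) (auto simp: A_def)
  qed
  have null: "emeasure \<mu> (- S) = 0"
  proof -
    let ?F = "{U. open U \<and> emeasure \<mu> U = 0}"
    obtain F where F: "F \<subseteq> ?F" "countable F" "\<Union>F = \<Union>?F"
      using Lindelof[of ?F] by auto
    have "(\<Union>U\<in>F. U) \<in> null_sets \<mu>"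
      using F by (intro null_sets_UN') (auto simp: null_sets_def)
    moreover have "- S \<subseteq> (\<Union>U\<in>F. U)" using F(3) null_nbhd by fastforce
    ultimately have "- S \<in> null_sets \<mu>"
      using S by (elim null_sets_subset) simp_all
    then show ?thesis by (rule null_setsD1)
  qed
  have null': "emeasure ?\<nu> (- S) = 0"
    using S S_iff by (subst nu) (auto simp: emeasure_count_space_eq_0)
  have red: "emeasure \<kappa> B = (\<integral>\<^sup>+x. emeasure \<kappa> {x} \<partial>count_space (B \<inter> S))"
    if "sets \<kappa> = sets borel" "emeasure \<kappa> (- S) = 0" "B \<in> sets borel" for \<kappa> and B :: "real set"
  proof -
    have "- S \<in> null_sets \<kappa>" using that S by (simp add: null_setsI)
    then have "emeasure \<kappa> B = emeasure \<kappa> (B - (- S))"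
      using that by (intro emeasure_Diff_null_set[symmetric]) auto
    also have "B - (- S) = B \<inter> S" by auto
    also have "emeasure \<kappa> (B \<inter> S) = (\<integral>\<^sup>+x. emeasure \<kappa> {x} \<partial>count_space (B \<inter> S))"
      using that \<open>countable S\<close> by (intro emeasure_countable_singleton) auto
    finally show ?thesis .
  qed
  fix B assume "B \<in> sets ?\<nu>"
  then have "B \<in> sets borel" by simp
  with red[of ?\<nu> B] red[of \<mu> B] null null' show "emeasure ?\<nu> B = emeasure \<mu> B"
    by (simp add: atom)
qed

text \<open>
  Genealogy in Ulam--Harris notation: the \<open>i\<close>-th child of \<open>u\<close> is \<open>u @ [i]\<close>. Here \<open>\<zeta>\<close> is one
  realisation of the whole family of reproduction processes: \<open>\<zeta> u\<close> consists of the displacements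
  of the children of \<open>u\<close> from \<open>u\<close>.
\<close>

definition individuals :: "(nat list \<Rightarrow> real measure) \<Rightarrow> nat \<Rightarrow> nat list set" where
  "individuals \<zeta> n =
     {u. length u = n \<and> (\<forall>k<n. of_nat (u ! k) < emeasure (\<zeta> (take k u)) UNIV)}"

definition position :: "(nat list \<Rightarrow> real measure) \<Rightarrow> nat list \<Rightarrow> real" where
  "position \<zeta> u = (\<Sum>k<length u. point_at (\<zeta> (take k u)) (u ! k))"

definition generation :: "(nat list \<Rightarrow> real measure) \<Rightarrow> nat \<Rightarrow> real measure" where
  "generation \<zeta> n = distr (count_space (individuals \<zeta> n)) borel (position \<zeta>)"

text \<open>The defining recursion of the branching random walk.\<close>

lemma generation_0: "generation \<zeta> 0 = return borel 0"
proof -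
  have *: "individuals \<zeta> 0 = {[]}" "position \<zeta> [] = 0"
    by (auto simp: individuals_def position_def)
  show ?thesis
    by (rule measure_eqI)
      (auto simp: generation_def * emeasure_distr emeasure_count_space indicator_def split: if_splits)
qed

lemma generation_Suc:
  assumes pm: "\<And>u. \<zeta> u \<in> point_measures" and B: "B \<in> sets borel"
  shows "emeasure (generation \<zeta> (Suc n)) B =
    (\<integral>\<^sup>+u. emeasure (\<zeta> u) {x. position \<zeta> u + x \<in> B} \<partial>count_space (individuals \<zeta> n))"
proof -
  have ind: "u @ [i] \<in> individuals \<zeta> (Suc n) \<longleftrightarrow>
      u \<in> individuals \<zeta> n \<and> of_nat i < emeasure (\<zeta> u) UNIV" for u i
    by (auto simp: individuals_def less_Suc_eq nth_append)
  have pos: "position \<zeta> (u @ [i]) = position \<zeta> u + point_at (\<zeta> u) i" for u i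
    by (simp add: position_def nth_append)
  let ?G = "individuals \<zeta>" and ?I = "\<lambda>u. {i. of_nat i < emeasure (\<zeta> u) UNIV}"
  let ?S = "{u \<in> ?G (Suc n). position \<zeta> u \<in> B}"
  let ?f = "\<lambda>(u, i). indicator ?S (u @ [i]) :: ennreal"
  have bij: "bij_betw (\<lambda>(u, i). u @ [i]) UNIV (UNIV - {[]})"
    by (rule bij_betwI[of _ _ _ "\<lambda>w. (butlast w, last w)"]) auto
  have "emeasure (generation \<zeta> (Suc n)) B =
      emeasure (count_space (?G (Suc n))) (position \<zeta> -` B \<inter> ?G (Suc n))"
    using B by (simp add: generation_def emeasure_distr)
  also have "position \<zeta> -` B \<inter> ?G (Suc n) = ?S" by auto
  also have "emeasure (count_space (?G (Suc n))) ?S = emeasure (count_space (UNIV - {[]})) ?S"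
    by (rule emeasure_count_space_subset) (auto simp: individuals_def)
  also have "\<dots> = (\<integral>\<^sup>+w. indicator ?S w \<partial>count_space (UNIV - {[]}))"
    by (rule nn_integral_indicator[symmetric]) (auto simp: individuals_def)
  also have "\<dots> = (\<integral>\<^sup>+p. ?f p \<partial>count_space UNIV)"
    by (subst nn_integral_bij_count_space[OF bij, symmetric]) (auto intro!: nn_integral_cong)
  also have "\<dots> = (\<integral>\<^sup>+u. \<integral>\<^sup>+i. ?f (u, i) \<partial>count_space UNIV \<partial>count_space UNIV)"
    by (rule nn_integral_fst_count_space[symmetric])
  also have "\<dots> = (\<integral>\<^sup>+u. emeasure (\<zeta> u) {x. position \<zeta> u + x \<in> B} * indicator (?G n) u \<partial>count_space UNIV)"
  proof (rule nn_integral_cong)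
    fix u
    let ?B = "{x. position \<zeta> u + x \<in> B}"
    have B': "?B \<in> sets borel"
      using measurable_sets[of "\<lambda>x. position \<zeta> u + x" borel borel B] B by (simp add: vimage_def)
    have "emeasure (\<zeta> u) ?B = emeasure (distr (count_space (?I u)) borel (point_at (\<zeta> u))) ?B"
      by (simp add: point_at_enumerates[OF pm])
    also have "\<dots> = emeasure (count_space (?I u)) (point_at (\<zeta> u) -` ?B \<inter> ?I u)"
      using B' by (simp add: emeasure_distr)
    also have "\<dots> = emeasure (count_space UNIV) (point_at (\<zeta> u) -` ?B \<inter> ?I u)"
      by (rule emeasure_count_space_subset) auto
    also have "\<dots> = (\<integral>\<^sup>+i. indicator (point_at (\<zeta> u) -` ?B \<inter> ?I u) i \<partial>count_space UNIV)"
      by simp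
    finally show "(\<integral>\<^sup>+i. ?f (u, i) \<partial>count_space UNIV) = emeasure (\<zeta> u) ?B * indicator (?G n) u"
      by (cases "u \<in> ?G n") (auto simp: ind pos indicator_def intro!: nn_integral_cong)
  qed
  also have "\<dots> = (\<integral>\<^sup>+u. emeasure (\<zeta> u) {x. position \<zeta> u + x \<in> B} \<partial>count_space (?G n))"
    by (simp add: nn_integral_count_space_indicator)
  finally show ?thesis .
qed

text \<open>The reproduction processes \<open>\<xi> u\<close> are independent copies of the point process \<open>M\<close>.\<close>

definition branching_random_walk ::
    "'w measure \<Rightarrow> ('w \<Rightarrow> real measure) \<Rightarrow> (nat list \<Rightarrow> 'w \<Rightarrow> real measure) \<Rightarrow> bool" where
  "branching_random_walk P M \<xi> \<longleftrightarrow>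
     prob_space P \<and>
     M \<in> measurable P point_space \<and>
     prob_space.indep_vars P (\<lambda>_. point_space) \<xi> UNIV \<and>
     (\<forall>u. distr P point_space (\<xi> u) = distr P point_space M)"

definition supercritical :: "'w measure \<Rightarrow> ('w \<Rightarrow> real measure) \<Rightarrow> bool" where
  "supercritical P M \<longleftrightarrow>
     ((AE \<omega> in P. emeasure (M \<omega>) UNIV < \<infinity>) \<longrightarrow> 1 < (\<integral>\<^sup>+\<omega>. emeasure (M \<omega>) UNIV \<partial>P))"

definition brw_gen :: "(nat list \<Rightarrow> 'w \<Rightarrow> real measure) \<Rightarrow> nat \<Rightarrow> 'w \<Rightarrow> real measure" where
  "brw_gen \<xi> n \<omega> = generation (\<lambda>u. \<xi> u \<omega>) n"

definition brw_moment :: "'w measure \<Rightarrow> (nat list \<Rightarrow> 'w \<Rightarrow> real measure) \<Rightarrow> real \<Rightarrow> ennreal" where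
  "brw_moment P \<xi> \<gamma> = (\<integral>\<^sup>+\<omega>. (\<integral>\<^sup>+x. ennreal (exp (\<gamma> * x)) \<partial>brw_gen \<xi> 1 \<omega>) \<partial>P)"

definition brw_Y ::
    "'w measure \<Rightarrow> (nat list \<Rightarrow> 'w \<Rightarrow> real measure) \<Rightarrow> real \<Rightarrow> nat list \<Rightarrow> 'w \<Rightarrow> real" where
  "brw_Y P \<xi> \<gamma> u \<omega> =
     exp (\<gamma> * position (\<lambda>v. \<xi> v \<omega>) u) / enn2real (brw_moment P \<xi> \<gamma>) ^ length u"

definition brw_W ::
    "'w measure \<Rightarrow> (nat list \<Rightarrow> 'w \<Rightarrow> real measure) \<Rightarrow> real \<Rightarrow> nat \<Rightarrow> 'w \<Rightarrow> real" where
  "brw_W P \<xi> \<gamma> n \<omega> =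
     enn2real (\<integral>\<^sup>+u. ennreal (brw_Y P \<xi> \<gamma> u \<omega>) \<partial>count_space (individuals (\<lambda>v. \<xi> v \<omega>) n))"

definition brw_W_lim ::
    "'w measure \<Rightarrow> (nat list \<Rightarrow> 'w \<Rightarrow> real measure) \<Rightarrow> real \<Rightarrow> 'w \<Rightarrow> real" where
  "brw_W_lim P \<xi> \<gamma> \<omega> = lim (\<lambda>n. brw_W P \<xi> \<gamma> n \<omega>)"

text \<open>
  \<open>Z\<close> has the size-biased law \<open>E r(Z) = E (\<Sum>|u|=1. Y u * r (Y u))\<close>. It lives on a space of
  its own, since \<open>P\<close> need not carry a variable with this law.
\<close>

definition size_biased ::
    "'w measure \<Rightarrow> (nat list \<Rightarrow> 'w \<Rightarrow> real measure) \<Rightarrow> real \<Rightarrow> 'z measure \<Rightarrow> ('z \<Rightarrow> real) \<Rightarrow> bool" where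
  "size_biased P \<xi> \<gamma> Q Z \<longleftrightarrow>
     prob_space Q \<and> Z \<in> borel_measurable Q \<and>
     (\<forall>r \<in> borel_measurable borel. (\<forall>x. 0 \<le> r x) \<and> bounded (range r) \<longrightarrow>
        (\<integral>\<^sup>+z. ennreal (r (Z z)) \<partial>Q) =
        (\<integral>\<^sup>+\<omega>. (\<integral>\<^sup>+u. ennreal (brw_Y P \<xi> \<gamma> u \<omega> * r (brw_Y P \<xi> \<gamma> u \<omega>))
                   \<partial>count_space (individuals (\<lambda>v. \<xi> v \<omega>) 1)) \<partial>P))"

definition non_arithmetic :: "'z measure \<Rightarrow> ('z \<Rightarrow> real) \<Rightarrow> bool" where
  "non_arithmetic Q X \<longleftrightarrow> (\<forall>d>0. \<not> (AE z in Q. X z \<in> range (\<lambda>k::int. d * of_int k)))"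

definition log_plus :: "real \<Rightarrow> real" where
  "log_plus x = (if x > 0 then max (ln x) 0 else 0)"

text \<open>
  Only the values on \<open>[0, \<infinity>)\<close> matter; eventually non-zero is implied by the case \<open>c = 1\<close>.
  Local boundedness, here on all of \<open>[0, \<infinity>)\<close>, is not implied by the limit relation: it
  excludes singularities of \<open>a\<close> at non-integer points, which the values \<open>a(n)\<close> do not see.
\<close>

definition regularly_varying :: "(real \<Rightarrow> real) \<Rightarrow> real \<Rightarrow> bool" where
  "regularly_varying a \<alpha> \<longleftrightarrow>
     a \<in> borel_measurable (restrict_space borel {0..}) \<and>
     (\<forall>x. bounded (a ` {0..x})) \<and>
     (\<forall>c>0. ((\<lambda>x. a (c * x) / a x) \<longlongrightarrow> c powr \<alpha>) at_top)"

end

theory Submission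
  imports Defs
begin

text \<open>
  The hypotheses force \<open>Z \<le> 1\<close>, so the weights \<open>Y u\<close> are products of factors in \<open>[0, 1]\<close>,
  and \<open>E (\<Sum>|u|=n. Y u * sqrt (Y u))\<close> and \<open>E (\<Sum>|u|=n. Y u * - ln (Y u))\<close> are geometric and linear in \<open>n\<close>:
  a typical weight of generation \<open>n\<close> is exponentially small, but not smaller than \<open>exp (- K * n)\<close>.
  This replaces all renewal theory. Let \<open>A\<close> be the partial sums of \<open>a\<close> and \<open>X = W 1\<close>. By regular
  variation \<open>A\<close> is doubling and comparable to \<open>x * a x\<close>, so the moment condition reads
  \<open>E (W * A (log+ W)) < \<infinity>\<close>; it is shown to be equivalent to the condition
  \<open>E (X * (\<Sum>k\<le>log+ X. A k)) < \<infinity>\<close> on one generation.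

  If the latter holds, truncating \<open>W (n + 1) - W n\<close> at \<open>Y u * (X u)\<^sup>2 \<le> 1\<close>, bounding the small part in
  \<open>L\<^sup>2\<close> and the large part in \<open>L\<^sup>1\<close>, gives \<open>\<Sum>n. A n * E \<bar>W (n + 1) - W n\<bar> < \<infinity>\<close>, hence convergence
  of the series by summation by parts. The passage between \<open>X\<close> and \<open>W\<close> uses the same truncation in one
  direction and, in the other, the growth of \<open>E max (W n - t) 0\<close> over the generations.

  If conversely the series converges, then \<open>sup A n * Y u * X u < \<infinity>\<close>: by independence, the first term
  of this kind above a level would make a partial sum of the series large with probability bounded
  below. On an event of large probability the partial sums and these terms stay below some \<open>C\<close>; there the
  series equals the martingale of truncated differences minus its compensator. The variance of the martingale is
  at most a multiple of the expected compensator, so the latter is bounded, which is the condition on \<open>X\<close>.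
\<close>

subsection \<open>Resampling the family tree\<close>

text \<open>Conditioning is done without filtrations or conditional expectations: on the product
  space the labels outside a set are resampled, so a conditional estimate is an ordinary integral
  for fixed \<zeta>, and \<open>nn_integral_mix\<close> removes the condition. The obstacle in the
  converse direction is that almost sure convergence carries no moments, while the decisive
  inequality has the unknown on both sides and can be solved only if the unknown is finite.
  Therefore the weights are frozen as \<open>A (min k N)\<close>: they are bounded, so the
  assumption on \<open>W 1\<close> gives finiteness, and they keep the doubling constant, so no
  constant depends on \<open>N\<close>. The inequality can be solved because, once the terms are cut
  at \<open>C\<close>, the variance is linear in the weights, just as the compensator is. In
  \<open>E \<bar>S\<bar> \<le> \<tau> + V / \<tau>\<close> a large \<tau> then leaves only a
  fraction of the unknown on the right. Exceptional events are measured by the integral of one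
  function that dominates all \<open>W n\<close>, not by their probability: outside the good event
  they must not carry much of the mass of any generation.\<close>

text \<open>Averaging over \<open>\<zeta>'\<close> in \<open>mix S \<zeta> \<zeta>'\<close> is conditioning on the coordinates in \<open>S\<close>.\<close>

definition mix :: "'i set \<Rightarrow> ('i \<Rightarrow> 'a) \<Rightarrow> ('i \<Rightarrow> 'a) \<Rightarrow> 'i \<Rightarrow> 'a" where
  "mix S \<zeta> \<zeta>' = (\<lambda>w. if w \<in> S then \<zeta> w else \<zeta>' w)"

locale iid_tree = N: prob_space \<nu> for \<nu> :: "'a measure"
begin

abbreviation \<Omega> :: "(nat list \<Rightarrow> 'a) measure" where
  "\<Omega> \<equiv> PiM UNIV (\<lambda>_. \<nu>)"

sublocale prod: product_prob_space "\<lambda>_::nat list. \<nu>" UNIV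
  by unfold_locales

sublocale pair: pair_prob_space \<Omega> \<Omega>
  by unfold_locales

lemma measurable_mix [measurable]:
  "(\<lambda>p. mix S (fst p) (snd p)) \<in> measurable (\<Omega> \<Otimes>\<^sub>M \<Omega>) \<Omega>"
proof (rule measurable_PiM_single')
  fix w show "(\<lambda>p. mix S (fst p) (snd p) w) \<in> measurable (\<Omega> \<Otimes>\<^sub>M \<Omega>) \<nu>"
    unfolding mix_def by (cases "w \<in> S") auto
qed (auto simp: space_pair_measure space_PiM mix_def PiE_iff)

text \<open>It is enough to compare cylinder sets. The preimage of a cylinder is a rectangle whose
  sides are cylinders over \<open>J \<inter> S\<close> and \<open>J - S\<close>, and the finite
  product defining its measure splits in the same way.\<close>

lemma distr_mix: "distr (\<Omega> \<Otimes>\<^sub>M \<Omega>) \<Omega> (\<lambda>p. mix S (fst p) (snd p)) = \<Omega>"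
proof (rule measure_eqI_PiM_infinite[symmetric, OF refl])
  show "finite_measure \<Omega>" by unfold_locales
  fix A :: "nat list \<Rightarrow> 'a set" and J :: "nat list set"
  assume J: "finite J" "J \<subseteq> UNIV" and A: "\<And>i. i \<in> J \<Longrightarrow> A i \<in> sets \<nu>"
  let ?E = "\<lambda>J. prod_emb UNIV (\<lambda>_::nat list. \<nu>) J (Pi\<^sub>E J A)"
  have em: "emeasure \<Omega> (?E J') = (\<Prod>i\<in>J'. emeasure \<nu> (A i))" if "J' \<subseteq> J" for J'
    using that J A by (intro prod.emeasure_PiM_emb) (auto dest: finite_subset)
  have [measurable]: "?E J' \<in> sets \<Omega>" if "J' \<subseteq> J" for J'
    using that J A by (intro sets_PiM_I) (auto dest: finite_subset)
  have E: "\<zeta> \<in> ?E J' \<longleftrightarrow> \<zeta> \<in> space \<Omega> \<and> (\<forall>i\<in>J'. \<zeta> i \<in> A i)" for \<zeta> J'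
    by (auto simp: prod_emb_def space_PiM PiE_def restrict_def extensional_def Pi_def)
  have vim: "(\<lambda>p. mix S (fst p) (snd p)) -` ?E J \<inter> space (\<Omega> \<Otimes>\<^sub>M \<Omega>) =
      ?E (J \<inter> S) \<times> ?E (J - S)"
  proof -
    have mixsp: "mix S x y \<in> space \<Omega>" if "x \<in> space \<Omega>" "y \<in> space \<Omega>" for x y
      using that by (auto simp: mix_def space_PiM PiE_iff)
    show ?thesis
    proof (rule set_eqI)
      fix p :: "(nat list \<Rightarrow> 'a) \<times> (nat list \<Rightarrow> 'a)"
      obtain x y where p: "p = (x, y)" by (cases p)
      have "(\<forall>i\<in>J. mix S x y i \<in> A i) \<longleftrightarrow> (\<forall>i\<in>J \<inter> S. x i \<in> A i) \<and> (\<forall>i\<in>J - S. y i \<in> A i)"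
        by (auto simp: mix_def)
      then show "p \<in> (\<lambda>p. mix S (fst p) (snd p)) -` ?E J \<inter> space (\<Omega> \<Otimes>\<^sub>M \<Omega>) \<longleftrightarrow>
          p \<in> ?E (J \<inter> S) \<times> ?E (J - S)"
        unfolding p Int_iff vimage_eq mem_Times_iff fst_conv snd_conv E space_pair_measure
        using mixsp by auto
    qed
  qed
  have "emeasure (distr (\<Omega> \<Otimes>\<^sub>M \<Omega>) \<Omega> (\<lambda>p. mix S (fst p) (snd p))) (?E J) =
      emeasure \<Omega> (?E (J \<inter> S)) * emeasure \<Omega> (?E (J - S))"
    by (subst emeasure_distr) (auto simp: vim intro!: prod.P.emeasure_pair_measure_Times)
  also have "\<dots> = (\<Prod>i\<in>J \<inter> S. emeasure \<nu> (A i)) * (\<Prod>i\<in>J - S. emeasure \<nu> (A i))"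
    by (simp add: em)
  also have "\<dots> = (\<Prod>i\<in>J. emeasure \<nu> (A i))"
    using J by (subst prod.union_disjoint[symmetric]) (auto intro!: prod.cong)
  also have "\<dots> = emeasure \<Omega> (?E J)" by (simp add: em)
  finally show "emeasure \<Omega> (?E J) = emeasure (distr (\<Omega> \<Otimes>\<^sub>M \<Omega>) \<Omega> (\<lambda>p. mix S (fst p) (snd p))) (?E J)"
    by simp
qed simp

lemma nn_integral_mix:
  assumes [measurable]: "f \<in> borel_measurable \<Omega>"
  shows "(\<integral>\<^sup>+\<zeta>. \<integral>\<^sup>+\<zeta>'. f (mix S \<zeta> \<zeta>') \<partial>\<Omega> \<partial>\<Omega>) = (\<integral>\<^sup>+\<zeta>. f \<zeta> \<partial>\<Omega>)"
proof -
  have "(\<integral>\<^sup>+\<zeta>. f \<zeta> \<partial>\<Omega>) = (\<integral>\<^sup>+p. f (mix S (fst p) (snd p)) \<partial>(\<Omega> \<Otimes>\<^sub>M \<Omega>))"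
    by (subst distr_mix[of S, symmetric], subst nn_integral_distr) auto
  also have "\<dots> = (\<integral>\<^sup>+\<zeta>. \<integral>\<^sup>+\<zeta>'. f (mix S \<zeta> \<zeta>') \<partial>\<Omega> \<partial>\<Omega>)"
    by (subst prod.P.nn_integral_fst[symmetric]) auto
  finally show ?thesis by simp
qed

text \<open>Almost every section of a null set is null. In this form almost sure identities survive
  the freezing of the first generations.\<close>

lemma AE_mix:
  assumes "AE \<zeta> in \<Omega>. Q \<zeta>"
  shows "AE \<zeta> in \<Omega>. AE \<zeta>' in \<Omega>. Q (mix S \<zeta> \<zeta>')"
proof -
  have "AE \<zeta> in distr (\<Omega> \<Otimes>\<^sub>M \<Omega>) \<Omega> (\<lambda>p. mix S (fst p) (snd p)). Q \<zeta>"
    using assms unfolding distr_mix .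
  then have "AE p in \<Omega> \<Otimes>\<^sub>M \<Omega>. Q (mix S (fst p) (snd p))"
    by (rule AE_distrD[rotated]) simp
  then have "AE p in \<Omega> \<Otimes>\<^sub>M \<Omega>. (\<lambda>(x,y). Q (mix S x y)) p" by (simp add: split_beta)
  from pair.AE_pair[OF this] show ?thesis by simp
qed

text \<open>The event or function \<open>f\<close> is determined by the coordinates in \<open>S\<close>, and \<open>g\<close> by those outside.\<close>

lemma nn_integral_indep:
  fixes f g :: "(nat list \<Rightarrow> 'a) \<Rightarrow> ennreal"
  assumes [measurable]: "f \<in> borel_measurable \<Omega>" "g \<in> borel_measurable \<Omega>"
    and f: "\<And>\<zeta> \<zeta>'. f (mix S \<zeta> \<zeta>') = f \<zeta>" and g: "\<And>\<zeta> \<zeta>'. g (mix S \<zeta> \<zeta>') = g \<zeta>'"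
  shows "(\<integral>\<^sup>+\<zeta>. f \<zeta> * g \<zeta> \<partial>\<Omega>) = (\<integral>\<^sup>+\<zeta>. f \<zeta> \<partial>\<Omega>) * (\<integral>\<^sup>+\<zeta>. g \<zeta> \<partial>\<Omega>)"
  by (subst nn_integral_mix[of _ S, symmetric])
    (auto simp: f g nn_integral_cmult nn_integral_multc)

definition sub :: "nat list \<Rightarrow> (nat list \<Rightarrow> 'a) \<Rightarrow> nat list \<Rightarrow> 'a" where
  "sub u \<zeta> = (\<lambda>v. \<zeta> (u @ v))"

lemma measurable_sub [measurable]: "sub u \<in> measurable \<Omega> \<Omega>"
  unfolding sub_def
  by (rule measurable_PiM_single') (auto simp: space_PiM)

text \<open>Appending to \<open>u\<close> is an injective reindexing, which preserves a product of
  equal factors.\<close>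

lemma distr_sub: "distr \<Omega> \<Omega> (sub u) = \<Omega>"
  using distr_PiM_reindex[of UNIV "\<lambda>_. \<nu>" "\<lambda>v. u @ v" UNIV]
  by (simp add: N.prob_space_axioms inj_on_def sub_def[abs_def] restrict_def)

lemma nn_integral_sub:
  assumes [measurable]: "f \<in> borel_measurable \<Omega>"
  shows "(\<integral>\<^sup>+\<zeta>. f (sub u \<zeta>) \<partial>\<Omega>) = (\<integral>\<^sup>+\<zeta>. f \<zeta> \<partial>\<Omega>)"
  by (subst (2) distr_sub[of u, symmetric], subst nn_integral_distr) auto

lemma nn_integral_coord:
  assumes [measurable]: "g \<in> borel_measurable \<nu>"
  shows "(\<integral>\<^sup>+\<zeta>. g (\<zeta> u) \<partial>\<Omega>) = (\<integral>\<^sup>+s. g s \<partial>\<nu>)"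
  by (subst (2) prod.PiM_component[of u, symmetric], simp, subst nn_integral_distr) auto

end

subsection \<open>Weighted branching processes\<close>

abbreviation csum :: "'i set \<Rightarrow> ('i \<Rightarrow> ennreal) \<Rightarrow> ennreal" where
  "csum I f \<equiv> \<integral>\<^sup>+u. f u \<partial>count_space I"

lemma borel_measurable_csum [measurable (raw)]:
  fixes f :: "'b \<Rightarrow> 'i::countable \<Rightarrow> ennreal"
  assumes "\<And>u. u \<in> I \<Longrightarrow> (\<lambda>x. f x u) \<in> borel_measurable M"
  shows "(\<lambda>x. csum I (f x)) \<in> borel_measurable M"
proof -
  interpret sigma_finite_measure "count_space I"
    by (rule sigma_finite_measure_count_space_countable) simp
  have "(\<lambda>(u, x). f x u) \<in> borel_measurable (count_space I \<Otimes>\<^sub>M M)"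
    by (rule measurable_pair_measure_countable1) (use assms in auto)
  then have "(\<lambda>(x, u). f x u) \<in> borel_measurable (M \<Otimes>\<^sub>M count_space I)"
    by (subst measurable_pair_swap_iff) (simp add: split_beta)
  then show ?thesis by measurable
qed

lemma csum_nn_integral:
  fixes f :: "'b \<Rightarrow> 'i::countable \<Rightarrow> ennreal"
  assumes "\<And>u. u \<in> I \<Longrightarrow> (\<lambda>x. f x u) \<in> borel_measurable M"
  shows "(\<integral>\<^sup>+x. csum I (f x) \<partial>M) = csum I (\<lambda>u. \<integral>\<^sup>+x. f x u \<partial>M)"
  using assms by (intro nn_integral_count_space_nn_integral) auto

lemma csum_mono: "(\<And>u. u \<in> I \<Longrightarrow> f u \<le> g u) \<Longrightarrow> csum I f \<le> csum I g"
  by (intro nn_integral_mono) auto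

lemma csum_cong: "(\<And>u. u \<in> I \<Longrightarrow> f u = g u) \<Longrightarrow> csum I f = csum I g"
  by (intro nn_integral_cong) auto

lemma csum_ge_single: "u \<in> I \<Longrightarrow> f u \<le> csum I f"
proof -
  assume u: "u \<in> I"
  have "f u = csum I (\<lambda>v. f u * indicator {u} v)"
    using u by (subst nn_integral_cmult_indicator) (auto simp: emeasure_count_space)
  also have "\<dots> \<le> csum I f" by (intro csum_mono) (auto simp: indicator_def)
  finally show ?thesis .
qed

lemma csum_diff_single:
  assumes "u \<in> I"
  shows "csum I f = f u + csum (I - {u}) f"
proof -
  have "csum I f = csum I (\<lambda>v. f v * indicator {u} v + f v * indicator (I - {u}) v)"
    by (intro csum_cong) (auto simp: indicator_def)
  also have "\<dots> = csum I (\<lambda>v. f v * indicator {u} v) + csum I (\<lambda>v. f v * indicator (I - {u}) v)"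
    by (rule nn_integral_add) auto
  also have "csum I (\<lambda>v. f v * indicator {u} v) = csum I (\<lambda>v. f u * indicator {u} v)"
    by (intro csum_cong) (auto simp: indicator_def)
  also have "\<dots> = f u"
    using assms by (subst nn_integral_cmult_indicator) (auto simp: emeasure_count_space)
  also have "csum I (\<lambda>v. f v * indicator (I - {u}) v) = csum (I - {u}) f"
    by (simp add: nn_integral_count_space_indicator) (intro nn_integral_cong; auto simp: indicator_def)
  finally show ?thesis .
qed

lemma csum_swap:
  fixes f :: "'i::countable \<Rightarrow> 'j::countable \<Rightarrow> ennreal"
  shows "csum I (\<lambda>u. csum J (\<lambda>v. f u v)) = csum J (\<lambda>v. csum I (\<lambda>u. f u v))"
  by (rule csum_nn_integral) simp

lemma csum_Times: "csum (I \<times> J) f = csum I (\<lambda>u. csum J (\<lambda>v. f (u, v)))"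
  by (simp add: nn_integral_count_space_indicator nn_integral_fst_count_space[symmetric]
      indicator_times nn_integral_multc flip: mult.assoc)
    (simp add: mult.commute mult.assoc mult.left_commute nn_integral_cmult)

text \<open>The triangle inequality for infinite sums of possibly different finite values. It is
  proved additively, as two bounds of the form \<open>csum I f \<le> csum I g + d\<close>, because
  subtraction in \<open>ennreal\<close> is truncated.\<close>

lemma enn2real_csum_abs_diff:
  assumes "csum I f < \<infinity>" "csum I g < \<infinity>" 
  shows "ennreal \<bar>enn2real (csum I f) - enn2real (csum I g)\<bar> \<le> csum I (\<lambda>u. ennreal \<bar>enn2real (f u) - enn2real (g u)\<bar>)"
proof -
  let ?d = "csum I (\<lambda>u. ennreal \<bar>enn2real (f u) - enn2real (g u)\<bar>)"
  have fin: "f u < \<infinity>" "g u < \<infinity>" if "u \<in> I" for u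
    using assms csum_ge_single[OF that, of f] csum_ge_single[OF that, of g] by (auto intro: le_less_trans)
  have *: "h u \<le> k u + ennreal \<bar>enn2real (h u) - enn2real (k u)\<bar>"
    if hk: "h u < \<infinity>" "k u < \<infinity>" for h k :: "'a \<Rightarrow> ennreal" and u
  proof -
    obtain x y where "h u = ennreal x" "k u = ennreal y" "0 \<le> x" "0 \<le> y"
      using hk by (cases "h u"; cases "k u") auto
    then show ?thesis by (auto simp: ennreal_plus[symmetric] simp del: ennreal_plus)
  qed
  have 1: "csum I f \<le> csum I g + ?d"
    by (subst nn_integral_add[symmetric], simp, simp) (intro csum_mono *; use fin in auto)
  have "csum I g \<le> csum I f + csum I (\<lambda>u. ennreal \<bar>enn2real (g u) - enn2real (f u)\<bar>)"
    by (subst nn_integral_add[symmetric], simp, simp) (intro csum_mono *; use fin in auto)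
  then have 2: "csum I g \<le> csum I f + ?d" by (simp add: abs_minus_commute)
  obtain x where x: "csum I f = ennreal x" "0 \<le> x" using assms by (cases "csum I f") auto
  obtain y where y: "csum I g = ennreal y" "0 \<le> y" using assms by (cases "csum I g") auto
  show ?thesis
  proof (cases ?d)
    case (real z)
    have "x \<le> y + z" "y \<le> x + z"
      using 1 2 x y real by (simp_all add: ennreal_plus[symmetric] del: ennreal_plus)
    then show ?thesis unfolding real(1) x(1) y(1) using x(2) y(2) real(2) by (auto intro!: ennreal_leI)
  qed simp
qed

text \<open>Variance of a sum of pairwise uncorrelated terms, bounded by the sum of the second
  moments. The deterministic shift \<open>a\<close> stands for the past of a martingale, which is
  constant once the first generations are frozen; centring at \<open>m\<close> removes the mixed
  term.\<close>

lemma (in prob_space) second_moment_csum: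
  fixes f :: "'i::countable \<Rightarrow> 'a \<Rightarrow> ennreal" and a :: real
  assumes [measurable]: "\<And>u. u \<in> I \<Longrightarrow> f u \<in> borel_measurable M"
    and indep: "\<And>u v. u \<in> I \<Longrightarrow> v \<in> I \<Longrightarrow> u \<noteq> v \<Longrightarrow>
      (\<integral>\<^sup>+x. f u x * f v x \<partial>M) \<le> (\<integral>\<^sup>+x. f u x \<partial>M) * (\<integral>\<^sup>+x. f v x \<partial>M)"
    and m: "csum I (\<lambda>u. \<integral>\<^sup>+x. f u x \<partial>M) = ennreal m" "0 \<le> m"
  shows "(\<integral>\<^sup>+x. ennreal ((a + (enn2real (csum I (\<lambda>u. f u x)) - m))\<^sup>2) \<partial>M) \<le>
    ennreal (a\<^sup>2) + csum I (\<lambda>u. \<integral>\<^sup>+x. (f u x)\<^sup>2 \<partial>M)"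
proof (cases "csum I (\<lambda>u. \<integral>\<^sup>+x. (f u x)\<^sup>2 \<partial>M)")
  case (real v)
  define S where "S x = csum I (\<lambda>u. f u x)" for x
  have [measurable]: "S \<in> borel_measurable M" unfolding S_def by measurable
  have ES: "(\<integral>\<^sup>+x. S x \<partial>M) = ennreal m"
    unfolding S_def by (subst csum_nn_integral) (auto simp: m)
  have "(\<integral>\<^sup>+x. (S x)\<^sup>2 \<partial>M) = (\<integral>\<^sup>+x. csum I (\<lambda>u. csum I (\<lambda>v. f u x * f v x)) \<partial>M)"
    unfolding S_def by (intro nn_integral_cong) (simp add: power2_eq_square nn_integral_cmult nn_integral_multc)
  also have "\<dots> = csum I (\<lambda>u. \<integral>\<^sup>+x. csum I (\<lambda>v. f u x * f v x) \<partial>M)"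
    by (rule csum_nn_integral) measurable
  also have "\<dots> = csum I (\<lambda>u. csum I (\<lambda>v. \<integral>\<^sup>+x. f u x * f v x \<partial>M))"
    by (intro csum_cong csum_nn_integral) measurable
  \<comment> \<open>On the diagonal the product of the means is added although the square alone
    would do: the off-diagonal bound then becomes a full double sum, which factors into
    \<open>m * m\<close>.\<close>
  also have "\<dots> \<le> csum I (\<lambda>u. csum I (\<lambda>v. (\<integral>\<^sup>+x. (f u x)\<^sup>2 \<partial>M) * indicator {u} v +
      (\<integral>\<^sup>+x. f u x \<partial>M) * (\<integral>\<^sup>+x. f v x \<partial>M)))"
    by (intro csum_mono) (auto simp: indicator_def power2_eq_square intro: indep)
  also have "\<dots> = csum I (\<lambda>u. \<integral>\<^sup>+x. (f u x)\<^sup>2 \<partial>M) + ennreal m * ennreal m"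
    by (simp add: nn_integral_add nn_integral_cmult nn_integral_multc m(1) emeasure_count_space_finite
        nn_integral_cmult_indicator cong: nn_integral_cong_simp)
  also have "\<dots> = ennreal (v + m\<^sup>2)"
    using m real by (simp add: ennreal_plus ennreal_mult power2_eq_square)
  finally have ES2: "(\<integral>\<^sup>+x. (S x)\<^sup>2 \<partial>M) \<le> ennreal (v + m\<^sup>2)" .
  have fin: "AE x in M. S x \<noteq> \<infinity>"
    using ES by (intro nn_integral_noteq_infinite) auto
  define r where "r x = enn2real (S x)" for x
  have [measurable]: "r \<in> borel_measurable M" unfolding r_def by measurable
  have rS: "AE x in M. ennreal (r x) = S x"
    using fin by eventually_elim (auto simp: r_def top.not_eq_extremum)
  have r0: "0 \<le> r x" for x by (simp add: r_def)
  have Er: "(\<integral>\<^sup>+x. ennreal (r x) \<partial>M) = ennreal m"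
    using rS by (subst nn_integral_cong_AE[of _ "\<lambda>x. S x"]) (auto simp: ES)
  have Er2: "(\<integral>\<^sup>+x. ennreal ((r x)\<^sup>2) \<partial>M) \<le> ennreal (v + m\<^sup>2)"
  proof -
    have "(\<integral>\<^sup>+x. ennreal ((r x)\<^sup>2) \<partial>M) = (\<integral>\<^sup>+x. (S x)\<^sup>2 \<partial>M)"
      using rS r0 by (intro nn_integral_cong_AE) (auto simp: ennreal_power[symmetric])
    then show ?thesis using ES2 by simp
  qed
  have ir: "integrable M r" using Er r0 by (intro integrableI_nonneg) auto
  have ir2: "integrable M (\<lambda>x. (r x)\<^sup>2)"
    using Er2 by (intro integrableI_nonneg) (auto simp: le_less_trans)
  have lr: "(\<integral>x. r x \<partial>M) = m" using Er r0 m by (simp add: integral_eq_nn_integral)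
  have lr2: "(\<integral>x. (r x)\<^sup>2 \<partial>M) \<le> v + m\<^sup>2"
    using Er2 ir2 real m by (simp add: nn_integral_eq_integral del: ennreal_plus)
  have eq: "(a + (r x - m))\<^sup>2 = (r x)\<^sup>2 + 2 * (a - m) * r x + (a - m)\<^sup>2" for x
    by (simp add: power2_eq_square algebra_simps)
  have "(\<integral>\<^sup>+x. ennreal ((a + (r x - m))\<^sup>2) \<partial>M) = ennreal (\<integral>x. (a + (r x - m))\<^sup>2 \<partial>M)"
  proof (rule nn_integral_eq_integral)
    show "integrable M (\<lambda>x. (a + (r x - m))\<^sup>2)"
      unfolding eq using ir ir2 by auto
  qed simp
  also have "(\<integral>x. (a + (r x - m))\<^sup>2 \<partial>M) = (\<integral>x. (r x)\<^sup>2 \<partial>M) + 2 * (a - m) * m + (a - m)\<^sup>2"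
    unfolding eq using ir ir2 by (simp add: lr prob_space)
  also have "\<dots> \<le> a\<^sup>2 + v" using lr2 by (simp add: power2_eq_square algebra_simps)
  finally show ?thesis using real by (simp add: r_def S_def ennreal_plus ennreal_leI)
qed simp


text \<open>Absent children are encoded by weight 0. Every node therefore has children indexed by
  all natural numbers, each generation is a fixed countable set, and all randomness sits in the
  weights. \<open>eta_nontrivial\<close> excludes that all weights are 0 or 1; it is what makes the
  typical weight decay.\<close>

locale weighted_branching = iid_tree \<nu> for \<nu> :: "'a measure" +
  fixes \<eta> :: "'a \<Rightarrow> nat \<Rightarrow> real"
  assumes eta_meas [measurable]: "\<And>i. (\<lambda>s. \<eta> s i) \<in> borel_measurable \<nu>"
    and eta_nonneg [simp]: "\<And>s i. 0 \<le> \<eta> s i"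
    and eta_le_1: "\<And>s i. \<eta> s i \<le> 1"
    and eta_summable: "\<And>s. summable (\<eta> s)"
    and eta_mean: "(\<integral>\<^sup>+s. (\<Sum>i. ennreal (\<eta> s i)) \<partial>\<nu>) = 1"
    and eta_entropy: "(\<integral>\<^sup>+s. (\<Sum>i. ennreal (\<eta> s i * - ln (\<eta> s i))) \<partial>\<nu>) < \<infinity>"
    and eta_nontrivial: "\<not> (AE s in \<nu>. \<forall>i. \<eta> s i \<in> {0, 1})"
begin

definition X :: "'a \<Rightarrow> real" where "X s = (\<Sum>i. \<eta> s i)"

definition Y :: "nat list \<Rightarrow> (nat list \<Rightarrow> 'a) \<Rightarrow> real" where
  "Y u \<zeta> = (\<Prod>k<length u. \<eta> (\<zeta> (take k u)) (u ! k))"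

abbreviation gen :: "nat \<Rightarrow> nat list set" where "gen n \<equiv> {u. length u = n}"

abbreviation before :: "nat \<Rightarrow> nat list set" where "before n \<equiv> {u. length u < n}"

definition WE :: "nat \<Rightarrow> (nat list \<Rightarrow> 'a) \<Rightarrow> ennreal" where
  "WE n \<zeta> = csum (gen n) (\<lambda>u. ennreal (Y u \<zeta>))"

lemma X_meas [measurable]: "X \<in> borel_measurable \<nu>" unfolding X_def[abs_def] by measurable

lemma X_nonneg [simp]: "0 \<le> X s" unfolding X_def by (intro suminf_nonneg eta_summable) simp

lemma ennreal_X: "ennreal (X s) = (\<Sum>i. ennreal (\<eta> s i))"
  unfolding X_def by (intro suminf_ennreal2[symmetric] eta_summable) simp

lemma EX: "(\<integral>\<^sup>+s. ennreal (X s) \<partial>\<nu>) = 1" by (simp add: ennreal_X eta_mean)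

lemma Y_meas [measurable]: "Y u \<in> borel_measurable \<Omega>" unfolding Y_def[abs_def] by measurable

lemma Y_nonneg [simp]: "0 \<le> Y u \<zeta>" unfolding Y_def by (intro prod_nonneg) simp

lemma Y_le_1: "Y u \<zeta> \<le> 1" unfolding Y_def by (intro prod_le_1) (simp add: eta_le_1)

lemma Y_Nil [simp]: "Y [] \<zeta> = 1" by (simp add: Y_def)

lemma Y_snoc: "Y (u @ [i]) \<zeta> = Y u \<zeta> * \<eta> (\<zeta> u) i"
  by (simp add: Y_def nth_append)

lemma Y_append: "Y (u @ v) \<zeta> = Y u \<zeta> * Y v (sub u \<zeta>)"
proof (induction v rule: rev_induct)
  case (snoc i v)
  have "Y (u @ v @ [i]) \<zeta> = Y ((u @ v) @ [i]) \<zeta>" by simp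
  also have "\<dots> = Y u \<zeta> * Y (v @ [i]) (sub u \<zeta>)"
    unfolding Y_snoc snoc by (simp add: sub_def)
  finally show ?case .
qed simp

lemma Y_cong: "(\<And>k. k < length u \<Longrightarrow> \<zeta> (take k u) = \<zeta>' (take k u)) \<Longrightarrow> Y u \<zeta> = Y u \<zeta>'"
  by (simp add: Y_def)

lemma Y_mix [simp]: "length u \<le> n \<Longrightarrow> Y u (mix (before n) \<zeta> \<zeta>') = Y u \<zeta>"
  by (rule Y_cong) (auto simp: mix_def)

lemma mix_late [simp]: "n \<le> length u \<Longrightarrow> mix (before n) \<zeta> \<zeta>' u = \<zeta>' u"
  and mix_early [simp]: "length u < n \<Longrightarrow> mix (before n) \<zeta> \<zeta>' u = \<zeta> u"
  by (simp_all add: mix_def)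

lemma sub_mix [simp]: "n \<le> length u \<Longrightarrow> sub u (mix (before n) \<zeta> \<zeta>') = sub u \<zeta>'"
  by (auto simp: sub_def)

lemma csum_gen_0 [simp]: "csum (gen 0) f = f []" "csum {[]} f = f []"
  by (simp_all add: nn_integral_count_space_finite)

lemma csum_gen_add: "csum (gen (n + k)) f = csum (gen n) (\<lambda>u. csum (gen k) (\<lambda>v. f (u @ v)))"
proof -
  have bij: "bij_betw (\<lambda>w. (take n w, drop n w)) (gen (n + k)) (gen n \<times> gen k)"
    by (rule bij_betwI[of _ _ _ "\<lambda>(u, v). u @ v"]) auto
  have "csum (gen n) (\<lambda>u. csum (gen k) (\<lambda>v. f (u @ v))) =
      csum (gen n \<times> gen k) (\<lambda>p. f (fst p @ snd p))"
    by (simp add: csum_Times)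
  also have "\<dots> = csum (gen (n + k)) (\<lambda>w. f (take n w @ drop n w))"
    by (subst nn_integral_bij_count_space[OF bij, symmetric]) simp
  finally show ?thesis by simp
qed

lemma csum_gen_1: "csum (gen 1) f = (\<Sum>i. f [i])"
proof -
  have bij: "bij_betw (\<lambda>i. [i]) UNIV (gen 1)"
    by (rule bij_betwI[of _ _ _ hd]) (auto simp: length_Suc_conv)
  show ?thesis
    by (subst nn_integral_bij_count_space[OF bij, symmetric]) (simp add: nn_integral_count_space_nat)
qed

lemma csum_gen_Suc: "csum (gen (Suc n)) f = csum (gen n) (\<lambda>u. \<Sum>i. f (u @ [i]))"
  using csum_gen_add[of n 1 f] by (simp add: csum_gen_1[simplified])

lemma WE_meas [measurable]: "WE n \<in> borel_measurable \<Omega>"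
  unfolding WE_def[abs_def] by measurable

lemma WE_0 [simp]: "WE 0 \<zeta> = 1" unfolding WE_def csum_gen_0 by simp

lemma WE_Suc: "WE (Suc n) \<zeta> = csum (gen n) (\<lambda>u. ennreal (Y u \<zeta> * X (\<zeta> u)))"
  by (simp add: WE_def csum_gen_Suc Y_snoc ennreal_mult ennreal_X)

lemma WE_add: "WE (n + k) \<zeta> = csum (gen n) (\<lambda>u. ennreal (Y u \<zeta>) * WE k (sub u \<zeta>))"
  by (simp add: WE_def csum_gen_add Y_append ennreal_mult nn_integral_cmult)

lemma WE_mix [simp]: "m \<le> n \<Longrightarrow> WE m (mix (before n) \<zeta> \<zeta>') = WE m \<zeta>"
  unfolding WE_def by (intro csum_cong) auto

text \<open>\<open>Y u\<close> involves only the labels of the strict ancestors of \<open>u\<close>,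
  hence the label at \<open>u\<close> itself may be integrated separately.\<close>

lemma expect_step:
  assumes [measurable]: "case_prod F \<in> borel_measurable (borel \<Otimes>\<^sub>M \<nu>)"
  shows "(\<integral>\<^sup>+\<zeta>. F (Y u \<zeta>) (\<zeta> u) \<partial>\<Omega>) = (\<integral>\<^sup>+\<zeta>. \<integral>\<^sup>+s. F (Y u \<zeta>) s \<partial>\<nu> \<partial>\<Omega>)"
proof -
  have "(\<integral>\<^sup>+\<zeta>. F (Y u \<zeta>) (\<zeta> u) \<partial>\<Omega>) = (\<integral>\<^sup>+\<zeta>. \<integral>\<^sup>+\<zeta>'. F (Y u \<zeta>) (\<zeta>' u) \<partial>\<Omega> \<partial>\<Omega>)"
    by (subst nn_integral_mix[of _ "before (length u)", symmetric]) auto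
  also have "\<dots> = (\<integral>\<^sup>+\<zeta>. \<integral>\<^sup>+s. F (Y u \<zeta>) s \<partial>\<nu> \<partial>\<Omega>)"
  proof (intro nn_integral_cong)
    fix \<zeta>
    have "(\<lambda>s. F (Y u \<zeta>) s) \<in> borel_measurable \<nu>" by measurable
    then show "(\<integral>\<^sup>+\<zeta>'. F (Y u \<zeta>) (\<zeta>' u) \<partial>\<Omega>) = (\<integral>\<^sup>+s. F (Y u \<zeta>) s \<partial>\<nu>)"
      by (rule nn_integral_coord)
  qed
  finally show ?thesis .
qed

text \<open>The recursion behind all moments of a generation. For \<open>h\<close> equal to
  \<open>y\<close>, \<open>y * sqrt y\<close> and \<open>y * - ln y\<close> the inner integral
  reproduces \<open>h\<close> up to a factor or an additive term, which gives constant, geometric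
  and linear growth respectively.\<close>

lemma expect_gen_Suc:
  assumes [measurable]: "h \<in> borel_measurable (borel :: real measure)"
  shows "(\<integral>\<^sup>+\<zeta>. csum (gen (Suc n)) (\<lambda>u. h (Y u \<zeta>)) \<partial>\<Omega>) =
    (\<integral>\<^sup>+\<zeta>. csum (gen n) (\<lambda>u. \<integral>\<^sup>+s. (\<Sum>i. h (Y u \<zeta> * \<eta> s i)) \<partial>\<nu>) \<partial>\<Omega>)"
proof -
  have "(\<integral>\<^sup>+\<zeta>. csum (gen (Suc n)) (\<lambda>u. h (Y u \<zeta>)) \<partial>\<Omega>) =
      csum (gen n) (\<lambda>u. \<integral>\<^sup>+\<zeta>. (\<Sum>i. h (Y u \<zeta> * \<eta> (\<zeta> u) i)) \<partial>\<Omega>)"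
    unfolding csum_gen_Suc Y_snoc by (rule csum_nn_integral) measurable
  also have "\<dots> = csum (gen n) (\<lambda>u. \<integral>\<^sup>+\<zeta>. \<integral>\<^sup>+s. (\<Sum>i. h (Y u \<zeta> * \<eta> s i)) \<partial>\<nu> \<partial>\<Omega>)"
    by (intro csum_cong expect_step) measurable
  also have "\<dots> = (\<integral>\<^sup>+\<zeta>. csum (gen n) (\<lambda>u. \<integral>\<^sup>+s. (\<Sum>i. h (Y u \<zeta> * \<eta> s i)) \<partial>\<nu>) \<partial>\<Omega>)"
    by (rule csum_nn_integral[symmetric]) measurable
  finally show ?thesis .
qed

lemma expect_WE: "(\<integral>\<^sup>+\<zeta>. WE n \<zeta> \<partial>\<Omega>) = 1"
proof (induction n)
  case (Suc n)
  have "(\<integral>\<^sup>+\<zeta>. WE (Suc n) \<zeta> \<partial>\<Omega>) =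
      (\<integral>\<^sup>+\<zeta>. csum (gen n) (\<lambda>u. \<integral>\<^sup>+s. (\<Sum>i. ennreal (Y u \<zeta> * \<eta> s i)) \<partial>\<nu>) \<partial>\<Omega>)"
    unfolding WE_def by (rule expect_gen_Suc) measurable
  also have "\<dots> = (\<integral>\<^sup>+\<zeta>. WE n \<zeta> \<partial>\<Omega>)"
    by (simp add: WE_def ennreal_mult nn_integral_cmult eta_mean)
  finally show ?case using Suc by simp
qed (simp add: prod.P.emeasure_space_1)

lemma WE_finite: "AE \<zeta> in \<Omega>. WE n \<zeta> < \<infinity>"
  using nn_integral_noteq_infinite[of "WE n" \<Omega>] by (simp add: expect_WE less_top)

text \<open>In terms of the size-biased variable this is \<open>E (sqrt Z)\<close>. The exponent 3/2
  of the weights lies between 1, which belongs to means, and 2, which belongs to variances, and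
  serves to estimate both.\<close>

definition \<phi> :: real where
  "\<phi> = enn2real (\<integral>\<^sup>+s. (\<Sum>i. ennreal (\<eta> s i * sqrt (\<eta> s i))) \<partial>\<nu>)"

text \<open>Each weight splits as \<eta> = \<eta> * sqrt \<eta> + \<eta> * (1 - sqrt \<eta>), with
  total mean 1. The second part has mean zero only if almost surely every weight is 0 or 1.\<close>

lemma phi_eq: "(\<integral>\<^sup>+s. (\<Sum>i. ennreal (\<eta> s i * sqrt (\<eta> s i))) \<partial>\<nu>) = ennreal \<phi>"
  and phi_nonneg [simp]: "0 \<le> \<phi>" and phi_less_1: "\<phi> < 1"
proof -
  let ?I = "\<integral>\<^sup>+s. (\<Sum>i. ennreal (\<eta> s i * sqrt (\<eta> s i))) \<partial>\<nu>"
  let ?J = "\<integral>\<^sup>+s. (\<Sum>i. ennreal (\<eta> s i * (1 - sqrt (\<eta> s i)))) \<partial>\<nu>"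
  have s1: "sqrt (\<eta> s i) \<le> 1" for s i using eta_le_1 by simp
  have s2: "\<eta> s i * sqrt (\<eta> s i) \<le> \<eta> s i" for s i
    using mult_left_mono[OF s1 eta_nonneg, of s i s i] by simp
  have "?I + ?J = (\<integral>\<^sup>+s. (\<Sum>i. ennreal (\<eta> s i * sqrt (\<eta> s i)) + ennreal (\<eta> s i * (1 - sqrt (\<eta> s i)))) \<partial>\<nu>)"
    by (subst nn_integral_add[symmetric]) (auto simp: suminf_add)
  also have "\<dots> = 1"
  proof -
    have "ennreal (\<eta> s i * sqrt (\<eta> s i)) + ennreal (\<eta> s i * (1 - sqrt (\<eta> s i))) = ennreal (\<eta> s i)" for s i
      by (subst ennreal_plus[symmetric]) (simp_all add: s1 s2 right_diff_distrib)
    then show ?thesis by (simp add: eta_mean)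
  qed
  finally have sum: "?I + ?J = 1" .
  have "?J \<noteq> 0"
  proof
    assume "?J = 0"
    then have "AE s in \<nu>. (\<Sum>i. ennreal (\<eta> s i * (1 - sqrt (\<eta> s i)))) = 0"
      by (subst (asm) nn_integral_0_iff_AE) auto
    then have "AE s in \<nu>. \<forall>i. \<eta> s i \<in> {0, 1}"
    proof eventually_elim
      case (elim s)
      then have "\<eta> s i * (1 - sqrt (\<eta> s i)) \<le> 0" for i
        by (simp add: suminf_eq_zero_iff ennreal_eq_0_iff)
      moreover have "0 \<le> \<eta> s i * (1 - sqrt (\<eta> s i))" for i
        using s1 by simp
      ultimately have "\<eta> s i * (1 - sqrt (\<eta> s i)) = 0" for i by (metis antisym)
      then show ?case by auto
    qed
    with eta_nontrivial show False by simp
  qed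
  then have J: "?J > 0" by (simp add: zero_less_iff_neq_zero)
  have "?I \<le> 1" unfolding sum[symmetric] by simp
  then have fin: "?I < \<infinity>" by (rule le_less_trans) simp
  then show 1: "?I = ennreal \<phi>" unfolding \<phi>_def by (simp only: ennreal_enn2real infinity_ennreal_def)
  show p0: "0 \<le> \<phi>" unfolding \<phi>_def by (rule enn2real_nonneg)
  have "ennreal \<phi> < ennreal \<phi> + ?J"
    using J ennreal_add_left_cancel_less[of "ennreal \<phi>" 0 ?J] by (simp only: add_0_right infinity_ennreal_def ennreal_neq_top simp_thms)
  then have "ennreal \<phi> < ennreal 1" unfolding 1[symmetric] sum by simp
  then show "\<phi> < 1" using p0 by (simp only: ennreal_less_iff)
qed

lemma expect_Y_sqrt: "(\<integral>\<^sup>+\<zeta>. csum (gen n) (\<lambda>u. ennreal (Y u \<zeta> * sqrt (Y u \<zeta>))) \<partial>\<Omega>) = ennreal (\<phi> ^ n)"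
proof (induction n)
  case (Suc n)
  have "(\<integral>\<^sup>+\<zeta>. csum (gen (Suc n)) (\<lambda>u. ennreal (Y u \<zeta> * sqrt (Y u \<zeta>))) \<partial>\<Omega>) =
      (\<integral>\<^sup>+\<zeta>. csum (gen n) (\<lambda>u. \<integral>\<^sup>+s. (\<Sum>i. ennreal (Y u \<zeta> * \<eta> s i * sqrt (Y u \<zeta> * \<eta> s i))) \<partial>\<nu>) \<partial>\<Omega>)"
    by (rule expect_gen_Suc) measurable
  also have "\<dots> = (\<integral>\<^sup>+\<zeta>. csum (gen n) (\<lambda>u. ennreal (Y u \<zeta> * sqrt (Y u \<zeta>)) * ennreal \<phi>) \<partial>\<Omega>)"
  proof (intro nn_integral_cong)
    fix \<zeta> u
    have "(\<integral>\<^sup>+s. (\<Sum>i. ennreal (Y u \<zeta> * \<eta> s i * sqrt (Y u \<zeta> * \<eta> s i))) \<partial>\<nu>) =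
      (\<integral>\<^sup>+s. ennreal (Y u \<zeta> * sqrt (Y u \<zeta>)) * (\<Sum>i. ennreal (\<eta> s i * sqrt (\<eta> s i))) \<partial>\<nu>)"
      by (intro nn_integral_cong)
        (simp add: ennreal_mult[symmetric] real_sqrt_mult ac_simps flip: ennreal_suminf_cmult)
    then show "(\<integral>\<^sup>+s. (\<Sum>i. ennreal (Y u \<zeta> * \<eta> s i * sqrt (Y u \<zeta> * \<eta> s i))) \<partial>\<nu>) =
      ennreal (Y u \<zeta> * sqrt (Y u \<zeta>)) * ennreal \<phi>"
      by (simp add: nn_integral_cmult phi_eq)
  qed
  also have "\<dots> = (\<integral>\<^sup>+\<zeta>. csum (gen n) (\<lambda>u. ennreal (Y u \<zeta> * sqrt (Y u \<zeta>))) \<partial>\<Omega>) * ennreal \<phi>"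
    by (simp add: nn_integral_multc)
  finally show ?case using Suc by (simp add: ennreal_mult[symmetric] mult.commute)
qed (simp add: prod.P.emeasure_space_1)

text \<open>In terms of the size-biased variable this is \<open>E (- ln Z)\<close>, the mean
  exponential rate at which weights shrink from one generation to the next.\<close>

definition \<mu> :: real where
  "\<mu> = enn2real (\<integral>\<^sup>+s. (\<Sum>i. ennreal (\<eta> s i * - ln (\<eta> s i))) \<partial>\<nu>)"

lemma mu_eq: "(\<integral>\<^sup>+s. (\<Sum>i. ennreal (\<eta> s i * - ln (\<eta> s i))) \<partial>\<nu>) = ennreal \<mu>"
  using eta_entropy unfolding \<mu>_def by simp

lemma mu_nonneg [simp]: "0 \<le> \<mu>" by (simp add: \<mu>_def)

lemma xlnx_mult:
  fixes y z :: real
  assumes "0 \<le> y" "0 \<le> z" "y \<le> 1" "z \<le> 1"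
  shows "ennreal (y * z * - ln (y * z)) = ennreal (y * - ln y) * ennreal z + ennreal y * ennreal (z * - ln z)"
proof (cases "y = 0 \<or> z = 0")
  case False
  then have "0 < y" "0 < z" using assms by auto
  then have "ln y \<le> 0" "ln z \<le> 0" using assms by auto
  with \<open>0 < y\<close> \<open>0 < z\<close> show ?thesis
    by (simp add: ln_mult ennreal_mult[symmetric] ennreal_plus[symmetric] mult_nonneg_nonpos del: ennreal_plus)
      (subst ennreal_plus[symmetric], auto simp: algebra_simps mult_nonneg_nonpos)
qed auto

lemma expect_Y_ln: "(\<integral>\<^sup>+\<zeta>. csum (gen n) (\<lambda>u. ennreal (Y u \<zeta> * - ln (Y u \<zeta>))) \<partial>\<Omega>) = ennreal (real n * \<mu>)"
proof (induction n)
  case (Suc n)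
  have "(\<integral>\<^sup>+\<zeta>. csum (gen (Suc n)) (\<lambda>u. ennreal (Y u \<zeta> * - ln (Y u \<zeta>))) \<partial>\<Omega>) =
      (\<integral>\<^sup>+\<zeta>. csum (gen n) (\<lambda>u. \<integral>\<^sup>+s. (\<Sum>i. ennreal (Y u \<zeta> * \<eta> s i * - ln (Y u \<zeta> * \<eta> s i))) \<partial>\<nu>) \<partial>\<Omega>)"
    by (rule expect_gen_Suc) measurable
  also have "\<dots> = (\<integral>\<^sup>+\<zeta>. csum (gen n) (\<lambda>u. ennreal (Y u \<zeta> * - ln (Y u \<zeta>)) + ennreal (Y u \<zeta>) * ennreal \<mu>) \<partial>\<Omega>)"
  proof (intro nn_integral_cong)
    fix \<zeta> u
    have "(\<Sum>i. ennreal (Y u \<zeta> * \<eta> s i * - ln (Y u \<zeta> * \<eta> s i))) =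
        ennreal (Y u \<zeta> * - ln (Y u \<zeta>)) * (\<Sum>i. ennreal (\<eta> s i)) +
        ennreal (Y u \<zeta>) * (\<Sum>i. ennreal (\<eta> s i * - ln (\<eta> s i)))" for s
      unfolding xlnx_mult[OF Y_nonneg eta_nonneg Y_le_1 eta_le_1]
      by (simp add: suminf_add[symmetric] ennreal_suminf_cmult del: mult_minus_right)
    then show "(\<integral>\<^sup>+s. (\<Sum>i. ennreal (Y u \<zeta> * \<eta> s i * - ln (Y u \<zeta> * \<eta> s i))) \<partial>\<nu>) =
      ennreal (Y u \<zeta> * - ln (Y u \<zeta>)) + ennreal (Y u \<zeta>) * ennreal \<mu>"
      by (simp add: nn_integral_add nn_integral_cmult eta_mean mu_eq[simplified])
  qed
  also have "\<dots> = (\<integral>\<^sup>+\<zeta>. csum (gen n) (\<lambda>u. ennreal (Y u \<zeta> * - ln (Y u \<zeta>))) \<partial>\<Omega>) +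
      (\<integral>\<^sup>+\<zeta>. WE n \<zeta> \<partial>\<Omega>) * ennreal \<mu>"
    by (simp add: nn_integral_add nn_integral_multc WE_def del: mult_minus_right)
  finally show ?case using Suc
    by (simp add: expect_WE ennreal_plus[symmetric] distrib_right add.commute del: ennreal_plus mult_minus_right)
qed simp

end

subsection \<open>Doubling sequences\<close>

text \<open>The bound on \<open>A 1\<close> is separate because the doubling inequality at
  \<open>n = 0\<close> does not connect \<open>A 0\<close> with \<open>A 1\<close>. The lower bound
  1 allows additive constants to be absorbed into \<open>A\<close>.\<close>

definition doubling :: "real \<Rightarrow> (nat \<Rightarrow> real) \<Rightarrow> bool" where
  "doubling D A \<longleftrightarrow> mono A \<and> (\<forall>n. 1 \<le> A n) \<and> A 1 \<le> D \<and> (\<forall>n. A (2 * n) \<le> D * A n)"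

text \<open>A discrete integral of \<open>A\<close>. For doubling \<open>A\<close> it is comparable
  to \<open>(z + 1) * A (nat \<lfloor>z\<rfloor>)\<close>, see \<open>cumul_le\<close> and
  \<open>le_cumul\<close>; the moment of one generation thus carries one more logarithm than that of
  the limit.\<close>

definition cumul :: "(nat \<Rightarrow> real) \<Rightarrow> real \<Rightarrow> real" where
  "cumul A z = (\<Sum>k\<le>nat \<lfloor>z\<rfloor>. A k)"

lemma summable_poly_geometric:
  fixes r :: real
  assumes "0 < r" "r < 1"
  shows "summable (\<lambda>n. real n ^ q * r ^ n)"
proof -
  \<comment> \<open>With \<open>s ^ Suc q = r\<close> the term is
    \<open>(real n * s ^ n) ^ q * s ^ n\<close>: a bounded factor times a geometric one.\<close>
  define s where "s = root (Suc q) r"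
  have s: "0 < s" "s < 1" "s ^ Suc q = r"
    using assms unfolding s_def by (auto simp del: power_Suc real_root_Suc_0)
  have "(\<lambda>n. real n * s ^ n) \<longlonglongrightarrow> 0"
    using s powser_times_n_limit_0[of s] by simp
  then have "Bseq (\<lambda>n. real n * s ^ n)" by (intro convergent_imp_Bseq convergentI)
  then obtain B where B: "0 < B" "\<And>n. norm (real n * s ^ n) \<le> B" by (auto elim: BseqE)
  show ?thesis
  proof (rule summable_comparison_test')
    show "summable (\<lambda>n. B ^ q * s ^ n)" using s by (intro summable_mult summable_geometric) auto
    fix n :: nat
    have "real n ^ q * r ^ n = (real n * s ^ n) ^ q * s ^ n"
      unfolding s(3)[symmetric] by (simp add: power_mult_distrib power_mult[symmetric] mult.commute flip: power_add)
    also have "\<dots> \<le> B ^ q * s ^ n"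
      using B(2)[of n] s by (intro mult_right_mono power_mono) auto
    finally show "norm (real n ^ q * r ^ n) \<le> B ^ q * s ^ n" using assms by simp
  qed
qed

context
  fixes D :: real and A :: "nat \<Rightarrow> real"
  assumes dbl: "doubling D A"
begin

lemma doubling_mono: "m \<le> n \<Longrightarrow> A m \<le> A n"
  using dbl by (auto simp: doubling_def mono_def)

lemma doubling_ge_1: "1 \<le> A n" using dbl by (auto simp: doubling_def)

lemma doubling_nonneg: "0 \<le> A n" using doubling_ge_1[of n] by simp

lemma doubling_const: "1 \<le> D"
  using dbl unfolding doubling_def by (metis order.trans)

lemma doubling_2: "A (2 * n) \<le> D * A n" using dbl by (auto simp: doubling_def)

text \<open>Two doublings suffice since \<open>n \<le> 4 * (n div 2)\<close> for
  \<open>n \<ge> 2\<close>; the small values are covered by the bound on \<open>A 1\<close>.\<close>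

lemma doubling_div_2: "A n \<le> D\<^sup>2 * A (n div 2)"
proof (cases "n \<le> 1")
  case True
  have "A n \<le> A 1" using True by (rule doubling_mono)
  also have "A 1 \<le> D" using dbl by (auto simp: doubling_def)
  also have "D \<le> D * D * A (n div 2)"
    using doubling_const doubling_ge_1[of "n div 2"] by (smt (verit) mult_left_le_one_le mult_le_cancel_left1 mult_le_cancel_right1)
  finally show ?thesis by (simp add: power2_eq_square)
next
  case False
  then have "n \<le> 2 * (2 * (n div 2))" by presburger
  then have "A n \<le> A (2 * (2 * (n div 2)))" by (rule doubling_mono)
  also have "\<dots> \<le> D * A (2 * (n div 2))" by (rule doubling_2)
  also have "\<dots> \<le> D * (D * A (n div 2))"
    using doubling_const by (intro mult_left_mono doubling_2) auto
  finally show ?thesis by (simp add: power2_eq_square)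
qed

text \<open>Halving the argument costs a factor \<open>D\<^sup>2 < 2 ^ p\<close>, which the power
  \<open>p\<close> of the argument compensates.\<close>

lemma doubling_poly: "\<exists>p. \<forall>n\<ge>1. A n \<le> D * real n ^ p"
proof -
  obtain p where p: "D\<^sup>2 < 2 ^ p" using real_arch_pow[of 2 "D\<^sup>2"] by auto
  have "A n \<le> D * real n ^ p" if "n \<ge> 1" for n
    using that
  proof (induction n rule: less_induct)
    case (less n)
    show ?case
    proof (cases "n = 1")
      case True then show ?thesis using dbl by (auto simp: doubling_def)
    next
      case False
      then have m: "1 \<le> n div 2" "n div 2 < n" using less.prems by auto
      have "A n \<le> D\<^sup>2 * A (n div 2)" by (rule doubling_div_2)
      also have "\<dots> \<le> 2 ^ p * (D * real (n div 2) ^ p)"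
        using p less.IH[OF m(2,1)] doubling_nonneg by (intro mult_mono) auto
      also have "\<dots> = D * (2 * real (n div 2)) ^ p" by (simp add: power_mult_distrib)
      also have "\<dots> \<le> D * real n ^ p"
      proof (intro mult_left_mono power_mono)
        have "real (2 * (n div 2)) \<le> real n" by (intro of_nat_mono) simp
        then show "2 * real (n div 2) \<le> real n" by simp
      qed (use doubling_const in auto)
      finally show ?thesis .
    qed
  qed
  then show ?thesis by auto
qed

lemma doubling_summable_power2:
  assumes "0 < r" "r < 1"
  shows "summable (\<lambda>n. (A n)\<^sup>2 * r ^ n)"
proof -
  obtain p where p: "\<And>n. n \<ge> 1 \<Longrightarrow> A n \<le> D * real n ^ p" using doubling_poly by auto
  show ?thesis
  proof (rule summable_comparison_test'[of _ 1])
    show "summable (\<lambda>n. D\<^sup>2 * (real n ^ (p * 2) * r ^ n))"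
      by (intro summable_mult summable_poly_geometric assms)
    fix n :: nat assume n: "1 \<le> n"
    have "(A n)\<^sup>2 \<le> (D * real n ^ p)\<^sup>2" using p[OF n] doubling_nonneg by (intro power_mono) auto
    then have "(A n)\<^sup>2 * r ^ n \<le> (D * real n ^ p)\<^sup>2 * r ^ n" using assms by (intro mult_right_mono) auto
    then show "norm ((A n)\<^sup>2 * r ^ n) \<le> D\<^sup>2 * (real n ^ (p * 2) * r ^ n)"
      using assms by (simp add: power_mult_distrib power_mult)
  qed
qed

lemma doubling_summable:
  assumes "0 < r" "r < 1"
  shows "summable (\<lambda>n. A n * r ^ n)"
proof (rule summable_comparison_test'[OF doubling_summable_power2[OF assms]])
  fix n :: nat
  have "A n \<le> (A n)\<^sup>2" using doubling_ge_1[of n] by (simp add: power2_eq_square)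
  then show "norm (A n * r ^ n) \<le> (A n)\<^sup>2 * r ^ n"
    using assms doubling_nonneg[of n] by (simp add: abs_mult mult_right_mono)
qed

text \<open>Freezing a doubling sequence keeps its constant \<open>D\<close>. Estimates for the
  bounded sequence are therefore uniform in \<open>N\<close>.\<close>

lemma doubling_min: "doubling D (\<lambda>n. A (min n N))"
  unfolding doubling_def
proof (intro conjI allI)
  show "mono (\<lambda>n. A (min n N))" by (intro monoI doubling_mono) auto
  show "1 \<le> A (min n N)" for n by (rule doubling_ge_1)
  have "A (min 1 N) \<le> A 1" by (rule doubling_mono) auto
  also have "\<dots> \<le> D" using dbl by (auto simp: doubling_def)
  finally show "A (min 1 N) \<le> D" .
  fix n
  have "A (min (2 * n) N) \<le> A (2 * min n N)" by (rule doubling_mono) auto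
  also have "\<dots> \<le> D * A (min n N)" by (rule doubling_2)
  finally show "A (min (2 * n) N) \<le> D * A (min n N)" .
qed

lemma cumul_mono: "z \<le> z' \<Longrightarrow> cumul A z \<le> cumul A z'"
  unfolding cumul_def using doubling_nonneg
  by (intro sum_mono2) (auto intro: order.trans[OF _ nat_mono[OF floor_mono]])

lemma cumul_ge_1: "1 \<le> cumul A z"
proof -
  have "1 \<le> (\<Sum>k\<in>{0}. A k)" using doubling_ge_1 by simp
  also have "\<dots> \<le> cumul A z" unfolding cumul_def using doubling_nonneg by (intro sum_mono2) auto
  finally show ?thesis .
qed

text \<open>The terms with indices \<open>2 * j\<close> and \<open>2 * j + 1\<close> are both
  compared with \<open>A j\<close>.\<close>

lemma cumul_2:
  assumes "0 \<le> z"
  shows "cumul A (2 * z) \<le> (D + D\<^sup>2) * cumul A z"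
proof -
  let ?m = "nat \<lfloor>z\<rfloor>"
  have "\<lfloor>2 * z\<rfloor> \<le> 2 * \<lfloor>z\<rfloor> + 1" by linarith
  then have "nat \<lfloor>2 * z\<rfloor> \<le> 2 * ?m + 1" using assms by linarith
  then have "cumul A (2 * z) \<le> (\<Sum>k<2 * Suc ?m. A k)"
    unfolding cumul_def using doubling_nonneg by (intro sum_mono2) auto
  also have "\<dots> = (\<Sum>j<Suc ?m. A (2 * j) + A (2 * j + 1))"
  proof -
    have "(\<Sum>k<2 * n. A k) = (\<Sum>j<n. A (2 * j) + A (2 * j + 1))" for n
      by (induction n) auto
    then show ?thesis .
  qed
  also have "\<dots> \<le> (\<Sum>j<Suc ?m. D * A j + D\<^sup>2 * A j)"
  proof (intro sum_mono add_mono)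
    fix j show "A (2 * j) \<le> D * A j" by (rule doubling_2)
    show "A (2 * j + 1) \<le> D\<^sup>2 * A j" using doubling_div_2[of "2 * j + 1"] by simp
  qed
  also have "\<dots> = (D + D\<^sup>2) * cumul A z"
    unfolding cumul_def lessThan_Suc_atMost by (simp add: sum_distrib_left distrib_right)
  finally show ?thesis .
qed

lemma cumul_power_2:
  assumes "0 \<le> z"
  shows "cumul A (2 ^ j * z) \<le> (D + D\<^sup>2) ^ j * cumul A z"
proof (induction j)
  case (Suc j)
  have "cumul A (2 ^ Suc j * z) = cumul A (2 * (2 ^ j * z))" by (simp add: mult.assoc)
  also have "\<dots> \<le> (D + D\<^sup>2) * cumul A (2 ^ j * z)" using assms by (intro cumul_2) auto
  also have "\<dots> \<le> (D + D\<^sup>2) * ((D + D\<^sup>2) ^ j * cumul A z)"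
    using Suc doubling_const by (intro mult_left_mono) auto
  finally show ?case by (simp add: mult.assoc)
qed simp

lemma cumul_le: "0 \<le> z \<Longrightarrow> cumul A z \<le> (z + 1) * A (nat \<lfloor>z\<rfloor>)"
proof -
  assume z: "0 \<le> z"
  have "cumul A z \<le> (\<Sum>k\<le>nat \<lfloor>z\<rfloor>. A (nat \<lfloor>z\<rfloor>))"
    unfolding cumul_def by (intro sum_mono doubling_mono) auto
  also have "\<dots> = (real (nat \<lfloor>z\<rfloor>) + 1) * A (nat \<lfloor>z\<rfloor>)" by (simp add: add.commute)
  also have "\<dots> \<le> (z + 1) * A (nat \<lfloor>z\<rfloor>)"
    using z doubling_nonneg by (intro mult_right_mono) auto
  finally show ?thesis .
qed

text \<open>The upper half of the sum alone has at least \<open>n / 2\<close> terms, each at least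
  \<open>A (n div 2)\<close>, and doubling compares that value with \<open>A n\<close>.\<close>

lemma le_cumul:
  assumes "0 \<le> z"
  shows "(z + 1) * A (nat \<lfloor>z\<rfloor>) \<le> (2 * D\<^sup>2 + 2) * cumul A z"
proof -
  let ?n = "nat \<lfloor>z\<rfloor>"
  have "A ?n \<le> cumul A z" unfolding cumul_def by (rule member_le_sum) (auto intro: doubling_nonneg)
  have "real ?n / 2 * A (?n div 2) \<le> real (card {?n div 2..?n}) * A (?n div 2)"
    using doubling_nonneg by (intro mult_right_mono) auto
  also have "\<dots> = (\<Sum>k\<in>{?n div 2..?n}. A (?n div 2))" by simp
  also have "\<dots> \<le> (\<Sum>k\<in>{?n div 2..?n}. A k)" by (intro sum_mono doubling_mono) auto
  also have "\<dots> \<le> cumul A z" unfolding cumul_def by (intro sum_mono2) (auto intro: doubling_nonneg)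
  finally have 1: "real ?n * A (?n div 2) \<le> 2 * cumul A z" by simp
  have "real ?n * A ?n \<le> real ?n * (D\<^sup>2 * A (?n div 2))"
    by (intro mult_left_mono doubling_div_2) auto
  also have "\<dots> = D\<^sup>2 * (real ?n * A (?n div 2))" by simp
  also have "\<dots> \<le> D\<^sup>2 * (2 * cumul A z)" by (intro mult_left_mono 1) auto
  finally have 2: "real ?n * A ?n \<le> 2 * D\<^sup>2 * cumul A z" by simp
  have "z + 1 \<le> real ?n + 2" using assms by linarith
  then have "(z + 1) * A ?n \<le> (real ?n + 2) * A ?n" using doubling_nonneg by (intro mult_right_mono)
  also have "\<dots> \<le> 2 * D\<^sup>2 * cumul A z + 2 * cumul A z" using 2 \<open>A ?n \<le> cumul A z\<close> by (simp add: distrib_right)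
  finally show ?thesis by (simp add: distrib_right)
qed

end

text \<open>Iterated doubling of the argument. The order of the quantifiers matters:
  \<open>C\<close> depends on \<open>D\<close> and \<open>L\<close> only, hence serves all frozen
  versions of a sequence at once.\<close>

lemma cumul_scale: "\<exists>C\<ge>1. \<forall>A z. doubling D A \<longrightarrow> 0 \<le> z \<longrightarrow> cumul A (L * z) \<le> C * cumul A z"
proof -
  obtain j where j: "L < 2 ^ j" using real_arch_pow[of 2 L] by auto
  show ?thesis
  proof (intro exI[of _ "max 1 ((D + D\<^sup>2) ^ j)"] conjI allI impI)
    fix A and z :: real assume dbl: "doubling D A" and z: "0 \<le> z"
    have "cumul A (L * z) \<le> cumul A (2 ^ j * z)"
      using j z by (intro cumul_mono[OF dbl] mult_right_mono) auto
    also have "\<dots> \<le> (D + D\<^sup>2) ^ j * cumul A z" by (rule cumul_power_2[OF dbl z])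
    also have "\<dots> \<le> max 1 ((D + D\<^sup>2) ^ j) * cumul A z"
      using cumul_ge_1[OF dbl, of z] by (intro mult_right_mono) auto
    finally show "cumul A (L * z) \<le> max 1 ((D + D\<^sup>2) ^ j) * cumul A z" .
  qed simp
qed

lemma borel_measurable_cumul [measurable]: "cumul A \<in> borel_measurable borel"
  unfolding cumul_def[abs_def] by measurable

section \<open>Truncated martingale differences and their compensators\<close>

context weighted_branching
begin

definition Wr :: "nat \<Rightarrow> (nat list \<Rightarrow> 'a) \<Rightarrow> real" where "Wr n \<zeta> = enn2real (WE n \<zeta>)"

lemma Wr_meas [measurable]: "Wr n \<in> borel_measurable \<Omega>" unfolding Wr_def[abs_def] by measurable

lemma Wr_nonneg [simp]: "0 \<le> Wr n \<zeta>" by (simp add: Wr_def)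

lemma AE_Wr: "AE \<zeta> in \<Omega>. ennreal (Wr n \<zeta>) = WE n \<zeta>"
  using WE_finite[of n] by eventually_elim (simp add: Wr_def)

lemma Wr_mix [simp]: "m \<le> n \<Longrightarrow> Wr m (mix (before n) \<zeta> \<zeta>') = Wr m \<zeta>" by (simp add: Wr_def)

lemma Wr_0 [simp]: "Wr 0 \<zeta> = 1" by (simp add: Wr_def)

definition part :: "(real \<Rightarrow> real \<Rightarrow> bool) \<Rightarrow> nat \<Rightarrow> (nat list \<Rightarrow> 'a) \<Rightarrow> ennreal" where
  "part B k \<zeta> = csum (gen k) (\<lambda>u. if B (Y u \<zeta>) (X (\<zeta> u)) then ennreal (Y u \<zeta> * X (\<zeta> u)) else 0)"

text \<open>The conditional mean of \<open>part B k\<close> given the labels before generation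
  \<open>k\<close>: the label at \<open>u\<close> is replaced by an independent one.\<close>

definition comp :: "(real \<Rightarrow> real \<Rightarrow> bool) \<Rightarrow> nat \<Rightarrow> (nat list \<Rightarrow> 'a) \<Rightarrow> ennreal" where
  "comp B k \<zeta> = csum (gen k) (\<lambda>u. \<integral>\<^sup>+s. (if B (Y u \<zeta>) (X s) then ennreal (Y u \<zeta> * X s) else 0) \<partial>\<nu>)"

text \<open>The same selection with the roles exchanged: the offspring mass \<open>x\<close> is
  fixed, and the mean is taken over the tree.\<close>

definition tail_mean :: "(real \<Rightarrow> real \<Rightarrow> bool) \<Rightarrow> nat \<Rightarrow> real \<Rightarrow> ennreal" where
  "tail_mean B k x = (\<integral>\<^sup>+\<zeta>. csum (gen k) (\<lambda>u. if B (Y u \<zeta>) x then ennreal (Y u \<zeta>) else 0) \<partial>\<Omega>)"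

text \<open>The uncentred second moments of the selected terms, summed over generation
  \<open>k\<close>. It dominates the second moment of \<open>centred B k\<close>, for any selection
  \<open>B\<close>.\<close>

definition big_variance :: "(real \<Rightarrow> real \<Rightarrow> bool) \<Rightarrow> nat \<Rightarrow> ennreal" where
  "big_variance B k = (\<integral>\<^sup>+\<zeta>. csum (gen k) (\<lambda>u. \<integral>\<^sup>+s. (if B (Y u \<zeta>) (X s) then ennreal ((Y u \<zeta> * X s)\<^sup>2) else 0) \<partial>\<nu>) \<partial>\<Omega>)"

definition centred :: "(real \<Rightarrow> real \<Rightarrow> bool) \<Rightarrow> nat \<Rightarrow> (nat list \<Rightarrow> 'a) \<Rightarrow> real" where
  "centred B k \<zeta> = enn2real (part B k \<zeta>) - enn2real (comp B k \<zeta>)"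

context
  fixes B :: "real \<Rightarrow> real \<Rightarrow> bool"
  assumes B: "Measurable.pred (borel \<Otimes>\<^sub>M borel) (\<lambda>p. B (fst p) (snd p))"
begin

lemma B_meas [measurable (raw)]:
  assumes [measurable]: "f \<in> borel_measurable M" "g \<in> borel_measurable M"
  shows "Measurable.pred M (\<lambda>x. B (f x) (g x))"
  using measurable_compose[OF measurable_Pair[OF assms] B] by simp

lemma part_meas [measurable]: "part B k \<in> borel_measurable \<Omega>"
  unfolding part_def[abs_def] by measurable

lemma comp_meas [measurable]: "comp B k \<in> borel_measurable \<Omega>"
  unfolding comp_def[abs_def] by measurable

lemma centred_meas [measurable]: "centred B k \<in> borel_measurable \<Omega>"
  unfolding centred_def[abs_def] by measurable

lemma tail_mean_meas [measurable]: "tail_mean B k \<in> borel_measurable borel"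
  unfolding tail_mean_def[abs_def] by measurable

lemma part_add: "WE (Suc k) \<zeta> = part B k \<zeta> + part (\<lambda>y x. \<not> B y x) k \<zeta>"
  unfolding WE_Suc part_def by (subst nn_integral_add[symmetric]) (auto intro!: csum_cong)

lemma comp_add: "WE k \<zeta> = comp B k \<zeta> + comp (\<lambda>y x. \<not> B y x) k \<zeta>"
proof -
  have "comp B k \<zeta> + comp (\<lambda>y x. \<not> B y x) k \<zeta> = csum (gen k) (\<lambda>u. \<integral>\<^sup>+s. ennreal (Y u \<zeta>) * ennreal (X s) \<partial>\<nu>)"
    unfolding comp_def
    by (subst nn_integral_add[symmetric], simp, simp, intro csum_cong, subst nn_integral_add[symmetric])
      (auto intro!: nn_integral_cong simp: ennreal_mult)
  also have "\<dots> = WE k \<zeta>" by (simp add: nn_integral_cmult EX WE_def)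
  finally show ?thesis by simp
qed

lemma comp_le: "comp B k \<zeta> \<le> WE k \<zeta>" by (subst comp_add) simp

lemma part_le: "part B k \<zeta> \<le> WE (Suc k) \<zeta>" by (subst part_add) simp

text \<open>Fubini, with the resampled label integrated last. The tree then enters only through
  \<open>tail_mean\<close>, evaluated at the mass of one label.\<close>

lemma expect_comp: "(\<integral>\<^sup>+\<zeta>. comp B k \<zeta> \<partial>\<Omega>) = (\<integral>\<^sup>+s. ennreal (X s) * tail_mean B k (X s) \<partial>\<nu>)"
proof -
  have "(\<integral>\<^sup>+\<zeta>. comp B k \<zeta> \<partial>\<Omega>) =
      (\<integral>\<^sup>+\<zeta>. \<integral>\<^sup>+s. csum (gen k) (\<lambda>u. if B (Y u \<zeta>) (X s) then ennreal (Y u \<zeta> * X s) else 0) \<partial>\<nu> \<partial>\<Omega>)"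
    unfolding comp_def by (intro nn_integral_cong csum_nn_integral[symmetric]) measurable
  also have "\<dots> = (\<integral>\<^sup>+s. \<integral>\<^sup>+\<zeta>. csum (gen k) (\<lambda>u. if B (Y u \<zeta>) (X s) then ennreal (Y u \<zeta> * X s) else 0) \<partial>\<Omega> \<partial>\<nu>)"
  proof -
    interpret PP: pair_sigma_finite \<nu> \<Omega> by unfold_locales
    show ?thesis by (rule PP.Fubini') measurable
  qed
  also have "\<dots> = (\<integral>\<^sup>+s. ennreal (X s) * tail_mean B k (X s) \<partial>\<nu>)"
  proof (intro nn_integral_cong)
    fix s
    have "(\<integral>\<^sup>+\<zeta>. csum (gen k) (\<lambda>u. if B (Y u \<zeta>) (X s) then ennreal (Y u \<zeta> * X s) else 0) \<partial>\<Omega>) =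
      (\<integral>\<^sup>+\<zeta>. ennreal (X s) * csum (gen k) (\<lambda>u. if B (Y u \<zeta>) (X s) then ennreal (Y u \<zeta>) else 0) \<partial>\<Omega>)"
      by (subst nn_integral_cmult[symmetric], simp, intro nn_integral_cong csum_cong)
        (auto simp: ennreal_mult mult.commute)
    also have "\<dots> = ennreal (X s) * tail_mean B k (X s)"
      unfolding tail_mean_def by (rule nn_integral_cmult) measurable
    finally show "(\<integral>\<^sup>+\<zeta>. csum (gen k) (\<lambda>u. if B (Y u \<zeta>) (X s) then ennreal (Y u \<zeta> * X s) else 0) \<partial>\<Omega>) =
      ennreal (X s) * tail_mean B k (X s)" .
  qed
  finally show ?thesis .
qed

lemma expect_part: "(\<integral>\<^sup>+\<zeta>. part B k \<zeta> \<partial>\<Omega>) = (\<integral>\<^sup>+\<zeta>. comp B k \<zeta> \<partial>\<Omega>)"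
proof -
  have "(\<integral>\<^sup>+\<zeta>. part B k \<zeta> \<partial>\<Omega>) = csum (gen k) (\<lambda>u. \<integral>\<^sup>+\<zeta>. (if B (Y u \<zeta>) (X (\<zeta> u)) then ennreal (Y u \<zeta> * X (\<zeta> u)) else 0) \<partial>\<Omega>)"
    unfolding part_def by (intro csum_nn_integral) measurable
  also have "\<dots> = csum (gen k) (\<lambda>u. \<integral>\<^sup>+\<zeta>. \<integral>\<^sup>+s. (if B (Y u \<zeta>) (X s) then ennreal (Y u \<zeta> * X s) else 0) \<partial>\<nu> \<partial>\<Omega>)"
    by (intro csum_cong expect_step[where F = "\<lambda>y s. if B y (X s) then ennreal (y * X s) else 0"]) measurable
  also have "\<dots> = (\<integral>\<^sup>+\<zeta>. comp B k \<zeta> \<partial>\<Omega>)"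
    unfolding comp_def by (intro csum_nn_integral[symmetric]) measurable
  finally show ?thesis .
qed

lemma expect_abs_centred: "(\<integral>\<^sup>+\<zeta>. ennreal \<bar>centred B k \<zeta>\<bar> \<partial>\<Omega>) \<le> 2 * (\<integral>\<^sup>+s. ennreal (X s) * tail_mean B k (X s) \<partial>\<nu>)"
proof -
  have le: "ennreal \<bar>enn2real a - enn2real b\<bar> \<le> a + b" for a b
  proof (cases a; cases b)
    fix x y assume "a = ennreal x" "b = ennreal y" "0 \<le> x" "0 \<le> y"
    then show ?thesis by (auto simp: ennreal_plus[symmetric] simp del: ennreal_plus)
  qed auto
  have "(\<integral>\<^sup>+\<zeta>. ennreal \<bar>centred B k \<zeta>\<bar> \<partial>\<Omega>) \<le> (\<integral>\<^sup>+\<zeta>. part B k \<zeta> + comp B k \<zeta> \<partial>\<Omega>)"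
    unfolding centred_def by (intro nn_integral_mono le)
  also have "\<dots> = 2 * (\<integral>\<^sup>+\<zeta>. comp B k \<zeta> \<partial>\<Omega>)"
    by (subst nn_integral_add) (auto simp: expect_part mult_2)
  finally show ?thesis by (simp add: expect_comp)
qed

lemma comp_mix: "comp B k (mix (before k) \<zeta> \<zeta>') = comp B k \<zeta>"
  unfolding comp_def by (intro csum_cong nn_integral_cong) auto

lemma centred_mix: "k < n \<Longrightarrow> centred B k (mix (before n) \<zeta> \<zeta>') = centred B k \<zeta>"
proof -
  assume k: "k < n"
  have "part B k (mix (before n) \<zeta> \<zeta>') = part B k \<zeta>"
    unfolding part_def using k by (intro csum_cong) auto
  moreover have "comp B k (mix (before n) \<zeta> \<zeta>') = comp B k \<zeta>"
    unfolding comp_def using k by (intro csum_cong nn_integral_cong) auto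
  ultimately show ?thesis by (simp add: centred_def)
qed

text \<open>For frozen labels before generation \<open>k\<close> the weights \<open>Y u\<close> are
  constants, the terms of \<open>part\<close> depend on different labels and are independent, and
  \<open>comp\<close> is their total mean.\<close>

lemma centred_second_moment_mix:
  assumes fin: "WE k \<zeta> < \<infinity>"
  shows "(\<integral>\<^sup>+\<zeta>'. ennreal ((a + centred B k (mix (before k) \<zeta> \<zeta>'))\<^sup>2) \<partial>\<Omega>) \<le> ennreal (a\<^sup>2) +
    csum (gen k) (\<lambda>u. \<integral>\<^sup>+s. (if B (Y u \<zeta>) (X s) then ennreal ((Y u \<zeta> * X s)\<^sup>2) else 0) \<partial>\<nu>)"
proof -
  define f where "f u \<zeta>' = (if B (Y u \<zeta>) (X (\<zeta>' u)) then ennreal (Y u \<zeta> * X (\<zeta>' u)) else 0)" for u and \<zeta>' :: "nat list \<Rightarrow> 'a"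
  have [measurable]: "f u \<in> borel_measurable \<Omega>" for u unfolding f_def[abs_def] by measurable
  have Ef: "(\<integral>\<^sup>+\<zeta>'. f u \<zeta>' \<partial>\<Omega>) = (\<integral>\<^sup>+s. (if B (Y u \<zeta>) (X s) then ennreal (Y u \<zeta> * X s) else 0) \<partial>\<nu>)" for u
    unfolding f_def by (rule nn_integral_coord) measurable
  have Ef2: "(\<integral>\<^sup>+\<zeta>'. (f u \<zeta>')\<^sup>2 \<partial>\<Omega>) = (\<integral>\<^sup>+s. (if B (Y u \<zeta>) (X s) then ennreal ((Y u \<zeta> * X s)\<^sup>2) else 0) \<partial>\<nu>)" for u
  proof -
    have "(\<integral>\<^sup>+\<zeta>'. (f u \<zeta>')\<^sup>2 \<partial>\<Omega>) = (\<integral>\<^sup>+s. (if B (Y u \<zeta>) (X s) then ennreal (Y u \<zeta> * X s) else 0)\<^sup>2 \<partial>\<nu>)"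
      unfolding f_def by (rule nn_integral_coord) measurable
    also have "\<dots> = (\<integral>\<^sup>+s. (if B (Y u \<zeta>) (X s) then ennreal ((Y u \<zeta> * X s)\<^sup>2) else 0) \<partial>\<nu>)"
      by (intro nn_integral_cong) (auto simp: ennreal_power)
    finally show ?thesis .
  qed
  have "comp B k \<zeta> < \<infinity>" using comp_le fin by (rule le_less_trans)
  then have m: "csum (gen k) (\<lambda>u. \<integral>\<^sup>+\<zeta>'. f u \<zeta>' \<partial>\<Omega>) = ennreal (enn2real (comp B k \<zeta>))"
    unfolding Ef comp_def by simp
  have "(\<integral>\<^sup>+\<zeta>'. ennreal ((a + centred B k (mix (before k) \<zeta> \<zeta>'))\<^sup>2) \<partial>\<Omega>) =
      (\<integral>\<^sup>+\<zeta>'. ennreal ((a + (enn2real (csum (gen k) (\<lambda>u. f u \<zeta>')) - enn2real (comp B k \<zeta>)))\<^sup>2) \<partial>\<Omega>)"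
  proof (intro nn_integral_cong)
    fix \<zeta>'
    have "part B k (mix (before k) \<zeta> \<zeta>') = csum (gen k) (\<lambda>u. f u \<zeta>')"
      unfolding part_def f_def by (intro csum_cong) auto
    then show "ennreal ((a + centred B k (mix (before k) \<zeta> \<zeta>'))\<^sup>2) =
      ennreal ((a + (enn2real (csum (gen k) (\<lambda>u. f u \<zeta>')) - enn2real (comp B k \<zeta>)))\<^sup>2)"
      by (simp add: centred_def comp_mix)
  qed
  also have "\<dots> \<le> ennreal (a\<^sup>2) + csum (gen k) (\<lambda>u. \<integral>\<^sup>+\<zeta>'. (f u \<zeta>')\<^sup>2 \<partial>\<Omega>)"
  proof (rule prod.P.second_moment_csum)
    fix u v :: "nat list" assume "u \<noteq> v"
    then have "(\<integral>\<^sup>+\<zeta>'. f u \<zeta>' * f v \<zeta>' \<partial>\<Omega>) = (\<integral>\<^sup>+\<zeta>'. f u \<zeta>' \<partial>\<Omega>) * (\<integral>\<^sup>+\<zeta>'. f v \<zeta>' \<partial>\<Omega>)"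
      by (intro nn_integral_indep[of _ _ "{u}"]) (auto simp: f_def mix_def)
    then show "(\<integral>\<^sup>+\<zeta>'. f u \<zeta>' * f v \<zeta>' \<partial>\<Omega>) \<le> (\<integral>\<^sup>+\<zeta>'. f u \<zeta>' \<partial>\<Omega>) * (\<integral>\<^sup>+\<zeta>'. f v \<zeta>' \<partial>\<Omega>)" by simp
  qed (auto simp: m)
  finally show ?thesis by (simp add: Ef2)
qed

text \<open>Orthogonality of martingale differences: resampling from generation \<open>k\<close>
  onwards leaves \<open>S\<close> fixed, so it acts as the deterministic shift in the conditional
  estimate. As an inequality in \<open>ennreal\<close> it also makes sense when \<open>S\<close> has
  no second moment.\<close>

lemma centred_orthogonal:
  assumes [measurable]: "S \<in> borel_measurable \<Omega>"
    and S: "\<And>\<zeta> \<zeta>'. S (mix (before k) \<zeta> \<zeta>') = S \<zeta>"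
  shows "(\<integral>\<^sup>+\<zeta>. ennreal ((S \<zeta> + centred B k \<zeta>)\<^sup>2) \<partial>\<Omega>) \<le> (\<integral>\<^sup>+\<zeta>. ennreal ((S \<zeta>)\<^sup>2) \<partial>\<Omega>) + big_variance B k"
proof -
  have "(\<integral>\<^sup>+\<zeta>. ennreal ((S \<zeta> + centred B k \<zeta>)\<^sup>2) \<partial>\<Omega>) =
      (\<integral>\<^sup>+\<zeta>. \<integral>\<^sup>+\<zeta>'. ennreal ((S \<zeta> + centred B k (mix (before k) \<zeta> \<zeta>'))\<^sup>2) \<partial>\<Omega> \<partial>\<Omega>)"
    by (subst nn_integral_mix[of _ "before k", symmetric]) (auto simp: S)
  also have "\<dots> \<le> (\<integral>\<^sup>+\<zeta>. ennreal ((S \<zeta>)\<^sup>2) +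
      csum (gen k) (\<lambda>u. \<integral>\<^sup>+s. (if B (Y u \<zeta>) (X s) then ennreal ((Y u \<zeta> * X s)\<^sup>2) else 0) \<partial>\<nu>) \<partial>\<Omega>)"
    using WE_finite[of k]
    by (intro nn_integral_mono_AE, eventually_elim) (rule centred_second_moment_mix)
  also have "\<dots> = (\<integral>\<^sup>+\<zeta>. ennreal ((S \<zeta>)\<^sup>2) \<partial>\<Omega>) + big_variance B k"
    unfolding big_variance_def by (rule nn_integral_add) measurable
  finally show ?thesis .
qed

lemma centred_second_moment: "(\<integral>\<^sup>+\<zeta>. ennreal ((centred B k \<zeta>)\<^sup>2) \<partial>\<Omega>) \<le> big_variance B k"
  using centred_orthogonal[of "\<lambda>_. 0" k] by simp

text \<open>The two parts add up to \<open>W (k + 1)\<close>, and the two compensators to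
  \<open>W k\<close> because one label has mean mass 1. Almost surely all of these are finite, so
  the subtraction is legitimate.\<close>

lemma Wr_diff: "AE \<zeta> in \<Omega>. Wr (Suc k) \<zeta> - Wr k \<zeta> = centred (\<lambda>y x. \<not> B y x) k \<zeta> + centred B k \<zeta>"
  using WE_finite[of k] WE_finite[of "Suc k"]
proof eventually_elim
  case (elim \<zeta>)
  have "Wr k \<zeta> = enn2real (comp B k \<zeta>) + enn2real (comp (\<lambda>y x. \<not> B y x) k \<zeta>)"
    unfolding Wr_def using elim(1) by (subst comp_add) (subst enn2real_plus, auto simp: comp_add)
  moreover have "Wr (Suc k) \<zeta> = enn2real (part B k \<zeta>) + enn2real (part (\<lambda>y x. \<not> B y x) k \<zeta>)"
    unfolding Wr_def using elim(2) by (subst part_add) (subst enn2real_plus, auto simp: part_add)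
  ultimately show ?case by (simp add: centred_def)
qed

end

end

subsection \<open>The truncated martingale differences\<close>

lemma suminf_swap_ennreal:
  fixes f :: "nat \<Rightarrow> nat \<Rightarrow> ennreal"
  shows "(\<Sum>n. \<Sum>k. f n k) = (\<Sum>k. \<Sum>n. f n k)"
  using csum_swap[where I = UNIV and J = UNIV and f = f] unfolding nn_integral_count_space_nat .

text \<open>Summation by parts in absolute values: the distance from \<open>w n\<close> to the limit
  is at most the sum of all later increments, and the increment at \<open>k\<close> is counted with
  weight \<open>a n\<close> for every \<open>n \<le> k\<close>.\<close>

lemma summable_tail_weights:
  fixes w a :: "nat \<Rightarrow> real"
  assumes a: "\<And>n. 0 \<le> a n" and lim: "w \<longlonglongrightarrow> l"
    and sum: "(\<Sum>k. ennreal ((\<Sum>n\<le>k. a n) * \<bar>w (Suc k) - w k\<bar>)) < \<infinity>"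
  shows "summable (\<lambda>n. a n * (l - w n))"
proof -
  let ?d = "\<lambda>k. \<bar>w (Suc k) - w k\<bar>"
  have le: "ennreal \<bar>l - w n\<bar> \<le> (\<Sum>k. if n \<le> k then ennreal (?d k) else 0)" for n
  proof -
    have "ennreal \<bar>w m - w n\<bar> \<le> (\<Sum>k. if n \<le> k then ennreal (?d k) else 0)" if "n \<le> m" for m
    proof -
      have "\<bar>w m - w n\<bar> \<le> (\<Sum>k\<in>{n..<m}. ?d k)"
        using that sum_Suc_diff'[of n m w] sum_abs[of "\<lambda>k. w (Suc k) - w k" "{n..<m}"] by simp
      then have "ennreal \<bar>w m - w n\<bar> \<le> (\<Sum>k\<in>{n..<m}. ennreal (?d k))"
        by (simp add: sum_nonneg ennreal_leI)
      also have "\<dots> = (\<Sum>k\<in>{n..<m}. if n \<le> k then ennreal (?d k) else 0)" by (intro sum.cong) auto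
      also have "\<dots> \<le> (\<Sum>k. if n \<le> k then ennreal (?d k) else 0)" by (rule sum_le_suminf) simp_all
      finally show ?thesis .
    qed
    then have ev: "\<exists>N. \<forall>m\<ge>N. ennreal \<bar>w m - w n\<bar> \<le> (\<Sum>k. if n \<le> k then ennreal (?d k) else 0)" by blast
    have "(\<lambda>m. ennreal \<bar>w m - w n\<bar>) \<longlonglongrightarrow> ennreal \<bar>l - w n\<bar>"
      by (intro tendsto_ennrealI tendsto_rabs tendsto_diff lim tendsto_const)
    from LIMSEQ_le_const2[OF this ev] show ?thesis .
  qed
  have "(\<Sum>n. ennreal (a n * \<bar>l - w n\<bar>)) \<le> (\<Sum>n. \<Sum>k. ennreal (a n) * (if n \<le> k then ennreal (?d k) else 0))"
  proof (intro suminf_le)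
    fix n
    have "ennreal (a n * \<bar>l - w n\<bar>) = ennreal (a n) * ennreal \<bar>l - w n\<bar>"
      using a by (intro ennreal_mult) auto
    also have "\<dots> \<le> ennreal (a n) * (\<Sum>k. if n \<le> k then ennreal (?d k) else 0)"
      by (intro mult_left_mono le) simp
    finally show "ennreal (a n * \<bar>l - w n\<bar>) \<le> (\<Sum>k. ennreal (a n) * (if n \<le> k then ennreal (?d k) else 0))"
      by (simp only: ennreal_suminf_cmult)
  qed auto
  also have "\<dots> = (\<Sum>k. \<Sum>n. ennreal (a n) * (if n \<le> k then ennreal (?d k) else 0))"
    by (rule suminf_swap_ennreal)
  also have "\<dots> = (\<Sum>k. ennreal ((\<Sum>n\<le>k. a n) * ?d k))"
  proof (intro suminf_cong)
    fix k
    have "(\<Sum>n. ennreal (a n) * (if n \<le> k then ennreal (?d k) else 0)) =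
        (\<Sum>n\<le>k. ennreal (a n) * (if n \<le> k then ennreal (?d k) else 0))"
      by (rule suminf_finite) auto
    also have "\<dots> = (\<Sum>n\<le>k. ennreal (a n * ?d k))" using a by (intro sum.cong) (auto simp: ennreal_mult)
    also have "\<dots> = ennreal ((\<Sum>n\<le>k. a n) * ?d k)" using a by (simp add: sum_distrib_right sum_nonneg)
    finally show "(\<Sum>n. ennreal (a n) * (if n \<le> k then ennreal (?d k) else 0)) = ennreal ((\<Sum>n\<le>k. a n) * ?d k)" .
  qed
  finally have "(\<Sum>n. ennreal (a n * \<bar>l - w n\<bar>)) < \<infinity>" using sum by (rule le_less_trans)
  then have "(\<Sum>n. ennreal (a n * \<bar>l - w n\<bar>)) \<noteq> top" by (metis infinity_ennreal_def less_irrefl)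
  then have "summable (\<lambda>n. a n * \<bar>l - w n\<bar>)"
    by (rule summable_suminf_not_top[rotated]) (rule mult_nonneg_nonneg[OF a abs_ge_zero])
  then have "summable (\<lambda>n. \<bar>a n * (l - w n)\<bar>)" by (simp only: abs_mult abs_of_nonneg[OF a])
  then show ?thesis by (rule summable_rabs_cancel)
qed

text \<open>
  On \<open>small t\<close> the square \<open>(Y * X)\<^sup>2\<close> is at most \<open>sqrt t * Y * sqrt Y * X\<close>, whose mean decays geometrically,
  and \<open>big t\<close> affects only about \<open>log X\<close> generations.
\<close>

abbreviation big :: "real \<Rightarrow> real \<Rightarrow> real \<Rightarrow> bool" where "big t y x \<equiv> t < x\<^sup>2 * y"

abbreviation small :: "real \<Rightarrow> real \<Rightarrow> real \<Rightarrow> bool" where "small t y x \<equiv> \<not> big t y x"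

lemma log_plus_nonneg [simp]: "0 \<le> log_plus x" by (simp add: log_plus_def)

lemma log_plus_meas [measurable]: "log_plus \<in> borel_measurable borel"
  unfolding log_plus_def[abs_def] by measurable

context weighted_branching
begin

text \<open>A rate with \<phi> at most the square of \<rho>. One factor \<open>\<rho> ^ k\<close> is
  spent on cancelling a large \<open>x\<close>, the other is left for summation over
  \<open>k\<close>. The maximum with 1/2 makes \<rho> positive at once.\<close>

definition \<rho> :: real where "\<rho> = max (sqrt \<phi>) (1 / 2)"

lemma rho: "0 < \<rho>" "\<rho> < 1" "\<phi> \<le> \<rho>\<^sup>2"
proof -
  show "0 < \<rho>" "\<rho> < 1" using phi_less_1 by (auto simp: \<rho>_def)
  have "\<phi> = (sqrt \<phi>)\<^sup>2" by simp
  also have "\<dots> \<le> \<rho>\<^sup>2" unfolding \<rho>_def by (intro power_mono) auto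
  finally show "\<phi> \<le> \<rho>\<^sup>2" .
qed

lemma phi_power_le: "\<phi> ^ k \<le> \<rho> ^ k * \<rho> ^ k"
proof -
  have "\<phi> ^ k \<le> (\<rho>\<^sup>2) ^ k" using rho by (intro power_mono) auto
  then show ?thesis by (simp add: power2_eq_square power_mult_distrib)
qed

lemma big_variance_small:
  assumes t: "0 \<le> t"
  shows "big_variance (small t) k \<le> ennreal (sqrt t * \<phi> ^ k)"
proof -
  have le: "(if small t y x then ennreal ((y * x)\<^sup>2) else 0) \<le> ennreal (y * sqrt y * sqrt t) * ennreal x"
    if "0 \<le> y" "0 \<le> x" for x y
  proof (cases "small t y x")
    case True
    then have "sqrt (x\<^sup>2 * y) \<le> sqrt t" by simp
    then have "x * sqrt y \<le> sqrt t" using that by (simp add: real_sqrt_mult)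
    then have "(x * (y * sqrt y)) * (x * sqrt y) \<le> (x * (y * sqrt y)) * sqrt t"
      using that by (intro mult_left_mono) auto
    moreover have "(x * (y * sqrt y)) * (x * sqrt y) = (y * x)\<^sup>2"
      using that by (simp add: power2_eq_square algebra_simps)
    ultimately have "(y * x)\<^sup>2 \<le> (y * sqrt y * sqrt t) * x" by (simp add: mult_ac)
    with True that t show ?thesis by (auto simp: ennreal_mult[symmetric] intro!: ennreal_leI)
  qed auto
  have "big_variance (small t) k \<le> (\<integral>\<^sup>+\<zeta>. csum (gen k) (\<lambda>u. \<integral>\<^sup>+s. ennreal (Y u \<zeta> * sqrt (Y u \<zeta>) * sqrt t) * ennreal (X s) \<partial>\<nu>) \<partial>\<Omega>)"
    unfolding big_variance_def by (intro nn_integral_mono csum_mono le) auto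
  also have "\<dots> = (\<integral>\<^sup>+\<zeta>. csum (gen k) (\<lambda>u. ennreal (sqrt t) * ennreal (Y u \<zeta> * sqrt (Y u \<zeta>))) \<partial>\<Omega>)"
  proof (intro nn_integral_cong)
    fix \<zeta> u
    have "(\<integral>\<^sup>+s. ennreal (Y u \<zeta> * sqrt (Y u \<zeta>) * sqrt t) * ennreal (X s) \<partial>\<nu>) = ennreal (Y u \<zeta> * sqrt (Y u \<zeta>) * sqrt t)"
      by (subst nn_integral_cmult) (auto simp: EX)
    also have "\<dots> = ennreal (sqrt t) * ennreal (Y u \<zeta> * sqrt (Y u \<zeta>))"
      using t by (subst ennreal_mult[symmetric]) (auto simp: mult_ac)
    finally show "(\<integral>\<^sup>+s. ennreal (Y u \<zeta> * sqrt (Y u \<zeta>) * sqrt t) * ennreal (X s) \<partial>\<nu>) = \<dots>" .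
  qed
  also have "\<dots> = ennreal (sqrt t * \<phi> ^ k)"
    using t by (simp add: nn_integral_cmult expect_Y_sqrt) (simp add: ennreal_mult)
  finally show ?thesis .
qed

lemma big_meas: "Measurable.pred (borel \<Otimes>\<^sub>M borel) (\<lambda>p. big t (fst p) (snd p))"
  by measurable

lemma tail_mean_le_1: "tail_mean B k x \<le> 1"
  unfolding tail_mean_def expect_WE[of k, symmetric] WE_def
  by (intro nn_integral_mono csum_mono) auto

lemma tail_mean_big_eq_0:
  assumes "x\<^sup>2 \<le> t"
  shows "tail_mean (big t) k x = 0"
proof -
  have "\<not> big t (Y u \<zeta>) x" for u \<zeta>
    using assms mult_left_mono[OF Y_le_1, of "x\<^sup>2" u \<zeta>] by simp
  then show ?thesis by (simp add: tail_mean_def)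
qed

text \<open>Where \<open>t < x\<^sup>2 * y\<close> with \<open>t \<ge> 1\<close>, also
  \<open>1 \<le> x * sqrt y\<close>; this factor turns the weight \<open>y\<close> into
  \<open>x * (y * sqrt y)\<close>, whose mean decays geometrically.\<close>

lemma tail_mean_big_le:
  assumes "1 \<le> t" "0 \<le> x"
  shows "tail_mean (big t) k x \<le> ennreal (x * \<phi> ^ k)"
proof -
  have le: "(if big t y x then ennreal y else 0) \<le> ennreal x * ennreal (y * sqrt y)" if "0 \<le> y" for y
  proof (cases "big t y x")
    case True
    then have "1 \<le> sqrt (x\<^sup>2 * y)" using assms by simp
    then have "1 \<le> x * sqrt y" using that assms by (simp add: real_sqrt_mult)
    then have "y * 1 \<le> y * (x * sqrt y)" using that by (intro mult_left_mono) auto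
    with True that assms show ?thesis by (auto simp: ennreal_mult[symmetric] mult_ac intro!: ennreal_leI)
  qed auto
  have "tail_mean (big t) k x \<le> (\<integral>\<^sup>+\<zeta>. csum (gen k) (\<lambda>u. ennreal x * ennreal (Y u \<zeta> * sqrt (Y u \<zeta>))) \<partial>\<Omega>)"
    unfolding tail_mean_def by (intro nn_integral_mono csum_mono le) auto
  also have "\<dots> = ennreal (x * \<phi> ^ k)"
    using assms by (simp add: nn_integral_cmult expect_Y_sqrt) (simp add: ennreal_mult)
  finally show ?thesis .
qed

text \<open>The number of generations per unit of \<open>ln x\<close> after which
  \<open>\<rho> ^ k\<close> has made up for the size of \<open>x\<close>.\<close>

definition L\<rho> :: real where "L\<rho> = 1 / ln (1 / \<rho>)"

lemma L_rho_pos: "0 < L\<rho>" using rho by (simp add: L\<rho>_def)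

lemma rho_power_bound:
  assumes "1 \<le> x" "L\<rho> * ln x \<le> real k"
  shows "x * \<rho> ^ k \<le> 1"
proof -
  have "ln x \<le> real k * ln (1 / \<rho>)"
    using assms rho by (simp add: L\<rho>_def field_simps)
  then have "ln x \<le> ln ((1 / \<rho>) ^ k)" using rho by (simp add: ln_realpow)
  then have "x \<le> (1 / \<rho>) ^ k" using assms rho by (subst (asm) ln_le_cancel_iff) auto
  then show ?thesis using rho by (simp add: field_simps)
qed

text \<open>Up to about \<open>L\<rho> * ln x\<close> generations the trivial bound 1 is used and
  produces \<open>cumul\<close>. Afterwards \<open>x * \<rho> ^ k \<le> 1\<close>, so
  \<open>x * \<phi> ^ k \<le> \<rho> ^ k\<close>, and a geometric series remains. If
  \<open>x\<^sup>2 \<le> t\<close> nothing is selected, since no weight exceeds 1.\<close>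

lemma tail_sum:
  assumes A: "doubling D A" and t: "1 \<le> t" and x: "0 \<le> x"
  shows "(\<Sum>k. ennreal (A k) * tail_mean (big t) k x) \<le>
    (if t < x\<^sup>2 then ennreal (cumul A (L\<rho> * log_plus x) + (\<Sum>k. A k * \<rho> ^ k)) else 0)"
proof (cases "t < x\<^sup>2")
  case True
  then have "1\<^sup>2 < x\<^sup>2" using t by simp
  then have x1: "1 < x" using x by (rule power_less_imp_less_base)
  then have lx: "log_plus x = ln x" "0 \<le> ln x" by (auto simp: log_plus_def)
  let ?n = "nat \<lfloor>L\<rho> * ln x\<rfloor>"
  have A0: "0 \<le> A k" for k by (rule doubling_nonneg[OF A])
  have smm: "summable (\<lambda>k. A k * \<rho> ^ k)" by (rule doubling_summable[OF A rho(1,2)])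
  have "ennreal (A k) * tail_mean (big t) k x \<le> (if k \<le> ?n then ennreal (A k) else 0) + ennreal (A k * \<rho> ^ k)" for k
  proof (cases "k \<le> ?n")
    case True
    have "ennreal (A k) * tail_mean (big t) k x \<le> ennreal (A k) * 1" by (intro mult_left_mono tail_mean_le_1) auto
    with True show ?thesis by (simp add: add_increasing2)
  next
    case False
    then have "L\<rho> * ln x \<le> real k" using L_rho_pos lx by linarith
    then have 1: "x * \<rho> ^ k \<le> 1" using x1 by (intro rho_power_bound) auto
    have "x * \<phi> ^ k \<le> x * (\<rho> ^ k * \<rho> ^ k)" using x phi_power_le by (intro mult_left_mono) auto
    also have "\<dots> \<le> \<rho> ^ k" using 1 rho mult_right_mono[of "x * \<rho> ^ k" 1 "\<rho> ^ k"] by (simp add: mult.assoc)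
    finally have "tail_mean (big t) k x \<le> ennreal (\<rho> ^ k)"
      by (intro order.trans[OF tail_mean_big_le[OF t x]] ennreal_leI)
    then have "ennreal (A k) * tail_mean (big t) k x \<le> ennreal (A k) * ennreal (\<rho> ^ k)" by (intro mult_left_mono) auto
    with False A0 rho show ?thesis by (simp add: ennreal_mult)
  qed
  then have "(\<Sum>k. ennreal (A k) * tail_mean (big t) k x) \<le>
      (\<Sum>k. (if k \<le> ?n then ennreal (A k) else 0) + ennreal (A k * \<rho> ^ k))"
    by (intro suminf_le) auto
  also have "\<dots> = (\<Sum>k. if k \<le> ?n then ennreal (A k) else 0) + (\<Sum>k. ennreal (A k * \<rho> ^ k))"
    by (intro suminf_add[symmetric]) auto
  also have "(\<Sum>k. if k \<le> ?n then ennreal (A k) else 0) = (\<Sum>k\<le>?n. if k \<le> ?n then ennreal (A k) else 0)"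
    by (rule suminf_finite) auto
  also have "\<dots> = ennreal (cumul A (L\<rho> * log_plus x))" using A0 by (simp add: cumul_def lx)
  also have "(\<Sum>k. ennreal (A k * \<rho> ^ k)) = ennreal (\<Sum>k. A k * \<rho> ^ k)"
    using A0 rho smm by (intro suminf_ennreal2) auto
  also have "ennreal (cumul A (L\<rho> * log_plus x)) + ennreal (\<Sum>k. A k * \<rho> ^ k) =
      ennreal (cumul A (L\<rho> * log_plus x) + (\<Sum>k. A k * \<rho> ^ k))"
    using A0 rho smm by (intro ennreal_plus[symmetric] suminf_nonneg) (auto simp: cumul_def sum_nonneg)
  finally show ?thesis using True by simp
next
  case False
  then show ?thesis by (simp add: tail_mean_big_eq_0)
qed

text \<open>The passage from second to first moments, with a free parameter \<open>c\<close> to be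
  set to the expected size of \<open>z\<close>.\<close>

lemma abs_le_square: "0 < c \<Longrightarrow> \<bar>z\<bar> \<le> c + z\<^sup>2 / c" for c z :: real
proof -
  assume c: "0 < c"
  have "\<bar>z\<bar> * c \<le> c\<^sup>2 + z\<^sup>2"
  proof -
    have "2 * (\<bar>z\<bar> * c) \<le> c\<^sup>2 + z\<^sup>2" using sum_squares_bound[of "\<bar>z\<bar>" c] by (simp add: power2_eq_square)
    moreover have "0 \<le> \<bar>z\<bar> * c" using c by simp
    ultimately show ?thesis by linarith
  qed
  then show ?thesis using c by (simp add: field_simps power2_eq_square)
qed

lemma expect_centred_small:
  assumes t: "0 \<le> t"
  shows "(\<integral>\<^sup>+\<zeta>. ennreal ((centred (small t) k \<zeta>)\<^sup>2) \<partial>\<Omega>) \<le> ennreal (sqrt t * (\<rho> ^ k * \<rho> ^ k))"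
proof -
  have m: "Measurable.pred (borel \<Otimes>\<^sub>M borel) (\<lambda>p. small t (fst p) (snd p))" by measurable
  have "(\<integral>\<^sup>+\<zeta>. ennreal ((centred (small t) k \<zeta>)\<^sup>2) \<partial>\<Omega>) \<le> big_variance (small t) k"
    by (rule centred_second_moment[OF m])
  also have "\<dots> \<le> ennreal (sqrt t * \<phi> ^ k)" by (rule big_variance_small[OF t])
  also have "\<dots> \<le> ennreal (sqrt t * (\<rho> ^ k * \<rho> ^ k))"
    using t by (intro ennreal_leI mult_left_mono phi_power_le) auto
  finally show ?thesis .
qed

definition mean_step :: "nat \<Rightarrow> ennreal" where
  "mean_step k = (\<integral>\<^sup>+\<zeta>. ennreal \<bar>Wr (Suc k) \<zeta> - Wr k \<zeta>\<bar> \<partial>\<Omega>)"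

lemma mean_step_le: "mean_step k \<le> ennreal (2 * \<rho> ^ k) + 2 * (\<integral>\<^sup>+s. ennreal (X s) * tail_mean (big 1) k (X s) \<partial>\<nu>)"
proof -
  note [measurable] = big_meas
  have ms: "Measurable.pred (borel \<Otimes>\<^sub>M borel) (\<lambda>p. small 1 (fst p) (snd p))" by measurable
  have [measurable]: "centred (small 1) k \<in> borel_measurable \<Omega>" "centred (big 1) k \<in> borel_measurable \<Omega>"
    using centred_meas[OF ms] centred_meas[OF big_meas] by auto
  have r: "0 < \<rho> ^ k" using rho by simp
  \<comment> \<open>The small part has second moment at most \<open>\<rho> ^ k * \<rho> ^ k\<close>,
    so \<open>c = \<rho> ^ k\<close> balances the two terms of \<open>abs_le_square\<close>.\<close>
  have "mean_step k \<le> (\<integral>\<^sup>+\<zeta>. (ennreal (\<rho> ^ k) + ennreal ((centred (small 1) k \<zeta>)\<^sup>2) * ennreal (1 / \<rho> ^ k)) + ennreal \<bar>centred (big 1) k \<zeta>\<bar> \<partial>\<Omega>)"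
    unfolding mean_step_def
  proof (intro nn_integral_mono_AE)
    show "AE \<zeta> in \<Omega>. ennreal \<bar>Wr (Suc k) \<zeta> - Wr k \<zeta>\<bar> \<le>
        (ennreal (\<rho> ^ k) + ennreal ((centred (small 1) k \<zeta>)\<^sup>2) * ennreal (1 / \<rho> ^ k)) + ennreal \<bar>centred (big 1) k \<zeta>\<bar>"
      using Wr_diff[OF big_meas, of k 1]
    proof eventually_elim
      case (elim \<zeta>)
      have "\<bar>Wr (Suc k) \<zeta> - Wr k \<zeta>\<bar> \<le> (\<rho> ^ k + (centred (small 1) k \<zeta>)\<^sup>2 * (1 / \<rho> ^ k)) + \<bar>centred (big 1) k \<zeta>\<bar>"
        unfolding elim using abs_le_square[OF r, of "centred (small 1) k \<zeta>"] by simp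
      then show ?case using r
        by (simp add: ennreal_plus[symmetric] ennreal_mult[symmetric] del: ennreal_plus)
    qed
  qed
  also have "\<dots> = ennreal (\<rho> ^ k) + (\<integral>\<^sup>+\<zeta>. ennreal ((centred (small 1) k \<zeta>)\<^sup>2) \<partial>\<Omega>) * ennreal (1 / \<rho> ^ k) +
      (\<integral>\<^sup>+\<zeta>. ennreal \<bar>centred (big 1) k \<zeta>\<bar> \<partial>\<Omega>)"
    by (simp add: nn_integral_add nn_integral_multc prod.P.emeasure_space_1)
  also have "\<dots> \<le> ennreal (\<rho> ^ k) + ennreal (sqrt 1 * (\<rho> ^ k * \<rho> ^ k)) * ennreal (1 / \<rho> ^ k) +
      2 * (\<integral>\<^sup>+s. ennreal (X s) * tail_mean (big 1) k (X s) \<partial>\<nu>)"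
    by (intro add_mono mult_right_mono expect_centred_small expect_abs_centred big_meas) auto
  also have "ennreal (\<rho> ^ k) + ennreal (sqrt 1 * (\<rho> ^ k * \<rho> ^ k)) * ennreal (1 / \<rho> ^ k) = ennreal (2 * \<rho> ^ k)"
    using r by (simp add: ennreal_mult[symmetric] ennreal_plus[symmetric] del: ennreal_plus)
  finally show ?thesis .
qed

definition finite_moment_X :: "(nat \<Rightarrow> real) \<Rightarrow> bool" where
  "finite_moment_X A \<longleftrightarrow> (\<integral>\<^sup>+s. ennreal (X s * cumul A (log_plus (X s))) \<partial>\<nu>) < \<infinity>"

lemma finite_moment_X_scale:
  assumes A: "doubling D A" and finite_moment_X: "finite_moment_X A" and C: "0 \<le> C" and L: "0 \<le> L"
  shows "(\<integral>\<^sup>+s. ennreal (X s * (cumul A (L * log_plus (X s)) + C)) \<partial>\<nu>) < \<infinity>"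
proof -
  obtain K where K: "1 \<le> K" "\<And>z. 0 \<le> z \<Longrightarrow> cumul A (L * z) \<le> K * cumul A z"
    using cumul_scale[of D L] A by blast
  have "(\<integral>\<^sup>+s. ennreal (X s * (cumul A (L * log_plus (X s)) + C)) \<partial>\<nu>) \<le>
      (\<integral>\<^sup>+s. ennreal (K + C) * ennreal (X s * cumul A (log_plus (X s))) \<partial>\<nu>)"
  proof (intro nn_integral_mono)
    fix s
    have 1: "1 \<le> cumul A (log_plus (X s))" by (rule cumul_ge_1[OF A])
    have "cumul A (L * log_plus (X s)) + C \<le> K * cumul A (log_plus (X s)) + C * cumul A (log_plus (X s))"
      using K(2)[of "log_plus (X s)"] 1 C mult_left_mono[OF 1 C] by simp
    then have "X s * (cumul A (L * log_plus (X s)) + C) \<le> X s * ((K + C) * cumul A (log_plus (X s)))"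
      by (intro mult_left_mono) (auto simp: distrib_right)
    then show "ennreal (X s * (cumul A (L * log_plus (X s)) + C)) \<le> ennreal (K + C) * ennreal (X s * cumul A (log_plus (X s)))"
      using K C 1 by (simp add: ennreal_mult[symmetric] mult_ac ennreal_leI del: ennreal_plus)
  qed
  also have "\<dots> = ennreal (K + C) * (\<integral>\<^sup>+s. ennreal (X s * cumul A (log_plus (X s))) \<partial>\<nu>)"
    by (rule nn_integral_cmult) measurable
  also have "\<dots> < \<infinity>" using finite_moment_X by (auto simp: finite_moment_X_def ennreal_mult_less_top)
  finally show ?thesis .
qed

text \<open>The small parts contribute a convergent series for any doubling \<open>A\<close>. For
  the big parts the sum over generations is moved inside the integral over one label, where
  \<open>tail_sum\<close> evaluates it.\<close>

lemma finite_moment_X_mean_step: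
  assumes A: "doubling D A" and finite_moment_X: "finite_moment_X A"
  shows "(\<Sum>k. ennreal (A k) * mean_step k) < \<infinity>"
proof -
  have A0: "0 \<le> A k" for k by (rule doubling_nonneg[OF A])
  have smm: "summable (\<lambda>k. A k * \<rho> ^ k)" by (rule doubling_summable[OF A rho(1,2)])
  let ?C = "\<Sum>k. A k * \<rho> ^ k"
  have C: "0 \<le> ?C" using A0 rho smm by (intro suminf_nonneg) auto
  have [measurable]: "tail_mean (big 1) k \<in> borel_measurable borel" for k by (rule tail_mean_meas[OF big_meas])
  have "(\<Sum>k. ennreal (A k) * mean_step k) \<le>
      (\<Sum>k. ennreal (2 * (A k * \<rho> ^ k)) + 2 * (ennreal (A k) * (\<integral>\<^sup>+s. ennreal (X s) * tail_mean (big 1) k (X s) \<partial>\<nu>)))"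
  proof (intro suminf_le)
    fix k
    have "ennreal (A k) * mean_step k \<le> ennreal (A k) * (ennreal (2 * \<rho> ^ k) + 2 * (\<integral>\<^sup>+s. ennreal (X s) * tail_mean (big 1) k (X s) \<partial>\<nu>))"
      by (intro mult_left_mono mean_step_le) auto
    also have "\<dots> = ennreal (2 * (A k * \<rho> ^ k)) + 2 * (ennreal (A k) * (\<integral>\<^sup>+s. ennreal (X s) * tail_mean (big 1) k (X s) \<partial>\<nu>))"
      using A0 rho by (simp add: distrib_left ennreal_mult mult_ac)
    finally show "ennreal (A k) * mean_step k \<le> \<dots>" .
  qed auto
  also have "\<dots> = (\<Sum>k. ennreal (2 * (A k * \<rho> ^ k))) +
      2 * (\<Sum>k. ennreal (A k) * (\<integral>\<^sup>+s. ennreal (X s) * tail_mean (big 1) k (X s) \<partial>\<nu>))"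
    by (subst suminf_add[symmetric]) auto
  also have "(\<Sum>k. ennreal (2 * (A k * \<rho> ^ k))) = ennreal (\<Sum>k. 2 * (A k * \<rho> ^ k))"
    using A0 rho smm by (intro suminf_ennreal2 summable_mult) auto
  also have "(\<Sum>k. ennreal (A k) * (\<integral>\<^sup>+s. ennreal (X s) * tail_mean (big 1) k (X s) \<partial>\<nu>)) =
      (\<integral>\<^sup>+s. (\<Sum>k. ennreal (A k) * (ennreal (X s) * tail_mean (big 1) k (X s))) \<partial>\<nu>)"
    by (subst nn_integral_suminf) (auto simp: nn_integral_cmult)
  also have "\<dots> \<le> (\<integral>\<^sup>+s. ennreal (X s * (cumul A (L\<rho> * log_plus (X s)) + ?C)) \<partial>\<nu>)"
  proof (intro nn_integral_mono)
    fix s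
    have "(\<Sum>k. ennreal (A k) * (ennreal (X s) * tail_mean (big 1) k (X s))) =
        ennreal (X s) * (\<Sum>k. ennreal (A k) * tail_mean (big 1) k (X s))"
      by (subst ennreal_suminf_cmult[symmetric]) (simp add: mult_ac)
    also have "\<dots> \<le> ennreal (X s) * ennreal (cumul A (L\<rho> * log_plus (X s)) + ?C)"
      using tail_sum[OF A order_refl X_nonneg, of s]
      by (intro mult_left_mono) (auto split: if_splits)
    also have "\<dots> = ennreal (X s * (cumul A (L\<rho> * log_plus (X s)) + ?C))"
      using C order.trans[OF zero_le_one cumul_ge_1[OF A]] by (intro ennreal_mult[symmetric]) auto
    finally show "(\<Sum>k. ennreal (A k) * (ennreal (X s) * tail_mean (big 1) k (X s))) \<le> \<dots>" .
  qed
  finally have "(\<Sum>k. ennreal (A k) * mean_step k) \<le> ennreal (\<Sum>k. 2 * (A k * \<rho> ^ k)) +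
      2 * (\<integral>\<^sup>+s. ennreal (X s * (cumul A (L\<rho> * log_plus (X s)) + ?C)) \<partial>\<nu>)"
    by (simp add: add_left_mono mult_left_mono)
  also have "\<dots> < \<infinity>"
    using finite_moment_X_scale[OF A finite_moment_X C, of L\<rho>] L_rho_pos by (auto simp: ennreal_mult_less_top)
  finally show ?thesis .
qed

end

subsection \<open>The limit of the martingale\<close>

locale weighted_branching_xlogx = weighted_branching +
  assumes eta_xlogx: "(\<integral>\<^sup>+s. ennreal (X s * log_plus (X s)) \<partial>\<nu>) < \<infinity>"
begin

lemma doubling_1: "doubling 1 (\<lambda>_. 1)" by (auto simp: doubling_def mono_def)

text \<open>For constant weights \<open>cumul\<close> is linear, so the condition on one generation
  is the given \<open>X log X\<close> moment. This case makes the increments of the martingale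
  absolutely summable in mean.\<close>

lemma finite_moment_X_1: "finite_moment_X (\<lambda>_. 1)"
proof -
  have "(\<integral>\<^sup>+s. ennreal (X s * cumul (\<lambda>_. 1) (log_plus (X s))) \<partial>\<nu>) \<le>
      (\<integral>\<^sup>+s. ennreal (X s * log_plus (X s)) + ennreal (X s) \<partial>\<nu>)"
  proof (intro nn_integral_mono)
    fix s
    have "cumul (\<lambda>_. 1) (log_plus (X s)) \<le> log_plus (X s) + 1" by (simp add: cumul_def)
    then have "X s * cumul (\<lambda>_. 1) (log_plus (X s)) \<le> X s * (log_plus (X s) + 1)" by (intro mult_left_mono) auto
    then show "ennreal (X s * cumul (\<lambda>_. 1) (log_plus (X s))) \<le> ennreal (X s * log_plus (X s)) + ennreal (X s)"
      by (simp add: ennreal_plus[symmetric] ennreal_leI distrib_left del: ennreal_plus)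
  qed
  also have "\<dots> = (\<integral>\<^sup>+s. ennreal (X s * log_plus (X s)) \<partial>\<nu>) + 1" by (simp add: nn_integral_add EX)
  also have "\<dots> < \<infinity>" using eta_xlogx by simp
  finally show ?thesis by (simp add: finite_moment_X_def)
qed

text \<open>An integrable bound for all \<open>W n\<close> and for the limit simultaneously; the 1
  is \<open>W 0\<close>. It does the work of uniform integrability and of a maximal
  inequality.\<close>

definition dominator :: "(nat list \<Rightarrow> 'a) \<Rightarrow> ennreal" where
  "dominator \<zeta> = 1 + (\<Sum>k. ennreal \<bar>Wr (Suc k) \<zeta> - Wr k \<zeta>\<bar>)"

text \<open>Where the martingale diverges \<open>lim\<close> is arbitrary, so non-negativity has to be enforced.\<close>

definition Wl :: "(nat list \<Rightarrow> 'a) \<Rightarrow> real" where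
  "Wl \<zeta> = max 0 (lim (\<lambda>n. Wr n \<zeta>))"

lemma dominator_meas [measurable]: "dominator \<in> borel_measurable \<Omega>" unfolding dominator_def[abs_def] by measurable

lemma Wl_meas [measurable]: "Wl \<in> borel_measurable \<Omega>" unfolding Wl_def[abs_def] by measurable

lemma Wl_nonneg [simp]: "0 \<le> Wl \<zeta>" by (simp add: Wl_def)

lemma expect_dominator: "(\<integral>\<^sup>+\<zeta>. dominator \<zeta> \<partial>\<Omega>) < \<infinity>"
proof -
  have "(\<integral>\<^sup>+\<zeta>. dominator \<zeta> \<partial>\<Omega>) = 1 + (\<Sum>k. ennreal 1 * mean_step k)"
    unfolding dominator_def mean_step_def by (simp add: nn_integral_add nn_integral_suminf prod.P.emeasure_space_1)
  also have "\<dots> < \<infinity>" using finite_moment_X_mean_step[OF doubling_1 finite_moment_X_1] by simp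
  finally show ?thesis .
qed

lemma Wr_le_dominator: "ennreal (Wr n \<zeta>) \<le> dominator \<zeta>"
proof -
  have "Wr n \<zeta> \<le> 1 + (\<Sum>k<n. \<bar>Wr (Suc k) \<zeta> - Wr k \<zeta>\<bar>)"
    using sum_lessThan_telescope[of "\<lambda>k. Wr k \<zeta>" n] sum_abs[of "\<lambda>k. Wr (Suc k) \<zeta> - Wr k \<zeta>" "{..<n}"]
    by simp
  then have "ennreal (Wr n \<zeta>) \<le> 1 + (\<Sum>k<n. ennreal \<bar>Wr (Suc k) \<zeta> - Wr k \<zeta>\<bar>)"
    by (subst sum_ennreal, simp) (auto simp: ennreal_1[symmetric] ennreal_plus[symmetric] sum_nonneg
        simp del: ennreal_1 ennreal_plus intro!: ennreal_leI)
  also have "\<dots> \<le> dominator \<zeta>" unfolding dominator_def by (intro add_left_mono sum_le_suminf) simp_all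
  finally show ?thesis .
qed

lemma Wr_tendsto: "AE \<zeta> in \<Omega>. (\<lambda>n. Wr n \<zeta>) \<longlonglongrightarrow> Wl \<zeta>"
proof -
  have "AE \<zeta> in \<Omega>. dominator \<zeta> \<noteq> \<infinity>"
    using expect_dominator by (intro nn_integral_noteq_infinite) auto
  then show ?thesis
  proof eventually_elim
    case (elim \<zeta>)
    then have "(\<Sum>k. ennreal \<bar>Wr (Suc k) \<zeta> - Wr k \<zeta>\<bar>) \<noteq> top" by (auto simp: dominator_def)
    then have "summable (\<lambda>k. \<bar>Wr (Suc k) \<zeta> - Wr k \<zeta>\<bar>)" by (rule summable_suminf_not_top[rotated]) simp
    then have "summable (\<lambda>k. Wr (Suc k) \<zeta> - Wr k \<zeta>)" by (rule summable_rabs_cancel)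
    then have "convergent (\<lambda>n. \<Sum>k<n. Wr (Suc k) \<zeta> - Wr k \<zeta>)" by (simp add: summable_iff_convergent)
    then have "convergent (\<lambda>n. (\<Sum>k<n. Wr (Suc k) \<zeta> - Wr k \<zeta>) + 1)" by (intro convergent_add convergent_const)
    moreover have "(\<lambda>n. (\<Sum>k<n. Wr (Suc k) \<zeta> - Wr k \<zeta>) + 1) = (\<lambda>n. Wr n \<zeta>)"
      using sum_lessThan_telescope[of "\<lambda>k. Wr k \<zeta>"] by (intro ext) simp
    ultimately have lim: "(\<lambda>n. Wr n \<zeta>) \<longlonglongrightarrow> lim (\<lambda>n. Wr n \<zeta>)" by (simp add: convergent_LIMSEQ_iff)
    moreover from lim have "0 \<le> lim (\<lambda>n. Wr n \<zeta>)" by (rule LIMSEQ_le_const) auto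
    ultimately show ?case by (simp add: Wl_def)
  qed
qed

lemma Wl_le_dominator: "AE \<zeta> in \<Omega>. ennreal (Wl \<zeta>) \<le> dominator \<zeta>"
  using Wr_tendsto
proof eventually_elim
  case (elim \<zeta>)
  from tendsto_ennrealI[OF this] show ?case by (rule LIMSEQ_le_const2) (auto intro: Wr_le_dominator)
qed

definition dist1 :: "nat \<Rightarrow> ennreal" where "dist1 n = (\<integral>\<^sup>+\<zeta>. ennreal \<bar>Wr n \<zeta> - Wl \<zeta>\<bar> \<partial>\<Omega>)"

lemma dist1_tendsto: "dist1 \<longlonglongrightarrow> 0"
proof -
  have "(\<lambda>n. \<integral>\<^sup>+\<zeta>. ennreal \<bar>Wr n \<zeta> - Wl \<zeta>\<bar> \<partial>\<Omega>) \<longlonglongrightarrow> (\<integral>\<^sup>+\<zeta>. 0 \<partial>\<Omega>)"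
  proof (rule nn_integral_dominated_convergence[where w = "\<lambda>\<zeta>. 2 * dominator \<zeta>"])
    fix n
    show "AE \<zeta> in \<Omega>. ennreal \<bar>Wr n \<zeta> - Wl \<zeta>\<bar> \<le> 2 * dominator \<zeta>"
      using Wl_le_dominator
    proof eventually_elim
      case (elim \<zeta>)
      have "ennreal \<bar>Wr n \<zeta> - Wl \<zeta>\<bar> \<le> ennreal (Wr n \<zeta>) + ennreal (Wl \<zeta>)"
        by (simp add: ennreal_plus[symmetric] ennreal_leI abs_le_iff del: ennreal_plus)
      also have "\<dots> \<le> dominator \<zeta> + dominator \<zeta>" by (intro add_mono Wr_le_dominator elim)
      finally show ?case by (simp add: mult_2)
    qed
  next
    show "AE \<zeta> in \<Omega>. (\<lambda>n. ennreal \<bar>Wr n \<zeta> - Wl \<zeta>\<bar>) \<longlonglongrightarrow> 0"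
      using Wr_tendsto
    proof eventually_elim
      case (elim \<zeta>)
      then have "(\<lambda>n. \<bar>Wr n \<zeta> - Wl \<zeta>\<bar>) \<longlonglongrightarrow> \<bar>Wl \<zeta> - Wl \<zeta>\<bar>" by (intro tendsto_intros)
      from tendsto_ennrealI[OF this] show ?case by simp
    qed
    show "(\<integral>\<^sup>+\<zeta>. 2 * dominator \<zeta> \<partial>\<Omega>) < \<infinity>"
      using expect_dominator by (simp add: nn_integral_cmult ennreal_mult_less_top)
  qed auto
  then show ?thesis by (simp add: dist1_def[abs_def])
qed

lemma expect_Wl: "(\<integral>\<^sup>+\<zeta>. ennreal (Wl \<zeta>) \<partial>\<Omega>) = 1"
proof -
  have "(\<lambda>n. \<integral>\<^sup>+\<zeta>. ennreal (Wr n \<zeta>) \<partial>\<Omega>) \<longlonglongrightarrow> (\<integral>\<^sup>+\<zeta>. ennreal (Wl \<zeta>) \<partial>\<Omega>)"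
    using expect_dominator Wr_tendsto
    by (intro nn_integral_dominated_convergence[where w = dominator]) (auto intro: Wr_le_dominator tendsto_ennrealI elim: eventually_mono)
  moreover have "(\<integral>\<^sup>+\<zeta>. ennreal (Wr n \<zeta>) \<partial>\<Omega>) = 1" for n
    using AE_Wr[of n] by (subst nn_integral_cong_AE[of _ "WE n"]) (auto simp: expect_WE)
  ultimately show ?thesis by (auto dest: LIMSEQ_unique[OF tendsto_const])
qed

lemma expect_branch:
  assumes [measurable]: "g \<in> borel_measurable \<Omega>"
  shows "(\<integral>\<^sup>+\<zeta>. csum (gen n) (\<lambda>u. ennreal (Y u \<zeta>) * g (sub u \<zeta>)) \<partial>\<Omega>) = (\<integral>\<^sup>+\<zeta>. g \<zeta> \<partial>\<Omega>)"
proof -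
  have "(\<integral>\<^sup>+\<zeta>. csum (gen n) (\<lambda>u. ennreal (Y u \<zeta>) * g (sub u \<zeta>)) \<partial>\<Omega>) =
      csum (gen n) (\<lambda>u. \<integral>\<^sup>+\<zeta>. ennreal (Y u \<zeta>) * g (sub u \<zeta>) \<partial>\<Omega>)"
    by (rule csum_nn_integral) measurable
  also have "\<dots> = csum (gen n) (\<lambda>u. (\<integral>\<^sup>+\<zeta>. ennreal (Y u \<zeta>) \<partial>\<Omega>) * (\<integral>\<^sup>+\<zeta>. g \<zeta> \<partial>\<Omega>))"
  proof (intro csum_cong)
    fix u assume "u \<in> gen n"
    then have "(\<integral>\<^sup>+\<zeta>. ennreal (Y u \<zeta>) * g (sub u \<zeta>) \<partial>\<Omega>) = (\<integral>\<^sup>+\<zeta>. ennreal (Y u \<zeta>) \<partial>\<Omega>) * (\<integral>\<^sup>+\<zeta>. g (sub u \<zeta>) \<partial>\<Omega>)"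
      by (intro nn_integral_indep[of _ _ "before n"]) auto
    then show "(\<integral>\<^sup>+\<zeta>. ennreal (Y u \<zeta>) * g (sub u \<zeta>) \<partial>\<Omega>) = (\<integral>\<^sup>+\<zeta>. ennreal (Y u \<zeta>) \<partial>\<Omega>) * (\<integral>\<^sup>+\<zeta>. g \<zeta> \<partial>\<Omega>)"
      by (simp add: nn_integral_sub)
  qed
  also have "\<dots> = (\<integral>\<^sup>+\<zeta>. WE n \<zeta> \<partial>\<Omega>) * (\<integral>\<^sup>+\<zeta>. g \<zeta> \<partial>\<Omega>)"
    unfolding WE_def by (subst csum_nn_integral) (auto simp: nn_integral_multc)
  finally show ?thesis by (simp add: expect_WE)
qed

text \<open>Limit and infinite sum are not interchanged pointwise. Instead both sides are compared
  with the identity for \<open>W (n + k)\<close>: the mean error on the left is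
  \<open>dist1 (n + k)\<close>, on the right it is \<open>dist1 k\<close> because the weights of
  generation \<open>n\<close> have mean sum 1 and are independent of the subtrees.\<close>

lemma Wl_branch: "AE \<zeta> in \<Omega>. ennreal (Wl \<zeta>) = csum (gen n) (\<lambda>u. ennreal (Y u \<zeta>) * ennreal (Wl (sub u \<zeta>)))"
proof -
  define S where "S \<zeta> = csum (gen n) (\<lambda>u. ennreal (Y u \<zeta>) * ennreal (Wl (sub u \<zeta>)))" for \<zeta>
  have [measurable]: "S \<in> borel_measurable \<Omega>" unfolding S_def[abs_def] by measurable
  have ES: "(\<integral>\<^sup>+\<zeta>. S \<zeta> \<partial>\<Omega>) = 1" unfolding S_def by (subst expect_branch) (auto simp: expect_Wl)
  have S_fin: "AE \<zeta> in \<Omega>. S \<zeta> \<noteq> \<infinity>" using ES by (intro nn_integral_noteq_infinite) auto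
  have "(\<integral>\<^sup>+\<zeta>. ennreal \<bar>Wl \<zeta> - enn2real (S \<zeta>)\<bar> \<partial>\<Omega>) \<le> dist1 (n + k) + dist1 k" for k
  proof -
    have "(\<integral>\<^sup>+\<zeta>. ennreal \<bar>Wl \<zeta> - enn2real (S \<zeta>)\<bar> \<partial>\<Omega>) \<le>
        (\<integral>\<^sup>+\<zeta>. ennreal \<bar>Wr (n + k) \<zeta> - Wl \<zeta>\<bar> +
          csum (gen n) (\<lambda>u. ennreal (Y u \<zeta>) * ennreal \<bar>Wr k (sub u \<zeta>) - Wl (sub u \<zeta>)\<bar>) \<partial>\<Omega>)"
    proof (intro nn_integral_mono_AE)
      show "AE \<zeta> in \<Omega>. ennreal \<bar>Wl \<zeta> - enn2real (S \<zeta>)\<bar> \<le> ennreal \<bar>Wr (n + k) \<zeta> - Wl \<zeta>\<bar> +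
          csum (gen n) (\<lambda>u. ennreal (Y u \<zeta>) * ennreal \<bar>Wr k (sub u \<zeta>) - Wl (sub u \<zeta>)\<bar>)"
        using S_fin WE_finite[of "n + k"]
      proof eventually_elim
        case (elim \<zeta>)
        have "ennreal \<bar>Wr (n + k) \<zeta> - enn2real (S \<zeta>)\<bar> \<le>
          csum (gen n) (\<lambda>u. ennreal \<bar>enn2real (ennreal (Y u \<zeta>) * WE k (sub u \<zeta>)) - enn2real (ennreal (Y u \<zeta>) * ennreal (Wl (sub u \<zeta>)))\<bar>)"
          unfolding Wr_def WE_add S_def using elim
          by (intro enn2real_csum_abs_diff) (auto simp: WE_add S_def top.not_eq_extremum)
        also have "\<dots> = csum (gen n) (\<lambda>u. ennreal (Y u \<zeta>) * ennreal \<bar>Wr k (sub u \<zeta>) - Wl (sub u \<zeta>)\<bar>)"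
        proof (intro csum_cong)
          fix u
          have "\<bar>enn2real (ennreal (Y u \<zeta>) * WE k (sub u \<zeta>)) - enn2real (ennreal (Y u \<zeta>) * ennreal (Wl (sub u \<zeta>)))\<bar> =
              Y u \<zeta> * \<bar>Wr k (sub u \<zeta>) - Wl (sub u \<zeta>)\<bar>"
            by (simp add: enn2real_mult Wr_def right_diff_distrib[symmetric] abs_mult)
          then show "ennreal \<bar>enn2real (ennreal (Y u \<zeta>) * WE k (sub u \<zeta>)) - enn2real (ennreal (Y u \<zeta>) * ennreal (Wl (sub u \<zeta>)))\<bar> =
              ennreal (Y u \<zeta>) * ennreal \<bar>Wr k (sub u \<zeta>) - Wl (sub u \<zeta>)\<bar>"
            by (simp add: ennreal_mult)
        qed
        finally have 1: "ennreal \<bar>Wr (n + k) \<zeta> - enn2real (S \<zeta>)\<bar> \<le> \<dots>" .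
        have "ennreal \<bar>Wl \<zeta> - enn2real (S \<zeta>)\<bar> \<le> ennreal \<bar>Wr (n + k) \<zeta> - Wl \<zeta>\<bar> + ennreal \<bar>Wr (n + k) \<zeta> - enn2real (S \<zeta>)\<bar>"
          by (simp add: ennreal_plus[symmetric] ennreal_leI del: ennreal_plus)
        also note add_left_mono[OF 1]
        finally show ?case .
      qed
    qed
    also have "\<dots> = dist1 (n + k) + (\<integral>\<^sup>+\<zeta>. csum (gen n) (\<lambda>u. ennreal (Y u \<zeta>) * ennreal \<bar>Wr k (sub u \<zeta>) - Wl (sub u \<zeta>)\<bar>) \<partial>\<Omega>)"
      unfolding dist1_def by (rule nn_integral_add) measurable
    also have "(\<integral>\<^sup>+\<zeta>. csum (gen n) (\<lambda>u. ennreal (Y u \<zeta>) * ennreal \<bar>Wr k (sub u \<zeta>) - Wl (sub u \<zeta>)\<bar>) \<partial>\<Omega>) = dist1 k"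
      unfolding dist1_def by (rule expect_branch) measurable
    finally show ?thesis .
  qed
  moreover have "(\<lambda>k. dist1 (n + k) + dist1 k) \<longlonglongrightarrow> 0 + 0"
    using LIMSEQ_ignore_initial_segment[OF dist1_tendsto, of n]
    by (intro tendsto_add dist1_tendsto) (simp add: add.commute)
  ultimately have "(\<integral>\<^sup>+\<zeta>. ennreal \<bar>Wl \<zeta> - enn2real (S \<zeta>)\<bar> \<partial>\<Omega>) \<le> 0"
    by (intro LIMSEQ_le_const[of _ 0]) auto
  then have "AE \<zeta> in \<Omega>. ennreal \<bar>Wl \<zeta> - enn2real (S \<zeta>)\<bar> = 0"
    by (subst (asm) le_zero_eq, subst (asm) nn_integral_0_iff_AE) auto
  with S_fin show ?thesis unfolding S_def[symmetric]
  proof eventually_elim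
    case (elim \<zeta>)
    then have "Wl \<zeta> = enn2real (S \<zeta>)" by (simp add: ennreal_eq_0_iff)
    then show ?case using elim(1) by (simp add: top.not_eq_extremum)
  qed
qed

section \<open>Individuals whose weight is not too small\<close>

definition K\<mu> :: nat where "K\<mu> = Suc (nat \<lceil>4 * \<mu>\<rceil>)"

definition heavy :: "nat \<Rightarrow> (nat list \<Rightarrow> 'a) \<Rightarrow> ennreal" where
  "heavy n \<zeta> = csum (gen n) (\<lambda>u. if exp (- real (K\<mu> * n)) \<le> Y u \<zeta> then ennreal (Y u \<zeta>) else 0)"

lemma heavy_meas [measurable]: "heavy n \<in> borel_measurable \<Omega>" unfolding heavy_def[abs_def] by measurable

text \<open>Markov's inequality for \<open>- ln (Y u)\<close> under the weights \<open>Y u\<close>: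
  its mean is \<open>n * \<mu>\<close>, the level is \<open>K\<mu> * n\<close>, and
  \<open>K\<mu>\<close> is chosen positive and at least \<open>4 * \<mu>\<close>.\<close>

lemma expect_light:
  "(\<integral>\<^sup>+\<zeta>. csum (gen n) (\<lambda>u. if exp (- real (K\<mu> * n)) \<le> Y u \<zeta> then 0 else ennreal (Y u \<zeta>)) \<partial>\<Omega>) \<le> ennreal (1 / 4)"
proof (cases "n = 0")
  case True
  then show ?thesis by simp
next
  case False
  have K: "0 < real K\<mu>" "4 * \<mu> \<le> real K\<mu>" unfolding K\<mu>_def by linarith+
  have pos: "0 < real (K\<mu> * n)" using K False by simp
  have le: "(if exp (- real (K\<mu> * n)) \<le> y then 0 else ennreal y) \<le> ennreal (1 / real (K\<mu> * n)) * ennreal (y * - ln y)"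
    if "0 \<le> y" for y
  proof (cases "exp (- real (K\<mu> * n)) \<le> y \<or> y = 0")
    case False
    then have "0 < y" using that by simp
    then have "ln y < ln (exp (- real (K\<mu> * n)))"
      using False by (subst ln_less_cancel_iff) (auto simp: not_le)
    then have "ln y < - real (K\<mu> * n)" by simp
    then have "y * real (K\<mu> * n) \<le> y * - ln y" using \<open>0 < y\<close> by (intro mult_left_mono) auto
    then have "y \<le> 1 / real (K\<mu> * n) * (y * - ln y)" using pos by (simp add: field_simps)
    then have "ennreal y \<le> ennreal (1 / real (K\<mu> * n) * (y * - ln y))" by (rule ennreal_leI)
    also have "\<dots> = ennreal (1 / real (K\<mu> * n)) * ennreal (y * - ln y)"
      using pos by (intro ennreal_mult') simp
    finally show ?thesis using False by simp
  qed auto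
  have "(\<integral>\<^sup>+\<zeta>. csum (gen n) (\<lambda>u. if exp (- real (K\<mu> * n)) \<le> Y u \<zeta> then 0 else ennreal (Y u \<zeta>)) \<partial>\<Omega>) \<le>
      (\<integral>\<^sup>+\<zeta>. csum (gen n) (\<lambda>u. ennreal (1 / real (K\<mu> * n)) * ennreal (Y u \<zeta> * - ln (Y u \<zeta>))) \<partial>\<Omega>)"
    by (intro nn_integral_mono csum_mono le) simp
  also have "\<dots> = ennreal (1 / real (K\<mu> * n)) * ennreal (real n * \<mu>)"
  proof -
    have "(\<integral>\<^sup>+\<zeta>. csum (gen n) (\<lambda>u. ennreal (1 / real (K\<mu> * n)) * ennreal (Y u \<zeta> * - ln (Y u \<zeta>))) \<partial>\<Omega>) =
        (\<integral>\<^sup>+\<zeta>. ennreal (1 / real (K\<mu> * n)) * csum (gen n) (\<lambda>u. ennreal (Y u \<zeta> * - ln (Y u \<zeta>))) \<partial>\<Omega>)"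
      by (intro nn_integral_cong nn_integral_cmult) simp
    also have "\<dots> = ennreal (1 / real (K\<mu> * n)) * (\<integral>\<^sup>+\<zeta>. csum (gen n) (\<lambda>u. ennreal (Y u \<zeta> * - ln (Y u \<zeta>))) \<partial>\<Omega>)"
      by (rule nn_integral_cmult) measurable
    finally show ?thesis unfolding expect_Y_ln .
  qed
  also have "\<dots> = ennreal (\<mu> / real K\<mu>)"
    using False by (subst ennreal_mult'[symmetric]) auto
  also have "\<dots> \<le> ennreal (1 / 4)" using K by (intro ennreal_leI) (simp add: field_simps)
  finally show ?thesis .
qed

text \<open>Generation \<open>n\<close> has mean mass 1. At most 1/4 sits in light individuals, and
  at most 1/4 lies outside \<open>E\<close>, where the mass is bounded by \<open>dominator\<close>;
  this is why the event is measured by that integral.\<close>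

lemma heavy_event:
  assumes [measurable]: "Measurable.pred \<Omega> E"
    and E: "(\<integral>\<^sup>+\<zeta>. (if E \<zeta> then 0 else dominator \<zeta>) \<partial>\<Omega>) \<le> ennreal (1 / 4)"
  shows "ennreal (1 / 2) \<le> (\<integral>\<^sup>+\<zeta>. (if E \<zeta> then heavy n \<zeta> else 0) \<partial>\<Omega>)"
proof -
  let ?I = "\<integral>\<^sup>+\<zeta>. (if E \<zeta> then heavy n \<zeta> else 0) \<partial>\<Omega>"
  let ?light = "\<lambda>\<zeta>. csum (gen n) (\<lambda>u. if exp (- real (K\<mu> * n)) \<le> Y u \<zeta> then 0 else ennreal (Y u \<zeta>))"
  have split: "WE n \<zeta> = heavy n \<zeta> + ?light \<zeta>" for \<zeta>
    unfolding WE_def heavy_def by (subst nn_integral_add[symmetric]) (auto intro!: csum_cong)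
  have "1 = (\<integral>\<^sup>+\<zeta>. WE n \<zeta> \<partial>\<Omega>)" by (simp add: expect_WE)
  also have "\<dots> \<le> (\<integral>\<^sup>+\<zeta>. (if E \<zeta> then heavy n \<zeta> else 0) + (if E \<zeta> then 0 else dominator \<zeta>) + ?light \<zeta> \<partial>\<Omega>)"
  proof (intro nn_integral_mono_AE)
    show "AE \<zeta> in \<Omega>. WE n \<zeta> \<le> (if E \<zeta> then heavy n \<zeta> else 0) + (if E \<zeta> then 0 else dominator \<zeta>) + ?light \<zeta>"
      using AE_Wr[of n]
    proof eventually_elim
      case (elim \<zeta>)
      show ?case
      proof (cases "E \<zeta>")
        case True then show ?thesis by (simp add: split)
      next
        case False
        have "WE n \<zeta> \<le> dominator \<zeta>" unfolding elim[symmetric] by (rule Wr_le_dominator)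
        with False show ?thesis by (simp add: add_increasing2)
      qed
    qed
  qed
  also have "\<dots> = ?I + (\<integral>\<^sup>+\<zeta>. (if E \<zeta> then 0 else dominator \<zeta>) \<partial>\<Omega>) + (\<integral>\<^sup>+\<zeta>. ?light \<zeta> \<partial>\<Omega>)"
    by (subst nn_integral_add, measurable, subst nn_integral_add, measurable)
  also have "\<dots> \<le> ?I + ennreal (1 / 4) + ennreal (1 / 4)"
    by (intro add_mono E expect_light order_refl)
  also have "\<dots> = ?I + ennreal (1 / 2)" by (simp add: add.assoc ennreal_plus[symmetric] del: ennreal_plus)
  finally have le: "ennreal 1 \<le> ?I + ennreal (1 / 2)" by simp
  show ?thesis
  proof (cases ?I)
    case (real i)
    have eq: "ennreal i + ennreal (1 / 2) = ennreal (i + 1 / 2)"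
      using real(1) by (intro ennreal_plus[symmetric]) auto
    have "ennreal 1 \<le> ennreal (i + 1 / 2)" using le unfolding real(2) eq .
    then have "1 \<le> i + 1 / 2" using real(1) by (subst (asm) ennreal_le_iff) auto
    then show ?thesis unfolding real(2) by (intro ennreal_leI) simp
  qed simp
qed

theorem finite_moment_X_imp_summable:
  assumes a: "\<And>n. 0 \<le> a n" and A: "doubling D (\<lambda>k. \<Sum>n\<le>k. a n)" and finite_moment_X: "finite_moment_X (\<lambda>k. \<Sum>n\<le>k. a n)"
  shows "AE \<zeta> in \<Omega>. summable (\<lambda>n. a n * (Wl \<zeta> - Wr n \<zeta>))"
proof -
  let ?A = "\<lambda>k. \<Sum>n\<le>k. a n"
  have A0: "0 \<le> ?A k" for k using a by (simp add: sum_nonneg)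
  have "(\<integral>\<^sup>+\<zeta>. (\<Sum>k. ennreal (?A k * \<bar>Wr (Suc k) \<zeta> - Wr k \<zeta>\<bar>)) \<partial>\<Omega>) = (\<Sum>k. ennreal (?A k) * mean_step k)"
    unfolding mean_step_def using A0 by (simp add: nn_integral_suminf nn_integral_cmult ennreal_mult)
  also have "\<dots> < \<infinity>" by (rule finite_moment_X_mean_step[OF A finite_moment_X])
  finally have "AE \<zeta> in \<Omega>. (\<Sum>k. ennreal (?A k * \<bar>Wr (Suc k) \<zeta> - Wr k \<zeta>\<bar>)) \<noteq> \<infinity>"
    by (intro nn_integral_noteq_infinite) auto
  with Wr_tendsto show ?thesis
    by eventually_elim (rule summable_tail_weights[OF a], auto simp: top.not_eq_extremum)
qed

end

subsection \<open>Moments of the limit and of one generation\<close>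

text \<open>Cauchy-Schwarz with weights \<open>r ^ n\<close>. Geometrically decaying second moments
  of the single terms then bound the second moment of the whole sum, uniformly in
  \<open>N\<close>.\<close>

lemma sum_square_weighted:
  fixes z :: "nat \<Rightarrow> real"
  assumes r: "0 < r" "r < 1"
  shows "(\<Sum>n<N. z n)\<^sup>2 \<le> 1 / (1 - r) * (\<Sum>n<N. (z n)\<^sup>2 / r ^ n)"
proof -
  have "(\<Sum>n<N. z n) = (\<Sum>n<N. sqrt (r ^ n) * (z n / sqrt (r ^ n)))"
    using r by (intro sum.cong) auto
  then have "(\<Sum>n<N. z n)\<^sup>2 \<le> (\<Sum>n<N. (sqrt (r ^ n))\<^sup>2) * (\<Sum>n<N. (z n / sqrt (r ^ n))\<^sup>2)"
    using Cauchy_Schwarz_ineq_sum[of "\<lambda>n. sqrt (r ^ n)" "\<lambda>n. z n / sqrt (r ^ n)" "{..<N}"] by simp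
  also have "\<dots> = (\<Sum>n<N. r ^ n) * (\<Sum>n<N. (z n)\<^sup>2 / r ^ n)"
    using r by (simp add: power_divide)
  also have "\<dots> \<le> 1 / (1 - r) * (\<Sum>n<N. (z n)\<^sup>2 / r ^ n)"
  proof (intro mult_right_mono sum_nonneg)
    have "(\<Sum>n<N. r ^ n) \<le> (\<Sum>n. r ^ n)" using r by (intro sum_le_suminf summable_geometric) auto
    then show "(\<Sum>n<N. r ^ n) \<le> 1 / (1 - r)" using r by (simp add: suminf_geometric)
  qed (use r in auto)
  finally show ?thesis .
qed

lemma doubling_add_2:
  assumes A: "doubling D A"
  shows "A (n + 2) \<le> D\<^sup>2 * A n"
proof (cases "n = 0")
  case True
  have "A 2 \<le> D * A 1" using doubling_2[OF A, of 1] by simp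
  also have "\<dots> \<le> D * D" using A doubling_const[OF A] by (intro mult_left_mono) (auto simp: doubling_def)
  also have "\<dots> \<le> D\<^sup>2 * A 0"
    using mult_left_mono[OF doubling_ge_1[OF A, of 0], of "D\<^sup>2"] by (simp add: power2_eq_square)
  finally show ?thesis using True by (simp add: numeral_2_eq_2)
next
  case False
  have "A (n + 2) \<le> D\<^sup>2 * A ((n + 2) div 2)" by (rule doubling_div_2[OF A])
  also have "\<dots> \<le> D\<^sup>2 * A n" using False by (intro mult_left_mono doubling_mono[OF A]) auto
  finally show ?thesis .
qed

section \<open>Upper tails of the martingale and of its limit\<close>

context weighted_branching_xlogx
begin

text \<open>The bound of \<open>tail_sum\<close> for constant weights: the number of generations in
  the first regime plus the geometric series.\<close>

definition tail_bound :: "real \<Rightarrow> real" where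
  "tail_bound x = L\<rho> * log_plus x + 1 + 1 / (1 - \<rho>)"

lemma expect_big_parts:
  assumes t: "1 \<le> t"
  shows "(\<integral>\<^sup>+\<zeta>. (\<Sum>n. part (big t) n \<zeta>) \<partial>\<Omega>) \<le>
    (\<integral>\<^sup>+s. (if t < (X s)\<^sup>2 then ennreal (X s * tail_bound (X s)) else 0) \<partial>\<nu>)"
proof -
  have [measurable]: "part (big t) n \<in> borel_measurable \<Omega>" for n by (rule part_meas[OF big_meas])
  have [measurable]: "tail_mean (big t) k \<in> borel_measurable borel" for k by (rule tail_mean_meas[OF big_meas])
  have "(\<integral>\<^sup>+\<zeta>. (\<Sum>n. part (big t) n \<zeta>) \<partial>\<Omega>) = (\<Sum>n. \<integral>\<^sup>+s. ennreal (X s) * tail_mean (big t) n (X s) \<partial>\<nu>)"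
    by (subst nn_integral_suminf) (auto simp: expect_part[OF big_meas] expect_comp[OF big_meas])
  also have "\<dots> = (\<integral>\<^sup>+s. (\<Sum>n. ennreal (X s) * tail_mean (big t) n (X s)) \<partial>\<nu>)"
    by (subst nn_integral_suminf) auto
  also have "\<dots> \<le> (\<integral>\<^sup>+s. (if t < (X s)\<^sup>2 then ennreal (X s * tail_bound (X s)) else 0) \<partial>\<nu>)"
  proof (intro nn_integral_mono)
    fix s
    have 1: "(\<Sum>n. ennreal (X s) * tail_mean (big t) n (X s)) = ennreal (X s) * (\<Sum>n. ennreal 1 * tail_mean (big t) n (X s))"
      by simp
    have 2: "(\<Sum>n. ennreal 1 * tail_mean (big t) n (X s)) \<le>
        (if t < (X s)\<^sup>2 then ennreal (cumul (\<lambda>_. 1) (L\<rho> * log_plus (X s)) + (\<Sum>k. 1 * \<rho> ^ k)) else 0)"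
      by (rule tail_sum[OF doubling_1 t X_nonneg])
    have "cumul (\<lambda>_. 1) (L\<rho> * log_plus (X s)) + (\<Sum>k. 1 * \<rho> ^ k) \<le> tail_bound (X s)"
      using L_rho_pos rho by (simp add: cumul_def tail_bound_def suminf_geometric)
    then have "(\<Sum>n. ennreal 1 * tail_mean (big t) n (X s)) \<le> (if t < (X s)\<^sup>2 then ennreal (tail_bound (X s)) else 0)"
      by (cases "t < (X s)\<^sup>2") (use 2 in \<open>auto intro: order.trans[OF _ ennreal_leI]\<close>)
    then show "(\<Sum>n. ennreal (X s) * tail_mean (big t) n (X s)) \<le> (if t < (X s)\<^sup>2 then ennreal (X s * tail_bound (X s)) else 0)"
      unfolding 1 by (auto simp: ennreal_mult' intro: mult_left_mono split: if_splits)
  qed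
  finally show ?thesis .
qed

lemma expect_small_sum:
  assumes t: "1 \<le> t"
  shows "(\<integral>\<^sup>+\<zeta>. ennreal ((\<Sum>n<N. centred (small t) n \<zeta>)\<^sup>2) \<partial>\<Omega>) \<le> ennreal (sqrt t / (1 - \<rho>)\<^sup>2)"
proof -
  have ms: "Measurable.pred (borel \<Otimes>\<^sub>M borel) (\<lambda>p. small t (fst p) (snd p))" by measurable
  have [measurable]: "centred (small t) k \<in> borel_measurable \<Omega>" for k by (rule centred_meas[OF ms])
  have c: "0 \<le> 1 / (1 - \<rho>)" using rho by simp
  have "(\<integral>\<^sup>+\<zeta>. ennreal ((\<Sum>n<N. centred (small t) n \<zeta>)\<^sup>2) \<partial>\<Omega>) \<le>
      (\<integral>\<^sup>+\<zeta>. ennreal (1 / (1 - \<rho>)) * (\<Sum>n<N. ennreal ((centred (small t) n \<zeta>)\<^sup>2) * ennreal (1 / \<rho> ^ n)) \<partial>\<Omega>)"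
  proof (intro nn_integral_mono)
    fix \<zeta>
    have "(\<Sum>n<N. ennreal ((centred (small t) n \<zeta>)\<^sup>2) * ennreal (1 / \<rho> ^ n)) = ennreal (\<Sum>n<N. (centred (small t) n \<zeta>)\<^sup>2 / \<rho> ^ n)"
      using rho by (subst sum_ennreal[symmetric]) (auto simp: ennreal_mult[symmetric])
    then show "ennreal ((\<Sum>n<N. centred (small t) n \<zeta>)\<^sup>2) \<le>
        ennreal (1 / (1 - \<rho>)) * (\<Sum>n<N. ennreal ((centred (small t) n \<zeta>)\<^sup>2) * ennreal (1 / \<rho> ^ n))"
      using sum_square_weighted[OF rho(1,2), of "\<lambda>n. centred (small t) n \<zeta>" N] c
      by (simp only: ennreal_mult'[symmetric] ennreal_leI)
  qed
  also have "\<dots> = ennreal (1 / (1 - \<rho>)) * (\<Sum>n<N. (\<integral>\<^sup>+\<zeta>. ennreal ((centred (small t) n \<zeta>)\<^sup>2) \<partial>\<Omega>) * ennreal (1 / \<rho> ^ n))"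
    by (simp add: nn_integral_cmult nn_integral_sum nn_integral_multc)
  also have "\<dots> \<le> ennreal (1 / (1 - \<rho>)) * (\<Sum>n<N. ennreal (sqrt t * (\<rho> ^ n * \<rho> ^ n)) * ennreal (1 / \<rho> ^ n))"
    using t by (intro mult_left_mono sum_mono mult_right_mono expect_centred_small) auto
  also have "(\<Sum>n<N. ennreal (sqrt t * (\<rho> ^ n * \<rho> ^ n)) * ennreal (1 / \<rho> ^ n)) = (\<Sum>n<N. ennreal (sqrt t * \<rho> ^ n))"
    using rho t by (intro sum.cong) (auto simp: ennreal_mult[symmetric])
  also have "\<dots> = ennreal (sqrt t * (\<Sum>n<N. \<rho> ^ n))"
    using rho t by (subst sum_ennreal) (auto simp: sum_distrib_left)
  also have "\<dots> \<le> ennreal (sqrt t * (1 / (1 - \<rho>)))"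
  proof (intro ennreal_leI mult_left_mono)
    have "(\<Sum>n<N. \<rho> ^ n) \<le> (\<Sum>n. \<rho> ^ n)" using rho by (intro sum_le_suminf summable_geometric) auto
    then show "(\<Sum>n<N. \<rho> ^ n) \<le> 1 / (1 - \<rho>)" using rho by (simp add: suminf_geometric)
  qed (use t in auto)
  also have "ennreal (1 / (1 - \<rho>)) * \<dots> = ennreal (sqrt t / (1 - \<rho>)\<^sup>2)"
    using c t rho by (subst ennreal_mult[symmetric]) (auto simp: power2_eq_square field_simps)
  finally show ?thesis by (simp add: mult_left_mono)
qed

text \<open>\<open>W N\<close> is at most 1 plus the centred small parts \<open>z\<close> plus the
  uncentred big parts, as the compensators of the latter are only subtracted. The big parts
  contribute in mean through labels of mass above \<open>sqrt t\<close>. The second moment of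
  \<open>z\<close> is of order \<open>sqrt t\<close>, and division by \<open>t\<close> leaves a term
  that decays along \<open>t = exp m\<close>.\<close>

lemma Wr_tail:
  assumes t: "1 \<le> t"
  shows "(\<integral>\<^sup>+\<zeta>. (if 4 * t < Wr N \<zeta> then ennreal (Wr N \<zeta>) else 0) \<partial>\<Omega>) \<le>
    2 * (\<integral>\<^sup>+s. (if t < (X s)\<^sup>2 then ennreal (X s * tail_bound (X s)) else 0) \<partial>\<nu>) +
    ennreal (4 / (1 - \<rho>)\<^sup>2 / sqrt t)"
proof -
  have ms: "Measurable.pred (borel \<Otimes>\<^sub>M borel) (\<lambda>p. small t (fst p) (snd p))" by measurable
  have [measurable]: "centred (small t) k \<in> borel_measurable \<Omega>" for k by (rule centred_meas[OF ms])
  have [measurable]: "part (big t) n \<in> borel_measurable \<Omega>" for n by (rule part_meas[OF big_meas])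
  define z where "z \<zeta> = (\<Sum>n<N. centred (small t) n \<zeta>)" for \<zeta>
  have [measurable]: "z \<in> borel_measurable \<Omega>" unfolding z_def[abs_def] by measurable
  have "AE \<zeta> in \<Omega>. \<forall>n. Wr (Suc n) \<zeta> - Wr n \<zeta> = centred (small t) n \<zeta> + centred (big t) n \<zeta>"
    using Wr_diff[OF big_meas] by (simp add: AE_all_countable)
  moreover have "AE \<zeta> in \<Omega>. \<forall>n. WE n \<zeta> < \<infinity>" using WE_finite by (simp add: AE_all_countable)
  ultimately have AE: "AE \<zeta> in \<Omega>. (if 4 * t < Wr N \<zeta> then ennreal (Wr N \<zeta>) else 0) \<le>
      2 * (\<Sum>n. part (big t) n \<zeta>) + ennreal (4 / t) * ennreal ((z \<zeta>)\<^sup>2)"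
  proof eventually_elim
    case (elim \<zeta>)
    define j where "j = (\<Sum>n<N. enn2real (part (big t) n \<zeta>))"
    have j0: "0 \<le> j" unfolding j_def by (intro sum_nonneg) auto
    have pf: "part (big t) n \<zeta> < \<infinity>" for n
      using part_le[OF big_meas, of t n \<zeta>] elim(2) by (auto intro: le_less_trans)
    have "ennreal j = (\<Sum>n<N. part (big t) n \<zeta>)"
      unfolding j_def using pf by (subst sum_ennreal[symmetric]) auto
    also have "\<dots> \<le> (\<Sum>n. part (big t) n \<zeta>)" by (intro sum_le_suminf) auto
    finally have jle: "ennreal j \<le> (\<Sum>n. part (big t) n \<zeta>)" .
    have "Wr N \<zeta> = 1 + (\<Sum>n<N. Wr (Suc n) \<zeta> - Wr n \<zeta>)"
      using sum_lessThan_telescope[of "\<lambda>k. Wr k \<zeta>" N] by simp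
    also have "\<dots> = 1 + z \<zeta> + (\<Sum>n<N. centred (big t) n \<zeta>)"
      using elim(1) by (simp add: z_def sum.distrib)
    also have "(\<Sum>n<N. centred (big t) n \<zeta>) \<le> j"
      unfolding j_def centred_def by (intro sum_mono) simp
    finally have W: "Wr N \<zeta> \<le> 1 + z \<zeta> + j" by simp
    \<comment> \<open>Unless the big parts make up half of \<open>W N\<close>, the bound
      \<open>W N \<le> 1 + z + j\<close> together with \<open>1 < W N / 4\<close> gives
      \<open>W N \<le> 4 * z\<close>. Then \<open>z \<ge> t\<close>, and \<open>z\<close> may be
      replaced by the square of \<open>z\<close> over \<open>t\<close>.\<close>
    have "Wr N \<zeta> \<le> 2 * j + 4 / t * (z \<zeta>)\<^sup>2" if "4 * t < Wr N \<zeta>"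
    proof (cases "Wr N \<zeta> \<le> 2 * j")
      case True then show ?thesis using t by (simp add: add_increasing2)
    next
      case False
      then have "Wr N \<zeta> \<le> 4 * z \<zeta>" using W that t by simp
      moreover have zt: "t \<le> z \<zeta>" using calculation that by simp
      have "z \<zeta> * t \<le> z \<zeta> * z \<zeta>" using zt t by (intro mult_left_mono) auto
      then have "4 * z \<zeta> \<le> 4 / t * (z \<zeta>)\<^sup>2" using t by (simp add: field_simps power2_eq_square)
      ultimately show ?thesis using j0 by simp
    qed
    then have "(if 4 * t < Wr N \<zeta> then ennreal (Wr N \<zeta>) else 0) \<le> ennreal (2 * j + 4 / t * (z \<zeta>)\<^sup>2)"
      by (auto intro: ennreal_leI)
    also have "\<dots> = 2 * ennreal j + ennreal (4 / t) * ennreal ((z \<zeta>)\<^sup>2)"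
    proof -
      have "ennreal (2 * j) = 2 * ennreal j" using j0 by (simp add: ennreal_mult)
      moreover have "ennreal (4 / t * (z \<zeta>)\<^sup>2) = ennreal (4 / t) * ennreal ((z \<zeta>)\<^sup>2)"
        using t by (intro ennreal_mult) auto
      moreover have "ennreal (2 * j + 4 / t * (z \<zeta>)\<^sup>2) = ennreal (2 * j) + ennreal (4 / t * (z \<zeta>)\<^sup>2)"
        using j0 t by (intro ennreal_plus) auto
      ultimately show ?thesis by metis
    qed
    also have "\<dots> \<le> 2 * (\<Sum>n. part (big t) n \<zeta>) + ennreal (4 / t) * ennreal ((z \<zeta>)\<^sup>2)"
      by (intro add_right_mono mult_left_mono jle) simp
    finally show ?case .
  qed
  have "(\<integral>\<^sup>+\<zeta>. (if 4 * t < Wr N \<zeta> then ennreal (Wr N \<zeta>) else 0) \<partial>\<Omega>) \<le>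
      (\<integral>\<^sup>+\<zeta>. 2 * (\<Sum>n. part (big t) n \<zeta>) + ennreal (4 / t) * ennreal ((z \<zeta>)\<^sup>2) \<partial>\<Omega>)"
    by (rule nn_integral_mono_AE[OF AE])
  also have "\<dots> = 2 * (\<integral>\<^sup>+\<zeta>. (\<Sum>n. part (big t) n \<zeta>) \<partial>\<Omega>) + ennreal (4 / t) * (\<integral>\<^sup>+\<zeta>. ennreal ((z \<zeta>)\<^sup>2) \<partial>\<Omega>)"
    by (simp add: nn_integral_add nn_integral_cmult)
  also have "\<dots> \<le> 2 * (\<integral>\<^sup>+s. (if t < (X s)\<^sup>2 then ennreal (X s * tail_bound (X s)) else 0) \<partial>\<nu>) +
      ennreal (4 / t) * ennreal (sqrt t / (1 - \<rho>)\<^sup>2)"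
    unfolding z_def by (intro add_mono mult_left_mono expect_big_parts expect_small_sum t) auto
  also have "ennreal (4 / t) * ennreal (sqrt t / (1 - \<rho>)\<^sup>2) = ennreal (4 / (1 - \<rho>)\<^sup>2 / sqrt t)"
  proof -
    have "4 / t * (sqrt t / (1 - \<rho>)\<^sup>2) = 4 / (1 - \<rho>)\<^sup>2 * (sqrt t / t)" by simp
    also have "sqrt t / t = 1 / sqrt t" using t by (simp add: field_simps)
    finally show ?thesis using t by (simp add: ennreal_mult'[symmetric])
  qed
  finally show ?thesis .
qed

text \<open>Fatou. The level is exceeded strictly, which is an open condition: where the limit
  exceeds it, \<open>W N\<close> eventually does too.\<close>

lemma Wl_tail:
  assumes t: "1 \<le> t"
  shows "(\<integral>\<^sup>+\<zeta>. (if 4 * t < Wl \<zeta> then ennreal (Wl \<zeta>) else 0) \<partial>\<Omega>) \<le>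
    2 * (\<integral>\<^sup>+s. (if t < (X s)\<^sup>2 then ennreal (X s * tail_bound (X s)) else 0) \<partial>\<nu>) +
    ennreal (4 / (1 - \<rho>)\<^sup>2 / sqrt t)" (is "_ \<le> ?R")
proof -
  have "(\<integral>\<^sup>+\<zeta>. (if 4 * t < Wl \<zeta> then ennreal (Wl \<zeta>) else 0) \<partial>\<Omega>) \<le>
      (\<integral>\<^sup>+\<zeta>. liminf (\<lambda>N. if 4 * t < Wr N \<zeta> then ennreal (Wr N \<zeta>) else 0) \<partial>\<Omega>)"
  proof (intro nn_integral_mono_AE)
    show "AE \<zeta> in \<Omega>. (if 4 * t < Wl \<zeta> then ennreal (Wl \<zeta>) else 0) \<le>
        liminf (\<lambda>N. if 4 * t < Wr N \<zeta> then ennreal (Wr N \<zeta>) else 0)"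
      using Wr_tendsto
    proof eventually_elim
      case (elim \<zeta>)
      show ?case
      proof (cases "4 * t < Wl \<zeta>")
        case True
        with elim have "eventually (\<lambda>N. 4 * t < Wr N \<zeta>) sequentially" by (rule order_tendstoD)
        then have "(\<lambda>N. if 4 * t < Wr N \<zeta> then ennreal (Wr N \<zeta>) else 0) \<longlonglongrightarrow> ennreal (Wl \<zeta>)"
          by (intro Lim_transform_eventually[OF tendsto_ennrealI[OF elim]]) (auto elim: eventually_mono)
        then show ?thesis using True by (simp add: lim_imp_Liminf)
      qed simp
    qed
  qed
  also have "\<dots> \<le> liminf (\<lambda>N. \<integral>\<^sup>+\<zeta>. (if 4 * t < Wr N \<zeta> then ennreal (Wr N \<zeta>) else 0) \<partial>\<Omega>)"
    by (rule nn_integral_liminf) measurable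
  also have "\<dots> \<le> liminf (\<lambda>N. ?R)" by (intro Liminf_mono always_eventually allI Wr_tail t)
  also have "\<dots> = ?R" by (simp add: Liminf_const)
  finally show ?thesis .
qed

definition finite_moment_W :: "(nat \<Rightarrow> real) \<Rightarrow> bool" where
  "finite_moment_W A \<longleftrightarrow> (\<integral>\<^sup>+\<zeta>. ennreal (Wl \<zeta> * A (nat \<lfloor>log_plus (Wl \<zeta>)\<rfloor>)) \<partial>\<Omega>) < \<infinity>"

lemma partial_sum_shift_le:
  fixes a :: "nat \<Rightarrow> real"
  assumes a: "\<And>n. 0 \<le> a n"
  shows "(\<Sum>m. if m \<le> n then ennreal (a (m + 2)) else 0) \<le> ennreal (\<Sum>k\<le>n + 2. a k)"
proof -
  have "(\<Sum>m. if m \<le> n then ennreal (a (m + 2)) else 0) = (\<Sum>m\<le>n. if m \<le> n then ennreal (a (m + 2)) else 0)"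
    by (rule suminf_finite) auto
  also have "\<dots> = ennreal (\<Sum>m\<le>n. a (m + 2))" using a by simp
  also have "(\<Sum>m\<le>n. a (m + 2)) = (\<Sum>k\<in>(\<lambda>m. m + 2) ` {..n}. a k)" by (subst sum.reindex) (auto simp: inj_on_def)
  also have "ennreal \<dots> \<le> ennreal (\<Sum>k\<le>n + 2. a k)" using a by (intro ennreal_leI sum_mono2) auto
  finally show ?thesis .
qed

text \<open>The factor \<open>A (log+ W)\<close> is unfolded into its increments \<open>a\<close>,
  each attached to one level of \<open>W\<close>; at every level the tail of \<open>W\<close> is
  replaced by that of one generation, and the sum over the levels is reassembled for
  \<open>X\<close>.\<close>

theorem finite_moment_X_imp_finite_moment_W:
  assumes a: "\<And>n. 0 \<le> a n" and A: "doubling D (\<lambda>k. \<Sum>n\<le>k. a n)" and finite_moment_X: "finite_moment_X (\<lambda>k. \<Sum>n\<le>k. a n)"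
  shows "finite_moment_W (\<lambda>k. \<Sum>n\<le>k. a n)"
proof -
  define A where "A k = (\<Sum>n\<le>k. a n)" for k
  have dA: "doubling D A" using A by (simp add: A_def[abs_def])
  have A0: "0 \<le> A k" for k by (rule doubling_nonneg[OF dA])
  have aA: "a n \<le> A n" for n unfolding A_def using a by (intro member_le_sum) auto
  have D1: "1 \<le> D" by (rule doubling_const[OF dA])
  let ?c = "4 / (1 - \<rho>)\<^sup>2"
  let ?e = "\<lambda>m. exp (real m)"
  \<comment> \<open>The levels are \<open>4 * exp m\<close> because the tail estimate is stated at
    \<open>4 * t\<close>. Since 4 is below \<open>exp 2\<close>, a shift of the index by 2 pays for
    the factor, and \<open>A 1\<close> takes care of the first two indices.\<close>
  have pt: "ennreal (w * A (nat \<lfloor>log_plus w\<rfloor>)) \<le>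
      ennreal (A 1) * ennreal w + (\<Sum>m. ennreal (a (m + 2)) * (if 4 * ?e m < w then ennreal w else 0))" (is "_ \<le> ?R")
    if w: "0 \<le> w" for w
  proof -
    let ?n = "nat \<lfloor>log_plus w\<rfloor>"
    show ?thesis
    proof (cases "?n \<le> 1")
      case True
      then have "w * A ?n \<le> A 1 * w" using mult_left_mono[OF doubling_mono[OF dA True] w] by (simp add: mult.commute)
      then have "ennreal (w * A ?n) \<le> ennreal (A 1) * ennreal w" using w A0 by (simp add: ennreal_mult[symmetric] ennreal_leI)
      then show ?thesis by (simp add: add_increasing2)
    next
      case False
      then have lw: "real ?n \<le> log_plus w" "2 \<le> ?n" by (auto simp: log_plus_def intro: of_nat_floor)
      then have w1: "log_plus w = ln w" "0 < w" by (auto simp: log_plus_def max_def split: if_splits)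
      have "exp 1 \<ge> (2 :: real)" using exp_ge_add_one_self[of 1] by simp
      moreover have "(2::real) < exp 1" 
        using exp_gt_one[of 1] exp_ge_add_one_self[of "1/2"] mult_mono[of "3/2" "exp (1/2::real)" "3/2" "exp (1/2::real)"]
        by (simp add: exp_add[symmetric])
      ultimately have e2: "4 < exp (2::real)"
        using mult_strict_mono[of 2 "exp 1 :: real" 2 "exp 1"] by (simp add: exp_add[symmetric])
      have big: "4 * ?e m < w" if "m + 2 \<le> ?n" for m
      proof -
        have "4 * ?e m < exp 2 * ?e m" using e2 by simp
        also have "\<dots> = exp (real (m + 2))" by (simp add: exp_add[symmetric] add.commute)
        also have "\<dots> \<le> exp (ln w)"
        proof (subst exp_le_cancel_iff)
          have "real (m + 2) \<le> real ?n" using that by (rule of_nat_mono)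
          also have "\<dots> \<le> ln w" using lw w1 by simp
          finally show "real (m + 2) \<le> ln w" .
        qed
        finally show ?thesis using w1 by simp
      qed
      have split: "A ?n = A 1 + (\<Sum>m<?n - 1. a (m + 2))"
      proof -
        have "A (k + 1) = A 1 + (\<Sum>m<k. a (m + 2))" for k
          by (induction k) (auto simp: A_def)
        from this[of "?n - 1"] lw show ?thesis by simp
      qed
      have "ennreal (w * A ?n) = ennreal (A 1) * ennreal w + ennreal (\<Sum>m<?n - 1. a (m + 2) * w)"
        unfolding split using w A0 a
        by (simp add: ennreal_plus[symmetric] ennreal_mult[symmetric] sum_nonneg distrib_left sum_distrib_right sum_distrib_left mult.commute del: ennreal_plus)
      also have "ennreal (\<Sum>m<?n - 1. a (m + 2) * w) = (\<Sum>m<?n - 1. ennreal (a (m + 2)) * (if 4 * ?e m < w then ennreal w else 0))"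
        using w a big by (subst sum_ennreal[symmetric]) (auto intro!: sum.cong simp: ennreal_mult)
      also have "\<dots> \<le> (\<Sum>m. ennreal (a (m + 2)) * (if 4 * ?e m < w then ennreal w else 0))"
        by (rule sum_le_suminf) auto
      finally show ?thesis by (simp add: add_left_mono)
    qed
  qed
  obtain Kc where Kc: "1 \<le> Kc" "\<And>x. 0 \<le> x \<Longrightarrow> tail_bound x \<le> Kc * (2 * log_plus x + 1)"
  proof -
    let ?K = "max 1 (max L\<rho> (1 + 1 / (1 - \<rho>)))"
    have "tail_bound x \<le> ?K * (2 * log_plus x + 1)" for x
    proof -
      have "L\<rho> * log_plus x \<le> ?K * (2 * log_plus x)"
        using L_rho_pos by (intro mult_mono) auto
      moreover have "1 + 1 / (1 - \<rho>) \<le> ?K" by simp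
      ultimately show ?thesis unfolding tail_bound_def by (simp add: distrib_left)
    qed
    then show ?thesis using that[of ?K] by simp
  qed
  \<comment> \<open>Only levels with \<open>m < 2 * ln x\<close> are active. Their increments add up
    to at most \<open>A (n + 2)\<close>, with \<open>n\<close> the integer part of
    \<open>2 * log_plus x\<close>, and \<open>tail_bound\<close> supplies the factor
    \<open>2 * log_plus x + 1\<close> that turns \<open>A\<close> into \<open>cumul\<close>.\<close>
  have sumX: "(\<Sum>m. ennreal (a (m + 2)) * (if ?e m < x\<^sup>2 then ennreal (x * tail_bound x) else 0)) \<le>
      ennreal (Kc * D\<^sup>2 * (2 * D\<^sup>2 + 2)) * ennreal (x * cumul A (2 * log_plus x))" if x: "0 \<le> x" for x
  proof -
    let ?n = "nat \<lfloor>2 * log_plus x\<rfloor>"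
    have tb: "0 \<le> tail_bound x" using L_rho_pos rho by (simp add: tail_bound_def)
    have "?e m < x\<^sup>2 \<Longrightarrow> m \<le> ?n" for m
    proof -
      assume m: "?e m < x\<^sup>2"
      then have "0 < x" using x by (cases "x = 0") (auto simp: not_less order.asym[OF exp_gt_zero])
      then have "ln (?e m) < ln (x\<^sup>2)" using m by (subst ln_less_cancel_iff) auto
      then have "real m < ln (x\<^sup>2)" by simp
      also have "\<dots> = 2 * ln x" using \<open>0 < x\<close> by (simp add: ln_realpow)
      also have "\<dots> \<le> 2 * log_plus x" using \<open>0 < x\<close> by (simp add: log_plus_def)
      finally show "m \<le> ?n" by linarith
    qed
    then have "(\<Sum>m. ennreal (a (m + 2)) * (if ?e m < x\<^sup>2 then ennreal (x * tail_bound x) else 0)) \<le>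
        (\<Sum>m. (if m \<le> ?n then ennreal (a (m + 2)) else 0) * ennreal (x * tail_bound x))"
      by (intro suminf_le) auto
    also have "\<dots> = (\<Sum>m. (if m \<le> ?n then ennreal (a (m + 2)) else 0)) * ennreal (x * tail_bound x)" by simp
    also have "\<dots> \<le> ennreal (A (?n + 2)) * ennreal (x * tail_bound x)"
      unfolding A_def by (intro mult_right_mono partial_sum_shift_le a) auto
    also have "\<dots> = ennreal (x * (tail_bound x * A (?n + 2)))"
      using A0 x tb by (simp add: ennreal_mult[symmetric] mult_ac)
    also have "\<dots> \<le> ennreal (x * (Kc * D\<^sup>2 * (2 * D\<^sup>2 + 2) * cumul A (2 * log_plus x)))"
    proof (intro ennreal_leI mult_left_mono x)
      have "tail_bound x * A (?n + 2) \<le> (Kc * (2 * log_plus x + 1)) * (D\<^sup>2 * A ?n)"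
        using Kc x A0 tb by (intro mult_mono doubling_add_2[OF dA] Kc) auto
      also have "\<dots> = Kc * D\<^sup>2 * ((2 * log_plus x + 1) * A ?n)" by simp
      also have "\<dots> \<le> Kc * D\<^sup>2 * ((2 * D\<^sup>2 + 2) * cumul A (2 * log_plus x))"
        using Kc by (intro mult_left_mono le_cumul[OF dA]) auto
      finally show "tail_bound x * A (?n + 2) \<le> Kc * D\<^sup>2 * (2 * D\<^sup>2 + 2) * cumul A (2 * log_plus x)" by (simp add: mult_ac)
    qed
    also have "\<dots> = ennreal (Kc * D\<^sup>2 * (2 * D\<^sup>2 + 2)) * ennreal (x * cumul A (2 * log_plus x))"
      using Kc by (subst ennreal_mult'[symmetric]) (auto simp: mult_ac)
    finally show ?thesis .
  qed
  \<comment> \<open>The error of the small parts at level \<open>exp m\<close> is of order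
    \<open>exp (- m / 2)\<close>, which beats the polynomial growth of \<open>A\<close>.\<close>
  have sme: "summable (\<lambda>m. a (m + 2) * (?c / sqrt (?e m)))"
  proof (rule summable_comparison_test')
    show "summable (\<lambda>m. ?c * D\<^sup>2 * (A m * exp (- 1 / 2) ^ m))"
      by (intro summable_mult doubling_summable[OF dA]) auto
    fix m
    have "sqrt (?e m) = exp (real m / 2)" by (rule real_sqrt_unique) (auto simp: power2_eq_square exp_add[symmetric])
    moreover have "exp (- 1 / 2) ^ m = exp (- (real m / 2))"
      by (subst exp_of_nat_mult[symmetric]) simp
    ultimately have e: "exp (- 1 / 2) ^ m = 1 / sqrt (?e m)" by (simp add: exp_minus inverse_eq_divide)
    have "a (m + 2) * (?c / sqrt (?e m)) = ?c * (a (m + 2) * exp (- 1 / 2) ^ m)"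
      unfolding e by simp
    also have "\<dots> \<le> ?c * (D\<^sup>2 * A m * exp (- 1 / 2) ^ m)"
      using order.trans[OF aA doubling_add_2[OF dA], of m] by (intro mult_left_mono mult_right_mono) auto
    finally show "norm (a (m + 2) * (?c / sqrt (?e m))) \<le> ?c * D\<^sup>2 * (A m * exp (- 1 / 2) ^ m)"
      using a[of "m + 2"] by (simp add: mult_ac)
  qed
  have "(\<integral>\<^sup>+\<zeta>. ennreal (Wl \<zeta> * A (nat \<lfloor>log_plus (Wl \<zeta>)\<rfloor>)) \<partial>\<Omega>) \<le>
      (\<integral>\<^sup>+\<zeta>. ennreal (A 1) * ennreal (Wl \<zeta>) + (\<Sum>m. ennreal (a (m + 2)) * (if 4 * ?e m < Wl \<zeta> then ennreal (Wl \<zeta>) else 0)) \<partial>\<Omega>)"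
    by (intro nn_integral_mono pt) simp
  also have "\<dots> = ennreal (A 1) + (\<Sum>m. ennreal (a (m + 2)) * (\<integral>\<^sup>+\<zeta>. (if 4 * ?e m < Wl \<zeta> then ennreal (Wl \<zeta>) else 0) \<partial>\<Omega>))"
    by (simp add: nn_integral_add nn_integral_cmult nn_integral_suminf expect_Wl)
  also have "\<dots> \<le> ennreal (A 1) + (\<Sum>m. ennreal (a (m + 2)) * (2 * (\<integral>\<^sup>+s. (if ?e m < (X s)\<^sup>2 then ennreal (X s * tail_bound (X s)) else 0) \<partial>\<nu>) +
      ennreal (?c / sqrt (?e m))))"
    by (intro add_left_mono suminf_le mult_left_mono Wl_tail) auto
  also have "(\<Sum>m. ennreal (a (m + 2)) * (2 * (\<integral>\<^sup>+s. (if ?e m < (X s)\<^sup>2 then ennreal (X s * tail_bound (X s)) else 0) \<partial>\<nu>) +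
      ennreal (?c / sqrt (?e m)))) =
      2 * (\<integral>\<^sup>+s. (\<Sum>m. ennreal (a (m + 2)) * (if ?e m < (X s)\<^sup>2 then ennreal (X s * tail_bound (X s)) else 0)) \<partial>\<nu>) +
      (\<Sum>m. ennreal (a (m + 2) * (?c / sqrt (?e m))))"
  proof -
    have [measurable]: "tail_bound \<in> borel_measurable borel" unfolding tail_bound_def[abs_def] by measurable
    have 1: "ennreal (a (m + 2)) * (2 * I + ennreal (?c / sqrt (?e m))) =
        2 * (ennreal (a (m + 2)) * I) + ennreal (a (m + 2) * (?c / sqrt (?e m)))" for m I
    proof -
      have "ennreal (a (m + 2) * (?c / sqrt (?e m))) = ennreal (a (m + 2)) * ennreal (?c / sqrt (?e m))"
        using a by (intro ennreal_mult) auto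
      then show ?thesis by (simp only: distrib_left mult.left_commute)
    qed
    show ?thesis unfolding 1
      by (subst suminf_add[symmetric]) (simp_all add: nn_integral_suminf nn_integral_cmult)
  qed
  also have "(\<integral>\<^sup>+s. (\<Sum>m. ennreal (a (m + 2)) * (if ?e m < (X s)\<^sup>2 then ennreal (X s * tail_bound (X s)) else 0)) \<partial>\<nu>) \<le>
      (\<integral>\<^sup>+s. ennreal (Kc * D\<^sup>2 * (2 * D\<^sup>2 + 2)) * ennreal (X s * cumul A (2 * log_plus (X s))) \<partial>\<nu>)"
    by (intro nn_integral_mono sumX) simp
  also have "\<dots> = ennreal (Kc * D\<^sup>2 * (2 * D\<^sup>2 + 2)) * (\<integral>\<^sup>+s. ennreal (X s * cumul A (2 * log_plus (X s))) \<partial>\<nu>)"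
    by (rule nn_integral_cmult) measurable
  finally have "(\<integral>\<^sup>+\<zeta>. ennreal (Wl \<zeta> * A (nat \<lfloor>log_plus (Wl \<zeta>)\<rfloor>)) \<partial>\<Omega>) \<le> ennreal (A 1) +
      (2 * (ennreal (Kc * D\<^sup>2 * (2 * D\<^sup>2 + 2)) * (\<integral>\<^sup>+s. ennreal (X s * cumul A (2 * log_plus (X s))) \<partial>\<nu>)) +
      (\<Sum>m. ennreal (a (m + 2) * (?c / sqrt (?e m)))))"
    by (metis (no_types, lifting) add_mono mult_left_mono order_refl zero_le)
  also have "(\<Sum>m. ennreal (a (m + 2) * (?c / sqrt (?e m)))) = ennreal (\<Sum>m. a (m + 2) * (?c / sqrt (?e m)))"
    using a by (intro suminf_ennreal2 sme) auto
  also have "ennreal (A 1) +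
      (2 * (ennreal (Kc * D\<^sup>2 * (2 * D\<^sup>2 + 2)) * (\<integral>\<^sup>+s. ennreal (X s * cumul A (2 * log_plus (X s))) \<partial>\<nu>)) +
        ennreal (\<Sum>m. a (m + 2) * (?c / sqrt (?e m)))) < \<infinity>"
  proof -
    have "finite_moment_X A" using finite_moment_X by (simp only: A_def[abs_def])
    from finite_moment_X_scale[OF dA this, of 0 2]
    have "(\<integral>\<^sup>+s. ennreal (X s * cumul A (2 * log_plus (X s))) \<partial>\<nu>) < top" by (simp only: add_0_right infinity_ennreal_def order_refl)
    then show ?thesis by (auto simp: ennreal_mult_less_top)
  qed
  finally show ?thesis unfolding finite_moment_W_def A_def .
qed

end

text \<open>If at most one term exceeds \<open>t\<close>, its excess is at most that of the whole
  sum. If two terms do, then for every \<open>u\<close> some other term exceeds \<open>t\<close>,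
  and the double sum already contains the excess of \<open>u\<close>.\<close>

lemma csum_excess_le:
  fixes q :: "'i \<Rightarrow> ennreal" and t :: real
  shows "csum I (\<lambda>u. q u - t) \<le> (csum I q - t) +
    csum I (\<lambda>u. csum (I - {u}) (\<lambda>v. (q u - t) * (if t < q v then 1 else 0)))"
proof -
  have zero: "q u - t = 0" if "\<not> t < q u" for u using that by (auto simp: diff_eq_0_iff_ennreal not_less intro: le_less_trans)
  consider (none) "\<And>u. u \<in> I \<Longrightarrow> \<not> t < q u"
    | (one) u0 where "u0 \<in> I" "t < q u0" "\<And>u. u \<in> I \<Longrightarrow> u \<noteq> u0 \<Longrightarrow> \<not> t < q u"
    | (two) u0 u1 where "u0 \<in> I" "t < q u0" "u1 \<in> I" "t < q u1" "u0 \<noteq> u1" by blast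
  then show ?thesis
  proof cases
    case none
    then have "csum I (\<lambda>u. q u - t) = csum I (\<lambda>_. 0)" by (intro csum_cong zero)
    then show ?thesis by simp
  next
    case one
    have "csum (I - {u0}) (\<lambda>u. q u - t) = csum (I - {u0}) (\<lambda>_. 0)"
      using one(3) by (intro csum_cong zero) auto
    then have "csum I (\<lambda>u. q u - t) = q u0 - t" by (simp add: csum_diff_single[OF one(1)])
    also have "\<dots> \<le> csum I q - t" by (intro ennreal_minus_mono csum_ge_single one(1) order_refl)
    finally show ?thesis by (simp add: add_increasing2)
  next
    case two
    have "csum I (\<lambda>u. q u - t) \<le> csum I (\<lambda>u. csum (I - {u}) (\<lambda>v. (q u - t) * (if t < q v then 1 else 0)))"
    proof (intro csum_mono)
      fix u assume "u \<in> I"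
      obtain v where v: "v \<in> I - {u}" "t < q v" using two by (cases "u = u0") auto
      then have "q u - t = (q u - t) * (if t < q v then 1 else 0)" by simp
      also have "\<dots> \<le> csum (I - {u}) (\<lambda>v. (q u - t) * (if t < q v then 1 else 0))"
        by (rule csum_ge_single[OF v(1)])
      finally show "q u - t \<le> \<dots>" .
    qed
    then show ?thesis by (simp add: add_increasing)
  qed
qed

text \<open>By independence the double sum costs each excess a factor equal to the expected number
  of other large terms, which is at most 1/2 by Markov's inequality and the bound
  \<open>t / 2\<close> on the total mean. That half is absorbed on the left.\<close>

lemma (in prob_space) expect_excess_csum:
  fixes Q :: "'i::countable \<Rightarrow> 'a \<Rightarrow> ennreal" and t :: real
  assumes [measurable]: "\<And>u. u \<in> I \<Longrightarrow> Q u \<in> borel_measurable M"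
    and indep: "\<And>u v. u \<in> I \<Longrightarrow> v \<in> I \<Longrightarrow> u \<noteq> v \<Longrightarrow>
      (\<integral>\<^sup>+x. (Q u x - t) * (if t < Q v x then 1 else 0) \<partial>M) \<le>
      (\<integral>\<^sup>+x. (Q u x - t) \<partial>M) * (\<integral>\<^sup>+x. (if t < Q v x then 1 else 0) \<partial>M)"
    and t: "0 < t" and le: "csum I (\<lambda>u. \<integral>\<^sup>+x. Q u x \<partial>M) \<le> ennreal (t / 2)"
  shows "csum I (\<lambda>u. \<integral>\<^sup>+x. (Q u x - t) \<partial>M) \<le> 2 * (\<integral>\<^sup>+x. (csum I (\<lambda>u. Q u x) - t) \<partial>M)"
proof -
  let ?E = "csum I (\<lambda>u. \<integral>\<^sup>+x. (Q u x - t) \<partial>M)"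
  let ?F = "\<integral>\<^sup>+x. (csum I (\<lambda>u. Q u x) - t) \<partial>M"
  have m1 [measurable]: "(\<lambda>x. Q u x - ennreal t) \<in> borel_measurable M" if "u \<in> I" for u
    using that by measurable
  have m2 [measurable]: "(\<lambda>x. if ennreal t < Q u x then 1 else 0 :: ennreal) \<in> borel_measurable M" if "u \<in> I" for u
    using that by measurable
  have markov: "(\<integral>\<^sup>+x. (if t < Q v x then 1 else 0) \<partial>M) \<le> (\<integral>\<^sup>+x. Q v x \<partial>M) * ennreal (1 / t)" if v: "v \<in> I" for v
  proof -
    have "(\<integral>\<^sup>+x. (if t < Q v x then 1 else 0) \<partial>M) \<le> (\<integral>\<^sup>+x. Q v x * ennreal (1 / t) \<partial>M)"
    proof (intro nn_integral_mono)
      fix x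
      have "1 \<le> q * ennreal (1 / t)" if "ennreal t < q" for q
      proof -
        have "1 = ennreal t * ennreal (1 / t)" using t by (simp add: ennreal_mult[symmetric])
        also have "\<dots> \<le> q * ennreal (1 / t)" using that by (intro mult_right_mono) auto
        finally show ?thesis .
      qed
      then show "(if t < Q v x then 1 else 0) \<le> Q v x * ennreal (1 / t)" by auto
    qed
    then show ?thesis using v by (simp add: nn_integral_multc)
  qed
  have half: "csum (I - {u}) (\<lambda>v. \<integral>\<^sup>+x. (if t < Q v x then 1 else 0) \<partial>M) \<le> ennreal (1 / 2)" if "u \<in> I" for u
  proof -
    have "csum (I - {u}) (\<lambda>v. \<integral>\<^sup>+x. (if t < Q v x then 1 else 0) \<partial>M) \<le> csum (I - {u}) (\<lambda>v. (\<integral>\<^sup>+x. Q v x \<partial>M) * ennreal (1 / t))"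
      by (intro csum_mono markov) auto
    also have "\<dots> \<le> csum I (\<lambda>v. (\<integral>\<^sup>+x. Q v x \<partial>M) * ennreal (1 / t))"
      unfolding csum_diff_single[OF that] by simp
    also have "\<dots> = csum I (\<lambda>v. \<integral>\<^sup>+x. Q v x \<partial>M) * ennreal (1 / t)" by (simp add: nn_integral_multc)
    also have "\<dots> \<le> ennreal (t / 2) * ennreal (1 / t)" by (intro mult_right_mono le) auto
    also have "\<dots> = ennreal (1 / 2)" using t by (subst ennreal_mult[symmetric]) auto
    finally show ?thesis .
  qed
  have "?E = (\<integral>\<^sup>+x. csum I (\<lambda>u. Q u x - t) \<partial>M)" by (rule csum_nn_integral[symmetric]) measurable
  also have "\<dots> \<le> (\<integral>\<^sup>+x. (csum I (\<lambda>u. Q u x) - t) +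
      csum I (\<lambda>u. csum (I - {u}) (\<lambda>v. (Q u x - t) * (if t < Q v x then 1 else 0))) \<partial>M)"
    by (intro nn_integral_mono csum_excess_le)
  also have "\<dots> = ?F + (\<integral>\<^sup>+x. csum I (\<lambda>u. csum (I - {u}) (\<lambda>v. (Q u x - t) * (if t < Q v x then 1 else 0))) \<partial>M)"
    by (rule nn_integral_add) measurable
  also have "(\<integral>\<^sup>+x. csum I (\<lambda>u. csum (I - {u}) (\<lambda>v. (Q u x - t) * (if t < Q v x then 1 else 0))) \<partial>M) =
      csum I (\<lambda>u. \<integral>\<^sup>+x. csum (I - {u}) (\<lambda>v. (Q u x - t) * (if t < Q v x then 1 else 0)) \<partial>M)"
    by (rule csum_nn_integral) measurable
  also have "\<dots> = csum I (\<lambda>u. csum (I - {u}) (\<lambda>v. \<integral>\<^sup>+x. (Q u x - t) * (if t < Q v x then 1 else 0) \<partial>M))"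
    by (intro csum_cong csum_nn_integral) measurable
  also have "\<dots> \<le> csum I (\<lambda>u. csum (I - {u}) (\<lambda>v. (\<integral>\<^sup>+x. (Q u x - t) \<partial>M) * (\<integral>\<^sup>+x. (if t < Q v x then 1 else 0) \<partial>M)))"
    by (intro csum_mono indep) auto
  also have "\<dots> = csum I (\<lambda>u. (\<integral>\<^sup>+x. (Q u x - t) \<partial>M) * csum (I - {u}) (\<lambda>v. \<integral>\<^sup>+x. (if t < Q v x then 1 else 0) \<partial>M))"
    by (intro csum_cong nn_integral_cmult) auto
  also have "\<dots> \<le> csum I (\<lambda>u. (\<integral>\<^sup>+x. (Q u x - t) \<partial>M) * ennreal (1 / 2))"
    by (intro csum_mono mult_left_mono half) auto
  also have "\<dots> = ?E * ennreal (1 / 2)" by (rule nn_integral_multc) auto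
  finally have main: "?E \<le> ?F + ?E * ennreal (1 / 2)" by (simp add: add_left_mono)
  \<comment> \<open>The absorption requires finiteness, which the bound on the total mean
    supplies.\<close>
  have "?E \<le> csum I (\<lambda>u. \<integral>\<^sup>+x. Q u x \<partial>M)"
    by (intro csum_mono nn_integral_mono) (simp add: diff_le_self_ennreal)
  also note le
  finally have fin: "?E < \<infinity>" by (rule le_less_trans) simp
  show ?thesis
  proof (cases ?F)
    case top then show ?thesis by (simp add: ennreal_mult_top)
  next
    case (real f)
    obtain e where e: "?E = ennreal e" "0 \<le> e" using fin by (cases ?E) auto
    have "ennreal e \<le> ennreal (f + e * (1 / 2))"
    proof -
      have "ennreal e * ennreal (1 / 2) = ennreal (e * (1 / 2))" using e(2) by (intro ennreal_mult[symmetric]) auto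
      moreover have "ennreal (f + e * (1 / 2)) = ennreal f + ennreal (e * (1 / 2))"
        using e(2) real(1) by (intro ennreal_plus) auto
      ultimately show ?thesis using main unfolding e(1) real(2) by simp
    qed
    then have "e \<le> 2 * f" using e real by (subst (asm) ennreal_le_iff) auto
    then have "ennreal e \<le> ennreal (2 * f)" by (rule ennreal_leI)
    then show ?thesis unfolding e(1) real(2) using real(1) by (simp add: ennreal_mult)
  qed
qed

section \<open>From the limit back to one generation\<close>

context weighted_branching_xlogx
begin

text \<open>Subtraction in \<open>ennreal\<close> is truncated at 0, so this is
  \<open>E max (X - c) 0\<close>, a convex function of the variable, which therefore grows along
  martingales.\<close>

definition excess_X :: "real \<Rightarrow> ennreal" where "excess_X c = (\<integral>\<^sup>+s. (ennreal (X s) - ennreal c) \<partial>\<nu>)"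

text \<open>A heavy individual of weight \<open>y\<close> contributes \<open>y * X\<close>, whose
  excess over \<open>t\<close> is at least \<open>y\<close> times the excess of \<open>X\<close>
  over \<open>t * exp (K\<mu> * n)\<close>. As \<open>W n \<le> t / 2\<close>, the excesses of the
  single terms are bounded by twice that of their sum.\<close>

lemma excess_step:
  assumes t: "0 < t" and le: "WE n \<zeta> \<le> ennreal (t / 2)"
  shows "heavy n \<zeta> * excess_X (t * exp (real (K\<mu> * n))) \<le>
    2 * (\<integral>\<^sup>+\<zeta>'. (WE (Suc n) (mix (before n) \<zeta> \<zeta>') - ennreal t) \<partial>\<Omega>)"
proof -
  define Q where "Q u \<zeta>' = ennreal (Y u \<zeta> * X (\<zeta>' u))" for u and \<zeta>' :: "nat list \<Rightarrow> 'a"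
  have Qm [measurable]: "Q u \<in> borel_measurable \<Omega>" for u unfolding Q_def[abs_def] by measurable
  have EQ: "(\<integral>\<^sup>+\<zeta>'. Q u \<zeta>' \<partial>\<Omega>) = ennreal (Y u \<zeta>)" for u
  proof -
    have "(\<integral>\<^sup>+\<zeta>'. Q u \<zeta>' \<partial>\<Omega>) = (\<integral>\<^sup>+s. ennreal (Y u \<zeta> * X s) \<partial>\<nu>)"
      unfolding Q_def by (rule nn_integral_coord) measurable
    then show ?thesis by (simp add: ennreal_mult nn_integral_cmult EX)
  qed
  let ?g = "excess_X (t * exp (real (K\<mu> * n)))"
  have "heavy n \<zeta> * ?g = csum (gen n) (\<lambda>u. (if exp (- real (K\<mu> * n)) \<le> Y u \<zeta> then ennreal (Y u \<zeta>) else 0) * ?g)"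
    unfolding heavy_def by (rule nn_integral_multc[symmetric]) simp
  also have "\<dots> \<le> csum (gen n) (\<lambda>u. \<integral>\<^sup>+\<zeta>'. (Q u \<zeta>' - ennreal t) \<partial>\<Omega>)"
  proof (intro csum_mono)
    fix u
    show "(if exp (- real (K\<mu> * n)) \<le> Y u \<zeta> then ennreal (Y u \<zeta>) else 0) * ?g \<le> (\<integral>\<^sup>+\<zeta>'. (Q u \<zeta>' - ennreal t) \<partial>\<Omega>)"
    proof (cases "exp (- real (K\<mu> * n)) \<le> Y u \<zeta>")
      case True
      let ?y = "Y u \<zeta>" and ?c = "t * exp (real (K\<mu> * n))"
      have "exp (- real (K\<mu> * n)) * ?c \<le> ?y * ?c" using True t by (intro mult_right_mono) auto
      moreover have "exp (- real (K\<mu> * n)) * ?c = t" by (simp add: exp_minus field_simps)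
      ultimately have yc: "t \<le> ?y * ?c" by (simp only:)
      have "ennreal ?y * (ennreal x - ennreal ?c) \<le> ennreal (?y * x) - ennreal t" if "0 \<le> x" for x
      proof -
        have "ennreal ?y * (ennreal x - ennreal ?c) = ennreal (?y * (x - ?c))"
        proof -
          have "ennreal x - ennreal ?c = ennreal (x - ?c)" using t by (intro ennreal_minus) auto
          then show ?thesis by (simp only: ennreal_mult'[OF Y_nonneg])
        qed
        also have "\<dots> \<le> ennreal (?y * x - t)" using yc by (intro ennreal_leI) (simp add: right_diff_distrib)
        also have "\<dots> = ennreal (?y * x) - ennreal t" using t by (simp add: ennreal_minus)
        finally show ?thesis .
      qed
      then have "ennreal ?y * ?g \<le> (\<integral>\<^sup>+s. (ennreal (?y * X s) - ennreal t) \<partial>\<nu>)"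
        unfolding excess_X_def by (subst nn_integral_cmult[symmetric]) (auto intro!: nn_integral_mono)
      also have "\<dots> = (\<integral>\<^sup>+\<zeta>'. (Q u \<zeta>' - ennreal t) \<partial>\<Omega>)"
        unfolding Q_def by (rule nn_integral_coord[symmetric]) measurable
      finally show ?thesis using True by simp
    qed simp
  qed
  also have "\<dots> \<le> 2 * (\<integral>\<^sup>+\<zeta>'. (csum (gen n) (\<lambda>u. Q u \<zeta>') - ennreal t) \<partial>\<Omega>)"
  proof (rule prod.P.expect_excess_csum)
    fix u v :: "nat list" assume "u \<noteq> v"
    then show "(\<integral>\<^sup>+x. (Q u x - ennreal t) * (if ennreal t < Q v x then 1 else 0) \<partial>\<Omega>) \<le>
      (\<integral>\<^sup>+x. (Q u x - ennreal t) \<partial>\<Omega>) * (\<integral>\<^sup>+x. (if ennreal t < Q v x then 1 else 0) \<partial>\<Omega>)"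
      by (intro eq_refl nn_integral_indep[of _ _ "{u}"]) (auto simp: Q_def mix_def)
  next
    show "csum (gen n) (\<lambda>u. \<integral>\<^sup>+\<zeta>'. Q u \<zeta>' \<partial>\<Omega>) \<le> ennreal (t / 2)" using le unfolding EQ WE_def .
  qed (rule Qm t)+
  also have "(\<integral>\<^sup>+\<zeta>'. (csum (gen n) (\<lambda>u. Q u \<zeta>') - ennreal t) \<partial>\<Omega>) =
      (\<integral>\<^sup>+\<zeta>'. (WE (Suc n) (mix (before n) \<zeta> \<zeta>') - ennreal t) \<partial>\<Omega>)"
    unfolding WE_Suc Q_def by (intro nn_integral_cong arg_cong2[where f = minus] csum_cong refl) auto
  finally show ?thesis .
qed

text \<open>Jensen's inequality for the conditional mean, obtained from
  \<open>S \<le> (S - t) + t\<close> with truncated subtraction.\<close>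

lemma excess_mono:
  "WE n \<zeta> - ennreal t \<le> (\<integral>\<^sup>+\<zeta>'. (WE (Suc n) (mix (before n) \<zeta> \<zeta>') - ennreal t) \<partial>\<Omega>)"
proof -
  let ?S = "\<lambda>\<zeta>'. csum (gen n) (\<lambda>u. ennreal (Y u \<zeta>) * ennreal (X (\<zeta>' u)))"
  have S: "WE (Suc n) (mix (before n) \<zeta> \<zeta>') = ?S \<zeta>'" for \<zeta>'
    unfolding WE_Suc by (intro csum_cong) (auto simp: ennreal_mult)
  have "WE n \<zeta> = (\<integral>\<^sup>+\<zeta>'. ?S \<zeta>' \<partial>\<Omega>)"
    by (subst csum_nn_integral) (auto simp: nn_integral_cmult nn_integral_coord[of "\<lambda>s. ennreal (X s)"] EX WE_def)
  also have "\<dots> \<le> (\<integral>\<^sup>+\<zeta>'. (?S \<zeta>' - ennreal t) + ennreal t \<partial>\<Omega>)"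
  proof (intro nn_integral_mono)
    fix \<zeta>'
    show "?S \<zeta>' \<le> (?S \<zeta>' - ennreal t) + ennreal t"
      by (cases "ennreal t \<le> ?S \<zeta>'") (simp_all add: diff_add_cancel_ennreal add_increasing)
  qed
  also have "\<dots> = (\<integral>\<^sup>+\<zeta>'. (?S \<zeta>' - ennreal t) \<partial>\<Omega>) + ennreal t"
    by (subst nn_integral_add) (auto simp: prod.P.emeasure_space_1)
  finally have "WE n \<zeta> \<le> ennreal t + (\<integral>\<^sup>+\<zeta>'. (?S \<zeta>' - ennreal t) \<partial>\<Omega>)" by (simp only: add.commute)
  then show ?thesis unfolding S by (simp only: ennreal_minus_le_iff ennreal_neq_top simp_thms)
qed

text \<open>Where \<open>dominator \<le> t / 2\<close>, the excess of \<open>W n\<close> is 0 and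
  the whole conditional excess of \<open>W (n + 1)\<close> is gain; elsewhere it does not decrease.
  The factor 1/4 is 1/2 from \<open>excess_step\<close> times 1/2 for the heavy mass on the good
  event.\<close>

lemma excess_growth:
  assumes t: "0 < t" and dominator: "(\<integral>\<^sup>+\<zeta>. (if dominator \<zeta> \<le> ennreal (t / 2) then 0 else dominator \<zeta>) \<partial>\<Omega>) \<le> ennreal (1 / 4)"
  shows "(\<integral>\<^sup>+\<zeta>. (WE n \<zeta> - ennreal t) \<partial>\<Omega>) + ennreal (1 / 4) * excess_X (t * exp (real (K\<mu> * n))) \<le>
    (\<integral>\<^sup>+\<zeta>. (WE (Suc n) \<zeta> - ennreal t) \<partial>\<Omega>)"
proof -
  let ?g = "excess_X (t * exp (real (K\<mu> * n)))"
  let ?e = "\<lambda>\<zeta>. \<integral>\<^sup>+\<zeta>'. (WE (Suc n) (mix (before n) \<zeta> \<zeta>') - ennreal t) \<partial>\<Omega>"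
  have "ennreal (1 / 4) * ?g = ennreal (1 / 2) * ennreal (1 / 2) * ?g"
    by (subst ennreal_mult[symmetric]) simp_all
  also have "\<dots> \<le> ennreal (1 / 2) * (\<integral>\<^sup>+\<zeta>. (if dominator \<zeta> \<le> ennreal (t / 2) then heavy n \<zeta> else 0) \<partial>\<Omega>) * ?g"
    using dominator by (intro mult_right_mono mult_left_mono heavy_event) auto
  also have "\<dots> = (\<integral>\<^sup>+\<zeta>. ennreal (1 / 2) * ((if dominator \<zeta> \<le> ennreal (t / 2) then heavy n \<zeta> else 0) * ?g) \<partial>\<Omega>)"
    by (simp add: nn_integral_cmult nn_integral_multc mult.assoc)
  finally have "(\<integral>\<^sup>+\<zeta>. (WE n \<zeta> - ennreal t) \<partial>\<Omega>) + ennreal (1 / 4) * ?g \<le>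
    (\<integral>\<^sup>+\<zeta>. (WE n \<zeta> - ennreal t) \<partial>\<Omega>) + (\<integral>\<^sup>+\<zeta>. ennreal (1 / 2) * ((if dominator \<zeta> \<le> ennreal (t / 2) then heavy n \<zeta> else 0) * ?g) \<partial>\<Omega>)"
    by (intro add_left_mono)
  also have "\<dots> = (\<integral>\<^sup>+\<zeta>. (WE n \<zeta> - ennreal t) + ennreal (1 / 2) * ((if dominator \<zeta> \<le> ennreal (t / 2) then heavy n \<zeta> else 0) * ?g) \<partial>\<Omega>)"
    by (rule nn_integral_add[symmetric]) measurable
  also have "\<dots> \<le> (\<integral>\<^sup>+\<zeta>. ?e \<zeta> \<partial>\<Omega>)"
  proof (intro nn_integral_mono_AE)
    show "AE \<zeta> in \<Omega>. (WE n \<zeta> - ennreal t) + ennreal (1 / 2) * ((if dominator \<zeta> \<le> ennreal (t / 2) then heavy n \<zeta> else 0) * ?g) \<le> ?e \<zeta>"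
      using AE_Wr[of n]
    proof eventually_elim
      case (elim \<zeta>)
      show ?case
      proof (cases "dominator \<zeta> \<le> ennreal (t / 2)")
        case True
        have "WE n \<zeta> \<le> ennreal (t / 2)" using Wr_le_dominator[of n \<zeta>] True unfolding elim by (rule order.trans)
        then have 1: "heavy n \<zeta> * ?g \<le> 2 * ?e \<zeta>" by (rule excess_step[OF t])
        have "WE n \<zeta> \<le> ennreal t" by (rule order.trans[OF \<open>WE n \<zeta> \<le> ennreal (t / 2)\<close>]) (use t in \<open>auto intro: ennreal_leI\<close>)
        then have 0: "WE n \<zeta> - ennreal t = 0" by (auto simp: diff_eq_0_iff_ennreal intro: le_less_trans)
        have "ennreal (1 / 2) * (heavy n \<zeta> * ?g) \<le> ennreal (1 / 2) * (2 * ?e \<zeta>)" by (intro mult_left_mono 1) simp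
        also have "\<dots> = ennreal (1 / 2) * ennreal 2 * ?e \<zeta>" by (simp add: mult.assoc)
        also have "ennreal (1 / 2) * ennreal 2 = 1" by (subst ennreal_mult[symmetric]) auto
        finally show ?thesis using True by (simp add: 0)
      next
        case False
        then show ?thesis using excess_mono[of n \<zeta> t] by simp
      qed
    qed
  qed
  also have "\<dots> = (\<integral>\<^sup>+\<zeta>. (WE (Suc n) \<zeta> - ennreal t) \<partial>\<Omega>)"
    by (rule nn_integral_mix) measurable
  finally show ?thesis .
qed

lemma dominator_tail_small: "\<exists>c>0. (\<integral>\<^sup>+\<zeta>. (if dominator \<zeta> \<le> ennreal c then 0 else dominator \<zeta>) \<partial>\<Omega>) \<le> ennreal (1 / 4)"
proof -
  have fin: "AE \<zeta> in \<Omega>. dominator \<zeta> \<noteq> \<infinity>" using expect_dominator by (intro nn_integral_noteq_infinite) auto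
  have "(\<lambda>c::nat. \<integral>\<^sup>+\<zeta>. (if dominator \<zeta> \<le> ennreal (real c) then 0 else dominator \<zeta>) \<partial>\<Omega>) \<longlonglongrightarrow> (\<integral>\<^sup>+\<zeta>. 0 \<partial>\<Omega>)"
  proof (rule nn_integral_dominated_convergence[where w = dominator])
    show "AE \<zeta> in \<Omega>. (\<lambda>c::nat. if dominator \<zeta> \<le> ennreal (real c) then 0 else dominator \<zeta>) \<longlonglongrightarrow> 0"
      using fin
    proof eventually_elim
      case (elim \<zeta>)
      then obtain r where r: "dominator \<zeta> = ennreal r" "0 \<le> r" by (cases "dominator \<zeta>") auto
      obtain N :: nat where "r \<le> real N" using real_arch_simple by blast
      then have "eventually (\<lambda>c::nat. (if dominator \<zeta> \<le> ennreal (real c) then 0 else dominator \<zeta>) = 0) sequentially"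
        unfolding r(1) by (intro eventually_sequentiallyI[of N]) (auto intro: ennreal_leI)
      then show ?case by (rule tendsto_eventually)
    qed
  qed (use expect_dominator in auto)
  then have "eventually (\<lambda>c::nat. (\<integral>\<^sup>+\<zeta>. (if dominator \<zeta> \<le> ennreal (real c) then 0 else dominator \<zeta>) \<partial>\<Omega>) < ennreal (1 / 4)) sequentially"
    by (rule order_tendstoD) simp
  then obtain N where N: "\<And>c::nat. N \<le> c \<Longrightarrow> (\<integral>\<^sup>+\<zeta>. (if dominator \<zeta> \<le> ennreal (real c) then 0 else dominator \<zeta>) \<partial>\<Omega>) < ennreal (1 / 4)"
    by (auto simp: eventually_sequentially)
  show ?thesis using N[of "Suc N"] by (intro exI[of _ "real (Suc N)"]) auto
qed

definition excess_W :: "real \<Rightarrow> ennreal" where "excess_W t = (\<integral>\<^sup>+\<zeta>. (ennreal (Wl \<zeta>) - ennreal t) \<partial>\<Omega>)"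

text \<open>The gains of all generations add up, and convergence in mean carries the sum over to the
  limit. The threshold \<open>t0\<close> ensures that the event \<open>dominator \<le> t / 2\<close>
  is good enough for every later \<open>t\<close>.\<close>

lemma excess_W_lower: "\<exists>t0\<ge>1. \<forall>t\<ge>t0. ennreal (1 / 4) * (\<Sum>n. excess_X (t * exp (real (K\<mu> * n)))) \<le> excess_W t"
proof -
  obtain c where c: "0 < c" "(\<integral>\<^sup>+\<zeta>. (if dominator \<zeta> \<le> ennreal c then 0 else dominator \<zeta>) \<partial>\<Omega>) \<le> ennreal (1 / 4)"
    using dominator_tail_small by auto
  have "ennreal (1 / 4) * (\<Sum>n. excess_X (t * exp (real (K\<mu> * n)))) \<le> excess_W t" if t: "max 1 (2 * c) \<le> t" for t
  proof -
    have t0: "0 < t" using t by simp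
    have dominator: "(\<integral>\<^sup>+\<zeta>. (if dominator \<zeta> \<le> ennreal (t / 2) then 0 else dominator \<zeta>) \<partial>\<Omega>) \<le> ennreal (1 / 4)"
    proof (rule order.trans[OF nn_integral_mono c(2)])
      fix \<zeta>
      have "ennreal c \<le> ennreal (t / 2)" using t by (intro ennreal_leI) auto
      then show "(if dominator \<zeta> \<le> ennreal (t / 2) then 0 else dominator \<zeta>) \<le> (if dominator \<zeta> \<le> ennreal c then 0 else dominator \<zeta>)"
        by (auto intro: order.trans)
    qed
    have sum: "(\<Sum>n<N. ennreal (1 / 4) * excess_X (t * exp (real (K\<mu> * n)))) \<le> (\<integral>\<^sup>+\<zeta>. (WE N \<zeta> - ennreal t) \<partial>\<Omega>)" for N
    proof (induction N)
      case (Suc N)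
      show ?case using order.trans[OF add_right_mono[OF Suc] excess_growth[OF t0 dominator]] by simp
    qed simp
    have up: "(\<integral>\<^sup>+\<zeta>. (WE N \<zeta> - ennreal t) \<partial>\<Omega>) \<le> excess_W t + dist1 N" for N
    proof -
      have "(\<integral>\<^sup>+\<zeta>. (WE N \<zeta> - ennreal t) \<partial>\<Omega>) \<le> (\<integral>\<^sup>+\<zeta>. (ennreal (Wl \<zeta>) - ennreal t) + ennreal \<bar>Wr N \<zeta> - Wl \<zeta>\<bar> \<partial>\<Omega>)"
      proof (intro nn_integral_mono_AE)
        show "AE \<zeta> in \<Omega>. WE N \<zeta> - ennreal t \<le> (ennreal (Wl \<zeta>) - ennreal t) + ennreal \<bar>Wr N \<zeta> - Wl \<zeta>\<bar>"
          using AE_Wr[of N]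
        proof eventually_elim
          case (elim \<zeta>)
          show ?case unfolding elim[symmetric] using t0
            by (auto simp: ennreal_minus max_def ennreal_plus_if intro!: ennreal_leI)
        qed
      qed
      also have "\<dots> = excess_W t + dist1 N" unfolding excess_W_def dist1_def by (rule nn_integral_add) measurable
      finally show ?thesis .
    qed
    have "(\<lambda>M. excess_W t + dist1 M) \<longlonglongrightarrow> excess_W t + 0" by (intro tendsto_add tendsto_const dist1_tendsto)
    have "(\<Sum>n<N. ennreal (1 / 4) * excess_X (t * exp (real (K\<mu> * n)))) \<le> excess_W t" for N
    proof (rule LIMSEQ_le_const)
      show "(\<lambda>M. excess_W t + dist1 M) \<longlonglongrightarrow> excess_W t" using \<open>(\<lambda>M. excess_W t + dist1 M) \<longlonglongrightarrow> excess_W t + 0\<close> by simp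
      have "(\<Sum>n<N. ennreal (1 / 4) * excess_X (t * exp (real (K\<mu> * n)))) \<le> excess_W t + dist1 M" if "N \<le> M" for M
      proof -
        have "(\<Sum>n<N. ennreal (1 / 4) * excess_X (t * exp (real (K\<mu> * n)))) \<le> (\<Sum>n<M. ennreal (1 / 4) * excess_X (t * exp (real (K\<mu> * n))))"
          using that by (intro sum_mono2) auto
        also note sum
        also note up
        finally show ?thesis .
      qed
      then show "\<exists>M0. \<forall>M\<ge>M0. (\<Sum>n<N. ennreal (1 / 4) * excess_X (t * exp (real (K\<mu> * n)))) \<le> excess_W t + dist1 M" by blast
    qed
    then have "(\<Sum>n. ennreal (1 / 4) * excess_X (t * exp (real (K\<mu> * n)))) \<le> excess_W t"
      by (intro suminf_le_const) auto
    then show ?thesis by simp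
  qed
  then show ?thesis by (intro exI[of _ "max 1 (2 * c)"]) auto
qed

text \<open>A deterministic count: on the square of indices \<open>m, j \<le> n1\<close>, with
  \<open>n1\<close> proportional to \<open>log x\<close>, each excess is at least
  \<open>x / 2\<close>. Summation over \<open>j\<close> gives a factor of order
  \<open>log x\<close>, summation over \<open>m\<close> gives \<open>A n1\<close> up to the
  discarded first levels.\<close>

lemma cumul_le_excess:
  fixes a :: "nat \<Rightarrow> real"
  assumes a: "\<And>n. 0 \<le> a n" and dA: "doubling D (\<lambda>k. \<Sum>n\<le>k. a n)"
  shows "\<exists>C1 C2. 0 \<le> C1 \<and> 0 \<le> C2 \<and> (\<forall>x\<ge>0. ennreal (x * cumul (\<lambda>k. \<Sum>n\<le>k. a n) (log_plus x)) \<le>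
    ennreal C1 * (\<Sum>m. \<Sum>j. ennreal (if m0 \<le> m then a m else 0) * (ennreal x - ennreal (exp (real m) * exp (real (K * j))))) +
    ennreal C2 * (ennreal (x * log_plus x) + ennreal x))"
proof -
  define A where "A k = (\<Sum>n\<le>k. a n)" for k
  have dA: "doubling D A" using dA by (simp add: A_def[abs_def])
  have A0: "0 \<le> A k" for k by (rule doubling_nonneg[OF dA])
  obtain C where C: "1 \<le> C" "\<And>z. 0 \<le> z \<Longrightarrow> cumul A (2 * (real K + 1) * z) \<le> C * cumul A z"
    using cumul_scale[of D "2 * (real K + 1)"] dA by blast
  let ?H = "\<lambda>x. \<Sum>m. \<Sum>j. ennreal (if m0 \<le> m then a m else 0) * (ennreal x - ennreal (exp (real m) * exp (real (K * j))))"
  let ?C2 = "max (cumul A 2) (2 * C * A m0)"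
  have SA0: "0 \<le> cumul A z" for z using cumul_ge_1[OF dA, of z] by simp
  have C20: "0 \<le> ?C2" using SA0[of 2] by (rule max.coboundedI1)
  have "ennreal (x * cumul A (log_plus x)) \<le> ennreal (4 * C) * ?H x + ennreal ?C2 * (ennreal (x * log_plus x) + ennreal x)"
    if x: "0 \<le> x" for x
  proof -
    let ?z = "log_plus x"
    have x2: "ennreal (x * ?z) + ennreal x = ennreal (x * (?z + 1))"
      using x by (subst ennreal_plus[symmetric]) (auto simp: distrib_left)
    show ?thesis
    proof (cases "?z < 2")
      case True
      have "x * cumul A ?z \<le> x * cumul A 2" using x True by (intro mult_left_mono cumul_mono[OF dA]) auto
      also have "\<dots> \<le> ?C2 * (x * (?z + 1))"
      proof -
        have "cumul A 2 * (x * 1) \<le> ?C2 * (x * (?z + 1))" using x SA0 C20 by (intro mult_mono) (auto simp del: le_max_iff_disj max.bounded_iff)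
        then show ?thesis by (simp add: mult.commute)
      qed
      finally have "ennreal (x * cumul A ?z) \<le> ennreal (?C2 * (x * (?z + 1)))" by (rule ennreal_leI)
      also have "\<dots> = ennreal ?C2 * (ennreal (x * ?z) + ennreal x)"
        unfolding x2 by (rule ennreal_mult'[OF C20])
      finally show ?thesis by (simp add: add_increasing)
    next
      case False
      then have xp: "0 < x" "?z = ln x" by (auto simp: log_plus_def max_def split: if_splits)
      \<comment> \<open>Chosen so that \<open>m + K * j \<le> ln x - 1\<close> for all indices up to
        \<open>n1\<close>; hence \<open>exp m * exp (K * j) \<le> x / exp 1 \<le> x / 2\<close>.
        Since \<open>ln x \<ge> 2\<close>, subtracting 1 costs at most half of the
        logarithm.\<close>
      define z1 where "z1 = (?z - 1) / (real K + 1)"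
      define n1 where "n1 = nat \<lfloor>z1\<rfloor>"
      have z1: "0 \<le> z1" "?z \<le> 2 * (real K + 1) * z1" "(real K + 1) * z1 = ?z - 1"
      proof -
        show e: "(real K + 1) * z1 = ?z - 1" by (simp add: z1_def)
        show "0 \<le> z1" using False by (simp add: z1_def)
        show "?z \<le> 2 * (real K + 1) * z1" unfolding mult.assoc e using False by simp
      qed
      have n1: "real n1 \<le> z1" "z1 + 1 \<le> 2 * (real n1 + 1)"
      proof -
        show "real n1 \<le> z1" unfolding n1_def using z1(1) by linarith
        have "z1 < real n1 + 1" unfolding n1_def using z1(1) by linarith
        then show "z1 + 1 \<le> 2 * (real n1 + 1)" by simp
      qed
      have "(real K + 1) * z1 \<ge> 1 * z1" using z1(1) by (intro mult_right_mono) auto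
      then have z1z: "z1 \<le> ?z - 1" using z1(3) by simp
      have "ennreal (x / 2 * (real n1 + 1) * (A n1 - A m0)) \<le>
          (\<Sum>m\<le>n1. \<Sum>j\<le>n1. ennreal (if m0 \<le> m then a m else 0) * (ennreal x - ennreal (exp (real m) * exp (real (K * j)))))"
      proof -
        have ge: "x / 2 \<le> x - exp (real m) * exp (real (K * j))" if "m \<le> n1" "j \<le> n1" for m j
        proof -
          have "real m + real K * real j \<le> z1 + real K * z1"
            using that n1 by (intro add_mono mult_left_mono) auto
          also have "\<dots> = ln x - 1" using z1(3) xp by (simp add: algebra_simps)
          finally have "exp (real m) * exp (real (K * j)) \<le> exp (ln x - 1)"
            by (simp add: exp_add[symmetric])
          also have "\<dots> = x / exp 1" using xp by (simp add: exp_diff)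
          also have "\<dots> \<le> x / 2"
            using xp exp_ge_add_one_self[of 1] by (intro divide_left_mono) auto
          finally show ?thesis by simp
        qed
        have "A n1 - A m0 \<le> (\<Sum>m\<le>n1. if m0 \<le> m then a m else 0)"
        proof -
          have "A n1 \<le> (\<Sum>m\<le>n1. (if m0 \<le> m then a m else 0) + (if m \<le> m0 then a m else 0))"
            unfolding A_def using a by (intro sum_mono) auto
          also have "\<dots> = (\<Sum>m\<le>n1. if m0 \<le> m then a m else 0) + (\<Sum>m\<le>n1. if m \<le> m0 then a m else 0)"
            by (rule sum.distrib)
          also have "(\<Sum>m\<le>n1. if m \<le> m0 then a m else 0) = (\<Sum>m\<in>{..n1} \<inter> {..m0}. a m)"
            by (simp add: sum.If_cases Int_def)
          also have "\<dots> \<le> A m0" unfolding A_def using a by (intro sum_mono2) auto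
          finally show ?thesis by simp
        qed
        then have "x / 2 * (real n1 + 1) * (A n1 - A m0) \<le> x / 2 * (real n1 + 1) * (\<Sum>m\<le>n1. if m0 \<le> m then a m else 0)"
          using x by (intro mult_left_mono) auto
        also have "\<dots> = (\<Sum>m\<le>n1. \<Sum>j\<le>n1. (if m0 \<le> m then a m else 0) * (x / 2))"
          by (simp add: sum_distrib_left mult_ac add.commute[of 1])
        finally have "ennreal (x / 2 * (real n1 + 1) * (A n1 - A m0)) \<le> ennreal (\<Sum>m\<le>n1. \<Sum>j\<le>n1. (if m0 \<le> m then a m else 0) * (x / 2))"
          by (rule ennreal_leI)
        also have "\<dots> = (\<Sum>m\<le>n1. \<Sum>j\<le>n1. ennreal ((if m0 \<le> m then a m else 0) * (x / 2)))"
        proof -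
          have nn: "0 \<le> (if m0 \<le> m then a m else 0) * (x / 2)" for m using a x by auto
          show ?thesis by (subst sum_ennreal, rule nn, subst sum_ennreal, rule sum_nonneg, rule nn, rule refl)
        qed
        also have "\<dots> \<le> (\<Sum>m\<le>n1. \<Sum>j\<le>n1. ennreal (if m0 \<le> m then a m else 0) * (ennreal x - ennreal (exp (real m) * exp (real (K * j)))))"
        proof (intro sum_mono)
          fix m j assume mj: "m \<in> {..n1}" "j \<in> {..n1}"
          have "ennreal ((if m0 \<le> m then a m else 0) * (x / 2)) = ennreal (if m0 \<le> m then a m else 0) * ennreal (x / 2)"
            using a by (intro ennreal_mult') auto
          also have "\<dots> \<le> ennreal (if m0 \<le> m then a m else 0) * ennreal (x - exp (real m) * exp (real (K * j)))"
            using ge[of m j] mj by (intro mult_left_mono ennreal_leI) auto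
          also have "ennreal (x - exp (real m) * exp (real (K * j))) = ennreal x - ennreal (exp (real m) * exp (real (K * j)))"
            by (intro ennreal_minus[symmetric]) auto
          finally show "ennreal ((if m0 \<le> m then a m else 0) * (x / 2)) \<le>
            ennreal (if m0 \<le> m then a m else 0) * (ennreal x - ennreal (exp (real m) * exp (real (K * j))))" .
        qed
        finally show ?thesis .
      qed
      also have "\<dots> \<le> (\<Sum>m\<le>n1. \<Sum>j. ennreal (if m0 \<le> m then a m else 0) * (ennreal x - ennreal (exp (real m) * exp (real (K * j)))))"
        by (intro sum_mono sum_le_suminf) auto
      also have "\<dots> \<le> ?H x" by (intro sum_le_suminf) auto
      finally have H: "ennreal (x / 2 * (real n1 + 1) * (A n1 - A m0)) \<le> ?H x" .
      have "cumul A ?z \<le> cumul A (2 * (real K + 1) * z1)" by (rule cumul_mono[OF dA z1(2)])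
      also have "\<dots> \<le> C * cumul A z1" by (rule C(2)[OF z1(1)])
      also have "\<dots> \<le> C * ((z1 + 1) * A n1)" unfolding n1_def using C z1 by (intro mult_left_mono cumul_le[OF dA]) auto
      also have "\<dots> \<le> C * (2 * (real n1 + 1) * A n1)" using C n1 A0 by (intro mult_left_mono mult_right_mono) auto
      finally have "x * cumul A ?z \<le> x * (C * (2 * (real n1 + 1) * A n1))" using x by (intro mult_left_mono)
      also have "\<dots> = 4 * C * (x / 2 * (real n1 + 1) * (A n1 - A m0)) + 2 * C * A m0 * (x * (real n1 + 1))"
        by (simp add: field_simps)
      also have "\<dots> \<le> 4 * C * (x / 2 * (real n1 + 1) * (A n1 - A m0)) + ?C2 * (x * (?z + 1))"
        using x C A0 n1 z1z C20 by (intro add_left_mono mult_mono) auto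
      finally have "ennreal (x * cumul A ?z) \<le> ennreal (4 * C * (x / 2 * (real n1 + 1) * (A n1 - A m0)) + ?C2 * (x * (?z + 1)))"
        by (rule ennreal_leI)
      \<comment> \<open>\<open>A n1 - A m0\<close> may be negative. This direction still holds,
        because \<open>ennreal\<close> sends negative numbers to 0.\<close>
      also have "\<dots> \<le> ennreal (4 * C * (x / 2 * (real n1 + 1) * (A n1 - A m0))) + ennreal (?C2 * (x * (?z + 1)))"
        by (auto simp: ennreal_plus_if intro!: ennreal_leI)
      also have "ennreal (4 * C * (x / 2 * (real n1 + 1) * (A n1 - A m0))) = ennreal (4 * C) * ennreal (x / 2 * (real n1 + 1) * (A n1 - A m0))"
        using C by (intro ennreal_mult') auto
      also have "ennreal (?C2 * (x * (?z + 1))) = ennreal ?C2 * (ennreal (x * ?z) + ennreal x)"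
        unfolding x2 by (rule ennreal_mult'[OF C20])
      also have "ennreal (4 * C) * ennreal (x / 2 * (real n1 + 1) * (A n1 - A m0)) \<le> ennreal (4 * C) * ?H x"
        by (intro mult_left_mono H) simp
      finally show ?thesis by (simp add: add_right_mono)
    qed
  qed
  moreover have "0 \<le> 4 * C" using C by simp
  moreover note C20
  ultimately show ?thesis unfolding A_def[abs_def] by blast
qed

text \<open>The lower bound for the excess of \<open>W\<close> is used at the levels
  \<open>exp m\<close> with weights \<open>a m\<close>. On the side of \<open>W\<close> the sum of
  the excesses is at most \<open>W * A (log+ W)\<close>; on the side of \<open>X\<close> the double
  sum is the one evaluated by \<open>cumul_le_excess\<close>.\<close>

theorem finite_moment_W_imp_finite_moment_X:
  assumes a: "\<And>n. 0 \<le> a n" and A: "doubling D (\<lambda>k. \<Sum>n\<le>k. a n)" and finite_moment_W: "finite_moment_W (\<lambda>k. \<Sum>n\<le>k. a n)"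
  shows "finite_moment_X (\<lambda>k. \<Sum>n\<le>k. a n)"
proof -
  define A where "A k = (\<Sum>n\<le>k. a n)" for k
  obtain t0 where t0: "1 \<le> t0" "\<And>t. t0 \<le> t \<Longrightarrow> ennreal (1 / 4) * (\<Sum>n. excess_X (t * exp (real (K\<mu> * n)))) \<le> excess_W t"
    using excess_W_lower by auto
  obtain m0 :: nat where m0: "ln t0 \<le> real m0" using real_arch_simple by blast
  have em: "t0 \<le> exp (real m)" if "m0 \<le> m" for m
  proof -
    have "ln t0 \<le> real m" using m0 that by simp
    then have "exp (ln t0) \<le> exp (real m)" by simp
    then show ?thesis using t0 by simp
  qed
  let ?a = "\<lambda>m. if m0 \<le> m then a m else 0"
  let ?H = "\<lambda>x. \<Sum>m. \<Sum>j. ennreal (?a m) * (ennreal x - ennreal (exp (real m) * exp (real (K\<mu> * j))))"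
  have "(\<integral>\<^sup>+s. ?H (X s) \<partial>\<nu>) = (\<Sum>m. ennreal (?a m) * (\<Sum>j. excess_X (exp (real m) * exp (real (K\<mu> * j)))))"
    unfolding excess_X_def by (simp add: nn_integral_suminf nn_integral_cmult del: ennreal_suminf_cmult) simp
  also have "\<dots> \<le> (\<Sum>m. ennreal 4 * (ennreal (a m) * excess_W (exp (real m))))"
  proof (intro suminf_le)
    fix m
    show "ennreal (?a m) * (\<Sum>j. excess_X (exp (real m) * exp (real (K\<mu> * j)))) \<le> ennreal 4 * (ennreal (a m) * excess_W (exp (real m)))"
    proof (cases "m0 \<le> m")
      case True
      have "(\<Sum>j. excess_X (exp (real m) * exp (real (K\<mu> * j)))) = (ennreal 4 * ennreal (1 / 4)) * (\<Sum>j. excess_X (exp (real m) * exp (real (K\<mu> * j))))"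
        by (subst ennreal_mult[symmetric]) auto
      also have "\<dots> \<le> ennreal 4 * excess_W (exp (real m))"
        unfolding mult.assoc by (intro mult_left_mono t0(2) em True) simp
      finally have "ennreal (a m) * (\<Sum>j. excess_X (exp (real m) * exp (real (K\<mu> * j)))) \<le> ennreal (a m) * (ennreal 4 * excess_W (exp (real m)))"
        by (rule mult_left_mono) (rule zero_le)
      then show ?thesis using True by (simp only: if_True mult.left_commute)
    qed simp
  qed auto
  also have "\<dots> = ennreal 4 * (\<integral>\<^sup>+\<zeta>. (\<Sum>m. ennreal (a m) * (ennreal (Wl \<zeta>) - ennreal (exp (real m)))) \<partial>\<Omega>)"
    unfolding excess_W_def by (simp add: nn_integral_suminf nn_integral_cmult)
  also have "\<dots> \<le> ennreal 4 * (\<integral>\<^sup>+\<zeta>. ennreal (Wl \<zeta> * A (nat \<lfloor>log_plus (Wl \<zeta>)\<rfloor>)) \<partial>\<Omega>)"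
  proof (intro mult_left_mono nn_integral_mono)
    fix \<zeta>
    let ?w = "Wl \<zeta>" and ?n = "nat \<lfloor>log_plus (Wl \<zeta>)\<rfloor>"
    have zero: "ennreal ?w - ennreal (exp (real m)) = 0" if "\<not> m \<le> ?n" for m
    proof -
      have "\<not> exp (real m) < ?w"
      proof
        assume *: "exp (real m) < ?w"
        then have "0 < ?w" using exp_gt_zero[of "real m"] by linarith
        then have "ln (exp (real m)) < ln ?w" using * by (subst ln_less_cancel_iff) auto
        then have "real m < log_plus ?w" using \<open>0 < ?w\<close> by (simp add: log_plus_def)
        then show False using that by linarith
      qed
      then show ?thesis by (simp add: ennreal_minus ennreal_eq_0_iff)
    qed
    have "(\<Sum>m. ennreal (a m) * (ennreal ?w - ennreal (exp (real m)))) = (\<Sum>m\<le>?n. ennreal (a m) * (ennreal ?w - ennreal (exp (real m))))"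
      by (rule suminf_finite) (auto simp: zero)
    also have "\<dots> \<le> (\<Sum>m\<le>?n. ennreal (a m) * ennreal ?w)"
      by (intro sum_mono mult_left_mono) (auto simp: diff_le_self_ennreal)
    also have "\<dots> = ennreal (\<Sum>m\<le>?n. a m * ?w)"
      using a by (subst sum_ennreal[symmetric]) (auto simp: ennreal_mult)
    also have "\<dots> = ennreal (?w * A ?n)" by (simp add: A_def sum_distrib_left mult.commute)
    finally show "(\<Sum>m. ennreal (a m) * (ennreal ?w - ennreal (exp (real m)))) \<le> ennreal (?w * A ?n)" .
  qed simp
  also have "\<dots> < \<infinity>" using finite_moment_W by (simp add: finite_moment_W_def A_def ennreal_mult_less_top)
  finally have H: "(\<integral>\<^sup>+s. ?H (X s) \<partial>\<nu>) < \<infinity>" .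
  obtain C1 C2 where C: "0 \<le> C1" "0 \<le> C2" "\<And>x. 0 \<le> x \<Longrightarrow> ennreal (x * cumul A (log_plus x)) \<le>
      ennreal C1 * ?H x + ennreal C2 * (ennreal (x * log_plus x) + ennreal x)"
    using cumul_le_excess[OF a A, of m0 K\<mu>] unfolding A_def[abs_def, symmetric] by blast
  have "(\<integral>\<^sup>+s. ennreal (X s * cumul A (log_plus (X s))) \<partial>\<nu>) \<le>
      (\<integral>\<^sup>+s. ennreal C1 * ?H (X s) + ennreal C2 * (ennreal (X s * log_plus (X s)) + ennreal (X s)) \<partial>\<nu>)"
    by (intro nn_integral_mono C) simp
  also have "\<dots> = ennreal C1 * (\<integral>\<^sup>+s. ?H (X s) \<partial>\<nu>) + ennreal C2 * ((\<integral>\<^sup>+s. ennreal (X s * log_plus (X s)) \<partial>\<nu>) + 1)"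
    by (simp add: nn_integral_add nn_integral_cmult EX del: ennreal_suminf_cmult)
  also have "\<dots> < \<infinity>" using H eta_xlogx by (simp add: ennreal_mult_less_top)
  finally show ?thesis by (simp add: finite_moment_X_def A_def[abs_def])
qed

end

subsection \<open>Large terms\<close>

text \<open>Probabilities as integrals of 0-1 functions, so that Fubini,
  \<open>nn_integral_mix\<close> and the rules for sums apply to them directly.\<close>

abbreviation pr :: "'b measure \<Rightarrow> ('b \<Rightarrow> bool) \<Rightarrow> ennreal" where
  "pr M P \<equiv> \<integral>\<^sup>+x. (if P x then 1 else 0) \<partial>M"

lemma pr_mono_AE: "(AE x in M. P x \<longrightarrow> Q x) \<Longrightarrow> pr M P \<le> pr M Q"
  by (intro nn_integral_mono_AE) (auto elim: eventually_mono)

lemma pr_disj: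
  assumes [measurable]: "Measurable.pred M P" "Measurable.pred M Q"
  shows "pr M (\<lambda>x. P x \<or> Q x) \<le> pr M P + pr M Q"
proof -
  have "pr M (\<lambda>x. P x \<or> Q x) \<le> (\<integral>\<^sup>+x. (if P x then 1 else 0) + (if Q x then 1 else 0) \<partial>M)"
    by (intro nn_integral_mono) auto
  also have "\<dots> = pr M P + pr M Q" by (rule nn_integral_add) measurable
  finally show ?thesis .
qed

lemma (in prob_space) pr_le_1: "pr M P \<le> 1"
proof -
  have "pr M P \<le> (\<integral>\<^sup>+x. 1 \<partial>M)" by (intro nn_integral_mono) auto
  then show ?thesis by (simp add: emeasure_space_1)
qed

text \<open>A term above \<open>4 * C\<close> forces \<open>\<bar>S\<bar> > C\<close> unless the
  other terms compensate by falling below \<open>- 3 * C\<close>. They are independent of the event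
  \<open>E u\<close>, so compensation costs only a small fraction of its probability. The second
  moment method, applied to the number of uncompensated events, gives the bound on their
  union.\<close>

lemma (in prob_space) one_big_term:
  fixes T :: "'i::countable \<Rightarrow> 'a \<Rightarrow> real" and E :: "'i \<Rightarrow> 'a \<Rightarrow> bool" and \<kappa> C :: real
  assumes [measurable]: "\<And>u. u \<in> I \<Longrightarrow> T u \<in> borel_measurable M" "\<And>u. u \<in> I \<Longrightarrow> Measurable.pred M (E u)"
    and T0: "\<And>u x. 0 \<le> T u x"
    and fin: "AE x in M. csum I (\<lambda>u. ennreal (T u x)) < \<infinity>"
    and ET: "\<And>u x. u \<in> I \<Longrightarrow> E u x \<Longrightarrow> 4 * C < T u x"
    and EE: "\<And>u v. u \<in> I \<Longrightarrow> v \<in> I \<Longrightarrow> u \<noteq> v \<Longrightarrow> pr M (\<lambda>x. E u x \<and> E v x) \<le> pr M (E u) * pr M (E v)"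
    and rest: "\<And>u. u \<in> I \<Longrightarrow>
      pr M (\<lambda>x. E u x \<and> \<kappa> + enn2real (csum (I - {u}) (\<lambda>v. ennreal (T v x))) < - 3 * C) \<le>
      pr M (E u) * pr M (\<lambda>x. \<kappa> + enn2real (csum (I - {u}) (\<lambda>v. ennreal (T v x))) < - 3 * C)"
    and T_small: "\<And>u. u \<in> I \<Longrightarrow> pr M (\<lambda>x. 2 * C \<le> T u x) \<le> ennreal (1 / 16)"
    and S_small: "pr M (\<lambda>x. C < \<bar>\<kappa> + enn2real (csum I (\<lambda>u. ennreal (T u x)))\<bar>) \<le> ennreal (1 / 16)"
    and s: "csum I (\<lambda>u. pr M (E u)) = ennreal s" "0 \<le> s"
  shows "ennreal (s / (2 * (1 + s))) \<le>
    pr M (\<lambda>x. C < \<bar>\<kappa> + enn2real (csum I (\<lambda>u. ennreal (T u x)))\<bar> \<and> (\<exists>u\<in>I. E u x))"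
proof -
  define S where "S x = \<kappa> + enn2real (csum I (\<lambda>u. ennreal (T u x)))" for x
  define r where "r u x = \<kappa> + enn2real (csum (I - {u}) (\<lambda>v. ennreal (T v x)))" for u x
  have [measurable]: "S \<in> borel_measurable M" unfolding S_def[abs_def] by measurable
  have [measurable]: "r u \<in> borel_measurable M" for u unfolding r_def[abs_def] by measurable
  have Sr: "AE x in M. S x = T u x + r u x" if u: "u \<in> I" for u
    using fin
  proof eventually_elim
    case (elim x)
    then show ?case unfolding S_def r_def csum_diff_single[OF u]
      using T0 by (subst enn2real_plus) auto
  qed
  \<comment> \<open>If \<open>\<bar>S\<bar> \<le> C\<close> and \<open>T u < 2 * C\<close>, the rest
    is above \<open>- 3 * C\<close>. Both exceptions have probability at most 1/16.\<close>
  have r_small: "pr M (\<lambda>x. r u x < - 3 * C) \<le> ennreal (1 / 8)" if u: "u \<in> I" for u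
  proof -
    have "pr M (\<lambda>x. r u x < - 3 * C) \<le> pr M (\<lambda>x. C < \<bar>S x\<bar> \<or> 2 * C \<le> T u x)"
      using Sr[OF u] by (intro pr_mono_AE, eventually_elim) auto
    also have "\<dots> \<le> pr M (\<lambda>x. C < \<bar>S x\<bar>) + pr M (\<lambda>x. 2 * C \<le> T u x)"
      using u by (intro pr_disj) measurable
    also have "\<dots> \<le> ennreal (1 / 16) + ennreal (1 / 16)"
      using S_small T_small[OF u] unfolding S_def by (intro add_mono)
    also have "\<dots> = ennreal (1 / 8)" by (subst ennreal_plus[symmetric]) auto
    finally show ?thesis .
  qed
  define f :: "'i \<Rightarrow> 'a \<Rightarrow> ennreal" where "f u x = (if E u x \<and> C < \<bar>S x\<bar> then 1 else 0)" for u x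
  have f_meas [measurable]: "f u \<in> borel_measurable M" if "u \<in> I" for u
    using that unfolding f_def[abs_def] by measurable
  define N where "N x = csum I (\<lambda>u. f u x)" for x
  have [measurable]: "N \<in> borel_measurable M" unfolding N_def[abs_def] by measurable
  have Ef: "pr M (E u) \<le> (\<integral>\<^sup>+x. f u x \<partial>M) + pr M (E u) * ennreal (1 / 8)" if u: "u \<in> I" for u
  proof -
    have "pr M (E u) \<le> (\<integral>\<^sup>+x. f u x + (if E u x \<and> r u x < - 3 * C then 1 else 0) \<partial>M)"
    proof (intro nn_integral_mono_AE)
      show "AE x in M. (if E u x then 1 else 0) \<le> f u x + (if E u x \<and> r u x < - 3 * C then 1 else 0)"
        using Sr[OF u] by eventually_elim (use ET[OF u] in \<open>auto simp: f_def not_less\<close>, smt (verit))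
    qed
    also have "\<dots> = (\<integral>\<^sup>+x. f u x \<partial>M) + pr M (\<lambda>x. E u x \<and> r u x < - 3 * C)"
      using u by (intro nn_integral_add) measurable
    also have "\<dots> \<le> (\<integral>\<^sup>+x. f u x \<partial>M) + pr M (E u) * pr M (\<lambda>x. r u x < - 3 * C)"
      using rest[OF u] unfolding r_def by (intro add_left_mono)
    also have "\<dots> \<le> (\<integral>\<^sup>+x. f u x \<partial>M) + pr M (E u) * ennreal (1 / 8)"
      by (intro add_left_mono mult_left_mono r_small u) simp
    finally show ?thesis .
  qed
  have EN: "(\<integral>\<^sup>+x. N x \<partial>M) = csum I (\<lambda>u. \<integral>\<^sup>+x. f u x \<partial>M)"
    unfolding N_def by (rule csum_nn_integral) measurable
  have "csum I (\<lambda>u. pr M (E u)) \<le> csum I (\<lambda>u. (\<integral>\<^sup>+x. f u x \<partial>M) + pr M (E u) * ennreal (1 / 8))"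
    by (intro csum_mono Ef)
  also have "\<dots> = (\<integral>\<^sup>+x. N x \<partial>M) + csum I (\<lambda>u. pr M (E u)) * ennreal (1 / 8)"
    unfolding EN by (subst nn_integral_add) (auto simp: nn_integral_multc)
  finally have 1: "ennreal s \<le> (\<integral>\<^sup>+x. N x \<partial>M) + ennreal s * ennreal (1 / 8)" unfolding s .
  have f_le: "f u x \<le> (if E u x then 1 else 0)" for u x by (auto simp: f_def)
  have "(\<integral>\<^sup>+x. N x \<partial>M) \<le> ennreal s"
    unfolding EN s(1)[symmetric] by (intro csum_mono nn_integral_mono f_le)
  then obtain m where m: "(\<integral>\<^sup>+x. N x \<partial>M) = ennreal m" "0 \<le> m"
    by (cases "\<integral>\<^sup>+x. N x \<partial>M") (auto simp: top_unique)
  have "ennreal s \<le> ennreal (m + s * (1 / 8))"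
  proof -
    have "ennreal s * ennreal (1 / 8) = ennreal (s * (1 / 8))" using s(2) by (intro ennreal_mult[symmetric]) auto
    moreover have "ennreal (m + s * (1 / 8)) = ennreal m + ennreal (s * (1 / 8))" using s(2) m(2) by (intro ennreal_plus) auto
    ultimately show ?thesis using 1 unfolding m(1) by simp
  qed
  then have ms: "7 / 8 * s \<le> m" using s(2) m(2) by (subst (asm) ennreal_le_iff) auto
  \<comment> \<open>The first moment of \<open>N\<close> is at least \<open>7 / 8 * s\<close>, the
    second at most \<open>s + s * s\<close>. Cauchy-Schwarz bounds the probability below by
    \<open>49 / 64 * s / (1 + s)\<close>, and 49/64 exceeds 1/2.\<close>
  have "(\<integral>\<^sup>+x. (N x)\<^sup>2 \<partial>M) = (\<integral>\<^sup>+x. csum I (\<lambda>u. csum I (\<lambda>v. f u x * f v x)) \<partial>M)"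
    unfolding N_def by (intro nn_integral_cong) (simp add: power2_eq_square nn_integral_cmult nn_integral_multc)
  also have "\<dots> = csum I (\<lambda>u. \<integral>\<^sup>+x. csum I (\<lambda>v. f u x * f v x) \<partial>M)"
    by (rule csum_nn_integral) measurable
  also have "\<dots> = csum I (\<lambda>u. csum I (\<lambda>v. \<integral>\<^sup>+x. f u x * f v x \<partial>M))"
    by (intro csum_cong csum_nn_integral) measurable
  also have "\<dots> \<le> csum I (\<lambda>u. csum I (\<lambda>v. pr M (E u) * indicator {u} v + pr M (E u) * pr M (E v)))"
  proof (intro csum_mono)
    fix u v assume uv: "u \<in> I" "v \<in> I"
    show "(\<integral>\<^sup>+x. f u x * f v x \<partial>M) \<le> pr M (E u) * indicator {u} v + pr M (E u) * pr M (E v)"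
    proof (cases "u = v")
      case True
      have "(\<integral>\<^sup>+x. f u x * f v x \<partial>M) \<le> pr M (E u)" using True by (intro nn_integral_mono) (auto simp: f_def)
      then show ?thesis using True by (simp add: add_increasing2)
    next
      case False
      have "(\<integral>\<^sup>+x. f u x * f v x \<partial>M) \<le> pr M (\<lambda>x. E u x \<and> E v x)" by (intro nn_integral_mono) (auto simp: f_def)
      also have "\<dots> \<le> pr M (E u) * pr M (E v)" by (rule EE[OF uv False])
      finally show ?thesis by (simp add: add_increasing)
    qed
  qed
  also have "\<dots> = csum I (\<lambda>u. pr M (E u)) + ennreal s * ennreal s"
    by (simp add: nn_integral_add nn_integral_cmult nn_integral_multc s(1) emeasure_count_space_finite
        nn_integral_cmult_indicator cong: nn_integral_cong_simp)
  also have "\<dots> = ennreal (s + s * s)" using s by (simp add: ennreal_plus ennreal_mult)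
  finally have N2: "(\<integral>\<^sup>+x. (N x)\<^sup>2 \<partial>M) \<le> ennreal (s + s * s)" .
  let ?P = "pr M (\<lambda>x. C < \<bar>S x\<bar> \<and> (\<exists>u\<in>I. E u x))"
  define g :: "'a \<Rightarrow> ennreal" where "g x = (if C < \<bar>S x\<bar> \<and> (\<exists>u\<in>I. E u x) then 1 else 0)" for x
  have [measurable]: "g \<in> borel_measurable M" unfolding g_def[abs_def] by measurable
  have "?P \<le> 1" by (rule pr_le_1)
  then obtain p where p: "?P = ennreal p" "0 \<le> p" by (cases ?P) (auto simp: top_unique)
  have Ng: "N x * g x = N x" for x
  proof (cases "g x = 1")
    case False
    then have "f u x = 0" if "u \<in> I" for u using that by (auto simp: g_def f_def split: if_splits)
    then have "N x = csum I (\<lambda>_. 0)" unfolding N_def by (intro csum_cong)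
    then show ?thesis by simp
  qed simp
  have "(\<integral>\<^sup>+x. N x * g x \<partial>M)\<^sup>2 \<le> (\<integral>\<^sup>+x. (N x)\<^sup>2 \<partial>M) * (\<integral>\<^sup>+x. (g x)\<^sup>2 \<partial>M)"
    by (rule Cauchy_Schwarz_nn_integral) measurable
  also have "(\<integral>\<^sup>+x. (g x)\<^sup>2 \<partial>M) = ?P" by (intro nn_integral_cong) (simp add: g_def)
  also have "(\<integral>\<^sup>+x. (N x)\<^sup>2 \<partial>M) * ?P \<le> ennreal (s + s * s) * ennreal p"
    unfolding p(1) by (intro mult_right_mono N2) simp
  finally have "ennreal (m\<^sup>2) \<le> ennreal ((s + s * s) * p)"
    unfolding Ng m(1) using m(2) s(2) p(2) by (simp add: ennreal_power ennreal_mult)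
  then have "m\<^sup>2 \<le> (s + s * s) * p" using s(2) p(2) by (subst (asm) ennreal_le_iff) auto
  moreover have "(7 / 8 * s)\<^sup>2 \<le> m\<^sup>2" using ms s(2) by (intro power_mono) auto
  ultimately have main: "(7 / 8 * s)\<^sup>2 \<le> (s + s * s) * p" by linarith
  have "s / (2 * (1 + s)) \<le> p"
  proof (cases "s = 0")
    case False
    then have sp: "0 < s" using s(2) by simp
    have "s * (49 / 64 * s) \<le> s * ((1 + s) * p)" using main by (simp add: power2_eq_square algebra_simps)
    then have "49 / 64 * s \<le> (1 + s) * p" using sp by simp
    moreover have "0 \<le> (1 + s) * p" using sp p(2) by simp
    ultimately have "s \<le> 2 * ((1 + s) * p)" using sp by linarith
    then show ?thesis using sp by (simp add: field_simps)
  qed (use p in simp)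
  then show ?thesis unfolding S_def[symmetric] p(1) by (rule ennreal_leI)
qed

text \<open>Decomposes the occurrence of \<open>H n\<close> for some \<open>n\<close> according to the first such \<open>n\<close>.\<close>

lemma first_time_bound:
  fixes c :: ennreal and H :: "nat \<Rightarrow> 'b \<Rightarrow> bool"
  assumes [measurable]: "\<And>n. Measurable.pred M (H n)" "Measurable.pred M Q"
    and le: "\<And>n. pr M (\<lambda>x. (\<forall>m<n. \<not> H m x) \<and> H n x) \<le> c * pr M (\<lambda>x. ((\<forall>m<n. \<not> H m x) \<and> H n x) \<and> Q x)"
  shows "pr M (\<lambda>x. \<exists>n. H n x) \<le> c * pr M Q"
proof -
  let ?F = "\<lambda>n x. (\<forall>m<n. \<not> H m x) \<and> H n x"
  have F: "(\<Sum>n. if ?F n x \<and> R then 1 else 0 :: ennreal) = (if (\<exists>n. H n x) \<and> R then 1 else 0)" for x R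
  proof (cases "(\<exists>n. H n x) \<and> R")
    case True
    define n where "n = (LEAST n. H n x)"
    have n: "H n x" "\<And>m. m < n \<Longrightarrow> \<not> H m x"
      unfolding n_def using True LeastI_ex[of "\<lambda>n. H n x"] not_less_Least by auto
    then have "?F k x \<longleftrightarrow> k = n" for k by (metis linorder_neqE_nat)
    then have "(\<Sum>k. if ?F k x \<and> R then 1 else 0 :: ennreal) = (\<Sum>k. if k = n then 1 else 0)"
      using True by (intro suminf_cong) auto
    also have "\<dots> = (\<Sum>k\<in>{n}. if k = n then 1 else 0)" by (rule suminf_finite) auto
    finally show ?thesis using True by simp
  next
    case False
    then have "(\<Sum>k. if ?F k x \<and> R then 1 else 0 :: ennreal) = (\<Sum>k. 0)" by (intro suminf_cong) auto
    then show ?thesis using False by simp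
  qed
  have "pr M (\<lambda>x. \<exists>n. H n x) = (\<integral>\<^sup>+x. (\<Sum>n. if ?F n x \<and> True then 1 else 0) \<partial>M)"
    unfolding F by simp
  also have "\<dots> = (\<Sum>n. pr M (?F n))" by (subst nn_integral_suminf) auto
  also have "\<dots> \<le> (\<Sum>n. c * pr M (\<lambda>x. ?F n x \<and> Q x))" by (intro suminf_le le) auto
  also have "\<dots> = c * (\<integral>\<^sup>+x. (\<Sum>n. if ?F n x \<and> Q x then 1 else 0) \<partial>M)"
    by (subst nn_integral_suminf) auto
  also have "(\<integral>\<^sup>+x. (\<Sum>n. if ?F n x \<and> Q x then 1 else 0) \<partial>M) \<le> pr M Q"
    unfolding F by (intro nn_integral_mono) auto
  finally show ?thesis by (simp add: mult_left_mono)
qed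

section \<open>Conditioning on the generations before a large term\<close>

context weighted_branching_xlogx
begin

lemma Wl_truncation: "\<exists>K::nat. 1 \<le> K \<and> ennreal (3 / 4) \<le> (\<integral>\<^sup>+\<zeta>. ennreal (min (Wl \<zeta>) (real K)) \<partial>\<Omega>)"
proof -
  have "(\<lambda>K::nat. \<integral>\<^sup>+\<zeta>. ennreal (min (Wl \<zeta>) (real K)) \<partial>\<Omega>) \<longlonglongrightarrow> (\<integral>\<^sup>+\<zeta>. ennreal (Wl \<zeta>) \<partial>\<Omega>)"
  proof (rule nn_integral_dominated_convergence[where w = "\<lambda>\<zeta>. ennreal (Wl \<zeta>)"])
    show "AE \<zeta> in \<Omega>. (\<lambda>K::nat. ennreal (min (Wl \<zeta>) (real K))) \<longlonglongrightarrow> ennreal (Wl \<zeta>)"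
    proof (rule AE_I2)
      fix \<zeta>
      obtain N :: nat where "Wl \<zeta> \<le> real N" using real_arch_simple by blast
      then show "(\<lambda>K::nat. ennreal (min (Wl \<zeta>) (real K))) \<longlonglongrightarrow> ennreal (Wl \<zeta>)"
        by (intro tendsto_eventually eventually_sequentiallyI[of N]) auto
    qed
  qed (auto simp: expect_Wl intro!: ennreal_leI)
  then have "eventually (\<lambda>K::nat. ennreal (3 / 4) < (\<integral>\<^sup>+\<zeta>. ennreal (min (Wl \<zeta>) (real K)) \<partial>\<Omega>)) sequentially"
    unfolding expect_Wl by (rule order_tendstoD) (simp add: ennreal_less_one_iff)
  then obtain N where "\<And>K. N \<le> K \<Longrightarrow> ennreal (3 / 4) < (\<integral>\<^sup>+\<zeta>. ennreal (min (Wl \<zeta>) (real K)) \<partial>\<Omega>)"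
    by (auto simp: eventually_sequentially)
  from this[of "Suc N"] show ?thesis by (intro exI[of _ "Suc N"]) auto
qed

lemma Wl_branch_mix:
  "AE \<zeta> in \<Omega>. AE \<zeta>' in \<Omega>. ennreal (Wl (mix (before n) \<zeta> \<zeta>')) =
    csum (gen n) (\<lambda>u. ennreal (Y u \<zeta>) * ennreal (Wl (sub u \<zeta>')))"
  using AE_mix[OF Wl_branch[of n], of "before n"]
  by (elim eventually_mono) (auto elim!: eventually_mono intro!: csum_cong)

text \<open>Given the root, \<open>W\<close> is a weighted sum of independent copies with
  conditional mean \<open>X\<close>. Truncating the copies at \<open>K\<close> keeps at least 3/4 of
  the mean and bounds the sum by \<open>K * X\<close>, so it exceeds half of \<open>X\<close> with
  probability at least \<open>1 / (4 * K)\<close>. No second moment of \<open>W\<close> is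
  involved.\<close>

lemma Wl_large_given_root:
  "\<exists>c. 0 < c \<and> c \<le> 1 \<and> (\<forall>b\<ge>0. ennreal c * pr \<nu> (\<lambda>s. b < X s) \<le> pr \<Omega> (\<lambda>\<zeta>. b < X (\<zeta> []) \<and> X (\<zeta> []) < 2 * Wl \<zeta>))"
proof -
  obtain K :: nat where K: "1 \<le> K" "ennreal (3 / 4) \<le> (\<integral>\<^sup>+\<zeta>. ennreal (min (Wl \<zeta>) (real K)) \<partial>\<Omega>)"
    using Wl_truncation by auto
  let ?c = "1 / (4 * real K)"
  have AE: "AE \<zeta> in \<Omega>. AE \<zeta>' in \<Omega>. ennreal (Wl (mix (before 1) \<zeta> \<zeta>')) =
      csum (gen 1) (\<lambda>u. ennreal (Y u \<zeta>) * ennreal (Wl (sub u \<zeta>')))"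
    by (rule Wl_branch_mix)
  have "ennreal ?c * pr \<nu> (\<lambda>s. b < X s) \<le> pr \<Omega> (\<lambda>\<zeta>. b < X (\<zeta> []) \<and> X (\<zeta> []) < 2 * Wl \<zeta>)" if b: "0 \<le> b" for b
  proof -
    have "pr \<nu> (\<lambda>s. b < X s) = pr \<Omega> (\<lambda>\<zeta>. b < X (\<zeta> []))"
      by (rule nn_integral_coord[symmetric]) measurable
    then have "ennreal ?c * pr \<nu> (\<lambda>s. b < X s) = (\<integral>\<^sup>+\<zeta>. (if b < X (\<zeta> []) then ennreal ?c else 0) \<partial>\<Omega>)"
      by (simp add: nn_integral_cmult[symmetric] if_distrib cong: if_cong)
    also have "\<dots> \<le> (\<integral>\<^sup>+\<zeta>. pr \<Omega> (\<lambda>\<zeta>'. b < X (\<zeta> []) \<and> X (\<zeta> []) < 2 * Wl (mix (before 1) \<zeta> \<zeta>')) \<partial>\<Omega>)"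
    proof (intro nn_integral_mono_AE)
      show "AE \<zeta> in \<Omega>. (if b < X (\<zeta> []) then ennreal ?c else 0) \<le>
          pr \<Omega> (\<lambda>\<zeta>'. b < X (\<zeta> []) \<and> X (\<zeta> []) < 2 * Wl (mix (before 1) \<zeta> \<zeta>'))"
        using AE
      proof eventually_elim
        case (elim \<zeta>)
        show ?case
        proof (cases "b < X (\<zeta> [])")
          case True
          define x where "x = X (\<zeta> [])"
          have x: "0 < x" "b < x" using True b by (auto simp: x_def)
          have W1: "csum (gen 1) (\<lambda>u. ennreal (Y u \<zeta>)) = ennreal x"
            using WE_Suc[of 0 \<zeta>] by (simp add: WE_def x_def)
          define T where "T \<zeta>' = csum (gen 1) (\<lambda>u. ennreal (Y u \<zeta>) * ennreal (min (Wl (sub u \<zeta>')) (real K)))" for \<zeta>'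
          have [measurable]: "T \<in> borel_measurable \<Omega>" unfolding T_def[abs_def] by measurable
          let ?p = "pr \<Omega> (\<lambda>\<zeta>'. x < 2 * enn2real (T \<zeta>'))"
          have "(\<integral>\<^sup>+\<zeta>'. T \<zeta>' \<partial>\<Omega>) = csum (gen 1) (\<lambda>u. \<integral>\<^sup>+\<zeta>'. ennreal (Y u \<zeta>) * ennreal (min (Wl (sub u \<zeta>')) (real K)) \<partial>\<Omega>)"
            unfolding T_def by (rule csum_nn_integral) measurable
          also have "\<dots> = csum (gen 1) (\<lambda>u. ennreal (Y u \<zeta>) * (\<integral>\<^sup>+\<zeta>'. ennreal (min (Wl \<zeta>') (real K)) \<partial>\<Omega>))"
            by (intro csum_cong, subst nn_integral_cmult, measurable) (subst nn_integral_sub[symmetric], auto)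
          also have "\<dots> = ennreal x * (\<integral>\<^sup>+\<zeta>'. ennreal (min (Wl \<zeta>') (real K)) \<partial>\<Omega>)"
            by (subst nn_integral_multc) (use W1 in auto)
          also have "\<dots> \<ge> ennreal x * ennreal (3 / 4)" by (intro mult_left_mono K) simp
          finally have low: "ennreal x * ennreal (3 / 4) \<le> (\<integral>\<^sup>+\<zeta>'. T \<zeta>' \<partial>\<Omega>)" .
          have T_le: "T \<zeta>' \<le> ennreal (x * real K)" for \<zeta>'
          proof -
            have "T \<zeta>' \<le> csum (gen 1) (\<lambda>u. ennreal (Y u \<zeta>) * ennreal (real K))"
              unfolding T_def by (intro csum_mono mult_left_mono ennreal_leI) auto
            also have "\<dots> = csum (gen 1) (\<lambda>u. ennreal (Y u \<zeta>)) * ennreal (real K)"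
              by (rule nn_integral_multc) simp
            also have "\<dots> = ennreal (x * real K)" unfolding W1 using x by (intro ennreal_mult[symmetric]) auto
            finally show ?thesis .
          qed
          have "(\<integral>\<^sup>+\<zeta>'. T \<zeta>' \<partial>\<Omega>) \<le> (\<integral>\<^sup>+\<zeta>'. ennreal (x / 2) + ennreal (x * real K) * (if x < 2 * enn2real (T \<zeta>') then 1 else 0) \<partial>\<Omega>)"
          proof (intro nn_integral_mono)
            fix \<zeta>'
            have "T \<zeta>' < \<infinity>" using T_le by (rule le_less_trans) simp
            then obtain y where y: "T \<zeta>' = ennreal y" "0 \<le> y" by (cases "T \<zeta>'") auto
            show "T \<zeta>' \<le> ennreal (x / 2) + ennreal (x * real K) * (if x < 2 * enn2real (T \<zeta>') then 1 else 0)"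
            proof (cases "x < 2 * y")
              case True
              then show ?thesis using T_le[of \<zeta>'] y by (simp add: add_increasing)
            next
              case False
              then have "ennreal y \<le> ennreal (x / 2)" by (intro ennreal_leI) simp
              then show ?thesis using y False by simp
            qed
          qed
          also have "\<dots> = ennreal (x / 2) + ennreal (x * real K) * ?p"
            by (subst nn_integral_add) (auto simp: nn_integral_cmult prod.P.emeasure_space_1)
          finally have up: "ennreal x * ennreal (3 / 4) \<le> ennreal (x / 2) + ennreal (x * real K) * ?p"
            by (rule order.trans[OF low])
          have "?p \<le> 1" by (rule prod.P.pr_le_1)
          then obtain p where p: "?p = ennreal p" "0 \<le> p" by (cases ?p) (auto simp: top_unique)
          have "ennreal (x * (3 / 4)) \<le> ennreal (x / 2 + x * real K * p)"
          proof -
            have 1: "ennreal (x * (3 / 4)) = ennreal x * ennreal (3 / 4)" using x by (intro ennreal_mult) auto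
            have 2: "ennreal (x * real K * p) = ennreal (x * real K) * ennreal p" using x p by (intro ennreal_mult) auto
            have 3: "ennreal (x / 2 + x * real K * p) = ennreal (x / 2) + ennreal (x * real K * p)"
              using x p by (intro ennreal_plus) auto
            show ?thesis unfolding 1 3 2 using up unfolding p(1) .
          qed
          then have "x * (3 / 4) \<le> x / 2 + x * real K * p" using x p by (subst (asm) ennreal_le_iff) auto
          then have "x * (1 / 4) \<le> x * (real K * p)" by (simp add: algebra_simps)
          then have "1 / 4 \<le> real K * p" using x by (subst (asm) mult_le_cancel_left_pos) auto
          then have "?c \<le> p" using K by (simp add: field_simps)
          then have "ennreal ?c \<le> ?p" unfolding p(1) by (rule ennreal_leI)
          also have "?p \<le> pr \<Omega> (\<lambda>\<zeta>'. b < X (\<zeta> []) \<and> X (\<zeta> []) < 2 * Wl (mix (before 1) \<zeta> \<zeta>'))"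
          proof (rule pr_mono_AE)
            show "AE \<zeta>' in \<Omega>. x < 2 * enn2real (T \<zeta>') \<longrightarrow> b < X (\<zeta> []) \<and> X (\<zeta> []) < 2 * Wl (mix (before 1) \<zeta> \<zeta>')"
              using elim
            proof eventually_elim
              case (elim \<zeta>')
              have "T \<zeta>' \<le> ennreal (Wl (mix (before 1) \<zeta> \<zeta>'))"
                unfolding elim T_def by (intro csum_mono mult_left_mono ennreal_leI) auto
              then have "enn2real (T \<zeta>') \<le> Wl (mix (before 1) \<zeta> \<zeta>')"
                by (metis Wl_nonneg enn2real_ennreal enn2real_mono ennreal_less_top)
              then show ?case using True by (auto simp: x_def)
            qed
          qed
          finally show ?thesis using True by simp
        qed simp
      qed
    qed
    also have "\<dots> = (\<integral>\<^sup>+\<zeta>. pr \<Omega> (\<lambda>\<zeta>'. b < X (mix (before 1) \<zeta> \<zeta>' []) \<and> X (mix (before 1) \<zeta> \<zeta>' []) < 2 * Wl (mix (before 1) \<zeta> \<zeta>')) \<partial>\<Omega>)"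
      by (simp add: mix_def)
    also have "\<dots> = pr \<Omega> (\<lambda>\<zeta>. b < X (\<zeta> []) \<and> X (\<zeta> []) < 2 * Wl \<zeta>)"
      by (rule nn_integral_mix) measurable
    finally show ?thesis .
  qed
  moreover have "0 < ?c" "?c \<le> 1" using K by (auto simp: field_simps)
  ultimately show ?thesis by blast
qed

definition root_jump_prob :: real where
  "root_jump_prob = (SOME c. 0 < c \<and> c \<le> 1 \<and> (\<forall>b\<ge>0. ennreal c * pr \<nu> (\<lambda>s. b < X s) \<le> pr \<Omega> (\<lambda>\<zeta>. b < X (\<zeta> []) \<and> X (\<zeta> []) < 2 * Wl \<zeta>)))"

lemma root_jump_prob: "0 < root_jump_prob" "root_jump_prob \<le> 1"
  "\<And>b. 0 \<le> b \<Longrightarrow> ennreal root_jump_prob * pr \<nu> (\<lambda>s. b < X s) \<le> pr \<Omega> (\<lambda>\<zeta>. b < X (\<zeta> []) \<and> X (\<zeta> []) < 2 * Wl \<zeta>)"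
  using someI_ex[OF Wl_large_given_root] unfolding root_jump_prob_def[symmetric] by auto

text \<open>Partial sums with the final \<open>W\<close> in place. They depend on the whole tree,
  but given the first \<open>N\<close> generations they are affine in \<open>W\<close>.\<close>

definition R :: "(nat \<Rightarrow> real) \<Rightarrow> nat \<Rightarrow> (nat list \<Rightarrow> 'a) \<Rightarrow> real" where
  "R a N \<zeta> = (\<Sum>n<N. a n * (Wl \<zeta> - Wr n \<zeta>))"

lemma R_meas [measurable]: "R a N \<in> borel_measurable \<Omega>" unfolding R_def[abs_def] by measurable

lemma markov_real:
  assumes [measurable]: "f \<in> borel_measurable M" and f: "\<And>x. 0 \<le> f x" and c: "0 < c"
  shows "pr M (\<lambda>x. c \<le> f x) \<le> (\<integral>\<^sup>+x. ennreal (f x) \<partial>M) * ennreal (1 / c)"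
proof -
  have "pr M (\<lambda>x. c \<le> f x) \<le> (\<integral>\<^sup>+x. ennreal (f x) * ennreal (1 / c) \<partial>M)"
  proof (intro nn_integral_mono)
    fix x
    have "1 \<le> ennreal (f x * (1 / c))" if "c \<le> f x"
    proof -
      have "1 \<le> f x * (1 / c)" using that c by simp
      then show ?thesis using ennreal_leI[of 1 "f x * (1 / c)"] by simp
    qed
    then show "(if c \<le> f x then 1 else 0) \<le> ennreal (f x) * ennreal (1 / c)"
      using f[of x] c by (auto simp: ennreal_mult[symmetric])
  qed
  then show ?thesis by (simp add: nn_integral_multc)
qed

text \<open>For frozen labels before generation \<open>n\<close>, the partial sum is a constant plus
  the sum of \<open>q u\<close> times the limit of the subtree at \<open>u\<close>, over independent
  subtrees. A label mass above the level, followed by a subtree limit of at least half that mass, is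
  a single big term; the bound \<open>C / 8\<close> on \<open>q u\<close> makes
  \<open>T u \<ge> 2 * C\<close> improbable.\<close>

lemma jump_step:
  fixes a :: "nat \<Rightarrow> real"
  assumes a: "\<And>n. 0 \<le> a n" and C: "0 < C"
    and fin: "WE n \<zeta> < \<infinity>"
    and branch: "AE \<zeta>' in \<Omega>. ennreal (Wl (mix (before n) \<zeta> \<zeta>')) =
      csum (gen n) (\<lambda>u. ennreal (Y u \<zeta>) * ennreal (Wl (sub u \<zeta>')))"
    and q_le: "\<And>u. u \<in> gen n \<Longrightarrow> (\<Sum>k\<le>n. a k) * Y u \<zeta> \<le> C / 8"
    and small: "pr \<Omega> (\<lambda>\<zeta>'. C < \<bar>R a (Suc n) (mix (before n) \<zeta> \<zeta>')\<bar>) \<le> ennreal (1 / 16)"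
  shows "ennreal (root_jump_prob / 4) * pr \<Omega> (\<lambda>\<zeta>'. \<exists>u\<in>gen n. 8 * C < (\<Sum>k\<le>n. a k) * Y u \<zeta> * X (\<zeta>' u)) \<le>
    pr \<Omega> (\<lambda>\<zeta>'. C < \<bar>R a (Suc n) (mix (before n) \<zeta> \<zeta>')\<bar> \<and> (\<exists>u\<in>gen n. 8 * C < (\<Sum>k\<le>n. a k) * Y u \<zeta> * X (\<zeta>' u)))"
proof -
  define An where "An = (\<Sum>k\<le>n. a k)"
  have An: "0 \<le> An" unfolding An_def using a by (intro sum_nonneg) auto
  define q where "q u = An * Y u \<zeta>" for u
  have q0: "0 \<le> q u" for u unfolding q_def using An by simp
  define T where "T u \<zeta>' = q u * Wl (sub u \<zeta>')" for u and \<zeta>' :: "nat list \<Rightarrow> 'a"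
  define E where "E u \<zeta>' \<longleftrightarrow> 8 * C < q u * X (\<zeta>' u) \<and> X (\<zeta>' u) < 2 * Wl (sub u \<zeta>')" for u and \<zeta>' :: "nat list \<Rightarrow> 'a"
  define \<kappa> where "\<kappa> = - (\<Sum>l\<le>n. a l * Wr l \<zeta>)"
  have Tm [measurable]: "T u \<in> borel_measurable \<Omega>" for u unfolding T_def[abs_def] by measurable
  have Em [measurable]: "Measurable.pred \<Omega> (E u)" for u unfolding E_def[abs_def] by measurable
  have T0: "0 \<le> T u \<zeta>'" for u \<zeta>' unfolding T_def using q0 by simp
  have csumT: "csum (gen n) (\<lambda>u. ennreal (T u \<zeta>')) = ennreal An * csum (gen n) (\<lambda>u. ennreal (Y u \<zeta>) * ennreal (Wl (sub u \<zeta>')))" for \<zeta>'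
    unfolding T_def q_def using An by (subst nn_integral_cmult[symmetric]) (auto simp: ennreal_mult mult.assoc)
  have AE_T: "AE \<zeta>' in \<Omega>. csum (gen n) (\<lambda>u. ennreal (T u \<zeta>')) = ennreal (An * Wl (mix (before n) \<zeta> \<zeta>'))"
    using branch by eventually_elim (use An in \<open>simp add: csumT ennreal_mult\<close>)
  have AE_R: "AE \<zeta>' in \<Omega>. R a (Suc n) (mix (before n) \<zeta> \<zeta>') = \<kappa> + enn2real (csum (gen n) (\<lambda>u. ennreal (T u \<zeta>')))"
    using AE_T
  proof eventually_elim
    case (elim \<zeta>')
    have "R a (Suc n) (mix (before n) \<zeta> \<zeta>') = (\<Sum>l\<le>n. a l * (Wl (mix (before n) \<zeta> \<zeta>') - Wr l \<zeta>))"
      unfolding R_def lessThan_Suc_atMost by (intro sum.cong) auto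
    also have "\<dots> = \<kappa> + An * Wl (mix (before n) \<zeta> \<zeta>')"
      by (simp add: \<kappa>_def An_def right_diff_distrib sum_subtractf sum_distrib_right)
    finally show ?case unfolding elim using An by simp
  qed
  \<comment> \<open>For \<open>u\<close> of length \<open>n\<close> this is the subtree rooted at
    \<open>u\<close>: words shorter than \<open>n\<close> are their own prefixes and differ from
    \<open>u\<close>.\<close>
  let ?S = "\<lambda>u. {w. take n w = u}"
  have mix_in: "sub u (mix (?S u) \<zeta>1 \<zeta>2) = sub u \<zeta>1" "mix (?S u) \<zeta>1 \<zeta>2 u = \<zeta>1 u"
    if "u \<in> gen n" for u \<zeta>1 and \<zeta>2 :: "nat list \<Rightarrow> 'a"
    using that by (auto simp: sub_def mix_def)
  have mix_out: "sub v (mix (?S u) \<zeta>1 \<zeta>2) = sub v \<zeta>2" "mix (?S u) \<zeta>1 \<zeta>2 v = \<zeta>2 v"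
    if "u \<in> gen n" "v \<in> gen n" "v \<noteq> u" for u v \<zeta>1 and \<zeta>2 :: "nat list \<Rightarrow> 'a"
    using that by (auto simp: sub_def mix_def)
  have pE: "ennreal root_jump_prob * pr \<Omega> (\<lambda>\<zeta>'. 8 * C < q u * X (\<zeta>' u)) \<le> pr \<Omega> (E u)" for u
  proof (cases "q u = 0")
    case True then show ?thesis using C by simp
  next
    case False
    then have qp: "0 < q u" using q0[of u] by simp
    have iff: "8 * C < q u * x \<longleftrightarrow> 8 * C / q u < x" for x using qp by (simp add: field_simps)
    have "pr \<Omega> (\<lambda>\<zeta>'. 8 * C < q u * X (\<zeta>' u)) = pr \<nu> (\<lambda>s. 8 * C / q u < X s)"
      unfolding iff by (rule nn_integral_coord) measurable
    also have "ennreal root_jump_prob * \<dots> \<le> pr \<Omega> (\<lambda>\<zeta>. 8 * C / q u < X (\<zeta> []) \<and> X (\<zeta> []) < 2 * Wl \<zeta>)"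
      using C qp by (intro root_jump_prob(3)) auto
    also have "\<dots> = pr \<Omega> (\<lambda>\<zeta>. 8 * C / q u < X (sub u \<zeta> []) \<and> X (sub u \<zeta> []) < 2 * Wl (sub u \<zeta>))"
      by (rule nn_integral_sub[symmetric]) measurable
    also have "\<dots> = pr \<Omega> (E u)" unfolding E_def iff by (simp add: sub_def)
    finally show ?thesis .
  qed
  have p_le: "pr \<Omega> (\<lambda>\<zeta>'. 8 * C < q u * X (\<zeta>' u)) \<le> ennreal (q u) * ennreal (1 / (8 * C))" for u
  proof -
    have "pr \<Omega> (\<lambda>\<zeta>'. 8 * C < q u * X (\<zeta>' u)) \<le> pr \<Omega> (\<lambda>\<zeta>'. 8 * C \<le> q u * X (\<zeta>' u))"
      by (intro nn_integral_mono) auto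
    also have "\<dots> \<le> (\<integral>\<^sup>+\<zeta>'. ennreal (q u * X (\<zeta>' u)) \<partial>\<Omega>) * ennreal (1 / (8 * C))"
      using q0 C by (intro markov_real) auto
    also have "(\<integral>\<^sup>+\<zeta>'. ennreal (q u * X (\<zeta>' u)) \<partial>\<Omega>) = (\<integral>\<^sup>+s. ennreal (q u * X s) \<partial>\<nu>)"
      by (rule nn_integral_coord) measurable
    also have "\<dots> = ennreal (q u)" using q0 by (simp add: ennreal_mult nn_integral_cmult EX)
    finally show ?thesis .
  qed
  have E_le: "pr \<Omega> (E u) \<le> pr \<Omega> (\<lambda>\<zeta>'. 8 * C < q u * X (\<zeta>' u))" for u
    by (intro nn_integral_mono) (auto simp: E_def)
  have "csum (gen n) (\<lambda>u. pr \<Omega> (E u)) \<le> csum (gen n) (\<lambda>u. ennreal (Y u \<zeta>) * ennreal (An / (8 * C)))"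
  proof (intro csum_mono)
    fix u
    have "pr \<Omega> (E u) \<le> ennreal (q u) * ennreal (1 / (8 * C))" using E_le p_le by (rule order.trans)
    also have "\<dots> = ennreal (Y u \<zeta>) * ennreal (An / (8 * C))"
      unfolding q_def using An C by (simp add: ennreal_mult[symmetric] mult.commute)
    finally show "pr \<Omega> (E u) \<le> \<dots>" .
  qed
  also have "\<dots> = WE n \<zeta> * ennreal (An / (8 * C))" unfolding WE_def by (rule nn_integral_multc) simp
  also have "\<dots> < \<infinity>" using fin by (simp add: ennreal_mult_less_top)
  finally have "csum (gen n) (\<lambda>u. pr \<Omega> (E u)) < \<infinity>" .
  then obtain s where s: "csum (gen n) (\<lambda>u. pr \<Omega> (E u)) = ennreal s" "0 \<le> s"
    by (cases "csum (gen n) (\<lambda>u. pr \<Omega> (E u))") auto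
  have main: "ennreal (s / (2 * (1 + s))) \<le>
    pr \<Omega> (\<lambda>\<zeta>'. C < \<bar>\<kappa> + enn2real (csum (gen n) (\<lambda>u. ennreal (T u \<zeta>')))\<bar> \<and> (\<exists>u\<in>gen n. E u \<zeta>'))"
  proof (rule prod.P.one_big_term)
    show "AE \<zeta>' in \<Omega>. csum (gen n) (\<lambda>u. ennreal (T u \<zeta>')) < \<infinity>"
      using AE_T by eventually_elim simp
    show "4 * C < T u \<zeta>'" if "u \<in> gen n" "E u \<zeta>'" for u \<zeta>'
    proof -
      have "q u * X (\<zeta>' u) \<le> q u * (2 * Wl (sub u \<zeta>'))" using that q0 by (intro mult_left_mono) (auto simp: E_def)
      then show ?thesis using that by (simp add: E_def T_def)
    qed
    show "pr \<Omega> (\<lambda>x. E u x \<and> E v x) \<le> pr \<Omega> (E u) * pr \<Omega> (E v)" if uv: "u \<in> gen n" "v \<in> gen n" "u \<noteq> v" for u v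
    proof -
      have "pr \<Omega> (\<lambda>x. E u x \<and> E v x) = (\<integral>\<^sup>+x. (if E u x then 1 else 0) * (if E v x then 1 else 0) \<partial>\<Omega>)"
        by (intro nn_integral_cong) auto
      also have "\<dots> = pr \<Omega> (E u) * pr \<Omega> (E v)"
        using uv by (intro nn_integral_indep[of _ _ "?S u"]) (measurable, auto simp: E_def mix_in mix_out)
      finally show ?thesis by simp
    qed
    show "pr \<Omega> (\<lambda>x. E u x \<and> \<kappa> + enn2real (csum (gen n - {u}) (\<lambda>v. ennreal (T v x))) < - 3 * C) \<le>
      pr \<Omega> (E u) * pr \<Omega> (\<lambda>x. \<kappa> + enn2real (csum (gen n - {u}) (\<lambda>v. ennreal (T v x))) < - 3 * C)"
      if u: "u \<in> gen n" for u
    proof -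
      define r where "r x = \<kappa> + enn2real (csum (gen n - {u}) (\<lambda>v. ennreal (T v x)))" for x
      have [measurable]: "r \<in> borel_measurable \<Omega>" unfolding r_def[abs_def] by measurable
      have "csum (gen n - {u}) (\<lambda>v. ennreal (T v (mix (?S u) x y))) = csum (gen n - {u}) (\<lambda>v. ennreal (T v y))" for x y
        using u by (intro csum_cong) (auto simp: T_def mix_out)
      then have r: "r (mix (?S u) x y) = r y" for x y by (simp add: r_def)
      have "pr \<Omega> (\<lambda>x. E u x \<and> r x < - 3 * C) = (\<integral>\<^sup>+x. (if E u x then 1 else 0) * (if r x < - 3 * C then 1 else 0) \<partial>\<Omega>)"
        by (intro nn_integral_cong) auto
      also have "\<dots> = pr \<Omega> (E u) * pr \<Omega> (\<lambda>x. r x < - 3 * C)"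
        using u by (intro nn_integral_indep[of _ _ "?S u"]) (measurable, auto simp: E_def mix_in r)
      finally show ?thesis by (simp add: r_def)
    qed
    show "pr \<Omega> (\<lambda>x. 2 * C \<le> T u x) \<le> ennreal (1 / 16)" if u: "u \<in> gen n" for u
    proof -
      have "pr \<Omega> (\<lambda>x. 2 * C \<le> T u x) \<le> (\<integral>\<^sup>+x. ennreal (T u x) \<partial>\<Omega>) * ennreal (1 / (2 * C))"
        using T0 C by (intro markov_real) auto
      also have "(\<integral>\<^sup>+x. ennreal (T u x) \<partial>\<Omega>) = ennreal (q u) * (\<integral>\<^sup>+x. ennreal (Wl (sub u x)) \<partial>\<Omega>)"
        unfolding T_def using q0 by (simp add: ennreal_mult nn_integral_cmult)
      also have "(\<integral>\<^sup>+x. ennreal (Wl (sub u x)) \<partial>\<Omega>) = 1"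
        by (subst nn_integral_sub) (auto simp: expect_Wl)
      also have "ennreal (q u) * 1 * ennreal (1 / (2 * C)) = ennreal (q u * (1 / (2 * C)))"
        unfolding mult_1_right using q0 C by (intro ennreal_mult[symmetric]) auto
      also have "\<dots> \<le> ennreal (1 / 16)"
        using q_le[OF u] C unfolding An_def[symmetric] q_def[symmetric]
        by (intro ennreal_leI) (simp add: field_simps)
      finally show ?thesis .
    qed
    have "pr \<Omega> (\<lambda>x. C < \<bar>\<kappa> + enn2real (csum (gen n) (\<lambda>u. ennreal (T u x)))\<bar>) \<le>
        pr \<Omega> (\<lambda>\<zeta>'. C < \<bar>R a (Suc n) (mix (before n) \<zeta> \<zeta>')\<bar>)"
      using AE_R by (intro pr_mono_AE, eventually_elim) auto
    then show "pr \<Omega> (\<lambda>x. C < \<bar>\<kappa> + enn2real (csum (gen n) (\<lambda>u. ennreal (T u x)))\<bar>) \<le> ennreal (1 / 16)"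
      using small by (rule order.trans)
  qed (use T0 s in auto)
  let ?E = "\<lambda>\<zeta>'. \<exists>u\<in>gen n. 8 * C < q u * X (\<zeta>' u)"
  \<comment> \<open>If \<open>s \<le> 1\<close>, the right-hand side is at least
    \<open>s / 4\<close>, and the union bound estimates the probability of a jump. If
    \<open>s > 1\<close> it is at least 1/4, and the trivial bound suffices.\<close>
  have EA: "ennreal (root_jump_prob / 4) * pr \<Omega> ?E \<le> ennreal (s / (2 * (1 + s)))"
  proof (cases "s \<le> 1")
    case True
    have "pr \<Omega> ?E \<le> (\<integral>\<^sup>+\<zeta>'. csum (gen n) (\<lambda>u. if 8 * C < q u * X (\<zeta>' u) then 1 else 0) \<partial>\<Omega>)"
    proof (intro nn_integral_mono)
      fix \<zeta>'
      show "(if ?E \<zeta>' then 1 else 0) \<le> csum (gen n) (\<lambda>u. if 8 * C < q u * X (\<zeta>' u) then 1 else 0)"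
      proof (cases "?E \<zeta>'")
        case True
        then obtain u where u: "u \<in> gen n" "8 * C < q u * X (\<zeta>' u)" by blast
        then show ?thesis using csum_ge_single[OF u(1), of "\<lambda>u. if 8 * C < q u * X (\<zeta>' u) then 1 else 0"] True by simp
      qed simp
    qed
    also have "\<dots> = csum (gen n) (\<lambda>u. pr \<Omega> (\<lambda>\<zeta>'. 8 * C < q u * X (\<zeta>' u)))"
      by (rule csum_nn_integral) measurable
    finally have "ennreal root_jump_prob * pr \<Omega> ?E \<le> ennreal root_jump_prob * csum (gen n) (\<lambda>u. pr \<Omega> (\<lambda>\<zeta>'. 8 * C < q u * X (\<zeta>' u)))"
      by (rule mult_left_mono) (rule zero_le)
    also have "\<dots> = csum (gen n) (\<lambda>u. ennreal root_jump_prob * pr \<Omega> (\<lambda>\<zeta>'. 8 * C < q u * X (\<zeta>' u)))"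
      by (rule nn_integral_cmult[symmetric]) simp
    also have "\<dots> \<le> ennreal s" unfolding s(1)[symmetric] by (intro csum_mono pE)
    finally have 1: "ennreal root_jump_prob * pr \<Omega> ?E \<le> ennreal s" .
    have "ennreal (root_jump_prob / 4) * pr \<Omega> ?E = ennreal (1 / 4) * (ennreal root_jump_prob * pr \<Omega> ?E)"
      using root_jump_prob by (simp add: mult.assoc[symmetric] ennreal_mult[symmetric])
    also have "\<dots> \<le> ennreal (1 / 4) * ennreal s" by (intro mult_left_mono 1) simp
    also have "\<dots> = ennreal (1 / 4 * s)" using s by (intro ennreal_mult[symmetric]) auto
    also have "\<dots> \<le> ennreal (s / (2 * (1 + s)))"
    proof (intro ennreal_leI)
      have "s * (2 * (1 + s)) \<le> s * 4" using True s by (intro mult_left_mono) auto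
      then show "1 / 4 * s \<le> s / (2 * (1 + s))" using s by (simp add: field_simps)
    qed
    finally show ?thesis .
  next
    case False
    have "ennreal (root_jump_prob / 4) * pr \<Omega> ?E \<le> ennreal (root_jump_prob / 4) * 1" by (intro mult_left_mono prod.P.pr_le_1) simp
    also have "\<dots> \<le> ennreal (1 / 4)" using root_jump_prob by (simp add: ennreal_leI)
    also have "\<dots> \<le> ennreal (s / (2 * (1 + s)))" using False by (intro ennreal_leI) (simp add: field_simps)
    finally show ?thesis .
  qed
  also note main
  also have "pr \<Omega> (\<lambda>\<zeta>'. C < \<bar>\<kappa> + enn2real (csum (gen n) (\<lambda>u. ennreal (T u \<zeta>')))\<bar> \<and> (\<exists>u\<in>gen n. E u \<zeta>')) \<le>
      pr \<Omega> (\<lambda>\<zeta>'. C < \<bar>R a (Suc n) (mix (before n) \<zeta> \<zeta>')\<bar> \<and> ?E \<zeta>')"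
    using AE_R by (intro pr_mono_AE, eventually_elim) (auto simp: E_def)
  finally show ?thesis unfolding q_def An_def .
qed

lemma pr_tendsto_0:
  fixes P :: "nat \<Rightarrow> (nat list \<Rightarrow> 'a) \<Rightarrow> bool"
  assumes [measurable]: "\<And>C. Measurable.pred \<Omega> (P C)"
    and ev: "AE \<zeta> in \<Omega>. \<exists>C. \<forall>C'\<ge>C. \<not> P C' \<zeta>"
  shows "(\<lambda>C. pr \<Omega> (P C)) \<longlonglongrightarrow> 0"
proof -
  have "(\<lambda>C. pr \<Omega> (P C)) \<longlonglongrightarrow> (\<integral>\<^sup>+\<zeta>. 0 \<partial>\<Omega>)"
  proof (rule nn_integral_dominated_convergence[where w = "\<lambda>_. 1"])
    show "AE \<zeta> in \<Omega>. (\<lambda>C. if P C \<zeta> then 1 else 0 :: ennreal) \<longlonglongrightarrow> 0"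
      using ev
    proof eventually_elim
      case (elim \<zeta>)
      then obtain C where "\<And>C'. C \<le> C' \<Longrightarrow> \<not> P C' \<zeta>" by blast
      then show ?case by (intro tendsto_eventually eventually_sequentiallyI[of C]) auto
    qed
  qed (auto simp: prod.P.emeasure_space_1)
  then show ?thesis by simp
qed

text \<open>The sum of \<open>A n\<close> squared times \<open>Y u * sqrt (Y u)\<close> over all
  individuals has finite mean, and it dominates the square of each \<open>A n * Y u\<close> because
  \<open>Y u \<le> 1\<close>.\<close>

lemma Y_weights_bounded:
  assumes A: "doubling D A"
  shows "AE \<zeta> in \<Omega>. \<exists>C::nat. \<forall>n. \<forall>u\<in>gen n. A n * Y u \<zeta> \<le> real C"
proof -
  have A0: "0 \<le> A n" for n by (rule doubling_nonneg[OF A])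
  let ?S = "\<lambda>\<zeta>. \<Sum>n. ennreal ((A n)\<^sup>2) * csum (gen n) (\<lambda>u. ennreal (Y u \<zeta> * sqrt (Y u \<zeta>)))"
  have "(\<integral>\<^sup>+\<zeta>. ?S \<zeta> \<partial>\<Omega>) = (\<Sum>n. ennreal ((A n)\<^sup>2) * ennreal (\<phi> ^ n))"
    by (simp add: nn_integral_suminf nn_integral_cmult expect_Y_sqrt)
  also have "\<dots> \<le> (\<Sum>n. ennreal ((A n)\<^sup>2 * \<rho> ^ n))"
  proof (intro suminf_le)
    fix n
    have "\<phi> ^ n \<le> \<rho> ^ n * \<rho> ^ n" by (rule phi_power_le)
    also have "\<dots> \<le> \<rho> ^ n * 1" using rho by (intro mult_left_mono power_le_one) auto
    finally show "ennreal ((A n)\<^sup>2) * ennreal (\<phi> ^ n) \<le> ennreal ((A n)\<^sup>2 * \<rho> ^ n)"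
      by (simp add: ennreal_mult[symmetric] mult_left_mono ennreal_leI)
  qed auto
  also have "\<dots> = ennreal (\<Sum>n. (A n)\<^sup>2 * \<rho> ^ n)"
    using rho by (intro suminf_ennreal2 doubling_summable_power2[OF A]) auto
  also have "\<dots> < \<infinity>" by simp
  finally have "AE \<zeta> in \<Omega>. ?S \<zeta> \<noteq> \<infinity>" by (intro nn_integral_noteq_infinite) auto
  then show ?thesis
  proof eventually_elim
    case (elim \<zeta>)
    then obtain r where r: "?S \<zeta> = ennreal r" "0 \<le> r" by (cases "?S \<zeta>") auto
    obtain C :: nat where C: "max 1 r \<le> real C" using real_arch_simple by blast
    have "A n * Y u \<zeta> \<le> real C" if u: "u \<in> gen n" for n u
    proof -
      let ?y = "Y u \<zeta>"
      have "ennreal ((A n)\<^sup>2 * (?y * sqrt ?y)) = ennreal ((A n)\<^sup>2) * ennreal (?y * sqrt ?y)"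
        by (intro ennreal_mult) auto
      also have "\<dots> \<le> ennreal ((A n)\<^sup>2) * csum (gen n) (\<lambda>u. ennreal (Y u \<zeta> * sqrt (Y u \<zeta>)))"
        using csum_ge_single[OF u, of "\<lambda>u. ennreal (Y u \<zeta> * sqrt (Y u \<zeta>))"] by (intro mult_left_mono) auto
      also have "\<dots> \<le> ?S \<zeta>" using sum_le_suminf[of "\<lambda>n. ennreal ((A n)\<^sup>2) * csum (gen n) (\<lambda>u. ennreal (Y u \<zeta> * sqrt (Y u \<zeta>)))" "{n}"] by simp
      finally have 1: "(A n)\<^sup>2 * (?y * sqrt ?y) \<le> r" unfolding r(1) using r(2) by (subst (asm) ennreal_le_iff) auto
      have "?y \<le> sqrt ?y"
      proof (rule real_le_rsqrt)
        show "?y\<^sup>2 \<le> ?y" unfolding power2_eq_square by (rule mult_left_le[OF Y_le_1 Y_nonneg])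
      qed
      then have "?y * ?y \<le> ?y * sqrt ?y" by (intro mult_left_mono) auto
      then have "(A n)\<^sup>2 * (?y * ?y) \<le> (A n)\<^sup>2 * (?y * sqrt ?y)" by (rule mult_left_mono) simp
      then have "(A n * ?y)\<^sup>2 \<le> r" using 1 by (simp add: power2_eq_square mult_ac)
      also have "\<dots> \<le> real C * 1" using C by simp
      also have "\<dots> \<le> (real C)\<^sup>2" unfolding power2_eq_square using C by (intro mult_left_mono) auto
      finally show ?thesis by (rule power2_le_imp_le) simp
    qed
    then show ?case by blast
  qed
qed

lemma mix_mix: "m \<le> n \<Longrightarrow> mix (before m) (mix (before n) \<zeta> \<zeta>'') \<zeta>' = mix (before m) \<zeta> \<zeta>'"
  by (auto simp: mix_def)

text \<open>A jump at generation \<open>n\<close> falls into one of three classes: the weights were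
  already large; the past already made a large partial sum likely; or neither, and then
  \<open>jump_step\<close> applies. In the last two classes the first time of occurrence yields a
  large partial sum with conditional probability bounded below.\<close>

lemma jumps_bounded_prob:
  fixes a :: "nat \<Rightarrow> real"
  assumes a: "\<And>n. 0 \<le> a n" and C: "0 < C"
  defines "A \<equiv> \<lambda>n. \<Sum>k\<le>n. a k"
  shows "pr \<Omega> (\<lambda>\<zeta>. \<exists>n. \<exists>u\<in>gen n. 8 * C < A n * Y u \<zeta> * X (\<zeta> u)) \<le>
    ennreal (4 / root_jump_prob + 16) * pr \<Omega> (\<lambda>\<zeta>. \<exists>N. C < \<bar>R a N \<zeta>\<bar>) +
    pr \<Omega> (\<lambda>\<zeta>. \<exists>n. \<exists>u\<in>gen n. C / 8 < A n * Y u \<zeta>)"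
proof -
  let ?Q = "\<lambda>\<zeta>. \<exists>N. C < \<bar>R a N \<zeta>\<bar>"
  \<comment> \<open>The conditional probability, given the labels before generation
    \<open>n\<close>, that the next partial sum is large. If it ever exceeds 1/16, its first such
    time already forces the event \<open>?Q\<close> with that probability.\<close>
  define g where "g n \<zeta> = pr \<Omega> (\<lambda>\<zeta>'. C < \<bar>R a (Suc n) (mix (before n) \<zeta> \<zeta>')\<bar>)" for n \<zeta>
  have [measurable]: "g n \<in> borel_measurable \<Omega>" for n unfolding g_def[abs_def] by measurable
  have g_mix: "g m (mix (before n) \<zeta> \<zeta>') = g m \<zeta>" if "m \<le> n" for m n \<zeta> \<zeta>'
    using that by (simp add: g_def mix_mix)
  define U where "U n \<zeta> \<longleftrightarrow> (\<exists>u\<in>gen n. 8 * C < A n * Y u \<zeta> * X (\<zeta> u))" for n \<zeta>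
  define q where "q n \<zeta> \<longleftrightarrow> (\<forall>u\<in>gen n. A n * Y u \<zeta> \<le> C / 8)" for n \<zeta>
  have [measurable]: "Measurable.pred \<Omega> (U n)" "Measurable.pred \<Omega> (q n)" for n
    unfolding U_def[abs_def] q_def[abs_def] by measurable
  have q_mix: "q m (mix (before n) \<zeta> \<zeta>') = q m \<zeta>" if "m \<le> n" for m n \<zeta> \<zeta>'
    unfolding q_def using that by (intro ball_cong) auto
  have U_mix: "U m (mix (before n) \<zeta> \<zeta>') = U m \<zeta>" if "m < n" for m n \<zeta> \<zeta>'
    unfolding U_def using that by (intro bex_cong) auto
  have "pr \<Omega> (\<lambda>\<zeta>. \<exists>n. ennreal (1 / 16) < g n \<zeta>) \<le> ennreal 16 * pr \<Omega> ?Q"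
  proof (rule first_time_bound)
    fix n
    define F where "F \<zeta> \<longleftrightarrow> (\<forall>m<n. \<not> ennreal (1 / 16) < g m \<zeta>) \<and> ennreal (1 / 16) < g n \<zeta>" for \<zeta>
    have [measurable]: "Measurable.pred \<Omega> F" unfolding F_def[abs_def] by measurable
    have F_mix: "F (mix (before n) \<zeta> \<zeta>') = F \<zeta>" for \<zeta> \<zeta>'
      unfolding F_def by (intro conj_cong all_cong) (simp_all add: g_mix)
    have "ennreal (1 / 16) * pr \<Omega> F = (\<integral>\<^sup>+\<zeta>. ennreal (1 / 16) * (if F \<zeta> then 1 else 0) \<partial>\<Omega>)"
      by (rule nn_integral_cmult[symmetric]) measurable
    also have "\<dots> \<le> (\<integral>\<^sup>+\<zeta>. pr \<Omega> (\<lambda>\<zeta>'. F (mix (before n) \<zeta> \<zeta>') \<and> C < \<bar>R a (Suc n) (mix (before n) \<zeta> \<zeta>')\<bar>) \<partial>\<Omega>)"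
    proof (intro nn_integral_mono)
      fix \<zeta>
      show "ennreal (1 / 16) * (if F \<zeta> then 1 else 0) \<le>
        pr \<Omega> (\<lambda>\<zeta>'. F (mix (before n) \<zeta> \<zeta>') \<and> C < \<bar>R a (Suc n) (mix (before n) \<zeta> \<zeta>')\<bar>)"
      proof (cases "F \<zeta>")
        case True
        then have "ennreal (1 / 16) < g n \<zeta>" unfolding F_def by blast
        then have "ennreal (1 / 16) \<le> pr \<Omega> (\<lambda>\<zeta>'. C < \<bar>R a (Suc n) (mix (before n) \<zeta> \<zeta>')\<bar>)"
          unfolding g_def by (rule less_imp_le)
        then show ?thesis using True by (simp only: F_mix simp_thms if_True mult_1_right)
      qed simp
    qed
    also have "\<dots> = pr \<Omega> (\<lambda>\<zeta>. F \<zeta> \<and> C < \<bar>R a (Suc n) \<zeta>\<bar>)" by (rule nn_integral_mix) measurable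
    also have "\<dots> \<le> pr \<Omega> (\<lambda>\<zeta>. F \<zeta> \<and> ?Q \<zeta>)" by (intro nn_integral_mono) auto
    finally have 1: "ennreal (1 / 16) * pr \<Omega> F \<le> pr \<Omega> (\<lambda>\<zeta>. F \<zeta> \<and> ?Q \<zeta>)" .
    have "pr \<Omega> F = ennreal 16 * ennreal (1 / 16) * pr \<Omega> F"
      by (subst ennreal_mult[symmetric]) auto
    also have "\<dots> \<le> ennreal 16 * pr \<Omega> (\<lambda>\<zeta>. F \<zeta> \<and> ?Q \<zeta>)"
      unfolding mult.assoc by (rule mult_left_mono[OF 1]) (rule zero_le)
    finally show "pr \<Omega> (\<lambda>\<zeta>. (\<forall>m<n. \<not> ennreal (1 / 16) < g m \<zeta>) \<and> ennreal (1 / 16) < g n \<zeta>) \<le>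
      ennreal 16 * pr \<Omega> (\<lambda>\<zeta>. ((\<forall>m<n. \<not> ennreal (1 / 16) < g m \<zeta>) \<and> ennreal (1 / 16) < g n \<zeta>) \<and> ?Q \<zeta>)"
      unfolding F_def .
  qed measurable
  note part1 = this
  \<comment> \<open>Given the labels before generation \<open>n\<close>, the last two conditions are
    decided, and so is every \<open>H m\<close> with \<open>m < n\<close>. Only \<open>U n\<close>
    still depends on generation \<open>n\<close>, which is what \<open>jump_step\<close> needs at
    the first time.\<close>
  define H where "H n \<zeta> \<longleftrightarrow> U n \<zeta> \<and> g n \<zeta> \<le> ennreal (1 / 16) \<and> q n \<zeta>" for n \<zeta>
  have [measurable]: "Measurable.pred \<Omega> (H n)" for n unfolding H_def[abs_def] by measurable
  have H_mix: "H m (mix (before n) \<zeta> \<zeta>') = H m \<zeta>" if "m < n" for m n \<zeta> \<zeta>'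
    using that by (simp add: H_def U_mix q_mix g_mix)
  have part2: "pr \<Omega> (\<lambda>\<zeta>. \<exists>n. H n \<zeta>) \<le> ennreal (4 / root_jump_prob) * pr \<Omega> ?Q"
  proof (rule first_time_bound)
    fix n
    define F where "F \<zeta> \<longleftrightarrow> (\<forall>m<n. \<not> H m \<zeta>) \<and> H n \<zeta>" for \<zeta>
    have [measurable]: "Measurable.pred \<Omega> F" unfolding F_def[abs_def] by measurable
    define G where "G \<zeta> \<longleftrightarrow> (\<forall>m<n. \<not> H m \<zeta>) \<and> g n \<zeta> \<le> ennreal (1 / 16) \<and> q n \<zeta>" for \<zeta>
    define J where "J \<zeta> \<zeta>' \<longleftrightarrow> (\<exists>u\<in>gen n. 8 * C < A n * Y u \<zeta> * X (\<zeta>' u))" for \<zeta> and \<zeta>' :: "nat list \<Rightarrow> 'a"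
    have F_mix: "F (mix (before n) \<zeta> \<zeta>') \<longleftrightarrow> G \<zeta> \<and> J \<zeta> \<zeta>'" for \<zeta> \<zeta>'
    proof -
      have "U n (mix (before n) \<zeta> \<zeta>') = J \<zeta> \<zeta>'" unfolding U_def J_def by (intro bex_cong) auto
      then show ?thesis unfolding F_def G_def H_def[of n] by (auto simp: H_mix g_mix q_mix)
    qed
    have "ennreal (root_jump_prob / 4) * pr \<Omega> F = ennreal (root_jump_prob / 4) * (\<integral>\<^sup>+\<zeta>. pr \<Omega> (\<lambda>\<zeta>'. F (mix (before n) \<zeta> \<zeta>')) \<partial>\<Omega>)"
      by (subst nn_integral_mix) auto
    also have "\<dots> = (\<integral>\<^sup>+\<zeta>. ennreal (root_jump_prob / 4) * pr \<Omega> (\<lambda>\<zeta>'. F (mix (before n) \<zeta> \<zeta>')) \<partial>\<Omega>)"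
      by (rule nn_integral_cmult[symmetric]) measurable
    also have "\<dots> \<le> (\<integral>\<^sup>+\<zeta>. pr \<Omega> (\<lambda>\<zeta>'. F (mix (before n) \<zeta> \<zeta>') \<and> C < \<bar>R a (Suc n) (mix (before n) \<zeta> \<zeta>')\<bar>) \<partial>\<Omega>)"
      unfolding F_mix
    proof (intro nn_integral_mono_AE)
      show "AE \<zeta> in \<Omega>. ennreal (root_jump_prob / 4) * pr \<Omega> (\<lambda>\<zeta>'. G \<zeta> \<and> J \<zeta> \<zeta>') \<le>
          pr \<Omega> (\<lambda>\<zeta>'. (G \<zeta> \<and> J \<zeta> \<zeta>') \<and> C < \<bar>R a (Suc n) (mix (before n) \<zeta> \<zeta>')\<bar>)"
        using WE_finite[of n] Wl_branch_mix[of n]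
      proof eventually_elim
        case (elim \<zeta>)
        show ?case
        proof (cases "G \<zeta>")
          case True
          have "ennreal (root_jump_prob / 4) * pr \<Omega> (\<lambda>\<zeta>'. J \<zeta> \<zeta>') \<le> pr \<Omega> (\<lambda>\<zeta>'. C < \<bar>R a (Suc n) (mix (before n) \<zeta> \<zeta>')\<bar> \<and> J \<zeta> \<zeta>')"
            unfolding J_def A_def
            by (rule jump_step[OF a C elim]) (use True in \<open>auto simp: G_def g_def q_def A_def\<close>)
          also have "\<dots> = pr \<Omega> (\<lambda>\<zeta>'. (G \<zeta> \<and> J \<zeta> \<zeta>') \<and> C < \<bar>R a (Suc n) (mix (before n) \<zeta> \<zeta>')\<bar>)"
            using True by (intro nn_integral_cong) auto
          finally show ?thesis using True by simp
        qed simp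
      qed
    qed
    also have "\<dots> = pr \<Omega> (\<lambda>\<zeta>. F \<zeta> \<and> C < \<bar>R a (Suc n) \<zeta>\<bar>)" by (rule nn_integral_mix) measurable
    also have "\<dots> \<le> pr \<Omega> (\<lambda>\<zeta>. F \<zeta> \<and> ?Q \<zeta>)" by (intro nn_integral_mono) auto
    finally have 1: "ennreal (root_jump_prob / 4) * pr \<Omega> F \<le> pr \<Omega> (\<lambda>\<zeta>. F \<zeta> \<and> ?Q \<zeta>)" .
    have "pr \<Omega> F = ennreal (4 / root_jump_prob) * ennreal (root_jump_prob / 4) * pr \<Omega> F"
      using root_jump_prob by (subst ennreal_mult[symmetric]) auto
    also have "\<dots> \<le> ennreal (4 / root_jump_prob) * pr \<Omega> (\<lambda>\<zeta>. F \<zeta> \<and> ?Q \<zeta>)"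
      unfolding mult.assoc by (rule mult_left_mono[OF 1]) (rule zero_le)
    finally show "pr \<Omega> (\<lambda>\<zeta>. (\<forall>m<n. \<not> H m \<zeta>) \<and> H n \<zeta>) \<le>
      ennreal (4 / root_jump_prob) * pr \<Omega> (\<lambda>\<zeta>. ((\<forall>m<n. \<not> H m \<zeta>) \<and> H n \<zeta>) \<and> ?Q \<zeta>)"
      unfolding F_def .
  qed measurable
  let ?B = "\<lambda>\<zeta>. \<exists>n. \<exists>u\<in>gen n. C / 8 < A n * Y u \<zeta>"
  have "pr \<Omega> (\<lambda>\<zeta>. \<exists>n. U n \<zeta>) \<le> pr \<Omega> (\<lambda>\<zeta>. ((\<exists>n. H n \<zeta>) \<or> (\<exists>n. ennreal (1 / 16) < g n \<zeta>)) \<or> ?B \<zeta>)"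
    by (intro nn_integral_mono) (auto simp: H_def q_def not_less not_le)
  also have "\<dots> \<le> pr \<Omega> (\<lambda>\<zeta>. (\<exists>n. H n \<zeta>) \<or> (\<exists>n. ennreal (1 / 16) < g n \<zeta>)) + pr \<Omega> ?B"
    by (rule pr_disj) measurable
  also have "pr \<Omega> (\<lambda>\<zeta>. (\<exists>n. H n \<zeta>) \<or> (\<exists>n. ennreal (1 / 16) < g n \<zeta>)) \<le> pr \<Omega> (\<lambda>\<zeta>. \<exists>n. H n \<zeta>) + pr \<Omega> (\<lambda>\<zeta>. \<exists>n. ennreal (1 / 16) < g n \<zeta>)"
    by (rule pr_disj) measurable
  also have "\<dots> \<le> ennreal (4 / root_jump_prob) * pr \<Omega> ?Q + ennreal 16 * pr \<Omega> ?Q" by (rule add_mono[OF part2 part1])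
  also have "\<dots> = ennreal (4 / root_jump_prob + 16) * pr \<Omega> ?Q"
    using root_jump_prob by (subst ennreal_plus) (auto simp: distrib_right)
  finally show ?thesis unfolding U_def by (simp add: add_right_mono)
qed

lemma summable_imp_bounded_R:
  assumes "summable (\<lambda>n. a n * (Wl \<zeta> - Wr n \<zeta>))"
  shows "\<exists>C::nat. \<forall>N. \<bar>R a N \<zeta>\<bar> \<le> real C"
proof -
  have "convergent (\<lambda>N. R a N \<zeta>)" using assms unfolding R_def summable_iff_convergent .
  from BseqD[OF convergent_imp_Bseq[OF this]]
  obtain K where K: "\<And>N. norm (R a N \<zeta>) \<le> K" by blast
  obtain C :: nat where "K \<le> real C" using real_arch_simple by blast
  then have "\<bar>R a N \<zeta>\<bar> \<le> real C" for N using K[of N] by simp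
  then show ?thesis by blast
qed

text \<open>As \<open>C\<close> grows, both probabilities on the right of
  \<open>jumps_bounded_prob\<close> tend to 0, by convergence of the series and by
  \<open>Y_weights_bounded\<close>.\<close>

theorem jumps_bounded:
  fixes a :: "nat \<Rightarrow> real"
  assumes a: "\<And>n. 0 \<le> a n" and A: "doubling D (\<lambda>n. \<Sum>k\<le>n. a k)"
    and sm: "AE \<zeta> in \<Omega>. summable (\<lambda>n. a n * (Wl \<zeta> - Wr n \<zeta>))"
  shows "AE \<zeta> in \<Omega>. \<exists>C::nat. \<forall>n. \<forall>u\<in>gen n. (\<Sum>k\<le>n. a k) * Y u \<zeta> * X (\<zeta> u) \<le> real C"
proof -
  let ?A = "\<lambda>n. \<Sum>k\<le>n. a k"
  define U where "U C \<zeta> \<longleftrightarrow> (\<exists>n. \<exists>u\<in>gen n. 8 * real (Suc C) < ?A n * Y u \<zeta> * X (\<zeta> u))" for C \<zeta>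
  define Q where "Q C \<zeta> \<longleftrightarrow> (\<exists>N. real (Suc C) < \<bar>R a N \<zeta>\<bar>)" for C \<zeta>
  define B where "B C \<zeta> \<longleftrightarrow> (\<exists>n. \<exists>u\<in>gen n. real (Suc C) / 8 < ?A n * Y u \<zeta>)" for C \<zeta>
  have [measurable]: "Measurable.pred \<Omega> (U C)" "Measurable.pred \<Omega> (Q C)" "Measurable.pred \<Omega> (B C)" for C
    unfolding U_def[abs_def] Q_def[abs_def] B_def[abs_def] by measurable
  have Q: "(\<lambda>C. pr \<Omega> (Q C)) \<longlonglongrightarrow> 0"
  proof (rule pr_tendsto_0)
    show "AE \<zeta> in \<Omega>. \<exists>C. \<forall>C'\<ge>C. \<not> Q C' \<zeta>"
      using sm
    proof eventually_elim
      case (elim \<zeta>)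
      then obtain C where C: "\<And>N. \<bar>R a N \<zeta>\<bar> \<le> real C" using summable_imp_bounded_R by blast
      have "\<not> real (Suc C') < \<bar>R a N \<zeta>\<bar>" if "C \<le> C'" for N C'
        using C[of N] that by simp
      then show ?case unfolding Q_def by blast
    qed
  qed measurable
  have B: "(\<lambda>C. pr \<Omega> (B C)) \<longlonglongrightarrow> 0"
  proof (rule pr_tendsto_0)
    show "AE \<zeta> in \<Omega>. \<exists>C. \<forall>C'\<ge>C. \<not> B C' \<zeta>"
      using Y_weights_bounded[OF A]
    proof eventually_elim
      case (elim \<zeta>)
      then obtain C where C: "\<And>n u. u \<in> gen n \<Longrightarrow> ?A n * Y u \<zeta> \<le> real C" by blast
      have "\<not> real (Suc C') / 8 < ?A n * Y u \<zeta>" if "8 * C \<le> C'" "u \<in> gen n" for n u C'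
        using C[OF that(2)] that(1) by simp
      then show ?case unfolding B_def by blast
    qed
  qed measurable
  have "(\<lambda>C. ennreal (4 / root_jump_prob + 16) * pr \<Omega> (Q C) + pr \<Omega> (B C)) \<longlonglongrightarrow> ennreal (4 / root_jump_prob + 16) * 0 + 0"
    by (intro tendsto_add B ennreal_tendsto_cmult Q) simp
  then have lim: "(\<lambda>C. ennreal (4 / root_jump_prob + 16) * pr \<Omega> (Q C) + pr \<Omega> (B C)) \<longlonglongrightarrow> 0" by simp
  have "pr \<Omega> (\<lambda>\<zeta>. \<forall>C. U C \<zeta>) \<le> 0"
  proof (rule LIMSEQ_le_const[OF lim], intro exI[of _ 0] allI impI)
    fix C
    have "pr \<Omega> (\<lambda>\<zeta>. \<forall>C. U C \<zeta>) \<le> pr \<Omega> (U C)" by (intro nn_integral_mono) auto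
    also have "\<dots> \<le> ennreal (4 / root_jump_prob + 16) * pr \<Omega> (Q C) + pr \<Omega> (B C)"
      unfolding U_def Q_def B_def by (rule jumps_bounded_prob[OF a]) simp
    finally show "pr \<Omega> (\<lambda>\<zeta>. \<forall>C. U C \<zeta>) \<le> \<dots>" .
  qed
  then have "pr \<Omega> (\<lambda>\<zeta>. \<forall>C. U C \<zeta>) = 0" by simp
  then have "AE \<zeta> in \<Omega>. (if \<forall>C. U C \<zeta> then 1 else 0 :: ennreal) = 0"
    by (rule nn_integral_0_iff_AE[THEN iffD1, rotated]) measurable
  then show ?thesis
  proof eventually_elim
    case (elim \<zeta>)
    then have "\<not> (\<forall>C. U C \<zeta>)" by (cases "\<forall>C. U C \<zeta>") simp_all
    then obtain C where C: "\<not> U C \<zeta>" by blast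
    have "?A n * Y u \<zeta> * X (\<zeta> u) \<le> real (8 * Suc C)" if "u \<in> gen n" for n u
    proof -
      have "\<not> 8 * real (Suc C) < ?A n * Y u \<zeta> * X (\<zeta> u)" using C that unfolding U_def by blast
      then show ?thesis by simp
    qed
    then show ?case by blast
  qed
qed

end

subsection \<open>The compensator of the truncated series\<close>

lemma weighted_telescope:
  fixes a w :: "nat \<Rightarrow> real"
  assumes "N < K"
  shows "(\<Sum>k<K. (\<Sum>n\<le>min k N. a n) * (w (Suc k) - w k)) = (\<Sum>n\<le>N. a n * (w K - w n))"
  using assms
proof (induction K)
  case (Suc K)
  show ?case
  proof (cases "N = K")
    case True
    have "(\<Sum>k<K'. (\<Sum>n\<le>min k N. a n) * (w (Suc k) - w k)) = (\<Sum>n<K'. a n * (w K' - w n))" if "K' \<le> Suc N" for K'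
      using that
    proof (induction K')
      case (Suc K')
      then have "min K' N = K'" by simp
      with Suc show ?case
        by (simp add: lessThan_Suc_atMost[symmetric] algebra_simps sum.distrib sum_subtractf sum_distrib_left)
    qed simp
    from this[of "Suc N"] True show ?thesis by (simp add: lessThan_Suc_atMost)
  next
    case False
    then have "N < K" "min K N = N" using Suc.prems by auto
    with Suc.IH show ?thesis by (simp add: algebra_simps sum.distrib sum_subtractf sum_distrib_left)
  qed
qed simp

section \<open>Jump weights and the truncated variance\<close>

context weighted_branching_xlogx
begin

text \<open>Collects \<open>b k\<close> over the generations in which a label of mass
  \<open>x\<close> at a heavy individual exceeds the truncation level: the weight is at least
  \<open>exp (- K\<mu> * k)\<close>, and \<open>b k \<ge> 1\<close>. Its mean bounds the compensator
  from below.\<close>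

definition jump_weight :: "real \<Rightarrow> (nat \<Rightarrow> real) \<Rightarrow> real \<Rightarrow> ennreal" where
  "jump_weight C b x = (\<Sum>k. if C * exp (real (K\<mu> * k)) < x then ennreal (b k) else 0)"

lemma jump_weight_meas [measurable]: "jump_weight C b \<in> borel_measurable borel"
  unfolding jump_weight_def[abs_def] by measurable

lemma K_mu_pos: "1 \<le> K\<mu>" by (simp add: K\<mu>_def)

text \<open>The generations counted by \<open>jump_weight\<close> reach up to
  \<open>(ln x - ln C) / K\<mu>\<close>; once \<open>ln x > 2 * ln C\<close> this exceeds a fixed
  multiple of \<open>ln x\<close>, and smaller \<open>x\<close> go into \<open>K2\<close>. Neither
  constant depends on \<open>b\<close>, only on \<open>D\<close> and the majorant
  \<open>A\<close>.\<close>

lemma cumul_le_jump_weight: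
  assumes C: "1 \<le> C" and L: "0 \<le> L" and A: "doubling D A"
  shows "\<exists>K1\<ge>1. \<exists>K2\<ge>0. \<forall>b. doubling D b \<longrightarrow> (\<forall>k. b k \<le> A k) \<longrightarrow>
    (\<forall>x\<ge>0. ennreal (cumul b (L * log_plus x)) \<le> ennreal K1 * jump_weight C b x + ennreal K2)"
proof -
  obtain K1 where K1: "1 \<le> K1" "\<And>b z. doubling D b \<Longrightarrow> 0 \<le> z \<Longrightarrow> cumul b (2 * real K\<mu> * L * z) \<le> K1 * cumul b z"
    using cumul_scale[of D "2 * real K\<mu> * L"] by blast
  let ?K2 = "cumul A (L * (2 * ln C))"
  have "ennreal (cumul b (L * log_plus x)) \<le> ennreal K1 * jump_weight C b x + ennreal ?K2"
    if b: "doubling D b" "\<And>k. b k \<le> A k" and x: "0 \<le> x" for b x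
  proof (cases "log_plus x \<le> 2 * ln C")
    case True
    have "cumul b (L * log_plus x) \<le> cumul b (L * (2 * ln C))"
      using L True by (intro cumul_mono[OF b(1)] mult_left_mono) auto
    also have "\<dots> \<le> ?K2" unfolding cumul_def by (intro sum_mono b)
    finally show ?thesis by (simp add: add_increasing ennreal_leI)
  next
    case False
    have lC: "0 \<le> ln C" using C by simp
    then have xp: "0 < x" "log_plus x = ln x" using False by (auto simp: log_plus_def max_def split: if_splits)
    have Kp: "0 < real K\<mu>" using K_mu_pos by simp
    define z where "z = ln x / (2 * real K\<mu>)"
    have z: "0 \<le> z" "L * log_plus x = 2 * real K\<mu> * L * z" proof -
      have "0 \<le> ln x" using False lC xp by linarith
      then show "0 \<le> z" unfolding z_def by simp
      show "L * log_plus x = 2 * real K\<mu> * L * z" using Kp xp by (simp add: z_def)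
    qed
    have b0: "0 \<le> b k" for k by (rule doubling_nonneg[OF b(1)])
    have in_range: "C * exp (real (K\<mu> * k)) < x" if "k \<le> nat \<lfloor>z\<rfloor>" for k
    proof -
      have "real k \<le> z" using that z(1) by linarith
      then have "real K\<mu> * real k \<le> real K\<mu> * z" by (intro mult_left_mono) auto
      also have "\<dots> = ln x / 2" using Kp by (simp add: z_def)
      also have "\<dots> < ln x - ln C" using False xp by simp
      finally have "exp (ln C + real (K\<mu> * k)) < exp (ln x)" by simp
      then show ?thesis using C xp by (simp add: exp_add)
    qed
    have "ennreal (cumul b z) = (\<Sum>k\<le>nat \<lfloor>z\<rfloor>. ennreal (b k))" using b0 by (simp add: cumul_def)
    also have "\<dots> = (\<Sum>k\<le>nat \<lfloor>z\<rfloor>. if C * exp (real (K\<mu> * k)) < x then ennreal (b k) else 0)"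
      using in_range by (intro sum.cong) auto
    also have "\<dots> \<le> jump_weight C b x" unfolding jump_weight_def by (rule sum_le_suminf) auto
    finally have 1: "ennreal (cumul b z) \<le> jump_weight C b x" .
    have "ennreal (cumul b (L * log_plus x)) \<le> ennreal (K1 * cumul b z)"
      unfolding z(2) by (intro ennreal_leI K1(2) b z)
    also have "\<dots> = ennreal K1 * ennreal (cumul b z)" using K1 by (intro ennreal_mult') auto
    also have "\<dots> \<le> ennreal K1 * jump_weight C b x" by (rule mult_left_mono[OF 1]) (rule zero_le)
    finally show ?thesis by (simp add: add_increasing2)
  qed
  moreover have "0 \<le> ?K2" using cumul_ge_1[OF A] by (meson order.trans zero_le_one)
  ultimately show ?thesis using K1(1) by blast
qed

text \<open>For bounded weights at most about \<open>log+ x\<close> generations count, so the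
  \<open>X log X\<close> moment suffices. This is the finiteness that a later absorption starts
  from.\<close>

lemma jump_weight_finite:
  assumes C: "1 \<le> C" and b: "\<And>k. 0 \<le> b k" "\<And>k. b k \<le> B"
  shows "(\<integral>\<^sup>+s. ennreal (X s) * jump_weight C b (X s) \<partial>\<nu>) < \<infinity>"
proof -
  have B: "0 \<le> B" using b[of 0] by linarith
  have le: "jump_weight C b x \<le> ennreal (B * (log_plus x + 1))" if x: "0 \<le> x" for x
  proof -
    let ?n = "nat \<lfloor>log_plus x\<rfloor>"
    have zero: "\<not> C * exp (real (K\<mu> * k)) < x" if "\<not> k \<le> ?n" for k
    proof
      assume *: "C * exp (real (K\<mu> * k)) < x"
      have "real (1 * k) \<le> real (K\<mu> * k)" using K_mu_pos by (intro of_nat_mono mult_right_mono) auto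
      then have "exp (real k) \<le> exp (real (K\<mu> * k))" by (simp only: exp_le_cancel_iff mult_1)
      also have "\<dots> \<le> C * exp (real (K\<mu> * k))" using C mult_right_mono[of 1 C "exp (real (K\<mu> * k))"] by simp
      finally have "exp (real k) < x" using * by simp
      then have "0 < x" using exp_gt_zero[of "real k"] by linarith
      then have "ln (exp (real k)) < ln x" using \<open>exp (real k) < x\<close> by (subst ln_less_cancel_iff) auto
      then have "real k < log_plus x" using \<open>0 < x\<close> by (simp add: log_plus_def)
      then show False using that by linarith
    qed
    have "jump_weight C b x = (\<Sum>k\<le>?n. if C * exp (real (K\<mu> * k)) < x then ennreal (b k) else 0)"
      unfolding jump_weight_def by (rule suminf_finite) (auto simp: zero simp del: of_nat_mult)
    also have "\<dots> \<le> (\<Sum>k\<le>?n. ennreal B)" by (intro sum_mono) (use b in \<open>auto intro: ennreal_leI\<close>)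
    also have "\<dots> = ennreal (\<Sum>k\<le>?n. B)" using B by (intro sum_ennreal) auto
    also have "\<dots> \<le> ennreal (B * (log_plus x + 1))"
    proof (rule ennreal_leI)
      have "real ?n + 1 \<le> log_plus x + 1" by simp
      then have "(real ?n + 1) * B \<le> (log_plus x + 1) * B" using B by (rule mult_right_mono)
      then show "(\<Sum>k\<le>?n. B) \<le> B * (log_plus x + 1)" by (simp add: mult.commute add.commute)
    qed
    finally show ?thesis .
  qed
  have "(\<integral>\<^sup>+s. ennreal (X s) * jump_weight C b (X s) \<partial>\<nu>) \<le> (\<integral>\<^sup>+s. ennreal B * (ennreal (X s * log_plus (X s)) + ennreal (X s)) \<partial>\<nu>)"
  proof (intro nn_integral_mono)
    fix s
    have "ennreal (X s) * jump_weight C b (X s) \<le> ennreal (X s) * ennreal (B * (log_plus (X s) + 1))"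
      by (rule mult_left_mono[OF le[OF X_nonneg]]) (rule zero_le)
    also have "\<dots> = ennreal (X s * (B * (log_plus (X s) + 1)))" using B by (intro ennreal_mult[symmetric]) auto
    also have "X s * (B * (log_plus (X s) + 1)) = B * (X s * log_plus (X s) + X s)" by (simp add: algebra_simps)
    also have "ennreal \<dots> = ennreal B * ennreal (X s * log_plus (X s) + X s)" using B by (intro ennreal_mult) auto
    also have "ennreal (X s * log_plus (X s) + X s) = ennreal (X s * log_plus (X s)) + ennreal (X s)" by (intro ennreal_plus) auto
    finally show "ennreal (X s) * jump_weight C b (X s) \<le> ennreal B * (ennreal (X s * log_plus (X s)) + ennreal (X s))" .
  qed
  also have "\<dots> = ennreal B * ((\<integral>\<^sup>+s. ennreal (X s * log_plus (X s)) \<partial>\<nu>) + 1)"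
    by (simp add: nn_integral_cmult nn_integral_add EX)
  also have "\<dots> < \<infinity>" using eta_xlogx by (simp add: ennreal_mult_less_top)
  finally show ?thesis .
qed

text \<open>The truncation that keeps every summand of \<open>b k * (W (k + 1) - W k)\<close> below \<open>C\<close>.\<close>

abbreviation exceeds :: "real \<Rightarrow> real \<Rightarrow> real \<Rightarrow> real \<Rightarrow> bool" where "exceeds C b y x \<equiv> C < b * y * x"

lemma exceeds_meas: "Measurable.pred (borel \<Otimes>\<^sub>M borel) (\<lambda>p. exceeds C b (fst p) (snd p))"
  "Measurable.pred (borel \<Otimes>\<^sub>M borel) (\<lambda>p. \<not> exceeds C b (fst p) (snd p))"
  by measurable

lemma truncated_sum_second_moment:
  fixes b :: "nat \<Rightarrow> real"
  assumes b: "\<And>k. 1 \<le> b k"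
  shows "(\<integral>\<^sup>+\<zeta>. ennreal ((\<Sum>k<K. b k * centred (\<lambda>y x. \<not> exceeds C (b k) y x) k \<zeta>)\<^sup>2) \<partial>\<Omega>) \<le>
    (\<Sum>k<K. ennreal ((b k)\<^sup>2) * big_variance (\<lambda>y x. \<not> exceeds C (b k) y x) k)"
proof (induction K)
  case (Suc K)
  let ?Z = "\<lambda>k. centred (\<lambda>y x. \<not> exceeds C (b k) y x) k"
  let ?S = "\<lambda>\<zeta>. \<Sum>k<K. b k * ?Z k \<zeta>"
  have [measurable]: "?Z k \<in> borel_measurable \<Omega>" for k by (rule centred_meas[OF exceeds_meas(2)])
  \<comment> \<open>The new difference carries the factor \<open>b K\<close>, whereas
    \<open>centred_orthogonal\<close> treats factor 1; the factor is pulled out of the whole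
    sum.\<close>
  have bK: "0 < b K" "b K \<noteq> 0" using b[of K] by auto
  have eq: "?S \<zeta> + b K * ?Z K \<zeta> = b K * (?S \<zeta> / b K + ?Z K \<zeta>)" for \<zeta> using bK by (simp add: distrib_left)
  have "(\<integral>\<^sup>+\<zeta>. ennreal ((\<Sum>k<Suc K. b k * ?Z k \<zeta>)\<^sup>2) \<partial>\<Omega>) =
      (\<integral>\<^sup>+\<zeta>. ennreal ((b K)\<^sup>2) * ennreal ((?S \<zeta> / b K + ?Z K \<zeta>)\<^sup>2) \<partial>\<Omega>)"
    by (intro nn_integral_cong) (simp add: eq power_mult_distrib ennreal_mult)
  also have "\<dots> = ennreal ((b K)\<^sup>2) * (\<integral>\<^sup>+\<zeta>. ennreal ((?S \<zeta> / b K + ?Z K \<zeta>)\<^sup>2) \<partial>\<Omega>)"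
    by (rule nn_integral_cmult) measurable
  also have "\<dots> \<le> ennreal ((b K)\<^sup>2) * ((\<integral>\<^sup>+\<zeta>. ennreal ((?S \<zeta> / b K)\<^sup>2) \<partial>\<Omega>) + big_variance (\<lambda>y x. \<not> exceeds C (b K) y x) K)"
  proof (rule mult_left_mono[OF centred_orthogonal[OF exceeds_meas(2)] zero_le])
    show "(\<lambda>\<zeta>. ?S \<zeta> / b K) \<in> borel_measurable \<Omega>" by measurable
    fix \<zeta> \<zeta>'
    have "?S (mix (before K) \<zeta> \<zeta>') = ?S \<zeta>" by (intro sum.cong) (auto simp: centred_mix[OF exceeds_meas(2)])
    then show "?S (mix (before K) \<zeta> \<zeta>') / b K = ?S \<zeta> / b K" by simp
  qed
  also have "\<dots> = (\<integral>\<^sup>+\<zeta>. ennreal ((?S \<zeta>)\<^sup>2) \<partial>\<Omega>) + ennreal ((b K)\<^sup>2) * big_variance (\<lambda>y x. \<not> exceeds C (b K) y x) K"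
  proof -
    have "ennreal ((b K)\<^sup>2) * (\<integral>\<^sup>+\<zeta>. ennreal ((?S \<zeta> / b K)\<^sup>2) \<partial>\<Omega>) = (\<integral>\<^sup>+\<zeta>. ennreal ((b K)\<^sup>2) * ennreal ((?S \<zeta> / b K)\<^sup>2) \<partial>\<Omega>)"
      by (rule nn_integral_cmult[symmetric]) measurable
    also have "\<dots> = (\<integral>\<^sup>+\<zeta>. ennreal ((?S \<zeta>)\<^sup>2) \<partial>\<Omega>)"
      using bK by (intro nn_integral_cong) (simp add: ennreal_mult[symmetric] power_divide)
    finally show ?thesis by (simp add: distrib_left)
  qed
  also have "\<dots> \<le> (\<Sum>k<K. ennreal ((b k)\<^sup>2) * big_variance (\<lambda>y x. \<not> exceeds C (b k) y x) k) + ennreal ((b K)\<^sup>2) * big_variance (\<lambda>y x. \<not> exceeds C (b K) y x) K"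
    by (rule add_right_mono[OF Suc])
  finally show ?case by simp
qed simp

lemma expect_Y_square_le: "(\<integral>\<^sup>+\<zeta>. csum (gen k) (\<lambda>u. ennreal ((Y u \<zeta>)\<^sup>2)) \<partial>\<Omega>) \<le> ennreal (\<rho> ^ k * \<rho> ^ k)"
proof -
  have "(\<integral>\<^sup>+\<zeta>. csum (gen k) (\<lambda>u. ennreal ((Y u \<zeta>)\<^sup>2)) \<partial>\<Omega>) \<le> (\<integral>\<^sup>+\<zeta>. csum (gen k) (\<lambda>u. ennreal (Y u \<zeta> * sqrt (Y u \<zeta>))) \<partial>\<Omega>)"
  proof (intro nn_integral_mono csum_mono ennreal_leI)
    fix \<zeta> u
    have "Y u \<zeta> \<le> sqrt (Y u \<zeta>)"
    proof (rule real_le_rsqrt)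
      show "(Y u \<zeta>)\<^sup>2 \<le> Y u \<zeta>" unfolding power2_eq_square by (rule mult_left_le[OF Y_le_1 Y_nonneg])
    qed
    then show "(Y u \<zeta>)\<^sup>2 \<le> Y u \<zeta> * sqrt (Y u \<zeta>)" unfolding power2_eq_square by (rule mult_left_mono) simp
  qed
  also have "\<dots> \<le> ennreal (\<rho> ^ k * \<rho> ^ k)" unfolding expect_Y_sqrt by (intro ennreal_leI phi_power_le)
  finally show ?thesis .
qed

text \<open>In the first \<open>L\<rho> * log x\<close> generations the truncation replaces one
  factor of the square by \<open>C\<close>, which makes the bound linear in \<open>b\<close>. Later
  generations are estimated without truncation: the square of \<open>x * \<rho> ^ k\<close> is at
  most \<open>x * \<rho> ^ k\<close>, and the convergent series that remains involves only the
  majorant \<open>A\<close>.\<close>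

lemma truncated_variance:
  assumes C: "1 \<le> C" and A: "doubling D A" and b: "doubling D b" "\<And>k. b k \<le> A k"
  shows "(\<Sum>k. ennreal ((b k)\<^sup>2) * big_variance (\<lambda>y x. \<not> exceeds C (b k) y x) k) \<le>
    (\<integral>\<^sup>+s. ennreal (X s) * ennreal (C * cumul b (L\<rho> * log_plus (X s)) + (\<Sum>k. (A k)\<^sup>2 * \<rho> ^ k)) \<partial>\<nu>)"
proof -
  have b0: "0 \<le> b k" for k by (rule doubling_nonneg[OF b(1)])
  let ?v = "\<lambda>k x. \<integral>\<^sup>+\<zeta>. csum (gen k) (\<lambda>u. if b k * Y u \<zeta> * x \<le> C then ennreal ((b k * Y u \<zeta> * x)\<^sup>2) else 0) \<partial>\<Omega>"
  have eq: "ennreal ((b k)\<^sup>2) * big_variance (\<lambda>y x. \<not> exceeds C (b k) y x) k = (\<integral>\<^sup>+s. ?v k (X s) \<partial>\<nu>)" for k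
  proof -
    have "ennreal ((b k)\<^sup>2) * big_variance (\<lambda>y x. \<not> exceeds C (b k) y x) k =
      (\<integral>\<^sup>+\<zeta>. csum (gen k) (\<lambda>u. \<integral>\<^sup>+s. ennreal ((b k)\<^sup>2) * (if \<not> exceeds C (b k) (Y u \<zeta>) (X s) then ennreal ((Y u \<zeta> * X s)\<^sup>2) else 0) \<partial>\<nu>) \<partial>\<Omega>)"
      unfolding big_variance_def
      by (simp add: nn_integral_cmult[symmetric])
    also have "\<dots> = (\<integral>\<^sup>+\<zeta>. \<integral>\<^sup>+s. csum (gen k) (\<lambda>u. if b k * Y u \<zeta> * X s \<le> C then ennreal ((b k * Y u \<zeta> * X s)\<^sup>2) else 0) \<partial>\<nu> \<partial>\<Omega>)"
      by (intro nn_integral_cong, subst csum_nn_integral, measurable)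
        (intro csum_cong nn_integral_cong, auto simp: ennreal_mult[symmetric] power_mult_distrib mult_ac not_less)
    also have "\<dots> = (\<integral>\<^sup>+s. ?v k (X s) \<partial>\<nu>)"
    proof -
      interpret PP: pair_sigma_finite \<nu> \<Omega> by unfold_locales
      show ?thesis by (rule PP.Fubini') measurable
    qed
    finally show ?thesis .
  qed
  have smm: "summable (\<lambda>k. (A k)\<^sup>2 * \<rho> ^ k)" by (rule doubling_summable_power2[OF A rho(1,2)])
  have pt: "(\<Sum>k. ?v k x) \<le> ennreal x * ennreal (C * cumul b (L\<rho> * log_plus x) + (\<Sum>k. (A k)\<^sup>2 * \<rho> ^ k))"
    if x: "0 \<le> x" for x
  proof -
    let ?n = "nat \<lfloor>L\<rho> * log_plus x\<rfloor>"
    have "?v k x \<le> ennreal x * ((if k \<le> ?n then ennreal (C * b k) else 0) + ennreal ((A k)\<^sup>2 * \<rho> ^ k))" for k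
    proof (cases "k \<le> ?n")
      case True
      have "?v k x \<le> (\<integral>\<^sup>+\<zeta>. csum (gen k) (\<lambda>u. ennreal (C * b k * x) * ennreal (Y u \<zeta>)) \<partial>\<Omega>)"
      proof (intro nn_integral_mono csum_mono)
        fix \<zeta> u
        let ?t = "b k * Y u \<zeta> * x"
        have "?t * ?t \<le> C * ?t" if "?t \<le> C" using that b0 x by (intro mult_right_mono) auto
        then show "(if ?t \<le> C then ennreal (?t\<^sup>2) else 0) \<le> ennreal (C * b k * x) * ennreal (Y u \<zeta>)"
          using C b0[of k] x by (auto simp: ennreal_mult[symmetric] power2_eq_square mult_ac intro!: ennreal_leI)
      qed
      also have "\<dots> = ennreal (C * b k * x) * (\<integral>\<^sup>+\<zeta>. WE k \<zeta> \<partial>\<Omega>)"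
        unfolding WE_def by (simp add: nn_integral_cmult)
      also have "\<dots> = ennreal x * ennreal (C * b k)"
        using C b0[of k] x by (simp add: expect_WE ennreal_mult[symmetric] mult_ac)
      finally show ?thesis using True by (simp add: distrib_left add_increasing2)
    next
      case False
      then have k: "L\<rho> * log_plus x \<le> real k" using L_rho_pos by (simp add: not_le nat_less_iff floor_less_iff)
      have xk: "x * \<rho> ^ k \<le> 1"
      proof (cases "1 \<le> x")
        case True
        then have "log_plus x = ln x" by (simp add: log_plus_def)
        then show ?thesis using k True by (intro rho_power_bound) auto
      next
        case False
        then have "x * \<rho> ^ k \<le> 1 * 1" using x rho by (intro mult_mono power_le_one) auto
        then show ?thesis by simp
      qed
      have "?v k x \<le> (\<integral>\<^sup>+\<zeta>. csum (gen k) (\<lambda>u. ennreal ((b k * x)\<^sup>2) * ennreal ((Y u \<zeta>)\<^sup>2)) \<partial>\<Omega>)"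
        by (intro nn_integral_mono csum_mono) (auto simp: ennreal_mult[symmetric] power_mult_distrib mult_ac)
      also have "\<dots> = ennreal ((b k * x)\<^sup>2) * (\<integral>\<^sup>+\<zeta>. csum (gen k) (\<lambda>u. ennreal ((Y u \<zeta>)\<^sup>2)) \<partial>\<Omega>)"
        by (simp add: nn_integral_cmult)
      also have "\<dots> \<le> ennreal ((b k * x)\<^sup>2) * ennreal (\<rho> ^ k * \<rho> ^ k)"
        by (rule mult_left_mono[OF expect_Y_square_le zero_le])
      also have "\<dots> = ennreal (((b k)\<^sup>2 * (x * \<rho> ^ k)) * (x * \<rho> ^ k))"
        using rho x b0[of k] by (subst ennreal_mult[symmetric]) (auto simp: power2_eq_square mult_ac)
      also have "\<dots> \<le> ennreal (((b k)\<^sup>2 * (x * \<rho> ^ k)) * 1)"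
        using xk x rho by (intro ennreal_leI mult_left_mono) auto
      also have "\<dots> \<le> ennreal (x * ((A k)\<^sup>2 * \<rho> ^ k))"
      proof (rule ennreal_leI)
        have "(b k)\<^sup>2 * (x * \<rho> ^ k) \<le> (A k)\<^sup>2 * (x * \<rho> ^ k)"
          using b(2) b0 x rho by (intro mult_right_mono power_mono) auto
        then show "(b k)\<^sup>2 * (x * \<rho> ^ k) * 1 \<le> x * ((A k)\<^sup>2 * \<rho> ^ k)" by (simp add: mult_ac)
      qed
      also have "\<dots> = ennreal x * ennreal ((A k)\<^sup>2 * \<rho> ^ k)" using x rho by (intro ennreal_mult) auto
      finally show ?thesis using False by simp
    qed
    then have "(\<Sum>k. ?v k x) \<le> (\<Sum>k. ennreal x * ((if k \<le> ?n then ennreal (C * b k) else 0) + ennreal ((A k)\<^sup>2 * \<rho> ^ k)))"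
      by (intro suminf_le) auto
    also have "\<dots> = ennreal x * ((\<Sum>k. if k \<le> ?n then ennreal (C * b k) else 0) + (\<Sum>k. ennreal ((A k)\<^sup>2 * \<rho> ^ k)))"
      by (subst suminf_add) auto
    also have "(\<Sum>k. if k \<le> ?n then ennreal (C * b k) else 0) = (\<Sum>k\<le>?n. if k \<le> ?n then ennreal (C * b k) else 0)"
      by (rule suminf_finite) auto
    also have "\<dots> = (\<Sum>k\<le>?n. ennreal (C * b k))" by (intro sum.cong) auto
    also have "\<dots> = ennreal (C * cumul b (L\<rho> * log_plus x))"
      unfolding cumul_def sum_distrib_left using C b0 by (intro sum_ennreal) auto
    also have "(\<Sum>k. ennreal ((A k)\<^sup>2 * \<rho> ^ k)) = ennreal (\<Sum>k. (A k)\<^sup>2 * \<rho> ^ k)"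
      using rho smm by (intro suminf_ennreal2) auto
    also have "ennreal (C * cumul b (L\<rho> * log_plus x)) + ennreal (\<Sum>k. (A k)\<^sup>2 * \<rho> ^ k) =
        ennreal (C * cumul b (L\<rho> * log_plus x) + (\<Sum>k. (A k)\<^sup>2 * \<rho> ^ k))"
      using C rho smm b0 by (intro ennreal_plus[symmetric] suminf_nonneg) (auto simp: cumul_def sum_nonneg)
    finally show ?thesis .
  qed
  have "(\<Sum>k. ennreal ((b k)\<^sup>2) * big_variance (\<lambda>y x. \<not> exceeds C (b k) y x) k) = (\<integral>\<^sup>+s. (\<Sum>k. ?v k (X s)) \<partial>\<nu>)"
    unfolding eq by (rule nn_integral_suminf[symmetric]) measurable
  also have "\<dots> \<le> (\<integral>\<^sup>+s. ennreal (X s) * ennreal (C * cumul b (L\<rho> * log_plus (X s)) + (\<Sum>k. (A k)\<^sup>2 * \<rho> ^ k)) \<partial>\<nu>)"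
    by (intro nn_integral_mono pt) simp
  finally show ?thesis .
qed

text \<open>For a heavy individual, a mass above \<open>C * exp (K\<mu> * k)\<close> makes weight
  times mass exceed \<open>C\<close>, even with the smallest admissible factor
  \<open>b = 1\<close>.\<close>

lemma comp_ge_heavy:
  assumes C: "0 \<le> C" and b: "1 \<le> b"
  shows "heavy k \<zeta> * (\<integral>\<^sup>+s. (if C * exp (real (K\<mu> * k)) < X s then ennreal (X s) else 0) \<partial>\<nu>) \<le> comp (exceeds C b) k \<zeta>"
proof -
  let ?h = "\<integral>\<^sup>+s. (if C * exp (real (K\<mu> * k)) < X s then ennreal (X s) else 0) \<partial>\<nu>"
  have "heavy k \<zeta> * ?h = csum (gen k) (\<lambda>u. (if exp (- real (K\<mu> * k)) \<le> Y u \<zeta> then ennreal (Y u \<zeta>) else 0) * ?h)"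
    unfolding heavy_def by (rule nn_integral_multc[symmetric]) simp
  also have "\<dots> \<le> comp (exceeds C b) k \<zeta>"
    unfolding comp_def
  proof (intro csum_mono)
    fix u
    show "(if exp (- real (K\<mu> * k)) \<le> Y u \<zeta> then ennreal (Y u \<zeta>) else 0) * ?h \<le>
        (\<integral>\<^sup>+s. (if exceeds C b (Y u \<zeta>) (X s) then ennreal (Y u \<zeta> * X s) else 0) \<partial>\<nu>)"
    proof (cases "exp (- real (K\<mu> * k)) \<le> Y u \<zeta>")
      case True
      have imp: "exceeds C b (Y u \<zeta>) x" if "C * exp (real (K\<mu> * k)) < x" for x
      proof -
        let ?e = "exp (- real (K\<mu> * k))"
        have x: "0 \<le> x" using that C by (smt (verit) exp_ge_zero mult_nonneg_nonneg)
        have "?e * (C * exp (real (K\<mu> * k))) < ?e * x" using that by (intro mult_strict_left_mono) auto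
        moreover have "?e * (C * exp (real (K\<mu> * k))) = C" by (simp add: exp_minus field_simps)
        moreover have "?e * x \<le> b * Y u \<zeta> * x"
        proof (rule mult_right_mono[OF _ x])
          have "1 * ?e \<le> b * Y u \<zeta>" using True b by (intro mult_mono) auto
          then show "?e \<le> b * Y u \<zeta>" by simp
        qed
        ultimately show ?thesis by (simp only:)
      qed
      have "ennreal (Y u \<zeta>) * ?h = (\<integral>\<^sup>+s. ennreal (Y u \<zeta>) * (if C * exp (real (K\<mu> * k)) < X s then ennreal (X s) else 0) \<partial>\<nu>)"
        by (rule nn_integral_cmult[symmetric]) measurable
      also have "\<dots> \<le> (\<integral>\<^sup>+s. (if exceeds C b (Y u \<zeta>) (X s) then ennreal (Y u \<zeta> * X s) else 0) \<partial>\<nu>)"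
        using imp by (intro nn_integral_mono) (auto simp: ennreal_mult)
      finally show ?thesis using True by simp
    qed simp
  qed
  finally show ?thesis .
qed

lemma expect_abs_le:
  assumes [measurable]: "f \<in> borel_measurable \<Omega>" and lam: "0 < \<tau>"
  shows "(\<integral>\<^sup>+\<zeta>. ennreal \<bar>f \<zeta>\<bar> \<partial>\<Omega>) \<le> ennreal \<tau> + ennreal (1 / \<tau>) * (\<integral>\<^sup>+\<zeta>. ennreal ((f \<zeta>)\<^sup>2) \<partial>\<Omega>)"
proof -
  have "(\<integral>\<^sup>+\<zeta>. ennreal \<bar>f \<zeta>\<bar> \<partial>\<Omega>) \<le> (\<integral>\<^sup>+\<zeta>. ennreal \<tau> + ennreal (1 / \<tau>) * ennreal ((f \<zeta>)\<^sup>2) \<partial>\<Omega>)"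
  proof (intro nn_integral_mono)
    fix \<zeta>
    have "ennreal \<bar>f \<zeta>\<bar> \<le> ennreal (\<tau> + 1 / \<tau> * (f \<zeta>)\<^sup>2)"
      using abs_le_square[OF lam, of "f \<zeta>"] by (intro ennreal_leI) simp
    also have "\<dots> = ennreal \<tau> + ennreal (1 / \<tau> * (f \<zeta>)\<^sup>2)" using lam by (intro ennreal_plus) auto
    also have "ennreal (1 / \<tau> * (f \<zeta>)\<^sup>2) = ennreal (1 / \<tau>) * ennreal ((f \<zeta>)\<^sup>2)" using lam by (intro ennreal_mult) auto
    finally show "ennreal \<bar>f \<zeta>\<bar> \<le> ennreal \<tau> + ennreal (1 / \<tau>) * ennreal ((f \<zeta>)\<^sup>2)" .
  qed
  also have "\<dots> = ennreal \<tau> + ennreal (1 / \<tau>) * (\<integral>\<^sup>+\<zeta>. ennreal ((f \<zeta>)\<^sup>2) \<partial>\<Omega>)"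
    by (simp add: nn_integral_add nn_integral_cmult prod.P.emeasure_space_1)
  finally show ?thesis .
qed

text \<open>On \<open>Ev\<close> no term exceeds \<open>C\<close>, so the truncated martingale minus
  the compensator is the series itself, which is at most \<open>C\<close> in absolute value. The
  compensator is thus bounded by the martingale; the heavy mass bounds its mean from below and the
  variance bounds the martingale from above.\<close>

lemma compensator_bound:
  fixes a :: "nat \<Rightarrow> real"
  assumes a: "\<And>n. 0 \<le> a n" and A: "doubling D (\<lambda>n. \<Sum>k\<le>n. a k)" and C: "1 \<le> C" and lam: "0 < \<tau>"
  defines "A \<equiv> \<lambda>n. \<Sum>k\<le>n. a k"
  defines "Ev \<equiv> \<lambda>\<zeta>. (\<forall>N. \<bar>R a N \<zeta>\<bar> \<le> C) \<and> (\<forall>n. \<forall>u\<in>gen n. A n * Y u \<zeta> * X (\<zeta> u) \<le> C)"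
  assumes Ev: "(\<integral>\<^sup>+\<zeta>. (if Ev \<zeta> then 0 else dominator \<zeta>) \<partial>\<Omega>) \<le> ennreal (1 / 4)"
  shows "ennreal (1 / 2) * (\<integral>\<^sup>+s. ennreal (X s) * jump_weight C (\<lambda>k. A (min k N)) (X s) \<partial>\<nu>) \<le>
    ennreal C + ennreal \<tau> + ennreal (1 / \<tau>) *
    (\<integral>\<^sup>+s. ennreal (X s) * ennreal (C * cumul (\<lambda>k. A (min k N)) (L\<rho> * log_plus (X s)) + (\<Sum>k. (A k)\<^sup>2 * \<rho> ^ k)) \<partial>\<nu>)"
    (is "_ \<le> ?bd")
proof -
  define b where "b k = A (min k N)" for k
  have dA: "doubling D A" using A by (simp add: A_def)
  have db: "doubling D b" unfolding b_def by (rule doubling_min[OF dA])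
  have b1: "1 \<le> b k" for k by (rule doubling_ge_1[OF db])
  have b0: "0 \<le> b k" for k by (rule doubling_nonneg[OF db])
  have bA: "b k \<le> A k" for k unfolding b_def by (rule doubling_mono[OF dA]) simp
  have AN: "0 \<le> A N" by (rule doubling_nonneg[OF dA])
  let ?Z = "\<lambda>k. centred (\<lambda>y x. \<not> exceeds C (b k) y x) k"
  define c where "c k \<zeta> = comp (exceeds C (b k)) k \<zeta>" for k \<zeta>
  have [measurable]: "?Z k \<in> borel_measurable \<Omega>" for k by (rule centred_meas[OF exceeds_meas(2)])
  have [measurable]: "c k \<in> borel_measurable \<Omega>" for k unfolding c_def[abs_def] by (rule comp_meas[OF exceeds_meas(1)])
  have Evm [measurable]: "Measurable.pred \<Omega> Ev" unfolding Ev_def by measurable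
  let ?V = "\<integral>\<^sup>+s. ennreal (X s) * ennreal (C * cumul b (L\<rho> * log_plus (X s)) + (\<Sum>k. (A k)\<^sup>2 * \<rho> ^ k)) \<partial>\<nu>"
  let ?h = "\<lambda>k. \<integral>\<^sup>+s. (if C * exp (real (K\<mu> * k)) < X s then ennreal (X s) else 0) \<partial>\<nu>"
  define S where "S K \<zeta> = (\<Sum>k<K. b k * ?Z k \<zeta>)" for K \<zeta>
  have [measurable]: "S K \<in> borel_measurable \<Omega>" for K unfolding S_def[abs_def] by measurable
  have ES: "(\<integral>\<^sup>+\<zeta>. ennreal \<bar>S K \<zeta>\<bar> \<partial>\<Omega>) \<le> ennreal \<tau> + ennreal (1 / \<tau>) * ?V" for K
  proof -
    have "(\<integral>\<^sup>+\<zeta>. ennreal ((S K \<zeta>)\<^sup>2) \<partial>\<Omega>) \<le> (\<Sum>k<K. ennreal ((b k)\<^sup>2) * big_variance (\<lambda>y x. \<not> exceeds C (b k) y x) k)"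
      unfolding S_def by (rule truncated_sum_second_moment[OF b1])
    also have "\<dots> \<le> (\<Sum>k. ennreal ((b k)\<^sup>2) * big_variance (\<lambda>y x. \<not> exceeds C (b k) y x) k)"
      by (rule sum_le_suminf) auto
    also have "\<dots> \<le> ?V" by (rule truncated_variance[OF C dA db bA])
    finally have "ennreal \<tau> + ennreal (1 / \<tau>) * (\<integral>\<^sup>+\<zeta>. ennreal ((S K \<zeta>)\<^sup>2) \<partial>\<Omega>) \<le> ennreal \<tau> + ennreal (1 / \<tau>) * ?V"
      by (intro add_left_mono mult_left_mono) auto
    then show ?thesis by (rule order.trans[OF expect_abs_le[OF _ lam], rotated]) measurable
  qed
  have step: "ennreal (1 / 2) * (\<Sum>k<K. ennreal (b k) * ?h k) \<le> ennreal C + (ennreal \<tau> + ennreal (1 / \<tau>) * ?V) + ennreal (A N) * dist1 K"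
    if K: "N < K" for K
  proof -
    have "AE \<zeta> in \<Omega>. \<forall>k. Wr (Suc k) \<zeta> - Wr k \<zeta> = ?Z k \<zeta> + centred (exceeds C (b k)) k \<zeta>"
      unfolding AE_all_countable using Wr_diff[OF exceeds_meas(1)] by blast
    moreover have "AE \<zeta> in \<Omega>. \<forall>k. WE k \<zeta> < \<infinity>" using WE_finite by (simp add: AE_all_countable)
    ultimately have AE: "AE \<zeta> in \<Omega>. (if Ev \<zeta> then \<Sum>k<K. ennreal (b k) * c k \<zeta> else 0) \<le>
        ennreal \<bar>S K \<zeta>\<bar> + ennreal C + ennreal (A N) * ennreal \<bar>Wr K \<zeta> - Wl \<zeta>\<bar>"
    proof eventually_elim
      case (elim \<zeta>)
      show ?case
      proof (cases "Ev \<zeta>")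
        case True
        \<comment> \<open>Jumps are bounded for the weights \<open>A k\<close>, a fortiori for the
          smaller \<open>b k\<close>.\<close>
        have part0: "part (exceeds C (b k)) k \<zeta> = 0" for k
        proof -
          have "\<not> exceeds C (b k) (Y u \<zeta>) (X (\<zeta> u))" if "u \<in> gen k" for u
          proof -
            have "b k * Y u \<zeta> * X (\<zeta> u) \<le> A k * Y u \<zeta> * X (\<zeta> u)"
              using bA by (intro mult_right_mono) auto
            also have "\<dots> \<le> C" using True that unfolding Ev_def by blast
            finally show ?thesis by simp
          qed
          then have "part (exceeds C (b k)) k \<zeta> = csum (gen k) (\<lambda>_. 0)" unfolding part_def by (intro csum_cong) simp
          then show ?thesis by simp
        qed
        have cf: "c k \<zeta> = ennreal (enn2real (c k \<zeta>))" for k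
        proof -
          have "c k \<zeta> \<le> WE k \<zeta>" unfolding c_def by (rule comp_le[OF exceeds_meas(1)])
          then have "c k \<zeta> < \<infinity>" using elim(2) by (auto intro: le_less_trans)
          then show ?thesis by simp
        qed
        have diff: "Wr (Suc k) \<zeta> - Wr k \<zeta> = ?Z k \<zeta> - enn2real (c k \<zeta>)" for k
          using elim(1) part0[of k] by (simp add: centred_def[of "exceeds C (b k)"] c_def)
        have "(\<Sum>k<K. b k * (Wr (Suc k) \<zeta> - Wr k \<zeta>)) = S K \<zeta> - (\<Sum>k<K. b k * enn2real (c k \<zeta>))"
          unfolding diff S_def by (simp add: right_diff_distrib sum_subtractf)
        moreover have "(\<Sum>k<K. b k * (Wr (Suc k) \<zeta> - Wr k \<zeta>)) = (\<Sum>n\<le>N. a n * (Wr K \<zeta> - Wr n \<zeta>))"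
          unfolding b_def A_def by (rule weighted_telescope[OF K])
        \<comment> \<open>\<open>R\<close> sums strictly below its bound, hence
          \<open>Suc N\<close>. Exchanging \<open>W K\<close> for the limit costs
          \<open>A N * dist1 K\<close> in mean, which vanishes as \<open>K\<close> grows with
          \<open>N\<close> fixed.\<close>
        moreover have "(\<Sum>n\<le>N. a n * (Wr K \<zeta> - Wr n \<zeta>)) = R a (Suc N) \<zeta> + A N * (Wr K \<zeta> - Wl \<zeta>)"
          unfolding R_def A_def lessThan_Suc_atMost sum_distrib_right sum.distrib[symmetric]
          by (intro sum.cong) (simp_all add: algebra_simps)
        ultimately have "(\<Sum>k<K. b k * enn2real (c k \<zeta>)) = S K \<zeta> - R a (Suc N) \<zeta> - A N * (Wr K \<zeta> - Wl \<zeta>)"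
          by linarith
        also have "\<dots> \<le> \<bar>S K \<zeta>\<bar> + C + A N * \<bar>Wr K \<zeta> - Wl \<zeta>\<bar>"
        proof -
          have "\<bar>R a (Suc N) \<zeta>\<bar> \<le> C" using True unfolding Ev_def by blast
          moreover have "\<bar>A N * (Wr K \<zeta> - Wl \<zeta>)\<bar> = A N * \<bar>Wr K \<zeta> - Wl \<zeta>\<bar>" using AN by (simp add: abs_mult)
          ultimately show ?thesis by linarith
        qed
        finally have le: "(\<Sum>k<K. b k * enn2real (c k \<zeta>)) \<le> \<bar>S K \<zeta>\<bar> + C + A N * \<bar>Wr K \<zeta> - Wl \<zeta>\<bar>" .
        have "(\<Sum>k<K. ennreal (b k) * c k \<zeta>) = (\<Sum>k<K. ennreal (b k * enn2real (c k \<zeta>)))"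
          by (subst cf) (simp add: ennreal_mult[OF b0])
        also have "\<dots> = ennreal (\<Sum>k<K. b k * enn2real (c k \<zeta>))" using b0 by (intro sum_ennreal) auto
        also have "\<dots> \<le> ennreal (\<bar>S K \<zeta>\<bar> + C + A N * \<bar>Wr K \<zeta> - Wl \<zeta>\<bar>)" by (rule ennreal_leI[OF le])
        also have "\<dots> = ennreal \<bar>S K \<zeta>\<bar> + ennreal C + ennreal (A N) * ennreal \<bar>Wr K \<zeta> - Wl \<zeta>\<bar>"
          using C AN by (simp add: ennreal_mult)
        finally show ?thesis using True by simp
      qed simp
    qed
    have half: "ennreal (1 / 2) * ?h k \<le> (\<integral>\<^sup>+\<zeta>. (if Ev \<zeta> then c k \<zeta> else 0) \<partial>\<Omega>)" for k
    proof -
      have "ennreal (1 / 2) * ?h k \<le> (\<integral>\<^sup>+\<zeta>. (if Ev \<zeta> then heavy k \<zeta> else 0) \<partial>\<Omega>) * ?h k"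
        by (rule mult_right_mono[OF heavy_event[OF Evm Ev] zero_le])
      also have "\<dots> = (\<integral>\<^sup>+\<zeta>. (if Ev \<zeta> then heavy k \<zeta> else 0) * ?h k \<partial>\<Omega>)"
        by (rule nn_integral_multc[symmetric]) measurable
      also have "\<dots> \<le> (\<integral>\<^sup>+\<zeta>. (if Ev \<zeta> then c k \<zeta> else 0) \<partial>\<Omega>)"
      proof (intro nn_integral_mono)
        fix \<zeta>
        show "(if Ev \<zeta> then heavy k \<zeta> else 0) * ?h k \<le> (if Ev \<zeta> then c k \<zeta> else 0)"
          using comp_ge_heavy[OF order.trans[OF zero_le_one C] b1[of k], of k \<zeta>]
          by (cases "Ev \<zeta>") (simp_all only: if_True if_False c_def mult_zero_left order_refl)
      qed
      finally show ?thesis .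
    qed
    have "ennreal (1 / 2) * (\<Sum>k<K. ennreal (b k) * ?h k) = (\<Sum>k<K. ennreal (b k) * (ennreal (1 / 2) * ?h k))"
      unfolding sum_distrib_left by (intro sum.cong) (simp_all only: mult.left_commute)
    also have "\<dots> \<le> (\<Sum>k<K. ennreal (b k) * (\<integral>\<^sup>+\<zeta>. (if Ev \<zeta> then c k \<zeta> else 0) \<partial>\<Omega>))"
      by (intro sum_mono mult_left_mono half zero_le)
    also have "\<dots> = (\<integral>\<^sup>+\<zeta>. (\<Sum>k<K. ennreal (b k) * (if Ev \<zeta> then c k \<zeta> else 0)) \<partial>\<Omega>)"
      by (subst nn_integral_sum) (auto simp: nn_integral_cmult)
    also have "\<dots> = (\<integral>\<^sup>+\<zeta>. (if Ev \<zeta> then \<Sum>k<K. ennreal (b k) * c k \<zeta> else 0) \<partial>\<Omega>)"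
      by (intro nn_integral_cong) auto
    also have "\<dots> \<le> (\<integral>\<^sup>+\<zeta>. ennreal \<bar>S K \<zeta>\<bar> + ennreal C + ennreal (A N) * ennreal \<bar>Wr K \<zeta> - Wl \<zeta>\<bar> \<partial>\<Omega>)"
      by (rule nn_integral_mono_AE[OF AE])
    also have "\<dots> = (\<integral>\<^sup>+\<zeta>. ennreal \<bar>S K \<zeta>\<bar> \<partial>\<Omega>) + ennreal C + ennreal (A N) * dist1 K"
      unfolding dist1_def by (simp add: nn_integral_add nn_integral_cmult prod.P.emeasure_space_1)
    also have "\<dots> \<le> (ennreal \<tau> + ennreal (1 / \<tau>) * ?V) + ennreal C + ennreal (A N) * dist1 K"
      by (intro add_right_mono ES)
    finally show ?thesis by (simp only: add.commute add.left_commute)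
  qed
  have lim: "(\<lambda>K. ennreal C + (ennreal \<tau> + ennreal (1 / \<tau>) * ?V) + ennreal (A N) * dist1 K) \<longlonglongrightarrow>
      ennreal C + (ennreal \<tau> + ennreal (1 / \<tau>) * ?V) + ennreal (A N) * 0"
    by (intro tendsto_add tendsto_const ennreal_tendsto_cmult dist1_tendsto) simp
  have fin: "ennreal (1 / 2) * (\<Sum>k<K. ennreal (b k) * ?h k) \<le> ennreal C + (ennreal \<tau> + ennreal (1 / \<tau>) * ?V)" for K
  proof -
    have "ennreal (1 / 2) * (\<Sum>k<K. ennreal (b k) * ?h k) \<le> ennreal C + (ennreal \<tau> + ennreal (1 / \<tau>) * ?V) + ennreal (A N) * dist1 K'"
      if "max K (Suc N) \<le> K'" for K'
    proof -
      have "ennreal (1 / 2) * (\<Sum>k<K. ennreal (b k) * ?h k) \<le> ennreal (1 / 2) * (\<Sum>k<K'. ennreal (b k) * ?h k)"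
        using that by (intro mult_left_mono sum_mono2) auto
      also have "\<dots> \<le> ennreal C + (ennreal \<tau> + ennreal (1 / \<tau>) * ?V) + ennreal (A N) * dist1 K'"
        using that by (intro step) simp
      finally show ?thesis .
    qed
    then have "ennreal (1 / 2) * (\<Sum>k<K. ennreal (b k) * ?h k) \<le> ennreal C + (ennreal \<tau> + ennreal (1 / \<tau>) * ?V) + ennreal (A N) * 0"
      by (intro LIMSEQ_le_const[OF lim]) blast
    then show ?thesis by simp
  qed
  have "(\<integral>\<^sup>+s. ennreal (X s) * jump_weight C b (X s) \<partial>\<nu>) = (\<Sum>k. ennreal (b k) * ?h k)"
  proof -
    have "(\<integral>\<^sup>+s. ennreal (X s) * jump_weight C b (X s) \<partial>\<nu>) =
        (\<integral>\<^sup>+s. (\<Sum>k. ennreal (b k) * (if C * exp (real (K\<mu> * k)) < X s then ennreal (X s) else 0)) \<partial>\<nu>)"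
      unfolding jump_weight_def ennreal_suminf_cmult[symmetric]
      by (intro nn_integral_cong suminf_cong) (auto simp: mult.commute)
    also have "\<dots> = (\<Sum>k. ennreal (b k) * ?h k)"
      by (subst nn_integral_suminf) (auto simp: nn_integral_cmult)
    finally show ?thesis .
  qed
  then have "ennreal (1 / 2) * (\<integral>\<^sup>+s. ennreal (X s) * jump_weight C b (X s) \<partial>\<nu>) = (\<Sum>k. ennreal (1 / 2) * (ennreal (b k) * ?h k))"
    by (simp only: ennreal_suminf_cmult)
  also have "\<dots> \<le> ennreal C + (ennreal \<tau> + ennreal (1 / \<tau>) * ?V)"
  proof (rule suminf_le_const)
    fix K show "(\<Sum>k<K. ennreal (1 / 2) * (ennreal (b k) * ?h k)) \<le> ennreal C + (ennreal \<tau> + ennreal (1 / \<tau>) * ?V)"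
      using fin[of K] by (simp only: sum_distrib_left)
  qed (rule summableI)
  finally show ?thesis unfolding b_def[abs_def] by (simp only: add.assoc)
qed

lemma expect_jump_weight:
  assumes b: "\<And>k. 0 \<le> b k"
  shows "(\<integral>\<^sup>+s. ennreal (X s) * jump_weight C b (X s) \<partial>\<nu>) =
    (\<Sum>k. ennreal (b k) * (\<integral>\<^sup>+s. (if C * exp (real (K\<mu> * k)) < X s then ennreal (X s) else 0) \<partial>\<nu>))"
proof -
  have "(\<integral>\<^sup>+s. ennreal (X s) * jump_weight C b (X s) \<partial>\<nu>) =
      (\<integral>\<^sup>+s. (\<Sum>k. ennreal (b k) * (if C * exp (real (K\<mu> * k)) < X s then ennreal (X s) else 0)) \<partial>\<nu>)"
    unfolding jump_weight_def ennreal_suminf_cmult[symmetric]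
    by (intro nn_integral_cong suminf_cong) (auto simp: mult.commute)
  also have "\<dots> = (\<Sum>k. ennreal (b k) * (\<integral>\<^sup>+s. (if C * exp (real (K\<mu> * k)) < X s then ennreal (X s) else 0) \<partial>\<nu>))"
    by (subst nn_integral_suminf) (auto simp: nn_integral_cmult)
  finally show ?thesis .
qed

text \<open>Dominated convergence as \<open>C\<close> grows: almost surely both suprema are finite.
  The exceptional set is measured by the integral of \<open>dominator\<close>, as
  \<open>heavy_event\<close> requires.\<close>

lemma good_event:
  fixes a :: "nat \<Rightarrow> real"
  assumes a: "\<And>n. 0 \<le> a n" and A: "doubling D (\<lambda>n. \<Sum>k\<le>n. a k)"
    and sm: "AE \<zeta> in \<Omega>. summable (\<lambda>n. a n * (Wl \<zeta> - Wr n \<zeta>))"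
  shows "\<exists>C\<ge>1. (\<integral>\<^sup>+\<zeta>. (if (\<forall>N. \<bar>R a N \<zeta>\<bar> \<le> C) \<and> (\<forall>n. \<forall>u\<in>gen n. (\<Sum>k\<le>n. a k) * Y u \<zeta> * X (\<zeta> u) \<le> C) then 0 else dominator \<zeta>) \<partial>\<Omega>) \<le> ennreal (1 / 4)"
proof -
  define Ev where "Ev C \<zeta> \<longleftrightarrow> (\<forall>N. \<bar>R a N \<zeta>\<bar> \<le> C) \<and> (\<forall>n. \<forall>u\<in>gen n. (\<Sum>k\<le>n. a k) * Y u \<zeta> * X (\<zeta> u) \<le> C)" for C \<zeta>
  have [measurable]: "Measurable.pred \<Omega> (Ev C)" for C unfolding Ev_def[abs_def] by measurable
  have "(\<lambda>C::nat. \<integral>\<^sup>+\<zeta>. (if Ev (real (Suc C)) \<zeta> then 0 else dominator \<zeta>) \<partial>\<Omega>) \<longlonglongrightarrow> (\<integral>\<^sup>+\<zeta>. 0 \<partial>\<Omega>)"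
  proof (rule nn_integral_dominated_convergence[where w = dominator])
    show "AE \<zeta> in \<Omega>. (\<lambda>C::nat. if Ev (real (Suc C)) \<zeta> then 0 else dominator \<zeta>) \<longlonglongrightarrow> 0"
      using sm jumps_bounded[OF a A sm]
    proof eventually_elim
      case (elim \<zeta>)
      obtain C1 where C1: "\<And>N. \<bar>R a N \<zeta>\<bar> \<le> real C1" using summable_imp_bounded_R[OF elim(1)] by blast
      obtain C2 where C2: "\<And>n u. u \<in> gen n \<Longrightarrow> (\<Sum>k\<le>n. a k) * Y u \<zeta> * X (\<zeta> u) \<le> real C2" using elim(2) by blast
      have "Ev (real (Suc C)) \<zeta>" if "max C1 C2 \<le> C" for C
      proof -
        have "\<bar>R a N \<zeta>\<bar> \<le> real (Suc C)" for N using C1[of N] that by simp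
        moreover have "(\<Sum>k\<le>n. a k) * Y u \<zeta> * X (\<zeta> u) \<le> real (Suc C)" if u: "u \<in> gen n" for n u
          using C2[OF u] \<open>max C1 C2 \<le> C\<close> by simp
        ultimately show ?thesis unfolding Ev_def by blast
      qed
      then have "eventually (\<lambda>C. (if Ev (real (Suc C)) \<zeta> then 0 else dominator \<zeta>) = 0) sequentially"
        by (intro eventually_sequentiallyI[of "max C1 C2"]) simp
      then show ?case by (rule tendsto_eventually)
    qed
  qed (use expect_dominator in auto)
  then have "eventually (\<lambda>C::nat. (\<integral>\<^sup>+\<zeta>. (if Ev (real (Suc C)) \<zeta> then 0 else dominator \<zeta>) \<partial>\<Omega>) < ennreal (1 / 4)) sequentially"
    by (rule order_tendstoD) simp
  then obtain C :: nat where C: "(\<integral>\<^sup>+\<zeta>. (if Ev (real (Suc C)) \<zeta> then 0 else dominator \<zeta>) \<partial>\<Omega>) < ennreal (1 / 4)"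
    unfolding eventually_sequentially by blast
  show ?thesis using less_imp_le[OF C] unfolding Ev_def by (intro exI[of _ "real (Suc C)"]) simp
qed

text \<open>The variance in \<open>compensator_bound\<close> is at most \<open>C * K1\<close> times
  the quantity to be bounded, plus a constant. Half of that quantity stands on the left, a quarter
  remains on the right, and letting \<open>N\<close> grow removes the freezing.\<close>

theorem summable_imp_finite_moment_X:
  fixes a :: "nat \<Rightarrow> real"
  assumes a: "\<And>n. 0 \<le> a n" and A: "doubling D (\<lambda>n. \<Sum>k\<le>n. a k)"
    and sm: "AE \<zeta> in \<Omega>. summable (\<lambda>n. a n * (Wl \<zeta> - Wr n \<zeta>))"
  shows "finite_moment_X (\<lambda>n. \<Sum>k\<le>n. a k)"
proof -
  define A where "A n = (\<Sum>k\<le>n. a k)" for n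
  have dA: "doubling D A" using A by (simp add: A_def[abs_def])
  have A0: "0 \<le> A k" for k by (rule doubling_nonneg[OF dA])
  obtain C where C: "1 \<le> C" and Ev: "(\<integral>\<^sup>+\<zeta>. (if (\<forall>N. \<bar>R a N \<zeta>\<bar> \<le> C) \<and>
      (\<forall>n. \<forall>u\<in>gen n. (\<Sum>k\<le>n. a k) * Y u \<zeta> * X (\<zeta> u) \<le> C) then 0 else dominator \<zeta>) \<partial>\<Omega>) \<le> ennreal (1 / 4)"
    using good_event[OF a A sm] by blast
  obtain K1 K2 where K: "1 \<le> K1" "0 \<le> K2" "\<And>b x. doubling D b \<Longrightarrow> (\<And>k. b k \<le> A k) \<Longrightarrow> 0 \<le> x \<Longrightarrow>
      ennreal (cumul b (L\<rho> * log_plus x)) \<le> ennreal K1 * jump_weight C b x + ennreal K2"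
    using cumul_le_jump_weight[OF C less_imp_le[OF L_rho_pos] dA] by blast
  let ?C' = "\<Sum>k. (A k)\<^sup>2 * \<rho> ^ k"
  have C': "0 \<le> ?C'" using rho by (intro suminf_nonneg doubling_summable_power2[OF dA]) auto
  \<comment> \<open>With this choice \<open>C * K1 * kp / \<tau>\<close> equals
    \<open>kp / 4\<close>.\<close>
  define \<tau> where "\<tau> = 4 * C * K1"
  define M where "M = C * K2 + ?C'"
  have tau: "0 < \<tau>" and M: "0 \<le> M" using C K C' by (auto simp: \<tau>_def M_def)
  let ?\<kappa> = "\<lambda>N. \<integral>\<^sup>+s. ennreal (X s) * jump_weight C (\<lambda>k. A (min k N)) (X s) \<partial>\<nu>"
  have bound: "?\<kappa> N \<le> ennreal (4 * (C + \<tau> + M / \<tau>))" for N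
  proof -
    define b where "b k = A (min k N)" for k
    have db: "doubling D b" unfolding b_def by (rule doubling_min[OF dA])
    have bA: "b k \<le> A k" for k unfolding b_def by (rule doubling_mono[OF dA]) simp
    have b0: "0 \<le> b k" for k unfolding b_def by (rule A0)
    \<comment> \<open>Finiteness for frozen weights, without which the term could not be moved to
      the other side.\<close>
    have "?\<kappa> N < \<infinity>"
      by (rule jump_weight_finite[OF C A0, of _ "A N"]) (rule doubling_mono[OF dA], simp)
    then obtain kp where kp: "?\<kappa> N = ennreal kp" "0 \<le> kp" by (cases "?\<kappa> N") auto
    have V: "(\<integral>\<^sup>+s. ennreal (X s) * ennreal (C * cumul b (L\<rho> * log_plus (X s)) + ?C') \<partial>\<nu>) \<le> ennreal (C * K1 * kp + M)"
    proof -
      have "(\<integral>\<^sup>+s. ennreal (X s) * ennreal (C * cumul b (L\<rho> * log_plus (X s)) + ?C') \<partial>\<nu>) \<le>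
          (\<integral>\<^sup>+s. ennreal (C * K1) * (ennreal (X s) * jump_weight C b (X s)) + ennreal M * ennreal (X s) \<partial>\<nu>)"
      proof (intro nn_integral_mono)
        fix s
        have SA0: "0 \<le> cumul b (L\<rho> * log_plus (X s))" unfolding cumul_def using b0 by (intro sum_nonneg)
        have "ennreal (C * cumul b (L\<rho> * log_plus (X s)) + ?C') = ennreal C * ennreal (cumul b (L\<rho> * log_plus (X s))) + ennreal ?C'"
          using C C' SA0 by (subst ennreal_plus) (auto simp: ennreal_mult)
        also have "\<dots> \<le> ennreal C * (ennreal K1 * jump_weight C b (X s) + ennreal K2) + ennreal ?C'"
          by (intro add_right_mono mult_left_mono K(3)[OF db bA X_nonneg] zero_le)
        also have "\<dots> = ennreal (C * K1) * jump_weight C b (X s) + ennreal M"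
        proof -
          have "ennreal M = ennreal C * ennreal K2 + ennreal ?C'"
            unfolding M_def using C K C' by (subst ennreal_plus) (auto simp: ennreal_mult)
          moreover have "ennreal (C * K1) = ennreal C * ennreal K1" using C K by (intro ennreal_mult) auto
          ultimately show ?thesis by (simp only: distrib_left mult.assoc add.assoc)
        qed
        finally have "ennreal (X s) * ennreal (C * cumul b (L\<rho> * log_plus (X s)) + ?C') \<le>
            ennreal (X s) * (ennreal (C * K1) * jump_weight C b (X s) + ennreal M)" by (rule mult_left_mono) (rule zero_le)
        then show "ennreal (X s) * ennreal (C * cumul b (L\<rho> * log_plus (X s)) + ?C') \<le>
            ennreal (C * K1) * (ennreal (X s) * jump_weight C b (X s)) + ennreal M * ennreal (X s)"
          by (simp only: distrib_left mult.left_commute mult.commute[of "ennreal (X s)" "ennreal M"])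
      qed
      also have "\<dots> = ennreal (C * K1) * ennreal kp + ennreal M"
        unfolding kp(1)[symmetric] b_def by (simp add: nn_integral_add nn_integral_cmult EX)
      also have "\<dots> = ennreal (C * K1 * kp + M)"
        using C K kp(2) M by (subst ennreal_plus) (auto simp: ennreal_mult)
      finally show ?thesis .
    qed
    have "ennreal (1 / 2 * kp) = ennreal (1 / 2) * ?\<kappa> N"
      unfolding kp(1) using kp(2) by (intro ennreal_mult) auto
    also have "\<dots> \<le> ennreal C + ennreal \<tau> + ennreal (1 / \<tau>) *
        (\<integral>\<^sup>+s. ennreal (X s) * ennreal (C * cumul b (L\<rho> * log_plus (X s)) + ?C') \<partial>\<nu>)"
      using compensator_bound[OF a A C tau Ev, of N] unfolding A_def b_def .
    also have "\<dots> \<le> ennreal C + ennreal \<tau> + ennreal (1 / \<tau>) * ennreal (C * K1 * kp + M)"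
      by (intro add_left_mono mult_left_mono V zero_le)
    also have "\<dots> = ennreal (C + \<tau> + 1 / \<tau> * (C * K1 * kp + M))"
    proof -
      have nn: "0 \<le> C * K1 * kp + M" using C K kp(2) M by simp
      have "ennreal (1 / \<tau> * (C * K1 * kp + M)) = ennreal (1 / \<tau>) * ennreal (C * K1 * kp + M)"
        using tau nn by (intro ennreal_mult) auto
      moreover have "ennreal (C + \<tau> + 1 / \<tau> * (C * K1 * kp + M)) = ennreal C + ennreal \<tau> + ennreal (1 / \<tau> * (C * K1 * kp + M))"
      proof -
        have "0 \<le> 1 / \<tau> * (C * K1 * kp + M)" using tau nn by simp
        then show ?thesis using C tau by (simp only: ennreal_plus add_nonneg_nonneg order.trans[OF zero_le_one] less_imp_le)
      qed
      ultimately show ?thesis by (simp only:)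
    qed
    finally have "1 / 2 * kp \<le> C + \<tau> + 1 / \<tau> * (C * K1 * kp + M)"
      using C tau K kp(2) M by (subst (asm) ennreal_le_iff) auto
    moreover have eq: "1 / \<tau> * (C * K1 * kp + M) = kp / 4 + M / \<tau>"
      using C K by (simp add: \<tau>_def field_simps)
    ultimately have "1 / 2 * kp \<le> C + \<tau> + (kp / 4 + M / \<tau>)" by (simp only:)
    then have "kp \<le> 4 * (C + \<tau> + M / \<tau>)" by (simp only: distrib_left)
    then show ?thesis unfolding kp(1) by (rule ennreal_leI)
  qed
  have fin: "(\<integral>\<^sup>+s. ennreal (X s) * jump_weight C A (X s) \<partial>\<nu>) \<le> ennreal (4 * (C + \<tau> + M / \<tau>))"
    unfolding expect_jump_weight[of A, OF A0]
  proof (rule suminf_le_const)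
    fix N
    let ?h = "\<lambda>k. \<integral>\<^sup>+s. (if C * exp (real (K\<mu> * k)) < X s then ennreal (X s) else 0) \<partial>\<nu>"
    have "(\<Sum>k<N. ennreal (A k) * ?h k) = (\<Sum>k<N. ennreal (A (min k N)) * ?h k)" by (intro sum.cong) auto
    also have "\<dots> \<le> (\<Sum>k. ennreal (A (min k N)) * ?h k)" by (rule sum_le_suminf) auto
    also have "\<dots> = ?\<kappa> N" by (rule expect_jump_weight[symmetric, OF A0])
    also note bound
    finally show "(\<Sum>k<N. ennreal (A k) * ?h k) \<le> ennreal (4 * (C + \<tau> + M / \<tau>))" .
  qed (rule summableI)
  obtain K3 K4 where K3: "\<And>x. 0 \<le> x \<Longrightarrow> ennreal (cumul A (1 * log_plus x)) \<le> ennreal K3 * jump_weight C A x + ennreal K4"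
    using cumul_le_jump_weight[OF C zero_le_one dA] dA by blast
  have "(\<integral>\<^sup>+s. ennreal (X s * cumul A (log_plus (X s))) \<partial>\<nu>) \<le>
      (\<integral>\<^sup>+s. ennreal K3 * (ennreal (X s) * jump_weight C A (X s)) + ennreal K4 * ennreal (X s) \<partial>\<nu>)"
  proof (intro nn_integral_mono)
    fix s
    have "ennreal (X s * cumul A (log_plus (X s))) = ennreal (X s) * ennreal (cumul A (1 * log_plus (X s)))"
      unfolding mult_1 by (intro ennreal_mult') simp
    also have "\<dots> \<le> ennreal (X s) * (ennreal K3 * jump_weight C A (X s) + ennreal K4)"
      by (rule mult_left_mono[OF K3[OF X_nonneg] zero_le])
    finally show "ennreal (X s * cumul A (log_plus (X s))) \<le> ennreal K3 * (ennreal (X s) * jump_weight C A (X s)) + ennreal K4 * ennreal (X s)"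
      by (simp only: distrib_left mult.left_commute mult.commute[of "ennreal (X s)" "ennreal K4"])
  qed
  also have "\<dots> = ennreal K3 * (\<integral>\<^sup>+s. ennreal (X s) * jump_weight C A (X s) \<partial>\<nu>) + ennreal K4"
    by (simp add: nn_integral_add nn_integral_cmult EX)
  also have "\<dots> < \<infinity>"
    using le_less_trans[OF fin] by (simp add: ennreal_mult_less_top)
  finally show ?thesis by (simp add: finite_moment_X_def A_def[abs_def])
qed

theorem summable_iff_finite_moment_W:
  fixes a :: "nat \<Rightarrow> real"
  assumes a: "\<And>n. 0 \<le> a n" and A: "doubling D (\<lambda>n. \<Sum>k\<le>n. a k)"
  shows "(AE \<zeta> in \<Omega>. summable (\<lambda>n. a n * (Wl \<zeta> - Wr n \<zeta>))) \<longleftrightarrow> finite_moment_W (\<lambda>n. \<Sum>k\<le>n. a k)"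
  using finite_moment_X_imp_summable[OF a A] summable_imp_finite_moment_X[OF a A] finite_moment_X_imp_finite_moment_W[OF a A] finite_moment_W_imp_finite_moment_X[OF a A]
  by blast

end

subsection \<open>Regularly varying functions\<close>

lemma near_constant_set_measurable:
  fixes g :: "real \<Rightarrow> real" and t :: "nat \<Rightarrow> real"
  assumes [measurable]: "g \<in> borel_measurable borel"
  shows "{x\<in>{0..2}. \<forall>m\<ge>n. \<bar>g (t m + x) - g (t m)\<bar> \<le> 1 / 2} \<in> sets borel"
proof -
  have "{x\<in>space borel. x \<in> {0..2} \<and> (\<forall>m\<ge>n. \<bar>g (t m + x) - g (t m)\<bar> \<le> 1 / 2)} \<in> sets borel" by measurable
  then show ?thesis by simp
qed

text \<open>Pointwise convergence makes these sets increase to the whole interval, whose length is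
  2; continuity of measure replaces uniformity in \<open>x\<close>.\<close>

lemma near_constant_set_large:
  fixes g :: "real \<Rightarrow> real" and t :: "nat \<Rightarrow> real"
  assumes [measurable]: "g \<in> borel_measurable borel"
    and g: "\<And>s. ((\<lambda>t. g (t + s) - g t) \<longlongrightarrow> 0) at_top"
    and t: "filterlim t at_top sequentially"
  shows "\<forall>\<^sub>F n in sequentially. ennreal (3 / 2) < emeasure lborel {x\<in>{0..2}. \<forall>m\<ge>n. \<bar>g (t m + x) - g (t m)\<bar> \<le> 1 / 2}"
proof -
  define E where "E = (\<lambda>n. {x\<in>{0..2}. \<forall>m\<ge>n. \<bar>g (t m + x) - g (t m)\<bar> \<le> 1 / 2})"
  have E_sets: "E n \<in> sets lborel" for n
    using near_constant_set_measurable[OF assms(1)] by (simp add: E_def)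
  have "(\<lambda>n. emeasure lborel (E n)) \<longlonglongrightarrow> emeasure lborel (\<Union>n. E n)"
  proof (rule Lim_emeasure_incseq)
    show "range E \<subseteq> sets lborel" using E_sets by auto
    show "incseq E" unfolding incseq_def E_def by (auto intro: le_trans)
  qed
  moreover have "(\<Union>n. E n) = {0..2}"
  proof (intro equalityI subsetI)
    fix x :: real assume x: "x \<in> {0..2}"
    have "(\<lambda>n. g (t n + x) - g (t n)) \<longlonglongrightarrow> 0" by (rule filterlim_compose[OF g t])
    then have "\<forall>\<^sub>F n in sequentially. dist (g (t n + x) - g (t n)) 0 < 1 / 2" by (rule tendstoD) simp
    then obtain N where "\<And>n. N \<le> n \<Longrightarrow> \<bar>g (t n + x) - g (t n)\<bar> < 1 / 2"
      by (auto simp: eventually_sequentially)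
    then have "x \<in> E N" using x by (auto simp: E_def intro: less_imp_le)
    then show "x \<in> (\<Union>n. E n)" by auto
  qed (auto simp: E_def)
  ultimately have "(\<lambda>n. emeasure lborel (E n)) \<longlonglongrightarrow> ennreal 2" by simp
  then have "\<forall>\<^sub>F n in sequentially. ennreal (3 / 2) < emeasure lborel (E n)"
    by (rule order_tendstoD) (simp add: ennreal_less_iff)
  then show ?thesis unfolding E_def .
qed

text \<open>A weak form of the uniform convergence theorem for slowly varying functions, in additive
  notation. If increments over \<open>s n\<close> stayed above 1, the near-constant sets around
  \<open>t n\<close> and around \<open>t n + s n\<close> would be disjoint. But they lie in an
  interval of length 3 and each is longer than 3/2.\<close>

lemma eventually_bounded_increments:
  fixes g :: "real \<Rightarrow> real"
  assumes [measurable]: "g \<in> borel_measurable borel"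
    and g: "\<And>s. ((\<lambda>t. g (t + s) - g t) \<longlongrightarrow> 0) at_top"
  shows "\<exists>T. \<forall>t\<ge>T. \<forall>s\<in>{0..1}. \<bar>g (t + s) - g t\<bar> \<le> 1"
proof (rule ccontr)
  assume "\<not> ?thesis"
  then have "\<forall>n::nat. \<exists>t. \<exists>s. real n \<le> t \<and> s \<in> {0..1} \<and> 1 < \<bar>g (t + s) - g t\<bar>"
    unfolding not_ex not_all not_imp Bex_def Ball_def not_le by blast
  then obtain t s where ts: "\<And>n. real n \<le> t n" "\<And>n. s n \<in> {0..1}" "\<And>n. 1 < \<bar>g (t n + s n) - g (t n)\<bar>"
    by metis
  have t: "filterlim t at_top sequentially"
    by (rule filterlim_at_top_mono[OF filterlim_real_sequentially]) (use ts(1) in auto)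
  have t': "filterlim (\<lambda>n. t n + s n) at_top sequentially"
    by (rule filterlim_at_top_mono[OF t]) (use ts(2) in auto)
  define V where "V = (\<lambda>n. {x\<in>{0..2}. \<forall>m\<ge>n. \<bar>g (t m + x) - g (t m)\<bar> \<le> 1 / 2})"
  define U where "U = (\<lambda>n. {x\<in>{0..2}. \<forall>m\<ge>n. \<bar>g (t m + s m + x) - g (t m + s m)\<bar> \<le> 1 / 2})"
  have "\<forall>\<^sub>F n in sequentially. ennreal (3 / 2) < emeasure lborel (V n) \<and> ennreal (3 / 2) < emeasure lborel (U n)"
    unfolding V_def U_def by (intro eventually_conj near_constant_set_large[OF assms] t t')
  then obtain n where V: "ennreal (3 / 2) < emeasure lborel (V n)" and U: "ennreal (3 / 2) < emeasure lborel (U n)"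
    using eventually_happens'[OF sequentially_bot] by blast
  define U' where "U' = {x. x - s n \<in> U n}"
  have sets: "V n \<in> sets borel" "U n \<in> sets borel"
    unfolding V_def U_def by (rule near_constant_set_measurable[OF assms(1)])+
  have U'_sets: "U' \<in> sets borel"
    using measurable_sets[of "\<lambda>x. x - s n" borel borel "U n"] sets by (simp add: U'_def vimage_def)
  have "emeasure lborel (U n) = emeasure (distr lborel borel ((+) (- s n))) (U n)"
    by (simp add: lborel_distr_plus)
  also have "\<dots> = emeasure lborel U'"
    using sets by (simp add: emeasure_distr U'_def vimage_def)
  finally have U': "ennreal (3 / 2) < emeasure lborel U'" using U by simp
  have "V n \<inter> U' = {}"
  proof (rule ccontr)
    assume "V n \<inter> U' \<noteq> {}"
    then obtain x where "x \<in> V n" "x - s n \<in> U n" by (auto simp: U'_def)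
    then have "\<bar>g (t n + x) - g (t n)\<bar> \<le> 1 / 2" "\<bar>g (t n + s n + (x - s n)) - g (t n + s n)\<bar> \<le> 1 / 2"
      by (auto simp: V_def U_def)
    moreover have "t n + s n + (x - s n) = t n + x" by simp
    ultimately have "\<bar>g (t n + s n) - g (t n)\<bar> \<le> 1" by (simp only:)
    then show False using ts(3)[of n] by linarith
  qed
  then have "emeasure lborel (V n) + emeasure lborel U' = emeasure lborel (V n \<union> U')"
    using sets U'_sets by (intro plus_emeasure) auto
  also have "\<dots> \<le> emeasure lborel {0..3::real}"
    using ts(2)[of n] by (intro emeasure_mono) (auto simp: V_def U_def U'_def)
  also have "\<dots> = ennreal (3 / 2) + ennreal (3 / 2)" by (simp flip: ennreal_plus)
  also have "\<dots> < emeasure lborel (V n) + emeasure lborel U'" using V U' by (rule add_strict_mono)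
  finally show False by simp
qed

text \<open>After the substitution \<open>x = exp t\<close> the function
  \<open>ln (a (exp t)) - \<alpha> * t\<close> has vanishing increments, and boundedness of these
  increments uniformly on \<open>[0, 1]\<close> compares the values of \<open>a\<close> throughout
  \<open>[x, 2 * x]\<close>, as \<open>ln 2 < 1\<close>.\<close>

lemma regularly_varying_bounds:
  assumes rv: "regularly_varying a \<alpha>" and nn: "\<And>x. 0 \<le> x \<Longrightarrow> 0 \<le> a x" and alpha: "-1 < \<alpha>"
  obtains x0 C q where "1 \<le> x0" "1 \<le> C" "1 < q"
    "\<And>x. x0 \<le> x \<Longrightarrow> q * (x * a x) \<le> (2 * x) * a (2 * x)"
    "\<And>x y. x0 \<le> x \<Longrightarrow> x \<le> y \<Longrightarrow> y \<le> 2 * x \<Longrightarrow> a x \<le> C * a y \<and> a y \<le> C * a x"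
proof -
  have meas: "a \<in> borel_measurable (restrict_space borel {0..})"
    and lim: "\<And>c. 0 < c \<Longrightarrow> ((\<lambda>x. a (c * x) / a x) \<longlongrightarrow> c powr \<alpha>) at_top"
    using rv unfolding regularly_varying_def by blast+
  have "\<forall>\<^sub>F x in at_top. 0 < a (1 * x) / a x" by (rule order_tendstoD(1)[OF lim]) simp_all
  moreover have "\<forall>\<^sub>F x in at_top. (0::real) \<le> x" by (rule eventually_ge_at_top)
  ultimately have pos: "\<forall>\<^sub>F x in at_top. 0 < a x"
  proof eventually_elim
    case (elim x)
    then show ?case using nn[of x] by (cases "a x = 0") simp_all
  qed
  define g where "g = (\<lambda>t. ln (a (exp t)) - \<alpha> * t)"
  have "(\<lambda>t. a (exp t)) \<in> borel_measurable borel"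
    by (rule measurable_compose[OF _ meas], rule measurable_restrict_space2) auto
  then have g_meas: "g \<in> borel_measurable borel" unfolding g_def by measurable
  have g_lim: "((\<lambda>t. g (t + s) - g t) \<longlongrightarrow> 0) at_top" for s
  proof -
    have "((\<lambda>t. a (exp s * exp t) / a (exp t)) \<longlongrightarrow> exp s powr \<alpha>) at_top"
      by (rule filterlim_compose[OF lim[OF exp_gt_zero] exp_at_top])
    then have "((\<lambda>t. ln (a (exp s * exp t) / a (exp t)) - \<alpha> * s) \<longlongrightarrow> ln (exp s powr \<alpha>) - \<alpha> * s) at_top"
      by (intro tendsto_intros) auto
    then have *: "((\<lambda>t. ln (a (exp s * exp t) / a (exp t)) - \<alpha> * s) \<longlongrightarrow> 0) at_top"
      by (simp add: ln_powr)
    have ev: "\<forall>\<^sub>F t in at_top. 0 < a (exp (t + u))" for u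
    proof -
      obtain x1 where x1: "0 < x1" "\<And>x. x1 \<le> x \<Longrightarrow> 0 < a x"
        using eventually_conj[OF pos eventually_gt_at_top[of 0]] unfolding eventually_at_top_linorder
        by (meson order.refl)
      show ?thesis
      proof (rule eventually_at_top_linorderI[of "ln x1 - u"])
        fix t assume "ln x1 - u \<le> t"
        then have "exp (ln x1) \<le> exp (t + u)" by simp
        then show "0 < a (exp (t + u))" using x1 by simp
      qed
    qed
    have "\<forall>\<^sub>F t in at_top. 0 < a (exp t)" using ev[of 0] by simp
    moreover note ev[of s]
    ultimately have "\<forall>\<^sub>F t in at_top. ln (a (exp s * exp t) / a (exp t)) - \<alpha> * s = g (t + s) - g t"
      by eventually_elim (simp add: g_def exp_add ln_div algebra_simps)
    then show ?thesis using * by (rule Lim_transform_eventually[rotated])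
  qed
  obtain T where T: "\<And>t s. T \<le> t \<Longrightarrow> s \<in> {0..1} \<Longrightarrow> \<bar>g (t + s) - g t\<bar> \<le> 1"
    using eventually_bounded_increments[OF g_meas g_lim] by blast
  obtain x1 where x1: "\<And>x. x1 \<le> x \<Longrightarrow> 0 < a x" using pos by (auto simp: eventually_at_top_linorder)
  \<comment> \<open>The midpoint of -1 and \<alpha>: below \<alpha>, so
    \<open>a (2 * x) / a x\<close> eventually exceeds \<open>2 powr \<beta>\<close>, and above -1,
    so doubling the argument multiplies \<open>x * a x\<close> by at least some
    \<open>q > 1\<close>.\<close>
  define \<beta> where "\<beta> = (\<alpha> - 1) / 2"
  have \<beta>: "-1 < \<beta>" "\<beta> < \<alpha>" using alpha by (auto simp: \<beta>_def)
  have "\<forall>\<^sub>F x in at_top. 2 powr \<beta> < a (2 * x) / a x"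
    by (rule order_tendstoD(1)[OF lim]) (use \<beta> in simp_all)
  then obtain x2 where x2: "\<And>x. x2 \<le> x \<Longrightarrow> 2 powr \<beta> < a (2 * x) / a x" by (auto simp: eventually_at_top_linorder)
  define C where "C = exp (1 + \<bar>\<alpha>\<bar>)"
  define q where "q = (2::real) powr (1 + \<beta>)"
  define x0 where "x0 = max 1 (max x1 (max x2 (exp T)))"
  show ?thesis
  proof (rule that[of x0 C q])
    show "1 \<le> x0" by (simp add: x0_def)
    show "1 \<le> C" by (simp add: C_def)
    show "1 < q" using \<beta> by (simp add: q_def)
    fix x assume x: "x0 \<le> x"
    then have x': "1 \<le> x" "x1 \<le> x" "x2 \<le> x" "exp T \<le> x" by (auto simp: x0_def)
    have "2 powr \<beta> * a x \<le> a (2 * x)" using x2[OF x'(3)] x1[OF x'(2)] by (simp add: field_simps)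
    then have "2 * x * (2 powr \<beta> * a x) \<le> 2 * x * a (2 * x)" using x' by (intro mult_left_mono) auto
    then show "q * (x * a x) \<le> (2 * x) * a (2 * x)" by (simp add: q_def powr_add mult_ac)
    fix y assume y: "x \<le> y" "y \<le> 2 * x"
    define t s where "t = ln x" and "s = ln y - ln x"
    have xy: "0 < x" "0 < y" "x1 \<le> y" using x' y by auto
    have "s \<le> ln (2 * x) - ln x" unfolding s_def using xy y by simp
    also have "\<dots> = ln 2" using xy by (simp add: ln_mult)
    also have "\<dots> \<le> 1" using ln_2_less_1 by simp
    finally have s: "s \<in> {0..1}" using xy y by (simp add: s_def)
    have "T \<le> t" using x'(4) xy(1) by (simp add: t_def ln_ge_iff)
    then have "\<bar>g (t + s) - g t\<bar> \<le> 1" using s by (rule T)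
    moreover have "g (t + s) - g t = ln (a y) - ln (a x) - \<alpha> * s"
      using xy by (simp add: g_def t_def s_def algebra_simps)
    moreover have "\<bar>\<alpha> * s\<bar> \<le> \<bar>\<alpha>\<bar>" using s by (simp add: abs_mult mult_left_le)
    ultimately have "ln (a x) \<le> (1 + \<bar>\<alpha>\<bar>) + ln (a y)" "ln (a y) \<le> (1 + \<bar>\<alpha>\<bar>) + ln (a x)" by linarith+
    then have "exp (ln (a x)) \<le> exp ((1 + \<bar>\<alpha>\<bar>) + ln (a y))" "exp (ln (a y)) \<le> exp ((1 + \<bar>\<alpha>\<bar>) + ln (a x))"
      by (simp_all only: exp_le_cancel_iff)
    then show "a x \<le> C * a y \<and> a y \<le> C * a x"
      unfolding exp_add C_def using x1[OF x'(2)] x1[OF xy(3)] by simp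
  qed
qed

text \<open>Karamata's comparison of the partial sums with \<open>x * a x\<close>, up to constants.
  The 1 added at \<open>k = 0\<close> makes all partial sums at least 1 and changes only one term of
  the series.\<close>

lemma regularly_varying_partial_sums:
  assumes rv: "regularly_varying a \<alpha>" and nn: "\<And>x. 0 \<le> x \<Longrightarrow> 0 \<le> a x" and alpha: "-1 < \<alpha>"
  defines "A \<equiv> \<lambda>n. \<Sum>k\<le>n. a (real k) + (if k = 0 then 1 else 0)"
  obtains D K where "doubling D A" "0 \<le> K"
    "\<And>x. 0 \<le> x \<Longrightarrow> x * a x \<le> K * A (nat \<lfloor>x\<rfloor>)"
    "\<And>x. 0 \<le> x \<Longrightarrow> A (nat \<lfloor>x\<rfloor>) \<le> K * (x * a x) + K"
proof -
  obtain x0 C q where x0: "1 \<le> x0" and C: "1 \<le> C" and q: "1 < q"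
    and fq: "\<And>x. x0 \<le> x \<Longrightarrow> q * (x * a x) \<le> (2 * x) * a (2 * x)"
    and aC: "\<And>x y. x0 \<le> x \<Longrightarrow> x \<le> y \<Longrightarrow> y \<le> 2 * x \<Longrightarrow> a x \<le> C * a y \<and> a y \<le> C * a x"
    using regularly_varying_bounds[OF rv nn alpha] by blast
  let ?a' = "\<lambda>k::nat. a (real k) + (if k = 0 then 1 else 0)"
  have a'_nn: "0 \<le> ?a' k" for k using nn[of "real k"] by simp
  have A_mono: "A m \<le> A n" if "m \<le> n" for m n
    unfolding A_def using that by (intro sum_mono2 a'_nn) auto
  have A1: "1 \<le> A n" for n
  proof -
    have "1 \<le> A 0" using nn[of 0] by (simp add: A_def)
    also have "\<dots> \<le> A n" by (rule A_mono) simp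
    finally show ?thesis .
  qed
  define X where "X = 2 * x0 + 4"
  have "bounded (a ` {0..X})" using rv by (simp add: regularly_varying_def)
  then obtain B where B: "0 < B" "\<And>x. 0 \<le> x \<Longrightarrow> x \<le> X \<Longrightarrow> a x \<le> B"
    unfolding bounded_pos by (force simp: abs_le_iff)
  define K1 where "K1 = X * B + 4 * C"
  have f_le: "x * a x \<le> K1 * A (nat \<lfloor>x\<rfloor>)" if x: "0 \<le> x" for x
  proof (cases "x \<le> X")
    case True
    have "x * a x \<le> X * B" using True x B nn by (intro mult_mono) auto
    also have "\<dots> \<le> K1 * 1" using C by (simp add: K1_def)
    also have "\<dots> \<le> K1 * A (nat \<lfloor>x\<rfloor>)"
      using A1 B C x True by (intro mult_left_mono) (auto simp: K1_def intro!: add_nonneg_nonneg mult_nonneg_nonneg)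
    finally show ?thesis .
  next
    case False
    \<comment> \<open>For the upper bound on \<open>x * a x\<close> the upper half of the sum is
      enough: it has at least \<open>x / 4\<close> terms, each comparable to
      \<open>a x\<close>.\<close>
    define I where "I = {nat \<lceil>x / 2\<rceil>..nat \<lfloor>x\<rfloor>}"
    have card: "x / 4 \<le> real (card I)"
      using False x0 unfolding I_def X_def card_atLeastAtMost by linarith
    have "x / 4 * (a x / C) \<le> real (card I) * (a x / C)"
      using card C nn[OF x] by (intro mult_right_mono) auto
    also have "\<dots> = (\<Sum>k\<in>I. a x / C)" by simp
    also have "\<dots> \<le> (\<Sum>k\<in>I. ?a' k)"
    proof (rule sum_mono)
      fix k assume "k \<in> I"
      then have "x / 2 \<le> real k" "real k \<le> x" using x unfolding I_def atLeastAtMost_iff by linarith+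
      moreover have "x0 \<le> x / 2" using False by (simp add: X_def)
      ultimately have "a x \<le> C * a (real k)" using aC[of "real k" x] by simp
      then have "a x / C \<le> a (real k)" using C by (simp add: divide_le_eq mult.commute)
      then show "a x / C \<le> ?a' k" by auto
    qed
    also have "\<dots> \<le> A (nat \<lfloor>x\<rfloor>)" unfolding A_def I_def by (intro sum_mono2 a'_nn) auto
    finally have "x * a x \<le> 4 * C * A (nat \<lfloor>x\<rfloor>)" using C by (simp add: field_simps)
    also have "\<dots> \<le> K1 * A (nat \<lfloor>x\<rfloor>)"
      using A1[of "nat \<lfloor>x\<rfloor>"] B x0 by (intro mult_right_mono) (auto simp: K1_def X_def)
    finally show ?thesis .
  qed
  have K1: "0 \<le> K1" using B C x0 by (simp add: K1_def X_def)
  \<comment> \<open>The solution of \<open>C + K2 / q = K2\<close>. In the induction the upper half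
    of the sum costs \<open>C * x * a x\<close>, and halving the argument shrinks
    \<open>x * a x\<close> by the factor \<open>q\<close>.\<close>
  define K2 where "K2 = C * q / (q - 1)"
  define K3 where "K3 = A (nat \<lfloor>X\<rfloor>)"
  have K2: "0 \<le> K2" "C + K2 / q = K2" using q C by (simp_all add: K2_def field_simps)
  have A_le: "A (nat \<lfloor>x\<rfloor>) \<le> K2 * (x * a x) + K3" if "0 \<le> x" for x
    using that
  proof (induction "nat \<lfloor>x\<rfloor>" arbitrary: x rule: less_induct)
    case less
    show ?case
    proof (cases "x \<le> X")
      case True
      then have "A (nat \<lfloor>x\<rfloor>) \<le> K3" unfolding K3_def by (intro A_mono nat_mono floor_mono)
      moreover have "0 \<le> K2 * (x * a x)" using less.prems nn K2 by simp
      ultimately show ?thesis by simp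
    next
      case False
      define J where "J = {nat \<lfloor>x / 2\<rfloor><..nat \<lfloor>x\<rfloor>}"
      have x: "x0 \<le> x / 2" "4 \<le> x" using False x0 by (auto simp: X_def)
      have lt: "nat \<lfloor>x / 2\<rfloor> < nat \<lfloor>x\<rfloor>" using x by linarith
      have IH: "A (nat \<lfloor>x / 2\<rfloor>) \<le> K2 * (x / 2 * a (x / 2)) + K3"
        using less.hyps[OF lt] x by simp
      have card: "real (card J) \<le> x" unfolding J_def card_greaterThanAtMost using x by linarith
      have "{..nat \<lfloor>x\<rfloor>} = {..nat \<lfloor>x / 2\<rfloor>} \<union> J" using lt by (auto simp: J_def)
      then have "A (nat \<lfloor>x\<rfloor>) = A (nat \<lfloor>x / 2\<rfloor>) + (\<Sum>k\<in>J. ?a' k)"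
        unfolding A_def by (simp only:) (rule sum.union_disjoint; auto simp: J_def)
      also have "(\<Sum>k\<in>J. ?a' k) \<le> (\<Sum>k\<in>J. C * a x)"
      proof (rule sum_mono)
        fix k assume "k \<in> J"
        then have k: "x / 2 \<le> real k" "real k \<le> x" using x unfolding J_def greaterThanAtMost_iff by linarith+
        then have "a (real k) \<le> C * a x" using aC[of "real k" x] x by simp
        moreover have "k \<noteq> 0" using k x by auto
        ultimately show "?a' k \<le> C * a x" by simp
      qed
      also have "\<dots> = real (card J) * (C * a x)" by simp
      also have "\<dots> \<le> x * (C * a x)" using card C nn[of x] x by (intro mult_right_mono) auto
      also have "A (nat \<lfloor>x / 2\<rfloor>) \<le> K2 / q * (x * a x) + K3"
      proof -
        have "K2 / q * (q * (x / 2 * a (x / 2))) \<le> K2 / q * (2 * (x / 2) * a (2 * (x / 2)))"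
          using fq[OF x(1)] K2 q by (intro mult_left_mono) auto
        moreover have "K2 / q * (q * (x / 2 * a (x / 2))) = K2 * (x / 2 * a (x / 2))" using q by simp
        moreover have "2 * (x / 2) = x" by simp
        ultimately have "K2 * (x / 2 * a (x / 2)) \<le> K2 / q * (x * a x)" by (simp only:)
        then show ?thesis using IH by linarith
      qed
      finally have "A (nat \<lfloor>x\<rfloor>) \<le> (C + K2 / q) * (x * a x) + K3" by (simp add: algebra_simps)
      then show ?thesis unfolding K2(2) .
    qed
  qed
  define K where "K = max K1 (max K2 K3)"
  have K_ge: "K1 \<le> K" "K2 \<le> K" "K3 \<le> K" by (auto simp: K_def)
  have K: "0 \<le> K" using K1 K_ge by simp
  have u1: "x * a x \<le> K * A (nat \<lfloor>x\<rfloor>)" if "0 \<le> x" for x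
  proof -
    have "K1 * A (nat \<lfloor>x\<rfloor>) \<le> K * A (nat \<lfloor>x\<rfloor>)"
      using K_ge A1[of "nat \<lfloor>x\<rfloor>"] by (intro mult_right_mono) auto
    then show ?thesis using f_le[OF that] by linarith
  qed
  have u2: "A (nat \<lfloor>x\<rfloor>) \<le> K * (x * a x) + K" if "0 \<le> x" for x
  proof -
    have "K2 * (x * a x) \<le> K * (x * a x)"
      using K_ge nn[OF that] that by (intro mult_right_mono) auto
    then show ?thesis using A_le[OF that] K_ge by linarith
  qed
  define D where "D = max (A 1) (A (2 * nat \<lceil>x0\<rceil>) + (2 * C * K * K + K))"
  have "doubling D A" unfolding doubling_def
  proof (intro conjI allI)
    show "mono A" by (intro monoI A_mono)
    show "1 \<le> A n" for n by (rule A1)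
    show "A 1 \<le> D" by (simp add: D_def)
    fix n :: nat
    let ?L = "2 * C * K * K + K"
    have L: "0 \<le> ?L" using C K by simp
    have D: "A (2 * nat \<lceil>x0\<rceil>) + ?L \<le> D" by (simp add: D_def)
    show "A (2 * n) \<le> D * A n"
    proof (cases "x0 \<le> real n")
      case False
      then have "n \<le> nat \<lceil>x0\<rceil>" by linarith
      then have "A (2 * n) \<le> A (2 * nat \<lceil>x0\<rceil>)" by (intro A_mono) simp
      also have "\<dots> \<le> D * 1" using D L by simp
      also have "\<dots> \<le> D * A n" using A1[of n] A1[of "2 * nat \<lceil>x0\<rceil>"] D L by (intro mult_left_mono) auto
      finally show ?thesis .
    next
      case True
      define y where "y = real n * a (real n)"
      have y: "0 \<le> y" using nn[of "real n"] by (simp add: y_def)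
      have "a (2 * real n) \<le> C * a (real n)" using aC[OF True, of "2 * real n"] by simp
      then have "2 * real n * a (2 * real n) \<le> 2 * real n * (C * a (real n))" by (intro mult_left_mono) auto
      then have 1: "2 * real n * a (2 * real n) \<le> 2 * C * y" by (simp add: y_def mult_ac)
      have "A (2 * n) \<le> K * (2 * real n * a (2 * real n)) + K"
        using u2[of "real (2 * n)"] unfolding floor_of_nat nat_int by simp
      also have "\<dots> \<le> K * (2 * C * y) + K" using 1 K by (intro add_right_mono mult_left_mono) auto
      also have "\<dots> \<le> K * (2 * C * (K * A n)) + K * A n"
      proof (intro add_mono mult_left_mono)
        show "y \<le> K * A n" using u1[of "real n"] by (simp add: y_def)
        show "K \<le> K * A n" using K A1[of n] by (simp add: mult_le_cancel_left1)
      qed (use K C in auto)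
      also have "\<dots> = ?L * A n" by (simp add: algebra_simps)
      also have "\<dots> \<le> D * A n" using A1[of n] A1[of "2 * nat \<lceil>x0\<rceil>"] D by (intro mult_right_mono) auto
      finally show ?thesis .
    qed
  qed
  then show ?thesis using K u1 u2 by (rule that)
qed

lemma nn_integral_log_moment_iff:
  fixes W :: "'b \<Rightarrow> real"
  assumes W [measurable]: "W \<in> borel_measurable M" and W_nn: "\<And>x. 0 \<le> W x" and fin: "(\<integral>\<^sup>+x. ennreal (W x) \<partial>M) < \<infinity>"
    and [measurable]: "f \<in> borel_measurable borel"
    and K: "0 \<le> K" "\<And>x. 0 \<le> x \<Longrightarrow> 0 \<le> f x" "\<And>n. 0 \<le> A n"
    and fA: "\<And>x. 0 \<le> x \<Longrightarrow> f x \<le> K * A (nat \<lfloor>x\<rfloor>)"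
    and Af: "\<And>x. 0 \<le> x \<Longrightarrow> A (nat \<lfloor>x\<rfloor>) \<le> K * f x + K"
  shows "(\<integral>\<^sup>+x. ennreal (W x * f (log_plus (W x))) \<partial>M) < \<infinity> \<longleftrightarrow>
    (\<integral>\<^sup>+x. ennreal (W x * A (nat \<lfloor>log_plus (W x)\<rfloor>)) \<partial>M) < \<infinity>"
    (is "?I < \<infinity> \<longleftrightarrow> ?J < \<infinity>")
proof
  assume I: "?I < \<infinity>"
  have "?J \<le> (\<integral>\<^sup>+x. ennreal K * ennreal (W x * f (log_plus (W x))) + ennreal K * ennreal (W x) \<partial>M)"
  proof (rule nn_integral_mono)
    fix x
    have "W x * A (nat \<lfloor>log_plus (W x)\<rfloor>) \<le> W x * (K * f (log_plus (W x)) + K)"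
      by (rule mult_left_mono[OF Af[OF log_plus_nonneg] W_nn])
    also have "\<dots> = K * (W x * f (log_plus (W x))) + K * W x" by (simp add: algebra_simps)
    finally have "ennreal (W x * A (nat \<lfloor>log_plus (W x)\<rfloor>)) \<le> ennreal (K * (W x * f (log_plus (W x))) + K * W x)"
      by (rule ennreal_leI)
    also have "\<dots> = ennreal K * ennreal (W x * f (log_plus (W x))) + ennreal K * ennreal (W x)"
      using K W_nn[of x] by (subst ennreal_plus) (auto simp: ennreal_mult intro!: mult_nonneg_nonneg)
    finally show "ennreal (W x * A (nat \<lfloor>log_plus (W x)\<rfloor>)) \<le> \<dots>" .
  qed
  also have "\<dots> = ennreal K * ?I + ennreal K * (\<integral>\<^sup>+x. ennreal (W x) \<partial>M)"
    by (simp add: nn_integral_add nn_integral_cmult)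
  also have "\<dots> < \<infinity>" using I fin by (simp add: ennreal_mult_less_top)
  finally show "?J < \<infinity>" .
next
  assume J: "?J < \<infinity>"
  have "?I \<le> (\<integral>\<^sup>+x. ennreal K * ennreal (W x * A (nat \<lfloor>log_plus (W x)\<rfloor>)) \<partial>M)"
  proof (rule nn_integral_mono)
    fix x
    have "W x * f (log_plus (W x)) \<le> W x * (K * A (nat \<lfloor>log_plus (W x)\<rfloor>))"
      by (rule mult_left_mono[OF fA[OF log_plus_nonneg] W_nn])
    then show "ennreal (W x * f (log_plus (W x))) \<le> ennreal K * ennreal (W x * A (nat \<lfloor>log_plus (W x)\<rfloor>))"
      using K W_nn[of x] by (subst ennreal_mult[symmetric]) (auto intro!: ennreal_leI simp: mult.left_commute)
  qed
  also have "\<dots> = ennreal K * ?J" by (intro nn_integral_cmult) measurable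
  also have "\<dots> < \<infinity>" using J by (simp add: ennreal_mult_less_top)
  finally show "?I < \<infinity>" .
qed

subsection \<open>The branching random walk as a weighted branching process\<close>

lemma space_point_space: "space point_space = point_measures"
proof -
  have "(sets borel :: real set set) \<noteq> {}" by auto
  then show ?thesis unfolding point_space_def space_Sup_eq_UN by auto
qed

lemma measurable_emeasure_point_space [measurable]:
  assumes "B \<in> sets borel"
  shows "(\<lambda>\<mu>. emeasure \<mu> B) \<in> borel_measurable point_space"
  unfolding point_space_def
  by (rule measurable_SUP1[OF assms measurable_vimage_algebra1]) auto

text \<open>The infimum from \<open>point_at\<close>, set to 0 where there is no point with index
  \<open>i\<close>; there the infimum would be taken over the empty set.\<close>

definition point_radius :: "real measure \<Rightarrow> nat \<Rightarrow> real" where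
  "point_radius \<mu> i =
     (if of_nat i < emeasure \<mu> UNIV then Inf {t. 0 \<le> t \<and> of_nat i < emeasure \<mu> {-t..t}} else 0)"

lemma point_radius_nonneg: "\<mu> \<in> point_measures \<Longrightarrow> 0 \<le> point_radius \<mu> i"
  using point_at_spec(1) by (auto simp: point_radius_def)

lemma point_radius_le_iff:
  assumes mu: "\<mu> \<in> point_measures" and i: "of_nat i < emeasure \<mu> UNIV" and t: "0 \<le> t"
  shows "point_radius \<mu> i \<le> t \<longleftrightarrow> of_nat i < emeasure \<mu> {-t..t}"
proof
  note spec = point_at_spec[OF mu i]
  have r: "point_radius \<mu> i = Inf {t. 0 \<le> t \<and> of_nat i < emeasure \<mu> {-t..t}}" using i by (simp add: point_radius_def)
  show "of_nat i < emeasure \<mu> {-t..t} \<Longrightarrow> point_radius \<mu> i \<le> t" unfolding r by (rule spec(3)[OF t])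
  assume le: "point_radius \<mu> i \<le> t"
  have "of_nat i < emeasure \<mu> {- point_radius \<mu> i..point_radius \<mu> i}" using spec(2) by (simp only: r)
  also have "\<dots> \<le> emeasure \<mu> {-t..t}"
    using le mu by (intro emeasure_mono) (auto simp: point_measures_def)
  finally show "of_nat i < emeasure \<mu> {-t..t}" .
qed

lemma measurable_point_radius [measurable]: "(\<lambda>\<mu>. point_radius \<mu> i) \<in> borel_measurable point_space"
proof (rule borel_measurableI_le)
  fix t :: real
  have "{\<mu> \<in> space point_space. point_radius \<mu> i \<le> t} =
    {\<mu> \<in> space point_space. 0 \<le> t \<and> (of_nat i < emeasure \<mu> UNIV \<longrightarrow> of_nat i < emeasure \<mu> {-t..t})}"
  proof (intro Collect_cong conj_cong refl)
    fix \<mu> assume "\<mu> \<in> space point_space"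
    then have mu: "\<mu> \<in> point_measures" by (simp add: space_point_space)
    show "point_radius \<mu> i \<le> t \<longleftrightarrow> 0 \<le> t \<and> (of_nat i < emeasure \<mu> UNIV \<longrightarrow> of_nat i < emeasure \<mu> {-t..t})"
    proof (cases "0 \<le> t")
      case True
      show ?thesis
      proof (cases "of_nat i < emeasure \<mu> UNIV")
        case False then show ?thesis using True by (simp add: point_radius_def)
      qed (use True point_radius_le_iff[OF mu _ True] in simp)
    qed (use point_radius_nonneg[OF mu, of i] in auto)
  qed
  also have "\<dots> \<in> sets point_space" by measurable
  finally show "{\<mu> \<in> space point_space. point_radius \<mu> i \<le> t} \<in> sets point_space" .
qed

text \<open>Quantifying over rationals makes the mass of a half-open interval with a random end point measurable.\<close>

lemma negative_point_iff:
  assumes mu: "\<mu> \<in> point_measures"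
  shows "of_nat i < emeasure \<mu> {-r..<r} \<longleftrightarrow>
    (\<forall>p. r < of_rat p \<longrightarrow> (\<exists>q. of_rat q < r \<and> of_nat i < emeasure \<mu> {- of_rat p..of_rat q}))"
proof
  have [simp]: "sets \<mu> = sets borel" using mu by (simp add: point_measures_def)
  assume lt: "of_nat i < emeasure \<mu> {-r..<r}"
  show "\<forall>p. r < of_rat p \<longrightarrow> (\<exists>q. of_rat q < r \<and> of_nat i < emeasure \<mu> {- of_rat p..of_rat q})"
  proof (intro allI impI)
    fix p :: rat assume p: "r < of_rat p"
    define B where "B = (\<lambda>n. {-r .. r - 1 / real (Suc n)})"
    have inv: "1 / real (Suc n) \<le> 1 / real (Suc m)" if "m \<le> n" for m n using that by (simp add: field_simps)
    have "(\<lambda>n. emeasure \<mu> (B n)) \<longlonglongrightarrow> emeasure \<mu> (\<Union>n. B n)"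
    proof (rule Lim_emeasure_incseq)
      show "incseq B" unfolding incseq_def B_def
      proof (intro allI impI)
        fix m n :: nat assume "m \<le> n"
        from inv[OF this] show "{-r .. r - 1 / real (Suc m)} \<subseteq> {-r .. r - 1 / real (Suc n)}" by auto
      qed
    qed (auto simp: B_def)
    moreover have "(\<Union>n. B n) = {-r..<r}"
    proof (intro equalityI subsetI)
      fix x assume "x \<in> {-r..<r}"
      then obtain n where "1 / real (Suc n) < r - x" "- r \<le> x" using nat_approx_posE[of "r - x"] by auto
      then show "x \<in> (\<Union>n. B n)" by (intro UN_I[of n]) (auto simp: B_def)
    next
      fix x assume "x \<in> (\<Union>n. B n)"
      then obtain n where n: "-r \<le> x" "x \<le> r - 1 / real (Suc n)" by (auto simp: B_def)
      have "0 < 1 / real (Suc n)" by simp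
      then show "x \<in> {-r..<r}" using n unfolding atLeastLessThan_iff by linarith
    qed
    ultimately have "\<forall>\<^sub>F n in sequentially. of_nat i < emeasure \<mu> (B n)"
      using lt by (intro order_tendstoD(1)[of _ "emeasure \<mu> {-r..<r}"]) simp_all
    then obtain n where n: "of_nat i < emeasure \<mu> (B n)" using eventually_happens'[OF sequentially_bot] by blast
    obtain q where q: "r - 1 / real (Suc n) < of_rat q" "of_rat q < r"
      using of_rat_dense[of "r - 1 / real (Suc n)" r] by auto
    have "emeasure \<mu> (B n) \<le> emeasure \<mu> {- of_rat p..of_rat q}"
      using p q by (intro emeasure_mono) (auto simp: B_def)
    then show "\<exists>q. of_rat q < r \<and> of_nat i < emeasure \<mu> {- of_rat p..of_rat q}"
      using n q by (intro exI[of _ q]) (auto intro: less_le_trans)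
  qed
next
  have [simp]: "sets \<mu> = sets borel" using mu by (simp add: point_measures_def)
  assume R: "\<forall>p. r < of_rat p \<longrightarrow> (\<exists>q. of_rat q < r \<and> of_nat i < emeasure \<mu> {- of_rat p..of_rat q})"
  define A where "A = (\<lambda>n. {-(r + 1 / real (Suc n)) ..< r})"
  have inv: "1 / real (Suc n) \<le> 1 / real (Suc m)" if "m \<le> n" for m n using that by (simp add: field_simps)
  have bnd: "bounded {x..<y}" for x y :: real by (rule bounded_subset[of "{x..y}"]) auto
  have "(\<lambda>n. emeasure \<mu> (A n)) \<longlonglongrightarrow> emeasure \<mu> (\<Inter>n. A n)"
  proof (rule Lim_emeasure_decseq)
    show "decseq A" unfolding decseq_def A_def
    proof (intro allI impI)
      fix m n :: nat assume "m \<le> n"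
      from inv[OF this] show "{-(r + 1 / real (Suc n)) ..< r} \<subseteq> {-(r + 1 / real (Suc m)) ..< r}"
        by (auto simp del: of_nat_Suc)
    qed
    show "emeasure \<mu> (A i) \<noteq> \<infinity>" for i unfolding A_def by (rule bounded_emeasure(2)[OF mu _ bnd]) simp
  qed (auto simp: A_def)
  moreover have "(\<Inter>n. A n) = {-r..<r}"
  proof (intro equalityI subsetI)
    fix x assume x: "x \<in> (\<Inter>n. A n)"
    have "- x \<le> r"
    proof (rule field_le_epsilon)
      fix e :: real assume "0 < e"
      then obtain n where "1 / real (Suc n) < e" using nat_approx_posE by blast
      moreover have "- (r + 1 / real (Suc n)) \<le> x" using x by (auto simp: A_def)
      ultimately show "- x \<le> r + e" by linarith
    qed
    then show "x \<in> {-r..<r}" using x by (auto simp: A_def)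
  next
    fix x assume x: "x \<in> {-r..<r}"
    have "0 \<le> 1 / real (Suc n)" for n by simp
    then have "- (r + 1 / real (Suc n)) \<le> x" for n using x unfolding atLeastLessThan_iff by (meson add_increasing2 le_minus_iff minus_le_iff order.trans)
    then show "x \<in> (\<Inter>n. A n)" using x by (auto simp: A_def)
  qed
  ultimately have lim: "(\<lambda>n. emeasure \<mu> (A n)) \<longlonglongrightarrow> emeasure \<mu> {-r..<r}" by simp
  \<comment> \<open>A strict inequality is lost in the limit. The masses are integers, so it may be
    sharpened to \<open>Suc i\<close> beforehand and weakened again afterwards.\<close>
  have "of_nat (Suc i) \<le> emeasure \<mu> (A n)" for n
  proof -
    obtain k :: nat where k: "emeasure \<mu> (A n) = of_nat k"
      using bounded_emeasure(1)[OF mu _ bnd] unfolding A_def by fastforce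
    obtain p where p: "r < of_rat p" "of_rat p < r + 1 / real (Suc n)"
      using of_rat_dense[of r "r + 1 / real (Suc n)"] by auto
    then obtain q where q: "of_rat q < r" "of_nat i < emeasure \<mu> {- of_rat p..of_rat q}" using R by blast
    have "emeasure \<mu> {- of_rat p..of_rat q} \<le> emeasure \<mu> (A n)"
      using p q by (intro emeasure_mono) (auto simp: A_def)
    then have "of_nat i < (of_nat k :: ennreal)" unfolding k by (rule less_le_trans[OF q(2)])
    then show ?thesis by (simp add: k Suc_le_eq del: of_nat_Suc)
  qed
  then have "of_nat (Suc i) \<le> emeasure \<mu> {-r..<r}" using LIMSEQ_le_const[OF lim] by blast
  moreover obtain l :: nat where "emeasure \<mu> {-r..<r} = of_nat l"
    using bounded_emeasure(1)[OF mu _ bnd] by fastforce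
  ultimately show "of_nat i < emeasure \<mu> {-r..<r}" by (simp add: Suc_le_eq del: of_nat_Suc)
qed

lemma measurable_negative_point [measurable]:
  "Measurable.pred point_space (\<lambda>\<mu>. of_nat i < emeasure \<mu> {- point_radius \<mu> i..<point_radius \<mu> i})"
proof -
  have "Measurable.pred point_space (\<lambda>\<mu>. \<forall>p. point_radius \<mu> i < of_rat p \<longrightarrow>
      (\<exists>q. of_rat q < point_radius \<mu> i \<and> of_nat i < emeasure \<mu> {- of_rat p..of_rat q}))"
    by measurable
  then show ?thesis
    by (rule measurable_cong[THEN iffD1, rotated]) (simp add: space_point_space negative_point_iff)
qed

lemma measurable_point_at [measurable]:
  "(\<lambda>\<mu>. if of_nat i < emeasure \<mu> UNIV then point_at \<mu> i else 0) \<in> borel_measurable point_space"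
proof -
  have "(\<lambda>\<mu>. if of_nat i < emeasure \<mu> UNIV then
      (if of_nat i < emeasure \<mu> {- point_radius \<mu> i..<point_radius \<mu> i} then - point_radius \<mu> i else point_radius \<mu> i)
      else 0) \<in> borel_measurable point_space" by measurable
  also have "?this \<longleftrightarrow> ?thesis"
    by (intro measurable_cong) (simp add: point_at_def point_radius_def Let_def)
  finally show ?thesis .
qed

lemma emeasure_point_at_pos:
  assumes mu: "\<mu> \<in> point_measures" and i: "of_nat i < emeasure \<mu> UNIV" and B: "B \<in> sets borel" "point_at \<mu> i \<in> B"
  shows "emeasure \<mu> B \<noteq> 0"
proof -
  let ?I = "{i. of_nat i < emeasure \<mu> UNIV}"
  have "emeasure \<mu> B = emeasure (distr (count_space ?I) borel (point_at \<mu>)) B"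
    by (simp add: point_at_enumerates[OF mu])
  also have "\<dots> = emeasure (count_space ?I) (point_at \<mu> -` B \<inter> ?I)"
    using B by (simp add: emeasure_distr)
  also have "\<dots> \<noteq> 0" using B i by (subst emeasure_count_space_eq_0) auto
  finally show ?thesis .
qed

text \<open>The value 0 marks an absent child; the weights of existing children are positive, so the
  two cannot be confused.\<close>

definition child_weight :: "real \<Rightarrow> real \<Rightarrow> real measure \<Rightarrow> nat \<Rightarrow> real" where
  "child_weight \<gamma> m \<mu> i = (if of_nat i < emeasure \<mu> UNIV then exp (\<gamma> * point_at \<mu> i) / m else 0)"

lemma child_weight_nonneg: "0 \<le> m \<Longrightarrow> 0 \<le> child_weight \<gamma> m \<mu> i"
  by (simp add: child_weight_def)

lemma measurable_child_weight [measurable]: "(\<lambda>\<mu>. child_weight \<gamma> m \<mu> i) \<in> borel_measurable point_space"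
proof -
  have "(\<lambda>\<mu>. if of_nat i < emeasure \<mu> UNIV
      then exp (\<gamma> * (if of_nat i < emeasure \<mu> UNIV then point_at \<mu> i else 0)) / m else 0) \<in> borel_measurable point_space"
    by measurable
  also have "?this \<longleftrightarrow> ?thesis" by (intro measurable_cong) (simp add: child_weight_def)
  finally show ?thesis .
qed

lemma prod_child_weight:
  "(\<Prod>k<length u. child_weight \<gamma> m (\<zeta> (take k u)) (u ! k)) =
     (if u \<in> individuals \<zeta> (length u) then exp (\<gamma> * position \<zeta> u) / m ^ length u else 0)"
proof (cases "u \<in> individuals \<zeta> (length u)")
  case True
  then have "(\<Prod>k<length u. child_weight \<gamma> m (\<zeta> (take k u)) (u ! k)) =
      (\<Prod>k<length u. exp (\<gamma> * point_at (\<zeta> (take k u)) (u ! k)) / m)"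
    by (intro prod.cong) (auto simp: individuals_def child_weight_def)
  also have "\<dots> = (\<Prod>k<length u. exp (\<gamma> * point_at (\<zeta> (take k u)) (u ! k))) / m ^ length u"
    by (simp add: prod_dividef)
  also have "(\<Prod>k<length u. exp (\<gamma> * point_at (\<zeta> (take k u)) (u ! k))) = exp (\<gamma> * position \<zeta> u)"
    by (simp add: position_def exp_sum sum_distrib_left)
  finally show ?thesis using True by simp
next
  case False
  then obtain k where "k < length u" "\<not> of_nat (u ! k) < emeasure (\<zeta> (take k u)) UNIV"
    by (auto simp: individuals_def)
  then have "(\<Prod>k<length u. child_weight \<gamma> m (\<zeta> (take k u)) (u ! k)) = 0"
    by (intro prod_zero bexI[of _ k]) (auto simp: child_weight_def)
  then show ?thesis using False by simp
qed

lemma csum_individuals_1: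
  assumes "\<And>u. u \<in> individuals \<zeta> 1 \<Longrightarrow> f u = g (child_weight \<gamma> m (\<zeta> []) (hd u))" and "g 0 = 0"
  shows "csum (individuals \<zeta> 1) f = (\<Sum>i. g (child_weight \<gamma> m (\<zeta> []) i))"
proof -
  let ?I = "{i. of_nat i < emeasure (\<zeta> []) UNIV}"
  have bij: "bij_betw (\<lambda>i. [i]) ?I (individuals \<zeta> 1)"
    by (rule bij_betwI[of _ _ _ hd]) (auto simp: individuals_def length_Suc_conv)
  have "csum (individuals \<zeta> 1) f = csum (individuals \<zeta> 1) (\<lambda>u. g (child_weight \<gamma> m (\<zeta> []) (hd u)))"
    by (intro csum_cong assms)
  also have "\<dots> = csum ?I (\<lambda>i. g (child_weight \<gamma> m (\<zeta> []) i))"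
    by (subst nn_integral_bij_count_space[OF bij, symmetric]) simp
  also have "\<dots> = csum UNIV (\<lambda>i. g (child_weight \<gamma> m (\<zeta> []) i))"
    using assms(2) by (simp add: nn_integral_count_space_indicator)
      (auto simp: indicator_def child_weight_def intro!: nn_integral_cong)
  finally show ?thesis by (simp add: nn_integral_count_space_nat)
qed

section \<open>The given branching random walk as an instance\<close>

locale brw_setting = prob_space P for P :: "'w measure" +
  fixes M :: "'w \<Rightarrow> real measure" and \<xi> :: "nat list \<Rightarrow> 'w \<Rightarrow> real measure" and \<gamma> :: real
    and Q :: "'z measure" and Z :: "'z \<Rightarrow> real"
  assumes brw: "branching_random_walk P M \<xi>"
    and moment: "0 < brw_moment P \<xi> \<gamma>" "brw_moment P \<xi> \<gamma> < \<infinity>"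
    and Z: "size_biased P \<xi> \<gamma> Q Z"
    and log_Z: "integrable Q (\<lambda>z. ln (Z z))" "(\<integral>z. ln (Z z) \<partial>Q) < 0"
    and W1_log: "(\<integral>\<^sup>+\<omega>. ennreal (brw_W P \<xi> \<gamma> 1 \<omega> * log_plus (brw_W P \<xi> \<gamma> 1 \<omega>)) \<partial>P) < \<infinity>"
    and upper_bound: "(\<gamma> > 0 \<and> (AE \<omega> in P. emeasure (M \<omega>) {ln (enn2real (brw_moment P \<xi> \<gamma>)) / \<gamma> <..} = 0)) \<or> \<gamma> = 0"
begin

definition m :: real where "m = enn2real (brw_moment P \<xi> \<gamma>)"

definition \<nu> :: "real measure measure" where "\<nu> = distr P point_space M"

abbreviation \<eta>0 :: "real measure \<Rightarrow> nat \<Rightarrow> real" where "\<eta>0 \<equiv> child_weight \<gamma> m"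

definition T :: "'w \<Rightarrow> nat list \<Rightarrow> real measure" where "T \<omega> = (\<lambda>u. \<xi> u \<omega>)"

lemma m_pos: "0 < m" using moment by (simp add: m_def enn2real_positive_iff)

lemma eta0_nonneg [simp]: "0 \<le> \<eta>0 \<mu> i" using m_pos by (intro child_weight_nonneg) simp

lemma sets_nu [measurable_cong]: "sets \<nu> = sets point_space" by (simp add: \<nu>_def)

lemma space_nu: "space \<nu> = point_measures" by (simp add: \<nu>_def space_point_space)

lemma M_meas [measurable]: "M \<in> measurable P point_space"
  using brw by (simp add: branching_random_walk_def)

lemma xi_meas [measurable]: "\<xi> u \<in> measurable P point_space"
  using brw by (auto simp: branching_random_walk_def indep_vars_def)

lemma distr_xi: "distr P point_space (\<xi> u) = \<nu>"
  using brw by (simp add: branching_random_walk_def \<nu>_def)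

sublocale iid_tree \<nu>
  unfolding iid_tree_def \<nu>_def by (rule prob_space_distr) measurable

lemma T_meas [measurable]: "T \<in> measurable P \<Omega>"
  unfolding T_def[abs_def]
  by (rule measurable_PiM_single')
    (use measurable_space[OF xi_meas] in \<open>auto simp: sets_nu space_nu space_point_space cong: measurable_cong_sets\<close>)

lemma distr_T: "distr P \<Omega> T = \<Omega>"
proof -
  have "indep_vars (\<lambda>_. point_space) \<xi> UNIV" using brw by (simp add: branching_random_walk_def)
  then have "distr P (PiM UNIV (\<lambda>_. point_space)) (\<lambda>\<omega>. \<lambda>u\<in>UNIV. \<xi> u \<omega>) = PiM UNIV (\<lambda>u. distr P point_space (\<xi> u))"
    by (subst (asm) indep_vars_iff_distr_eq_PiM') auto
  then have "distr P (PiM UNIV (\<lambda>_. point_space)) T = \<Omega>"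
    by (simp add: distr_xi restrict_def T_def[abs_def])
  moreover have "distr P (PiM UNIV (\<lambda>_. point_space)) T = distr P \<Omega> T"
    by (intro distr_cong sets_PiM_cong refl) (simp add: sets_nu)
  ultimately show ?thesis by simp
qed

lemma nn_integral_T: "f \<in> borel_measurable \<Omega> \<Longrightarrow> (\<integral>\<^sup>+\<omega>. f (T \<omega>) \<partial>P) = (\<integral>\<^sup>+\<zeta>. f \<zeta> \<partial>\<Omega>)"
  by (subst distr_T[symmetric], subst nn_integral_distr) auto

lemma nn_integral_xi: "f \<in> borel_measurable point_space \<Longrightarrow> (\<integral>\<^sup>+\<omega>. f (\<xi> u \<omega>) \<partial>P) = (\<integral>\<^sup>+\<mu>. f \<mu> \<partial>\<nu>)"
  by (subst distr_xi[of u, symmetric], subst nn_integral_distr) auto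

lemma AE_xi: "AE \<mu> in \<nu>. R \<mu> \<Longrightarrow> AE \<omega> in P. R (\<xi> u \<omega>)"
  by (rule AE_distrD[of "\<xi> u" P point_space]) (simp, unfold distr_xi)

lemma brw_Y_eq: "brw_Y P \<xi> \<gamma> u \<omega> = exp (\<gamma> * position (T \<omega>) u) / m ^ length u"
  by (simp add: brw_Y_def T_def m_def)

lemma csum_first_generation:
  assumes "g 0 = 0"
  shows "csum (individuals (T \<omega>) 1) (\<lambda>u. g (brw_Y P \<xi> \<gamma> u \<omega>)) = (\<Sum>i. g (\<eta>0 (\<xi> [] \<omega>) i))"
proof -
  have "csum (individuals (T \<omega>) 1) (\<lambda>u. g (brw_Y P \<xi> \<gamma> u \<omega>)) = (\<Sum>i. g (\<eta>0 (T \<omega> []) i))"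
  proof (rule csum_individuals_1)
    fix u assume "u \<in> individuals (T \<omega>) 1"
    then obtain i where "u = [i]" "of_nat i < emeasure (T \<omega> []) UNIV"
      by (auto simp: individuals_def length_Suc_conv)
    then show "g (brw_Y P \<xi> \<gamma> u \<omega>) = g (\<eta>0 (T \<omega> []) (hd u))"
      by (simp add: brw_Y_eq child_weight_def position_def)
  qed (use assms in simp)
  then show ?thesis by (simp add: T_def)
qed

lemma size_bias_bounded:
  assumes [measurable]: "r \<in> borel_measurable borel" and "\<And>x. 0 \<le> r x" "bounded (range r)"
  shows "(\<integral>\<^sup>+z. ennreal (r (Z z)) \<partial>Q) = (\<integral>\<^sup>+\<mu>. (\<Sum>i. ennreal (\<eta>0 \<mu> i * r (\<eta>0 \<mu> i))) \<partial>\<nu>)"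
proof -
  have "(\<integral>\<^sup>+z. ennreal (r (Z z)) \<partial>Q) =
      (\<integral>\<^sup>+\<omega>. csum (individuals (T \<omega>) 1) (\<lambda>u. ennreal (brw_Y P \<xi> \<gamma> u \<omega> * r (brw_Y P \<xi> \<gamma> u \<omega>))) \<partial>P)"
    using Z assms by (auto simp: size_biased_def T_def)
  also have "\<dots> = (\<integral>\<^sup>+\<omega>. (\<Sum>i. ennreal (\<eta>0 (\<xi> [] \<omega>) i * r (\<eta>0 (\<xi> [] \<omega>) i))) \<partial>P)"
    by (subst csum_first_generation[where g = "\<lambda>x. ennreal (x * r x)"]) simp_all
  also have "\<dots> = (\<integral>\<^sup>+\<mu>. (\<Sum>i. ennreal (\<eta>0 \<mu> i * r (\<eta>0 \<mu> i))) \<partial>\<nu>)"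
    by (rule nn_integral_xi) measurable
  finally show ?thesis .
qed

lemma Z_meas [measurable]: "Z \<in> borel_measurable Q" using Z by (simp add: size_biased_def)

text \<open>The defining identity of \<open>Z\<close> is available for bounded test functions;
  monotone convergence along \<open>min (r x) n\<close> extends it, in particular to the
  logarithm.\<close>

lemma size_bias:
  assumes [measurable]: "r \<in> borel_measurable borel" and r: "\<And>x. 0 \<le> r x"
  shows "(\<integral>\<^sup>+z. ennreal (r (Z z)) \<partial>Q) = (\<integral>\<^sup>+\<mu>. (\<Sum>i. ennreal (\<eta>0 \<mu> i * r (\<eta>0 \<mu> i))) \<partial>\<nu>)"
proof -
  define t where "t = (\<lambda>c x (n::nat). ennreal (c * min (r x) (real n)))"
  have t_meas [measurable (raw)]: "(\<lambda>x. t (f x) (g x) n) \<in> borel_measurable N"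
    if [measurable]: "f \<in> borel_measurable N" "g \<in> borel_measurable N" for f g n and N :: "'c measure"
    unfolding t_def by measurable
  have t_mono: "t c x n \<le> t c x k" if "0 \<le> c" "n \<le> k" for c x n k
    unfolding t_def using that by (intro ennreal_leI mult_left_mono) auto
  have SUP: "(SUP n. t c x n) = ennreal (c * r x)" if c: "0 \<le> c" for x c
  proof (rule antisym)
    show "(SUP n. t c x n) \<le> ennreal (c * r x)"
      unfolding t_def using c by (intro SUP_least ennreal_leI mult_left_mono) auto
    obtain n where "r x \<le> real n" using real_arch_simple by blast
    then have "ennreal (c * r x) = t c x n" by (simp add: t_def min_def)
    then show "ennreal (c * r x) \<le> (SUP n. t c x n)" by (simp add: SUP_upper)
  qed
  have "(\<integral>\<^sup>+z. ennreal (r (Z z)) \<partial>Q) = (\<integral>\<^sup>+z. (SUP n. t 1 (Z z) n) \<partial>Q)"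
    by (simp only: SUP[OF zero_le_one] mult_1)
  also have "\<dots> = (SUP n. \<integral>\<^sup>+z. t 1 (Z z) n \<partial>Q)"
  proof (rule nn_integral_monotone_convergence_SUP)
    show "incseq (\<lambda>n z. t 1 (Z z) n)" unfolding incseq_def le_fun_def by (intro allI impI t_mono) auto
  qed measurable
  also have "\<dots> = (SUP n. \<integral>\<^sup>+\<mu>. (\<Sum>i. t (\<eta>0 \<mu> i) (\<eta>0 \<mu> i) n) \<partial>\<nu>)"
  proof (rule SUP_cong[OF refl])
    fix n :: nat
    have "bounded (range (\<lambda>x. min (r x) (real n)))"
    proof (rule boundedI)
      fix y assume "y \<in> range (\<lambda>x. min (r x) (real n))"
      then obtain x where "y = min (r x) (real n)" by blast
      then have "0 \<le> y" "y \<le> real n" using r[of x] by (simp_all only: min.bounded_iff of_nat_0_le_iff min.cobounded2 simp_thms)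
      then show "norm y \<le> real n" by (simp only: real_norm_def abs_of_nonneg)
    qed
    moreover have "0 \<le> min (r x) (real n)" for x using r[of x] by (simp only: min.bounded_iff of_nat_0_le_iff simp_thms)
    moreover have "(\<lambda>x. min (r x) (real n)) \<in> borel_measurable borel" by measurable
    ultimately show "(\<integral>\<^sup>+z. t 1 (Z z) n \<partial>Q) = (\<integral>\<^sup>+\<mu>. (\<Sum>i. t (\<eta>0 \<mu> i) (\<eta>0 \<mu> i) n) \<partial>\<nu>)"
      using size_bias_bounded[of "\<lambda>x. min (r x) (real n)"] by (simp only: t_def mult_1)
  qed
  also have "\<dots> = (\<integral>\<^sup>+\<mu>. (SUP n. \<Sum>i. t (\<eta>0 \<mu> i) (\<eta>0 \<mu> i) n) \<partial>\<nu>)"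
  proof (rule nn_integral_monotone_convergence_SUP[symmetric])
    show "incseq (\<lambda>n \<mu>. \<Sum>i. t (\<eta>0 \<mu> i) (\<eta>0 \<mu> i) n)"
      unfolding incseq_def le_fun_def by (intro allI impI suminf_le t_mono summableI eta0_nonneg)
  qed measurable
  also have "\<dots> = (\<integral>\<^sup>+\<mu>. (\<Sum>i. SUP n. t (\<eta>0 \<mu> i) (\<eta>0 \<mu> i) n) \<partial>\<nu>)"
  proof (intro nn_integral_cong ennreal_suminf_SUP_eq[symmetric])
    show "incseq (\<lambda>n. t (\<eta>0 \<mu> i) (\<eta>0 \<mu> i) n)" for \<mu> i
      unfolding incseq_def by (intro allI impI t_mono eta0_nonneg)
  qed
  finally show ?thesis by (simp only: SUP[OF eta0_nonneg])
qed


lemma prob_Q: "prob_space Q" using Z by (simp add: size_biased_def)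

lemma expect_eta0: "(\<integral>\<^sup>+\<mu>. (\<Sum>i. ennreal (\<eta>0 \<mu> i)) \<partial>\<nu>) = 1"
proof -
  have "(\<integral>\<^sup>+z. ennreal 1 \<partial>Q) = (\<integral>\<^sup>+\<mu>. (\<Sum>i. ennreal (\<eta>0 \<mu> i * 1)) \<partial>\<nu>)"
    by (rule size_bias) simp_all
  then show ?thesis by (simp only: mult_1_right nn_integral_const ennreal_1 prob_space.emeasure_space_1[OF prob_Q])
qed

text \<open>The law of \<open>Z\<close> charges only values that occur as non-zero weights, by the
  size-biased identity for the indicator of the complement of \<open>R\<close>.\<close>

lemma AE_Z:
  assumes [measurable]: "Measurable.pred borel R"
    and R: "AE \<mu> in \<nu>. \<forall>i. \<eta>0 \<mu> i = 0 \<or> R (\<eta>0 \<mu> i)"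
  shows "AE z in Q. R (Z z)"
proof -
  define r where "r = (\<lambda>x. if R x then 0 else 1 :: real)"
  have "(\<integral>\<^sup>+z. ennreal (r (Z z)) \<partial>Q) = (\<integral>\<^sup>+\<mu>. (\<Sum>i. ennreal (\<eta>0 \<mu> i * r (\<eta>0 \<mu> i))) \<partial>\<nu>)"
  proof (rule size_bias)
    show "r \<in> borel_measurable borel" unfolding r_def by measurable
    show "0 \<le> r x" for x by (simp add: r_def)
  qed
  also have "\<dots> = (\<integral>\<^sup>+\<mu>. 0 \<partial>\<nu>)"
  proof (rule nn_integral_cong_AE)
    show "AE \<mu> in \<nu>. (\<Sum>i. ennreal (\<eta>0 \<mu> i * r (\<eta>0 \<mu> i))) = 0"
      using R
    proof eventually_elim
      case (elim \<mu>)
      then have "\<eta>0 \<mu> i * r (\<eta>0 \<mu> i) = 0" for i by (cases "R (\<eta>0 \<mu> i)") (auto simp: r_def)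
      then show ?case by (simp only: ennreal_0 suminf_zero)
    qed
  qed
  finally have "(\<integral>\<^sup>+z. ennreal (r (Z z)) \<partial>Q) = 0" by simp
  then have "AE z in Q. ennreal (r (Z z)) = 0"
    by (subst (asm) nn_integral_0_iff_AE) (unfold r_def, measurable)
  then show ?thesis by eventually_elim (auto simp: r_def split: if_splits)
qed

lemma AE_eta0_le_1: "AE \<mu> in \<nu>. \<forall>i. \<eta>0 \<mu> i \<le> 1"
  using upper_bound
proof
  assume *: "\<gamma> > 0 \<and> (AE \<omega> in P. emeasure (M \<omega>) {ln (enn2real (brw_moment P \<xi> \<gamma>)) / \<gamma> <..} = 0)"
  then have "AE \<omega> in P. emeasure (M \<omega>) {ln m / \<gamma> <..} = 0" by (simp add: m_def)
  then have "AE \<mu> in \<nu>. emeasure \<mu> {ln m / \<gamma> <..} = 0"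
    unfolding \<nu>_def by (subst AE_distr_iff) measurable
  then show ?thesis using AE_space
  proof eventually_elim
    case (elim \<mu>)
    then have mu: "\<mu> \<in> point_measures" by (simp add: space_nu)
    show ?case
    proof
      fix i
      show "\<eta>0 \<mu> i \<le> 1"
      proof (cases "of_nat i < emeasure \<mu> UNIV")
        case True
        have "point_at \<mu> i \<le> ln m / \<gamma>"
          using emeasure_point_at_pos[OF mu True, of "{ln m / \<gamma> <..}"] elim(1) by (fastforce simp: not_less[symmetric])
        then have "\<gamma> * point_at \<mu> i \<le> ln m" using * by (simp add: field_simps)
        then have "exp (\<gamma> * point_at \<mu> i) \<le> exp (ln m)" by simp
        then show ?thesis using True m_pos by (simp add: child_weight_def)
      qed (simp add: child_weight_def)
    qed
  qed
next
  interpret Q: prob_space Q by (rule prob_Q)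
  assume gamma: "\<gamma> = 0"
  have eta: "\<eta>0 \<mu> i = 0 \<or> \<eta>0 \<mu> i = 1 / m" for \<mu> i by (simp add: child_weight_def gamma)
  \<comment> \<open>Every existing child has weight \<open>1 / m\<close>, hence \<open>Z\<close> is
    constant, and the negative mean of its logarithm says \<open>m > 1\<close>.\<close>
  have "AE z in Q. Z z = 1 / m" by (rule AE_Z) (use eta in auto)
  then have "(\<integral>z. ln (Z z) \<partial>Q) = (\<integral>z. ln (1 / m) \<partial>Q)" by (intro integral_cong_AE) auto
  also have "\<dots> = - ln m" using m_pos by (simp add: Q.prob_space ln_div)
  finally have "1 < m" using log_Z(2) m_pos by simp
  then show ?thesis using eta m_pos by (intro AE_I2 allI) (metis divide_le_eq_1_pos less_imp_le zero_le_one)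
qed

lemma AE_eta0_summable: "AE \<mu> in \<nu>. summable (\<eta>0 \<mu>)"
proof -
  have "AE \<mu> in \<nu>. (\<Sum>i. ennreal (\<eta>0 \<mu> i)) \<noteq> \<infinity>"
    by (rule nn_integral_noteq_infinite) (simp_all add: expect_eta0)
  then show ?thesis by eventually_elim (auto intro!: summable_suminf_not_top)
qed

text \<open>The abstract process wants its weights to be summable and at most 1 everywhere, not just almost surely.\<close>

definition \<eta> :: "real measure \<Rightarrow> nat \<Rightarrow> real" where
  "\<eta> \<mu> i = (if (\<forall>j. \<eta>0 \<mu> j \<le> 1) \<and> summable (\<eta>0 \<mu>) then \<eta>0 \<mu> i else 0)"

lemma AE_eta: "AE \<mu> in \<nu>. \<eta> \<mu> = \<eta>0 \<mu>"
  using AE_eta0_le_1 AE_eta0_summable by eventually_elim (auto simp: \<eta>_def)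

lemma nn_integral_eta:
  "(\<integral>\<^sup>+\<mu>. (\<Sum>i. f (\<eta> \<mu> i)) \<partial>\<nu>) = (\<integral>\<^sup>+\<mu>. (\<Sum>i. f (\<eta>0 \<mu> i)) \<partial>\<nu>)"
proof (rule nn_integral_cong_AE)
  show "AE \<mu> in \<nu>. (\<Sum>i. f (\<eta> \<mu> i)) = (\<Sum>i. f (\<eta>0 \<mu> i))" using AE_eta by eventually_elim simp
qed

sublocale weighted_branching \<nu> \<eta>
proof
  show "(\<lambda>\<mu>. \<eta> \<mu> i) \<in> borel_measurable \<nu>" for i
  proof -
    have [measurable]: "Measurable.pred point_space (\<lambda>\<mu>. summable (\<eta>0 \<mu>))"
    proof -
      have "summable (\<eta>0 \<mu>) \<longleftrightarrow> (\<Sum>i. ennreal (\<eta>0 \<mu> i)) \<noteq> \<top>" for \<mu>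
      proof
        assume "summable (\<eta>0 \<mu>)"
        then show "(\<Sum>i. ennreal (\<eta>0 \<mu> i)) \<noteq> \<top>" by (subst suminf_ennreal2) auto
      next
        assume "(\<Sum>i. ennreal (\<eta>0 \<mu> i)) \<noteq> \<top>"
        then show "summable (\<eta>0 \<mu>)" by (rule summable_suminf_not_top[rotated]) simp
      qed
      then show ?thesis by simp
    qed
    show ?thesis unfolding \<eta>_def by measurable
  qed
  show "0 \<le> \<eta> \<mu> i" "\<eta> \<mu> i \<le> 1" for \<mu> i by (auto simp: \<eta>_def)
  show "summable (\<eta> \<mu>)" for \<mu>
    by (cases "(\<forall>j. \<eta>0 \<mu> j \<le> 1) \<and> summable (\<eta>0 \<mu>)") (simp_all add: \<eta>_def[abs_def])
  show "(\<integral>\<^sup>+\<mu>. (\<Sum>i. ennreal (\<eta> \<mu> i)) \<partial>\<nu>) = 1" by (simp add: nn_integral_eta expect_eta0)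
  \<comment> \<open>\<open>size_bias\<close> asks for a test function that is non-negative
    everywhere, so \<open>- ln\<close> is cut off outside the range of the weights.\<close>
  define r where "r = (\<lambda>x. if 0 < x \<and> x \<le> 1 then - ln x else 0 :: real)"
  have "(\<integral>\<^sup>+\<mu>. (\<Sum>i. ennreal (\<eta> \<mu> i * - ln (\<eta> \<mu> i))) \<partial>\<nu>) = (\<integral>\<^sup>+\<mu>. (\<Sum>i. ennreal (\<eta>0 \<mu> i * - ln (\<eta>0 \<mu> i))) \<partial>\<nu>)"
    by (rule nn_integral_eta)
  also have "\<dots> = (\<integral>\<^sup>+\<mu>. (\<Sum>i. ennreal (\<eta>0 \<mu> i * r (\<eta>0 \<mu> i))) \<partial>\<nu>)"
  proof (rule nn_integral_cong_AE)
    show "AE \<mu> in \<nu>. (\<Sum>i. ennreal (\<eta>0 \<mu> i * - ln (\<eta>0 \<mu> i))) = (\<Sum>i. ennreal (\<eta>0 \<mu> i * r (\<eta>0 \<mu> i)))"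
      using AE_eta0_le_1
    proof eventually_elim
      case (elim \<mu>)
      have "\<eta>0 \<mu> i * - ln (\<eta>0 \<mu> i) = \<eta>0 \<mu> i * r (\<eta>0 \<mu> i)" for i
      proof (cases "\<eta>0 \<mu> i = 0")
        case False
        then have "0 < \<eta>0 \<mu> i" using eta0_nonneg[of \<mu> i] by linarith
        then show ?thesis using elim by (simp add: r_def)
      qed simp
      then show ?case by simp
    qed
  qed
  also have "\<dots> = (\<integral>\<^sup>+z. ennreal (r (Z z)) \<partial>Q)"
  proof (rule size_bias[symmetric])
    show "r \<in> borel_measurable borel" unfolding r_def by measurable
    show "0 \<le> r x" for x by (auto simp: r_def)
  qed
  also have "\<dots> \<le> (\<integral>\<^sup>+z. ennreal (norm (ln (Z z))) \<partial>Q)"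
    by (intro nn_integral_mono ennreal_leI) (auto simp: r_def)
  also have "\<dots> < \<infinity>" using log_Z(1) by (simp add: integrable_iff_bounded)
  finally show "(\<integral>\<^sup>+\<mu>. (\<Sum>i. ennreal (\<eta> \<mu> i * - ln (\<eta> \<mu> i))) \<partial>\<nu>) < \<infinity>" .
  show "\<not> (AE \<mu> in \<nu>. \<forall>i. \<eta> \<mu> i \<in> {0, 1})"
  proof
    assume "AE \<mu> in \<nu>. \<forall>i. \<eta> \<mu> i \<in> {0, 1}"
    then have "AE \<mu> in \<nu>. \<forall>i. \<eta>0 \<mu> i = 0 \<or> \<eta>0 \<mu> i = 1" using AE_eta by eventually_elim auto
    then have "AE z in Q. Z z = 1" by (rule AE_Z[rotated]) measurable
    then have "(\<integral>z. ln (Z z) \<partial>Q) = (\<integral>z. 0 \<partial>Q)" by (intro integral_cong_AE) auto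
    then show False using log_Z(2) by simp
  qed
qed

lemma AE_T_eta: "AE \<omega> in P. \<forall>u. \<eta> (T \<omega> u) = \<eta>0 (T \<omega> u)"
  unfolding T_def AE_all_countable by (intro allI AE_xi AE_eta)

lemma AE_brw_W: "AE \<omega> in P. \<forall>n. brw_W P \<xi> \<gamma> n \<omega> = Wr n (T \<omega>)"
  using AE_T_eta
proof eventually_elim
  case (elim \<omega>)
  have Y: "Y u (T \<omega>) = (if u \<in> individuals (T \<omega>) (length u) then brw_Y P \<xi> \<gamma> u \<omega> else 0)" for u
    using elim by (simp add: Y_def prod_child_weight brw_Y_eq)
  show ?case
  proof
    fix n
    have sub: "individuals (T \<omega>) n \<subseteq> {u. length u = n}" by (auto simp: individuals_def)
    have "csum (individuals (T \<omega>) n) (\<lambda>u. ennreal (brw_Y P \<xi> \<gamma> u \<omega>)) = WE n (T \<omega>)"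
      unfolding WE_def using sub
      by (simp add: nn_integral_count_space_indicator) (auto simp: Y indicator_def intro!: nn_integral_cong)
    then show "brw_W P \<xi> \<gamma> n \<omega> = Wr n (T \<omega>)" by (simp add: brw_W_def Wr_def T_def)
  qed
qed

lemma AE_brw_W_1: "AE \<omega> in P. brw_W P \<xi> \<gamma> 1 \<omega> = X (\<xi> [] \<omega>)"
  using AE_T_eta
proof eventually_elim
  case (elim \<omega>)
  have eq: "\<eta> (\<xi> [] \<omega>) = \<eta>0 (\<xi> [] \<omega>)" using elim by (simp add: T_def)
  have "csum (individuals (T \<omega>) 1) (\<lambda>u. ennreal (brw_Y P \<xi> \<gamma> u \<omega>)) = (\<Sum>i. ennreal (\<eta> (\<xi> [] \<omega>) i))"
    unfolding eq by (rule csum_first_generation) simp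
  also have "\<dots> = ennreal (X (\<xi> [] \<omega>))"
    unfolding X_def by (intro suminf_ennreal2 eta_nonneg eta_summable)
  finally show ?case by (simp add: brw_W_def T_def[symmetric])
qed

sublocale weighted_branching_xlogx \<nu> \<eta>
proof
  have "(\<integral>\<^sup>+\<mu>. ennreal (X \<mu> * log_plus (X \<mu>)) \<partial>\<nu>) = (\<integral>\<^sup>+\<omega>. ennreal (X (\<xi> [] \<omega>) * log_plus (X (\<xi> [] \<omega>))) \<partial>P)"
    by (subst nn_integral_xi) (auto simp: measurable_cong_sets[OF sets_nu[symmetric] refl])
  also have "\<dots> = (\<integral>\<^sup>+\<omega>. ennreal (brw_W P \<xi> \<gamma> 1 \<omega> * log_plus (brw_W P \<xi> \<gamma> 1 \<omega>)) \<partial>P)"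
  proof (rule nn_integral_cong_AE)
    show "AE \<omega> in P. ennreal (X (\<xi> [] \<omega>) * log_plus (X (\<xi> [] \<omega>))) =
        ennreal (brw_W P \<xi> \<gamma> 1 \<omega> * log_plus (brw_W P \<xi> \<gamma> 1 \<omega>))"
      using AE_brw_W_1 by eventually_elim simp
  qed
  finally show "(\<integral>\<^sup>+\<mu>. ennreal (X \<mu> * log_plus (X \<mu>)) \<partial>\<nu>) < \<infinity>" using W1_log by simp
qed

lemma AE_brw_W_lim: "AE \<omega> in P. brw_W_lim P \<xi> \<gamma> \<omega> = Wl (T \<omega>)"
proof -
  have "AE \<omega> in P. (\<lambda>n. Wr n (T \<omega>)) \<longlonglongrightarrow> Wl (T \<omega>)"
    by (rule AE_distrD[of T P \<Omega>]) (simp, unfold distr_T, rule Wr_tendsto)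
  then show ?thesis using AE_brw_W
    by eventually_elim (auto simp: brw_W_lim_def intro!: limI)
qed


lemma AE_T_iff: "Measurable.pred \<Omega> \<Theta> \<Longrightarrow> (AE \<omega> in P. \<Theta> (T \<omega>)) \<longleftrightarrow> (AE \<zeta> in \<Omega>. \<Theta> \<zeta>)"
  by (subst distr_T[symmetric], subst AE_distr_iff) (auto simp: pred_def)

text \<open>Convergence ignores the term at 0. This permits replacing the coefficients by ones whose
  partial sums are at least 1.\<close>

lemma summable_brw_iff:
  fixes a b :: "nat \<Rightarrow> real"
  assumes ab: "\<And>n. n \<noteq> 0 \<Longrightarrow> a n = b n"
  shows "(AE \<omega> in P. summable (\<lambda>n. a n * (brw_W_lim P \<xi> \<gamma> \<omega> - brw_W P \<xi> \<gamma> n \<omega>))) \<longleftrightarrow>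
    (AE \<zeta> in \<Omega>. summable (\<lambda>n. b n * (Wl \<zeta> - Wr n \<zeta>)))"
proof -
  have "(AE \<omega> in P. summable (\<lambda>n. a n * (brw_W_lim P \<xi> \<gamma> \<omega> - brw_W P \<xi> \<gamma> n \<omega>))) \<longleftrightarrow>
    (AE \<omega> in P. summable (\<lambda>n. b n * (Wl (T \<omega>) - Wr n (T \<omega>))))"
  proof (rule eventually_subst)
    show "AE \<omega> in P. summable (\<lambda>n. a n * (brw_W_lim P \<xi> \<gamma> \<omega> - brw_W P \<xi> \<gamma> n \<omega>)) =
      summable (\<lambda>n. b n * (Wl (T \<omega>) - Wr n (T \<omega>)))"
      using AE_brw_W AE_brw_W_lim
    proof eventually_elim
      case (elim \<omega>)
      show ?case
      proof (rule summable_cong)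
        show "\<forall>\<^sub>F n in sequentially. a n * (brw_W_lim P \<xi> \<gamma> \<omega> - brw_W P \<xi> \<gamma> n \<omega>) =
            b n * (Wl (T \<omega>) - Wr n (T \<omega>))"
          using eventually_gt_at_top[of 0] by eventually_elim (simp add: elim ab)
      qed
    qed
  qed
  also have "\<dots> \<longleftrightarrow> (AE \<zeta> in \<Omega>. summable (\<lambda>n. b n * (Wl \<zeta> - Wr n \<zeta>)))"
  proof (rule AE_T_iff)
    \<comment> \<open>In this form the event involves countably many inequalities between measurable
      functions; the partial sums are real, so it is the event of convergence.\<close>
    have "{\<zeta> \<in> space \<Omega>. Cauchy (\<lambda>n. \<Sum>i<n. b i * (Wl \<zeta> - Wr i \<zeta>))} \<in> sets \<Omega>" by measurable
    then show "Measurable.pred \<Omega> (\<lambda>\<zeta>. summable (\<lambda>n. b n * (Wl \<zeta> - Wr n \<zeta>)))"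
      unfolding summable_iff_convergent Cauchy_convergent_iff pred_def .
  qed
  finally show ?thesis .
qed

end

theorem corollary1p1:
  fixes P :: "'w measure" and M :: "'w \<Rightarrow> real measure"
    and \<xi> :: "nat list \<Rightarrow> 'w \<Rightarrow> real measure"
    and Q :: "'z measure" and Z :: "'z \<Rightarrow> real"
    and \<gamma> \<alpha> :: real and a :: "real \<Rightarrow> real"
  assumes brw: "branching_random_walk P M \<xi>"
    and supercrit: "supercritical P M"
    and moment: "0 < brw_moment P \<xi> \<gamma>" "brw_moment P \<xi> \<gamma> < \<infinity>"
    and Z: "size_biased P \<xi> \<gamma> Q Z"
    and a_nonneg: "\<And>x. 0 \<le> x \<Longrightarrow> 0 \<le> a x"
    and a_rv: "regularly_varying a \<alpha>"
    and alpha: "-1 < \<alpha>"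
    and a_mono: "\<alpha> = 0 \<Longrightarrow> \<exists>x0. mono_on {x0..} a"
    and log_Z: "integrable Q (\<lambda>z. ln (Z z))" "(\<integral>z. ln (Z z) \<partial>Q) < 0"
    and W1_log: "(\<integral>\<^sup>+\<omega>. ennreal (brw_W P \<xi> \<gamma> 1 \<omega> * log_plus (brw_W P \<xi> \<gamma> 1 \<omega>)) \<partial>P) < \<infinity>"
    and cases:
      "(\<gamma> > 0 \<and>
        (AE \<omega> in P. emeasure (M \<omega>) {ln (enn2real (brw_moment P \<xi> \<gamma>)) / \<gamma> <..} = 0) \<and>
        non_arithmetic Q (\<lambda>z. ln (Z z)))
       \<or>
       (\<gamma> = 0 \<and>
        (\<forall>n. AE \<omega> in P. brw_W P \<xi> \<gamma> n \<omega> =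
           enn2real (emeasure (brw_gen \<xi> n \<omega>) UNIV) /
           enn2real (\<integral>\<^sup>+\<omega>. emeasure (M \<omega>) UNIV \<partial>P) ^ n))"
  shows "(AE \<omega> in P. summable (\<lambda>n. a (real n) * (brw_W_lim P \<xi> \<gamma> \<omega> - brw_W P \<xi> \<gamma> n \<omega>)))
     \<longleftrightarrow>
     (\<integral>\<^sup>+\<omega>. ennreal (brw_W_lim P \<xi> \<gamma> \<omega> * log_plus (brw_W_lim P \<xi> \<gamma> \<omega>) *
                    a (log_plus (brw_W_lim P \<xi> \<gamma> \<omega>))) \<partial>P) < \<infinity>"
proof -
  interpret S: brw_setting P M \<xi> \<gamma> Q Z
    unfolding brw_setting_def brw_setting_axioms_def
    using brw moment Z log_Z W1_log cases by (auto simp: branching_random_walk_def)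
  \<comment> \<open>The modified coefficient at 0 matches the partial sums of
    \<open>regularly_varying_partial_sums\<close>.\<close>
  define b where "b = (\<lambda>n::nat. a (real n) + (if n = 0 then 1 else 0))"
  define A where "A = (\<lambda>n. \<Sum>k\<le>n. b k)"
  obtain D K where D: "doubling D A" and K: "0 \<le> K"
    and aA: "\<And>x. 0 \<le> x \<Longrightarrow> x * a x \<le> K * A (nat \<lfloor>x\<rfloor>)"
    and Aa: "\<And>x. 0 \<le> x \<Longrightarrow> A (nat \<lfloor>x\<rfloor>) \<le> K * (x * a x) + K"
    using regularly_varying_partial_sums[OF a_rv a_nonneg alpha] unfolding A_def b_def by blast
  have b: "0 \<le> b n" for n using a_nonneg[of "real n"] by (simp add: b_def)
  \<comment> \<open>\<open>a\<close> is known to be measurable only on the half-line, so the product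
    is extended by 0. Only the values at \<open>log_plus\<close>, which is non-negative, are
    used.\<close>
  define f where "f = (\<lambda>x. if 0 \<le> x then x * a x else 0)"
  have f_meas [measurable]: "f \<in> borel_measurable borel"
  proof -
    have "(\<lambda>x. a (max 0 x)) \<in> borel_measurable borel"
      by (rule measurable_compose[of _ _ "restrict_space borel {0..}"], rule measurable_restrict_space2)
        (use a_rv in \<open>auto simp: regularly_varying_def\<close>)
    then have "(\<lambda>x. max 0 x * a (max 0 x)) \<in> borel_measurable borel" by measurable
    also have "(\<lambda>x. max 0 x * a (max 0 x)) = f" by (auto simp: f_def fun_eq_iff max_def)
    finally show ?thesis .
  qed
  have "(AE \<omega> in P. summable (\<lambda>n. a (real n) * (brw_W_lim P \<xi> \<gamma> \<omega> - brw_W P \<xi> \<gamma> n \<omega>))) \<longleftrightarrow>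
      (AE \<zeta> in S.\<Omega>. summable (\<lambda>n. b n * (S.Wl \<zeta> - S.Wr n \<zeta>)))"
    by (rule S.summable_brw_iff) (simp add: b_def)
  also have "\<dots> \<longleftrightarrow> S.finite_moment_W A"
    unfolding A_def by (rule S.summable_iff_finite_moment_W[OF b D[unfolded A_def]])
  also have "\<dots> \<longleftrightarrow> (\<integral>\<^sup>+\<zeta>. ennreal (S.Wl \<zeta> * f (log_plus (S.Wl \<zeta>))) \<partial>S.\<Omega>) < \<infinity>"
    unfolding S.finite_moment_W_def
  proof (rule nn_integral_log_moment_iff[where W = S.Wl and f = f and A = A and K = K, symmetric])
    show "0 \<le> A n" for n unfolding A_def by (intro sum_nonneg b)
    show "0 \<le> f x" if "0 \<le> x" for x using that a_nonneg by (simp add: f_def)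
    show "f x \<le> K * A (nat \<lfloor>x\<rfloor>)" "A (nat \<lfloor>x\<rfloor>) \<le> K * f x + K" if "0 \<le> x" for x
      using aA[OF that] Aa[OF that] that by (simp_all add: f_def)
  qed (simp_all add: f_meas K S.expect_Wl)
  also have "(\<integral>\<^sup>+\<zeta>. ennreal (S.Wl \<zeta> * f (log_plus (S.Wl \<zeta>))) \<partial>S.\<Omega>) =
      (\<integral>\<^sup>+\<omega>. ennreal (S.Wl (S.T \<omega>) * f (log_plus (S.Wl (S.T \<omega>)))) \<partial>P)"
    by (intro S.nn_integral_T[symmetric]) measurable
  also have "\<dots> = (\<integral>\<^sup>+\<omega>. ennreal (brw_W_lim P \<xi> \<gamma> \<omega> * log_plus (brw_W_lim P \<xi> \<gamma> \<omega>) *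
                    a (log_plus (brw_W_lim P \<xi> \<gamma> \<omega>))) \<partial>P)"
  proof (rule nn_integral_cong_AE)
    show "AE \<omega> in P. ennreal (S.Wl (S.T \<omega>) * f (log_plus (S.Wl (S.T \<omega>)))) =
        ennreal (brw_W_lim P \<xi> \<gamma> \<omega> * log_plus (brw_W_lim P \<xi> \<gamma> \<omega>) * a (log_plus (brw_W_lim P \<xi> \<gamma> \<omega>)))"
      using S.AE_brw_W_lim by eventually_elim (simp add: f_def mult.assoc)
  qed
  finally show ?thesis .
qed

end
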